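(* Assume the standing setup below. Let $\varepsilon>0$ and suppose two pairs $(p_{\varepsilon,1},q_{\varepsilon,1})$, $(p_{\varepsilon,2},q_{\varepsilon,2})$, each of whose components belongs to $H^2(\Omega)$ for every $\alpha$ and depends continuously on $\alpha\in[-d,d]$ (i.e. lies in $H^2(\Omega)\times C[-d,d]$), satisfy $L_1(p_{\varepsilon,i},q_{\varepsilon,i})=0$ and $L_2(p_{\varepsilon,i},q_{\varepsilon,i})=0$ in $\Omega\times(-d,d)$, $i=1,2$, and $$p_{\varepsilon,1}=p_{\varepsilon,2},\quad q_{\varepsilon,1}=q_{\varepsilon,2}\quad\text{for } x\in\partial\Omega\setminus\partial_2\Omega,\ \alpha\in(-d,d).$$ Let $M=\max\{\max_{i=1,2}\|p_{\varepsilon,i}\|_{C(\overline\Omega\times[-d,d])},\ \max_{i=1,2}\|q_{\varepsilon,i}\|_{C(\overline\Omega\times[-d,d])}\}$. Then there exists a constant $C_1=C_1(\Omega,d,\varepsilon,\|G\|_{C^1(\overline\Omega\times[-d,d]^2)},\|\mu_a\|_{C(\overline\Omega)},\|\mu_s\|_{C(\overline\Omega)},M)>0$, depending only on the listed parameters, such that $$\|(p_{\varepsilon,1}-p_{\varepsilon,2},q_{\varepsilon,1}-q_{\varepsilon,2})\|_{H^1_2(\Omega)\times L_{2,2}(-d,d)}\le C_1\,\mathcal E,$$ and, with $a_{\varepsilon,1},a_{\varepsilon,2}$ the functions obtained from the reconstruction formula $\mathcal A$ applied to $p_{\varepsilon,1}$, $p_{\varepsilon,2}$ respectively, $$\|a_{\varepsilon,1}-a_{\varepsilon,2}\|_{L_2(\Omega)}\le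 C_1\,\mathcal E,$$ where $$\mathcal E=\|p_{\varepsilon,1}-p_{\varepsilon,2}\|_{H^1(\partial_2\Omega)\times L_2(-d,d)}+\|\partial_zp_{\varepsilon,1}-\partial_zp_{\varepsilon,2}\|_{L_2(\partial_2\Omega)\times L_2(-d,d)}+\|q_{\varepsilon,1}-q_{\varepsilon,2}\|_{H^1(\partial_2\Omega)\times L_2(-d,d)}+\|\partial_zq_{\varepsilon,1}-\partial_zq_{\varepsilon,2}\|_{L_2(\partial_2\Omega)\times L_2(-d,d)}.$$ In particular, if in addition $p_{\varepsilon,1}=p_{\varepsilon,2}$, $q_{\varepsilon,1}=q_{\varepsilon,2}$, $\partial_zp_{\varepsilon,1}=\partial_zp_{\varepsilon,2}$, $\partial_zq_{\varepsilon,1}=\partial_zq_{\varepsilon,2}$ on $\partial_2\Omega\times(-d,d)$, then $p_{\varepsilon,1}\equiv p_{\varepsilon,2}$, $q_{\varepsilon,1}\equiv q_{\varepsilon,2}$ in $\Omega\times(-d,d)$ and $a_{\varepsilon,1}\equiv a_{\varepsilon,2}$ in $\Omega$.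
   Context: Standing setup. Let $n\ge2$; points of $\mathbb R^n$ are $x=(x_1,\dots,x_{n-1},z)$. Let $B,d>0$, $0<a<b$, $\Omega=\{-B<x_1,\dots,x_{n-1}<B,\ a<z<b\}$, with top face $\partial_2\Omega=\{-B<x_1,\dots,x_{n-1}<B,\ z=b\}$. For $\alpha\in[-d,d]$ let $x_\alpha=(\alpha,0,\dots,0)$ (so the source line lies outside $\overline\Omega$) and $\nu(x,\alpha)=(x-x_\alpha)/|x-x_\alpha|$; $\partial_\alpha\nu$ denotes its derivative in $\alpha$. Let $\mu_a,\mu_s\in C(\overline\Omega)$ be nonnegative, and let $G(x,\alpha,\beta)\ge0$ with $G\in C^1(\overline\Omega\times[-d,d]^2)$. For $\varepsilon>0$ and a pair of functions $(p,q)(x,\alpha)$ on $\Omega\times(-d,d)$ define $$L_1(p,q)=-\varepsilon\Delta p+\nu\cdot\nabla_xq+\partial_\alpha\nu\cdot\nabla_xp+e^{-p(x,\alpha)}q(x,\alpha)\mu_s(x)\int_{-d}^dG(x,\alpha,\beta)e^{p(x,\beta)}d\beta-e^{-p(x,\alpha)}\mu_s(x)\int_{-d}^d\partial_\alpha G(x,\alpha,\beta)e^{p(x,\beta)}d\beta,$$ and $L_2(p,q)$ by the same expression with $-\varepsilon\Delta p$ replaced by $-\varepsilon\Delta q$ ($\Delta,\nabla_x$ act in $x$). Reconstruction formula $\mathcal A$: for $p$ given, $$\mathcal A[p](x)=-\frac1{2d}\int_{-d}^d\nu(x,\alpha)\cdot\nabla_xp(x,\alpha)\,d\alpha+\frac1{2d}\int_{-d}^de^{-p(x,\alpha)}\mu_s(x)\int_{-d}^dG(x,\alpha,\beta)e^{p(x,\beta)}d\beta\,d\alpha,\quad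 x\in\Omega.$$ Norms: $\|(p,q)\|^2_{H^1_2(\Omega)\times L_{2,2}(-d,d)}=\int_{-d}^d(\|p(\cdot,\alpha)\|^2_{H^1(\Omega)}+\|q(\cdot,\alpha)\|^2_{H^1(\Omega)})d\alpha$; for a function $f(x,\alpha)$, $\|f\|^2_{H^1(\partial_2\Omega)\times L_2(-d,d)}=\int_{-d}^d\|f(\cdot,\alpha)\|^2_{H^1(\partial_2\Omega)}d\alpha$ and similarly $\|f\|^2_{L_2(\partial_2\Omega)\times L_2(-d,d)}=\int_{-d}^d\|f(\cdot,\alpha)\|^2_{L_2(\partial_2\Omega)}d\alpha$. *)

theory Defs
  imports "HOL-Analysis.Analysis"
begin

fun Ck_on :: "nat \<Rightarrow> 'a::euclidean_space set \<Rightarrow> ('a \<Rightarrow> real) \<Rightarrow> bool" where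
  "Ck_on 0 U f = continuous_on U f"
| "Ck_on (Suc k) U f = ((\<forall>x\<in>U. f differentiable (at x)) \<and>
      (\<forall>e\<in>Basis. Ck_on k U (\<lambda>x. frechet_derivative f (at x) e)))"

definition smooth_fun :: "('a::euclidean_space \<Rightarrow> real) \<Rightarrow> bool" where
  "smooth_fun f \<longleftrightarrow> (\<forall>k. Ck_on k UNIV f)"

definition test_fun :: "'a::euclidean_space set \<Rightarrow> ('a \<Rightarrow> real) \<Rightarrow> bool" where
  "test_fun U \<phi> \<longleftrightarrow> smooth_fun \<phi> \<and> compact (closure {x. \<phi> x \<noteq> 0})
      \<and> closure {x. \<phi> x \<noteq> 0} \<subseteq> U"

definition L2_on :: "'a::euclidean_space set \<Rightarrow> ('a \<Rightarrow> real) \<Rightarrow> bool" where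
  "L2_on U u \<longleftrightarrow> u \<in> borel_measurable (lebesgue_on U)
      \<and> integrable (lebesgue_on U) (\<lambda>x. (u x)\<^sup>2)"

definition sqL2 :: "'a::euclidean_space set \<Rightarrow> ('a \<Rightarrow> real) \<Rightarrow> real" where
  "sqL2 U u = (\<integral>x. (u x)\<^sup>2 \<partial>lebesgue_on U)"

definition is_weak_partial :: "'a::euclidean_space set \<Rightarrow> ('a \<Rightarrow> real) \<Rightarrow> 'a \<Rightarrow> ('a \<Rightarrow> real) \<Rightarrow> bool" where
  "is_weak_partial U u e v \<longleftrightarrow> (\<forall>\<phi>. test_fun U \<phi> \<longrightarrow>
      (\<integral>x. u x * frechet_derivative \<phi> (at x) e \<partial>lebesgue_on U)
        = - (\<integral>x. v x * \<phi> x \<partial>lebesgue_on U))"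

definition is_H1_grad :: "'a::euclidean_space set \<Rightarrow> ('a \<Rightarrow> real) \<Rightarrow> ('a \<Rightarrow> 'a) \<Rightarrow> bool" where
  "is_H1_grad U u Du \<longleftrightarrow> L2_on U u \<and>
      (\<forall>e\<in>Basis. L2_on U (\<lambda>x. Du x \<bullet> e) \<and> is_weak_partial U u e (\<lambda>x. Du x \<bullet> e))"

definition is_H2 :: "'a::euclidean_space set \<Rightarrow> ('a \<Rightarrow> real) \<Rightarrow> ('a \<Rightarrow> 'a) \<Rightarrow> ('a \<Rightarrow> 'a \<Rightarrow> 'a) \<Rightarrow> bool" where
  "is_H2 U u Du Hu \<longleftrightarrow> is_H1_grad U u Du \<and> (\<forall>e\<in>Basis. is_H1_grad U (\<lambda>x. Du x \<bullet> e) (\<lambda>x. Hu x e))"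

definition sqH1 :: "'a::euclidean_space set \<Rightarrow> ('a \<Rightarrow> real) \<Rightarrow> ('a \<Rightarrow> 'a) \<Rightarrow> real" where
  "sqH1 U u Du = (\<integral>x. (u x)\<^sup>2 + (norm (Du x))\<^sup>2 \<partial>lebesgue_on U)"

definition sqH2 :: "'a::euclidean_space set \<Rightarrow> ('a \<Rightarrow> real) \<Rightarrow> ('a \<Rightarrow> 'a) \<Rightarrow> ('a \<Rightarrow> 'a \<Rightarrow> 'a) \<Rightarrow> real" where
  "sqH2 U u Du Hu = (\<integral>x. (u x)\<^sup>2 + (norm (Du x))\<^sup>2 + (\<Sum>e\<in>Basis. (norm (Hu x e))\<^sup>2) \<partial>lebesgue_on U)"

text \<open>H^1 norm (squared) of a function, with weak gradient chosen (a.e. unique).\<close>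
definition weak_grad :: "'a::euclidean_space set \<Rightarrow> ('a \<Rightarrow> real) \<Rightarrow> ('a \<Rightarrow> 'a)" where
  "weak_grad U u = (SOME Du. is_H1_grad U u Du)"

definition sqH1w :: "'a::euclidean_space set \<Rightarrow> ('a \<Rightarrow> real) \<Rightarrow> real" where
  "sqH1w U u = sqH1 U u (weak_grad U u)"

definition C1_bounded :: "'a::euclidean_space set \<Rightarrow> real \<Rightarrow> ('a \<Rightarrow> real) \<Rightarrow> bool" where
  "C1_bounded S K f \<longleftrightarrow> (\<exists>U Df. open U \<and> S \<subseteq> U \<and>
      (\<forall>x\<in>U. (f has_derivative blinfun_apply (Df x)) (at x)) \<and> continuous_on U Df \<and>
      (\<forall>x\<in>S. \<bar>f x\<bar> \<le> K \<and> norm (Df x) \<le> K))"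

definition C1_near :: "'a::euclidean_space set \<Rightarrow> ('a \<Rightarrow> real) \<Rightarrow> bool" where
  "C1_near S f \<longleftrightarrow> (\<exists>U Df. open U \<and> S \<subseteq> U \<and>
      (\<forall>x\<in>U. (f has_derivative blinfun_apply (Df x)) (at x)) \<and> continuous_on U Df)"

definition class_grad :: "('a::euclidean_space \<Rightarrow> real) \<Rightarrow> 'a \<Rightarrow> 'a" where
  "class_grad f x = (\<Sum>e\<in>Basis. frechet_derivative f (at x) e *\<^sub>R e)"

section \<open>The geometry: points x = (y, z), y in R^(n-1) (type real^'m::finite), z real\<close>

type_synonym 'm pt = "(real^'m) \<times> real"

definition cubeQ :: "real \<Rightarrow> (real^'m::finite) set" where
  "cubeQ B = {y. \<forall>i. - B < y $ i \<and> y $ i < B}"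

definition Omega :: "real \<Rightarrow> real \<Rightarrow> real \<Rightarrow> 'm::finite pt set" where
  "Omega B a b = cubeQ B \<times> {a<..<b}"

definition top_face :: "real \<Rightarrow> real \<Rightarrow> 'm::finite pt set" where
  "top_face B b = cubeQ B \<times> {b}"

definition ez :: "'m::finite pt" where "ez = (0, 1)"

definition is_trace_top :: "real \<Rightarrow> real \<Rightarrow> real \<Rightarrow> ('m::finite pt \<Rightarrow> real) \<Rightarrow> ('m pt \<Rightarrow> 'm pt)
    \<Rightarrow> (real^'m::finite \<Rightarrow> real) \<Rightarrow> bool" where
  "is_trace_top B a b u Du g \<longleftrightarrow> L2_on (cubeQ B) g \<and>
     (\<exists>f. (\<forall>k. C1_near (closure (Omega B a b)) (f k)) \<and>
       (\<lambda>k. sqH1 (Omega B a b) (\<lambda>x. f k x - u x) (\<lambda>x. class_grad (f k) x - Du x)) \<longlonglongrightarrow> 0 \<and>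
       (\<lambda>k. sqL2 (cubeQ B) (\<lambda>y. f k (y, b) - g y)) \<longlonglongrightarrow> 0)"

definition trace_top :: "real \<Rightarrow> real \<Rightarrow> real \<Rightarrow> ('m::finite pt \<Rightarrow> real) \<Rightarrow> ('m pt \<Rightarrow> 'm pt) \<Rightarrow> (real^'m \<Rightarrow> real)" where
  "trace_top B a b u Du = (SOME g. is_trace_top B a b u Du g)"

text \<open>x_\<alpha> = (\<alpha>,0,...,0); e1 is the index of the coordinate x_1.\<close>
definition x_src :: "'m::finite \<Rightarrow> real \<Rightarrow> 'm pt" where
  "x_src e1 \<alpha> = (\<alpha> *\<^sub>R axis e1 1, 0)"

definition nu :: "'m::finite \<Rightarrow> 'm pt \<Rightarrow> real \<Rightarrow> 'm pt" where
  "nu e1 x \<alpha> = (1 / norm (x - x_src e1 \<alpha>)) *\<^sub>R (x - x_src e1 \<alpha>)"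

definition dnu :: "'m::finite \<Rightarrow> 'm pt \<Rightarrow> real \<Rightarrow> 'm pt" where
  "dnu e1 x \<alpha> = vector_derivative (\<lambda>t. nu e1 x t) (at \<alpha>)"

definition scatG :: "real \<Rightarrow> ('m::finite pt \<Rightarrow> real) \<Rightarrow> ('m pt \<times> real \<times> real \<Rightarrow> real)
    \<Rightarrow> ('m::finite pt \<Rightarrow> real \<Rightarrow> real) \<Rightarrow> 'm pt \<Rightarrow> real \<Rightarrow> real" where
  "scatG d mus G p x \<alpha> = mus x * (\<integral>\<beta>. G (x, \<alpha>, \<beta>) * exp (p x \<beta>) \<partial>lebesgue_on {-d..d})"

definition scatdG :: "real \<Rightarrow> ('m::finite pt \<Rightarrow> real) \<Rightarrow> ('m pt \<times> real \<times> real \<Rightarrow> real)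
    \<Rightarrow> ('m::finite pt \<Rightarrow> real \<Rightarrow> real) \<Rightarrow> 'm pt \<Rightarrow> real \<Rightarrow> real" where
  "scatdG d mus G p x \<alpha> = mus x * (\<integral>\<beta>. deriv (\<lambda>t. G (x, t, \<beta>)) \<alpha> * exp (p x \<beta>) \<partial>lebesgue_on {-d..d})"

text \<open>Common part of L_1 and L_2 (everything except the -\<epsilon>\<Delta> term).
  Dp, Dq are the x-gradients of p, q.\<close>
definition Lcommon :: "real \<Rightarrow> 'm::finite \<Rightarrow> ('m pt \<Rightarrow> real) \<Rightarrow> ('m pt \<times> real \<times> real \<Rightarrow> real)
    \<Rightarrow> ('m::finite pt \<Rightarrow> real \<Rightarrow> real) \<Rightarrow> ('m pt \<Rightarrow> real \<Rightarrow> 'm pt)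
    \<Rightarrow> ('m::finite pt \<Rightarrow> real \<Rightarrow> real) \<Rightarrow> ('m pt \<Rightarrow> real \<Rightarrow> 'm pt) \<Rightarrow> 'm pt \<Rightarrow> real \<Rightarrow> real" where
  "Lcommon d e1 mus G p Dp q Dq x \<alpha> =
     nu e1 x \<alpha> \<bullet> Dq x \<alpha> + dnu e1 x \<alpha> \<bullet> Dp x \<alpha>
     + exp (- p x \<alpha>) * q x \<alpha> * scatG d mus G p x \<alpha>
     - exp (- p x \<alpha>) * scatdG d mus G p x \<alpha>"

definition lap :: "('m::finite pt \<Rightarrow> real \<Rightarrow> 'm pt \<Rightarrow> 'm pt) \<Rightarrow> 'm pt \<Rightarrow> real \<Rightarrow> real" where
  "lap Hu x \<alpha> = (\<Sum>e\<in>Basis. Hu x \<alpha> e \<bullet> e)"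

definition recon :: "real \<Rightarrow> 'm::finite \<Rightarrow> ('m pt \<Rightarrow> real) \<Rightarrow> ('m pt \<times> real \<times> real \<Rightarrow> real)
    \<Rightarrow> ('m::finite pt \<Rightarrow> real \<Rightarrow> real) \<Rightarrow> ('m pt \<Rightarrow> real \<Rightarrow> 'm pt) \<Rightarrow> 'm pt \<Rightarrow> real" where
  "recon d e1 mus G p Dp x =
     - (1 / (2 * d)) * (\<integral>\<alpha>. nu e1 x \<alpha> \<bullet> Dp x \<alpha> \<partial>lebesgue_on {-d..d})
     + (1 / (2 * d)) * (\<integral>\<alpha>. exp (- p x \<alpha>) * scatG d mus G p x \<alpha> \<partial>lebesgue_on {-d..d})"

definition admissible ::
  "real \<Rightarrow> real \<Rightarrow> real \<Rightarrow> real \<Rightarrow> real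
   \<Rightarrow> ('m::finite pt \<Rightarrow> real \<Rightarrow> real) \<Rightarrow> ('m pt \<Rightarrow> real \<Rightarrow> 'm pt) \<Rightarrow> ('m pt \<Rightarrow> real \<Rightarrow> 'm pt \<Rightarrow> 'm pt) \<Rightarrow> bool" where
  "admissible B a b d M u Du Hu \<longleftrightarrow>
     (\<forall>\<alpha>\<in>{-d..d}. is_H2 (Omega B a b) (\<lambda>x. u x \<alpha>) (\<lambda>x. Du x \<alpha>) (\<lambda>x. Hu x \<alpha>)) \<and>
     (\<forall>\<alpha>0\<in>{-d..d}. ((\<lambda>\<alpha>. sqH2 (Omega B a b) (\<lambda>x. u x \<alpha> - u x \<alpha>0) (\<lambda>x. Du x \<alpha> - Du x \<alpha>0)
          (\<lambda>x e. Hu x \<alpha> e - Hu x \<alpha>0 e)) \<longlongrightarrow> 0) (at \<alpha>0 within {-d..d})) \<and>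
     (\<lambda>(x, \<alpha>). Du x \<alpha>) \<in> borel_measurable (lebesgue_on (Omega B a b \<times> {-d..d})) \<and>
     continuous_on (closure (Omega B a b) \<times> {-d..d}) (\<lambda>(x, \<alpha>). u x \<alpha>) \<and>
     (\<forall>x\<in>closure (Omega B a b). \<forall>\<alpha>\<in>{-d..d}. \<bar>u x \<alpha>\<bar> \<le> M)"

definition trz :: "real \<Rightarrow> real \<Rightarrow> real \<Rightarrow> ('m::finite pt \<Rightarrow> real \<Rightarrow> 'm pt) \<Rightarrow> ('m pt \<Rightarrow> real \<Rightarrow> 'm pt \<Rightarrow> 'm pt)
    \<Rightarrow> real \<Rightarrow> real^'m::finite \<Rightarrow> real" where
  "trz B a b Du Hu \<alpha> = trace_top B a b (\<lambda>x. Du x \<alpha> \<bullet> ez) (\<lambda>x. Hu x \<alpha> ez)"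

end

(* The difference v of two solutions vanishes on the lateral and bottom faces.  Expanding v(.,z) in
   sines on the cube turns the Laplacian into the operators v_k'' - mu_k v_k with mu_k >= 0, and a
   one-dimensional Carleman estimate with weight exp(lambda z^2) holds for all of them with constants
   independent of mu_k.  Summing over k by Parseval's identity gives a Carleman estimate for H^2
   functions on the box, in terms of Cauchy data on the top face only.  The equations bound the
   Laplacians of p1 - p2 and q1 - q2 by first order terms and by an integral over the source
   parameter; the weight does not depend on that parameter, so after integration over it all these
   terms are absorbed by choosing lambda large.  The trace on
   the top face is an explicit integral over vertical segments, and partial sums of the cosine series
   are the smooth approximants showing that it is the trace. *)

theory Submission
  imports Defs
begin

text \<open>Weak derivatives are tested only with compactly supported functions, while the Fourier
  argument needs test functions that reach the faces. The bridge is integration by parts with a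
  cutoff of width 1/n: its derivative has size n, but only on a strip of measure of order 1/n. The
  extra term disappears if the test function vanishes linearly at the two faces (sines, no condition
  on the function) or if the function is continuous and zero there (cosines allowed). This is why
  the trigonometric systems carry an arbitrary set of sine directions: v is expanded in sines in all
  lateral directions, its derivative in direction i in cosines in that direction and sines in the
  others.

  In the one-variable estimate mu_k has the good sign both in the interior and at z = b, so the
  constants do not see it. At z = a only v(a) = 0 enters; the remaining term in v'(a) has the good
  sign, so no Neumann data are required at the bottom. The assumption a > 0 keeps the derivative of
  z^2 away from zero and the source line away from the box. Finally lambda is given by an explicit
  formula, which makes the dependence of the constant on the listed parameters visible.\<close>

abbreviation (input) "leb \<equiv> lebesgue_on"

lemmas lint_add = Bochner_Integration.integral_add
  and lint_cong = Bochner_Integration.integral_cong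
  and lintable_add = Bochner_Integration.integrable_add
  and lint_sum = Bochner_Integration.integral_sum
  and lint_diff = Bochner_Integration.integral_diff
  and lintable_sum = Bochner_Integration.integrable_sum

section \<open>Square integrable functions\<close>

lemma L2_on_measurable: "L2_on U f ==> f \<in> borel_measurable (leb U)"
  by (simp add: L2_on_def)

lemma L2_on_integrable_sq: "L2_on U f ==> integrable (leb U) (\<lambda>x. (f x)^2)"
  by (simp add: L2_on_def)

lemma L2_on_integrable_mult:
  assumes "L2_on U f" "L2_on U g"
  shows "integrable (leb U) (\<lambda>x. f x * g x)"
proof (rule Bochner_Integration.integrable_bound)
  show "integrable (leb U) (\<lambda>x. (f x)^2 + (g x)^2)"
    using assms by (auto simp: L2_on_def)
  show "(\<lambda>x. f x * g x) \<in> borel_measurable (leb U)"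
    using assms by (auto simp: L2_on_def)
  have "\<bar>s * t\<bar> \<le> s^2 + t^2" for s t :: real
  proof -
    have "2 * \<bar>s * t\<bar> \<le> s^2 + t^2"
      using sum_squares_bound[of "\<bar>s\<bar>" "\<bar>t\<bar>"] by (simp add: abs_mult)
    then show ?thesis using abs_ge_zero[of "s * t"] by linarith
  qed
  then show "AE x in leb U. norm (f x * g x) \<le> norm ((f x)^2 + (g x)^2)"
    by (auto simp: abs_mult)
qed

lemma L2_on_dominated:
  assumes "L2_on U g" "f \<in> borel_measurable (leb U)"
    "AE x in leb U. \<bar>f x\<bar> \<le> \<bar>g x\<bar>"
  shows "L2_on U f"
  unfolding L2_on_def
proof (intro conjI assms(2))
  show "integrable (leb U) (\<lambda>x. (f x)^2)"
  proof (rule Bochner_Integration.integrable_bound[OF L2_on_integrable_sq[OF assms(1)]])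
    show "(\<lambda>x. (f x)^2) \<in> borel_measurable (leb U)" using assms(2) by simp
    show "AE x in leb U. norm ((f x)^2) \<le> norm ((g x)^2)"
      using assms(3) by eventually_elim (simp add: abs_le_square_iff)
  qed
qed

lemma L2_on_add:
  assumes "L2_on U f" "L2_on U g"
  shows "L2_on U (\<lambda>x. f x + g x)"
  unfolding L2_on_def
proof (intro conjI)
  show "(\<lambda>x. f x + g x) \<in> borel_measurable (leb U)"
    using assms by (auto simp: L2_on_def)
  have "integrable (leb U) (\<lambda>x. (f x)^2 + 2 * (f x * g x) + (g x)^2)"
    using L2_on_integrable_mult[OF assms] assms by (auto simp: L2_on_def)
  then show "integrable (leb U) (\<lambda>x. (f x + g x)^2)"
    by (simp add: power2_eq_square algebra_simps)
qed

lemma L2_on_cmult: "L2_on U f ==> L2_on U (\<lambda>x. c * f x)"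
  by (auto simp: L2_on_def power_mult_distrib)

lemma L2_on_zero [simp]: "L2_on U (\<lambda>x. 0)"
  by (auto simp: L2_on_def)

lemma L2_on_uminus: "L2_on U f ==> L2_on U (\<lambda>x. - f x)"
  using L2_on_cmult[of U f "-1"] by simp

lemma L2_on_diff:
  assumes "L2_on U f" "L2_on U g" shows "L2_on U (\<lambda>x. f x - g x)"
  using L2_on_add[OF assms(1) L2_on_uminus[OF assms(2)]] by simp

lemma L2_on_sum:
  assumes "\<And>i. i \<in> I ==> L2_on U (f i)" shows "L2_on U (\<lambda>x. \<Sum>i\<in>I. f i x)"
  using assms by (induction I rule: infinite_finite_induct) (auto intro: L2_on_add)

lemma L2_on_mult_bounded:
  assumes "L2_on U f" "h \<in> borel_measurable (leb U)" "\<And>x. x \<in> U ==> \<bar>h x\<bar> \<le> C"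
  shows "L2_on U (\<lambda>x. h x * f x)"
proof (rule L2_on_dominated[OF L2_on_cmult[OF assms(1), of "\<bar>C\<bar>"]])
  show "(\<lambda>x. h x * f x) \<in> borel_measurable (leb U)"
    using assms by (auto simp: L2_on_def)
  have "\<bar>h x * f x\<bar> \<le> \<bar>\<bar>C\<bar> * f x\<bar>" if "x \<in> U" for x
    using assms(3)[OF that] by (simp add: abs_mult mult_right_mono)
  then show "AE x in leb U. \<bar>h x * f x\<bar> \<le> \<bar>\<bar>C\<bar> * f x\<bar>"
    by (intro AE_I2) auto
qed

lemma L2_on_bounded:
  assumes "U \<in> lmeasurable" "h \<in> borel_measurable (leb U)" "\<And>x. x \<in> U ==> \<bar>h x\<bar> \<le> C"
  shows "L2_on U h"
proof -
  interpret finite_measure "leb U" by (rule finite_measure_lebesgue_on) fact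
  have "L2_on U (\<lambda>x. 1)" by (auto simp: L2_on_def)
  from L2_on_mult_bounded[OF this assms(2,3)] show ?thesis by simp
qed

lemma L2_on_continuous:
  assumes "continuous_on K h" "compact K" "U \<subseteq> K" "U \<in> lmeasurable"
  shows "L2_on U h"
proof -
  have "bounded (h ` K)" using assms compact_continuous_image compact_imp_bounded by blast
  then obtain C where "\<And>x. x \<in> K ==> \<bar>h x\<bar> \<le> C" by (auto simp: bounded_iff)
  moreover have "h \<in> borel_measurable (leb U)"
    using assms(1,3,4) by (intro continuous_imp_measurable_on_sets_lebesgue)
      (auto intro: continuous_on_subset)
  ultimately show ?thesis using assms(3,4) by (intro L2_on_bounded) auto
qed

lemma L2_on_integrable:
  assumes "U \<in> lmeasurable" "L2_on U f"
  shows "integrable (leb U) f"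
proof -
  have "L2_on U (\<lambda>x. 1)" by (rule L2_on_bounded[OF assms(1), of _ 1]) auto
  from L2_on_integrable_mult[OF assms(2) this] show ?thesis by simp
qed

lemma L2_on_cong_AE:
  assumes "L2_on U f" "g \<in> borel_measurable (leb U)" "AE x in leb U. f x = g x"
  shows "L2_on U g"
  by (rule L2_on_dominated[OF assms(1,2)]) (use assms(3) in eventually_elim, simp)

lemma sqL2_nonneg [simp]: "0 \<le> sqL2 U f"
  by (simp add: sqL2_def)

lemma sqL2_cmult: "sqL2 U (\<lambda>x. c * f x) = c^2 * sqL2 U f"
  by (simp add: sqL2_def power_mult_distrib)

lemma sqL2_minus_commute: "sqL2 U (\<lambda>x. f x - g x) = sqL2 U (\<lambda>x. g x - f x)"
  by (simp add: sqL2_def power2_commute)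

lemma sqL2_cong_AE:
  assumes "f \<in> borel_measurable (leb U)" "g \<in> borel_measurable (leb U)"
    "AE x in leb U. f x = g x"
  shows "sqL2 U f = sqL2 U g"
  unfolding sqL2_def by (rule integral_cong_AE) (use assms in auto)

lemma sqL2_mono_AE:
  assumes "L2_on U g" "L2_on U f" "AE x in leb U. \<bar>f x\<bar> \<le> \<bar>g x\<bar>"
  shows "sqL2 U f \<le> sqL2 U g"
  unfolding sqL2_def
  by (rule integral_mono_AE) (use assms in \<open>auto simp: L2_on_def abs_le_square_iff\<close>)

lemma sqL2_add_le:
  assumes "L2_on U f" "L2_on U g"
  shows "sqL2 U (\<lambda>x. f x + g x) \<le> 2 * sqL2 U f + 2 * sqL2 U g"
proof -
  have "sqL2 U (\<lambda>x. f x + g x) \<le> (LINT x|leb U. 2 * (f x)^2 + 2 * (g x)^2)"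
    unfolding sqL2_def
  proof (rule integral_mono)
    show "(f x + g x)^2 \<le> 2 * (f x)^2 + 2 * (g x)^2" for x
      using zero_le_power2[of "f x - g x"] by (simp add: power2_eq_square algebra_simps)
  qed (use assms L2_on_add[OF assms] in \<open>auto simp: L2_on_def\<close>)
  also have "\<dots> = 2 * sqL2 U f + 2 * sqL2 U g"
    using assms by (simp add: sqL2_def L2_on_def)
  finally show ?thesis .
qed

lemma sqL2_diff_le:
  assumes "L2_on U f" "L2_on U g"
  shows "sqL2 U (\<lambda>x. f x - g x) \<le> 2 * sqL2 U f + 2 * sqL2 U g"
  using sqL2_add_le[OF assms(1) L2_on_uminus[OF assms(2)]] by (simp add: sqL2_def)

lemma sqL2_triangle:
  assumes "L2_on U f" "L2_on U g" "L2_on U h"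
  shows "sqL2 U (\<lambda>x. f x - h x) \<le> 2 * sqL2 U (\<lambda>x. f x - g x) + 2 * sqL2 U (\<lambda>x. g x - h x)"
  using sqL2_add_le[OF L2_on_diff[OF assms(1,2)] L2_on_diff[OF assms(2,3)]] by simp

lemma sqL2_eq_0_iff:
  assumes "L2_on U f"
  shows "sqL2 U f = 0 \<longleftrightarrow> (AE x in leb U. f x = 0)"
  unfolding sqL2_def using assms by (subst integral_nonneg_eq_0_iff_AE) (auto simp: L2_on_def)

lemma L2_on_Cauchy_Schwarz:
  assumes "L2_on U f" "L2_on U g"
  shows "(LINT x|leb U. f x * g x)^2 \<le> sqL2 U f * sqL2 U g"
proof -
  let ?I = "\<integral>x. f x * g x \<partial>leb U"
  have exp: "sqL2 U (\<lambda>x. s * f x + t * g x) = s^2 * sqL2 U f + 2 * s * t * ?I + t^2 * sqL2 U g" for s t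
  proof -
    have "(\<lambda>x. (s * f x + t * g x)^2)
        = (\<lambda>x. s^2 * (f x)^2 + (2 * s * t) * (f x * g x) + t^2 * (g x)^2)"
      by (auto simp: power2_eq_square algebra_simps)
    then show ?thesis
      unfolding sqL2_def using L2_on_integrable_mult[OF assms] assms by (simp add: L2_on_def)
  qed
  show ?thesis
  proof (cases "sqL2 U g = 0")
    case True
    then have "AE x in leb U. f x * g x = 0"
      using sqL2_eq_0_iff[OF assms(2)] by auto
    then have "?I = 0"
      by (intro integral_eq_zero_AE)
    then show ?thesis by simp
  next
    case False
    then have pos: "sqL2 U g > 0" using sqL2_nonneg[of U g] by linarith
    \<comment> \<open>Up to the factor \<open>sqL2 U g\<close>, the function is \<open>f\<close>
      minus its projection onto \<open>g\<close>.\<close>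
    have "0 \<le> sqL2 U (\<lambda>x. sqL2 U g * f x + (- ?I) * g x)" by simp
    also have "\<dots> = sqL2 U g * (sqL2 U f * sqL2 U g - ?I^2)"
      unfolding exp by (simp add: power2_eq_square algebra_simps)
    finally show ?thesis using pos by (simp add: zero_le_mult_iff)
  qed
qed

lemma sqL2_expand_diff:
  assumes "L2_on U f" "L2_on U g"
  shows "sqL2 U (\<lambda>x. f x - g x) = sqL2 U f - 2 * (LINT x|leb U. f x * g x) + sqL2 U g"
proof -
  have "(\<lambda>x. (f x - g x)^2) = (\<lambda>x. (f x)^2 - 2 * (f x * g x) + (g x)^2)"
    by (auto simp: power2_eq_square algebra_simps)
  then show ?thesis
    unfolding sqL2_def using L2_on_integrable_mult[OF assms] assms by (simp add: L2_on_def)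
qed

lemma tendsto_square_iff_zero:
  fixes f :: "'b => real"
  shows "((\<lambda>x. (f x)^2) \<longlongrightarrow> 0) F ==> (f \<longlongrightarrow> 0) F"
  using tendsto_real_sqrt[of "\<lambda>x. (f x)^2" 0 F] by (simp add: tendsto_rabs_zero_iff)

text \<open>An arbitrary filter is allowed because the result is used later for limits in the source
  parameter, along \<open>at al0 within S\<close>, and not only for sequences.\<close>

lemma L2_on_tendsto_inner:
  assumes "\<And>n. L2_on U (f n)" "L2_on U f'" "L2_on U g"
    and "((\<lambda>n. sqL2 U (\<lambda>x. f n x - f' x)) \<longlongrightarrow> 0) F"
  shows "((\<lambda>n. \<integral>x. f n x * g x \<partial>leb U) \<longlongrightarrow> (LINT x|leb U. f' x * g x)) F"
proof -
  have eq: "(LINT x|leb U. f n x * g x) - (LINT x|leb U. f' x * g x)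
     = (LINT x|leb U. (f n x - f' x) * g x)" for n
    using L2_on_integrable_mult[OF assms(1) assms(3)] L2_on_integrable_mult[OF assms(2,3)]
    by (simp add: algebra_simps)
  have "((\<lambda>n. (LINT x|leb U. (f n x - f' x) * g x)^2) \<longlongrightarrow> 0) F"
  proof (rule tendsto_sandwich[OF _ _ tendsto_const])
    show "\<forall>\<^sub>F n in F. (LINT x|leb U. (f n x - f' x) * g x)^2
            \<le> sqL2 U (\<lambda>x. f n x - f' x) * sqL2 U g"
      by (intro always_eventually allI L2_on_Cauchy_Schwarz L2_on_diff assms)
    show "((\<lambda>n. sqL2 U (\<lambda>x. f n x - f' x) * sqL2 U g) \<longlongrightarrow> 0) F"
      using tendsto_mult_left_zero[OF assms(4)] by simp
  qed auto
  then have "((\<lambda>n. \<integral>x. (f n x - f' x) * g x \<partial>leb U) \<longlongrightarrow> 0) F"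
    by (rule tendsto_square_iff_zero)
  then show ?thesis unfolding eq[symmetric] by (simp add: LIM_zero_iff)
qed

lemma L2_on_tendsto_sqL2:
  assumes "\<And>n. L2_on U (f n)" "L2_on U g"
    and "((\<lambda>n. sqL2 U (\<lambda>x. f n x - g x)) \<longlongrightarrow> 0) F"
  shows "((\<lambda>n. sqL2 U (f n)) \<longlongrightarrow> sqL2 U g) F"
proof -
  have "sqL2 U (f n) = sqL2 U (\<lambda>x. f n x - g x) + 2 * (LINT x|leb U. f n x * g x) - sqL2 U g" for n
    using sqL2_expand_diff[OF assms(1,2)] by simp
  moreover have "((\<lambda>n. sqL2 U (\<lambda>x. f n x - g x) + 2 * (LINT x|leb U. f n x * g x) - sqL2 U g)
     \<longlongrightarrow> 0 + 2 * (LINT x|leb U. g x * g x) - sqL2 U g) F"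
    by (intro tendsto_intros assms(3) L2_on_tendsto_inner assms(1,2))
  ultimately show ?thesis by (simp add: sqL2_def power2_eq_square)
qed

lemma sqL2_dominated_convergence:
  assumes "\<And>n. f n \<in> borel_measurable (leb U)" "f' \<in> borel_measurable (leb U)"
    "L2_on U g" "AE x in leb U. (\<lambda>n. f n x) \<longlonglongrightarrow> f' x"
    "\<And>n. AE x in leb U. \<bar>f n x - f' x\<bar> \<le> \<bar>g x\<bar>"
  shows "(\<lambda>n. sqL2 U (\<lambda>x. f n x - f' x)) \<longlonglongrightarrow> 0"
proof -
  have "(\<lambda>n. sqL2 U (\<lambda>x. f n x - f' x)) \<longlonglongrightarrow> (LINT x|leb U. 0)"
    unfolding sqL2_def
  proof (rule integral_dominated_convergence[where w="\<lambda>x. (g x)^2"])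
    show "AE x in leb U. (\<lambda>n. (f n x - f' x)^2) \<longlonglongrightarrow> 0"
      using assms(4)
    proof eventually_elim
      case (elim x)
      then have "(\<lambda>n. (f n x - f' x)^2) \<longlonglongrightarrow> 0^2" by (intro tendsto_power) (simp add: LIM_zero)
      then show ?case by simp
    qed
    show "AE x in leb U. norm ((f n x - f' x)^2) \<le> (g x)^2" for n
      using assms(5)[of n] by eventually_elim (simp add: abs_le_square_iff)
  qed (use assms in \<open>auto simp: L2_on_def\<close>)
  then show ?thesis by simp
qed

section \<open>Products of Lebesgue measures\<close>

lemma AE_lebesgue_on_iff:
  "S \<in> sets lebesgue ==> (AE x in leb S. P x) \<longleftrightarrow> (AE x in lborel. x \<in> S \<longrightarrow> P x)"
  by (subst AE_restrict_space_iff) (auto simp: AE_completion_iff)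

text \<open>The completed measure on a product space is not the product of the completed measures,
  whereas \<open>lborel\<close> is multiplicative. Fubini and Tonelli for
  \<open>leb (A \<times> B)\<close> are therefore transferred to Borel representatives extended by
  zero.\<close>

lemma lebesgue_on_representative:
  fixes f g :: "'a::euclidean_space => real"
  assumes S: "S \<in> sets borel" and g: "g \<in> borel_measurable borel"
    and eq: "AE x in leb S. f x = g x" and 0: "\<And>x. x \<notin> S ==> g x = 0"
  shows "f \<in> borel_measurable (leb S)"
    and "integrable (leb S) f \<longleftrightarrow> integrable lborel g"
    and "integral\<^sup>L (leb S) f = integral\<^sup>L lborel g"
proof -
  have SL: "S \<in> sets lebesgue" using S by simp
  have gS: "g \<in> borel_measurable (leb S)"
    by (intro measurable_restrict_space1 measurable_completion) (use g in simp)
  have ae: "AE x in lebesgue. (if x \<in> S then g x else 0) = (if x \<in> S then f x else 0)"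
    using eq unfolding AE_lebesgue_on_iff[OF SL] AE_completion_iff by eventually_elim auto
  have "(\<lambda>x. if x \<in> S then f x else 0) \<in> borel_measurable lebesgue"
    by (rule borel_measurable_AE[OF _ ae]) (use gS borel_measurable_if[OF SL] in blast)
  then show f: "f \<in> borel_measurable (leb S)"
    using borel_measurable_if[OF SL] by blast
  have ind: "(\<lambda>x. indicator S x * g x) = g"
    using 0 by (auto simp: indicator_def fun_eq_iff)
  have "integrable (leb S) f \<longleftrightarrow> integrable (leb S) g"
    by (rule integrable_cong_AE[OF f gS eq])
  also have "\<dots> \<longleftrightarrow> integrable lebesgue g"
    using SL by (subst integrable_restrict_space) (auto simp: ind)
  also have "\<dots> \<longleftrightarrow> integrable lborel g"
    by (rule integrable_completion) (use g in simp)
  finally show "integrable (leb S) f \<longleftrightarrow> integrable lborel g" .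
  have "integral\<^sup>L (leb S) f = integral\<^sup>L (leb S) g"
    by (rule integral_cong_AE[OF f gS eq])
  also have "\<dots> = integral\<^sup>L lebesgue g"
    using SL by (subst integral_restrict_space) (auto simp: ind)
  also have "\<dots> = integral\<^sup>L lborel g"
    by (rule integral_completion) (use g in simp)
  finally show "integral\<^sup>L (leb S) f = integral\<^sup>L lborel g" .
qed

lemma ex_lebesgue_on_representative:
  fixes f :: "'a::euclidean_space => real"
  assumes S: "S \<in> sets borel" and f: "f \<in> borel_measurable (leb S)"
  obtains g where "g \<in> borel_measurable borel" "AE x in leb S. f x = g x"
    "\<And>x. x \<notin> S ==> g x = 0"
proof -
  have SL: "S \<in> sets lebesgue" using S by simp
  have "(\<lambda>x. if x \<in> S then f x else 0) \<in> borel_measurable lebesgue"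
    using f borel_measurable_if[OF SL] by blast
  from completion_ex_borel_measurable_real[OF this] obtain g
    where g: "g \<in> borel_measurable lborel" "AE x in lborel. (if x \<in> S then f x else 0) = g x" by auto
  show ?thesis
  proof
    show "(\<lambda>x. indicator S x * g x) \<in> borel_measurable borel"
      using g(1) S by simp
    show "AE x in leb S. f x = indicator S x * g x"
      unfolding AE_lebesgue_on_iff[OF SL] using g(2) by eventually_elim auto
  qed auto
qed

lemma AE_lborel_swap:
  fixes P :: "'a::euclidean_space \<times> 'b::euclidean_space => bool"
  assumes "AE z in lborel. P z"
  shows "AE z in lborel. P (snd z, fst z)"
proof -
  let ?s = "\<lambda>(x::'b, y::'a). (y, x)"
  have d: "(lborel \<Otimes>\<^sub>M lborel :: ('a \<times> 'b) measure) = distr (lborel \<Otimes>\<^sub>M lborel) (lborel \<Otimes>\<^sub>M lborel) ?s"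
    by (rule lborel_pair.distr_pair_swap)
  have "AE z in (lborel \<Otimes>\<^sub>M lborel :: ('a \<times> 'b) measure). P z"
    unfolding lborel_prod by (rule assms)
  then have "AE z in distr (lborel \<Otimes>\<^sub>M lborel) (lborel \<Otimes>\<^sub>M lborel) ?s. P z"
    by (subst (asm) d)
  then have "AE z in (lborel \<Otimes>\<^sub>M lborel). P ((\<lambda>(x::'b, y::'a). (y, x)) z)"
    by (rule AE_distrD[rotated]) simp
  then show ?thesis unfolding lborel_prod by (simp add: case_prod_unfold)
qed

lemma AE_lebesgue_on_slice:
  fixes P :: "'a::euclidean_space \<times> 'b::euclidean_space => bool"
  assumes A: "A \<in> sets borel" and B: "B \<in> sets borel"
    and P: "AE z in leb (A \<times> B). P z"
  shows "AE x in leb A. AE y in leb B. P (x, y)"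
proof -
  have AB: "A \<times> B \<in> sets borel" using A B by (simp add: borel_Times)
  have "AE z in lborel. z \<in> A \<times> B \<longrightarrow> P z"
    using P by (subst AE_lebesgue_on_iff[symmetric]) (use AB in auto)
  then have "AE x in lborel. AE y in lborel. (x, y) \<in> A \<times> B \<longrightarrow> P (x, y)"
    unfolding lborel_prod[symmetric] by (rule lborel_pair.AE_pair)
  then have "AE x in lborel. x \<in> A \<longrightarrow> (AE y in lborel. y \<in> B \<longrightarrow> P (x, y))"
  proof eventually_elim
    case (elim x)
    show ?case
    proof
      assume "x \<in> A"
      with elim show "AE y in lborel. y \<in> B \<longrightarrow> P (x, y)" by auto
    qed
  qed
  then show ?thesis
    using A B by (subst AE_lebesgue_on_iff; simp)+
qed

lemma AE_lebesgue_on_swap: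
  fixes P :: "'a::euclidean_space \<times> 'b::euclidean_space => bool"
  assumes A: "A \<in> sets borel" and B: "B \<in> sets borel"
    and P: "AE z in leb (A \<times> B). P z"
  shows "AE z in leb (B \<times> A). P (snd z, fst z)"
proof -
  have AB: "A \<times> B \<in> sets borel" "B \<times> A \<in> sets borel" using A B by (simp_all add: borel_Times)
  have "AE z in lborel. z \<in> A \<times> B \<longrightarrow> P z"
    using P by (subst AE_lebesgue_on_iff[symmetric]) (use AB in auto)
  from AE_lborel_swap[OF this] show ?thesis
    by (subst AE_lebesgue_on_iff) (use AB in \<open>auto simp: mem_Times_iff conj_commute\<close>)
qed

lemma lebesgue_on_swap:
  fixes f :: "'a::euclidean_space \<times> 'b::euclidean_space => real"
  assumes A: "A \<in> sets borel" and B: "B \<in> sets borel"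
    and f: "f \<in> borel_measurable (leb (A \<times> B))"
  shows "(\<lambda>z. f (snd z, fst z)) \<in> borel_measurable (leb (B \<times> A))"
    and "integrable (leb (B \<times> A)) (\<lambda>z. f (snd z, fst z)) \<longleftrightarrow> integrable (leb (A \<times> B)) f"
    and "(LINT z|leb (B \<times> A). f (snd z, fst z)) = (LINT z|leb (A \<times> B). f z)"
proof -
  have AB: "A \<times> B \<in> sets borel" "B \<times> A \<in> sets borel" using A B by (simp_all add: borel_Times)
  from ex_lebesgue_on_representative[OF AB(1) f] obtain g where
    g: "g \<in> borel_measurable borel" "AE x in leb (A \<times> B). f x = g x"
      "\<And>x. x \<notin> A \<times> B ==> g x = 0" by metis
  have gs: "(\<lambda>z. g (snd z, fst z)) \<in> borel_measurable borel"
    using g(1) by (intro measurable_compose[OF _ g(1)])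
      (auto intro!: borel_measurable_continuous_onI continuous_intros)
  have aes: "AE z in leb (B \<times> A). f (snd z, fst z) = g (snd z, fst z)"
    using AE_lebesgue_on_swap[OF A B g(2)] by simp
  have "g (snd z, fst z) = 0" if "z \<notin> B \<times> A" for z
    using g(3)[of "(snd z, fst z)"] that by (auto simp: mem_Times_iff)
  note rs = lebesgue_on_representative[OF AB(2) gs aes this]
  note r = lebesgue_on_representative[OF AB(1) g]
  have g2: "g \<in> borel_measurable (lborel \<Otimes>\<^sub>M lborel)" using g(1) by (simp add: lborel_prod)
  show "(\<lambda>z. f (snd z, fst z)) \<in> borel_measurable (leb (B \<times> A))" by (rule rs(1))
  have "integrable lborel (\<lambda>z. g (snd z, fst z)) \<longleftrightarrow> integrable lborel g"
    using lborel_pair.integrable_product_swap_iff[of g] by (simp add: lborel_prod case_prod_unfold)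
  then show "integrable (leb (B \<times> A)) (\<lambda>z. f (snd z, fst z)) \<longleftrightarrow> integrable (leb (A \<times> B)) f"
    using r(2) rs(2) by simp
  have "integral\<^sup>L lborel (\<lambda>z. g (snd z, fst z)) = integral\<^sup>L lborel g"
    using lborel_pair.integral_product_swap[OF g2] by (simp add: lborel_prod case_prod_unfold)
  then show "(LINT z|leb (B \<times> A). f (snd z, fst z)) = (LINT z|leb (A \<times> B). f z)"
    using r(3) rs(3) by simp
qed

text \<open>A null set of the product meets almost every slice in a null set, so a single Borel
  representative serves almost all slices at once.\<close>

lemma lebesgue_on_slice:
  fixes f :: "'a::euclidean_space \<times> 'b::euclidean_space => real"
  assumes A: "A \<in> sets borel" and B: "B \<in> sets borel"
    and f: "f \<in> borel_measurable (leb (A \<times> B))"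
  shows "\<exists>g. g \<in> borel_measurable borel \<and> (\<forall>x. x \<notin> A \<times> B \<longrightarrow> g x = 0)
    \<and> (AE x in leb (A \<times> B). f x = g x)
    \<and> (AE x in leb A. (\<lambda>y. f (x, y)) \<in> borel_measurable (leb B)
      \<and> (integrable (leb B) (\<lambda>y. f (x, y)) \<longleftrightarrow> integrable lborel (\<lambda>y. g (x, y)))
      \<and> (LINT y|leb B. f (x, y)) = (LINT y|lborel. g (x, y)))"
proof -
  have AB: "A \<times> B \<in> sets borel" using A B by (simp add: borel_Times)
  from ex_lebesgue_on_representative[OF AB(1) f] obtain g where
    g: "g \<in> borel_measurable borel" "AE x in leb (A \<times> B). f x = g x"
      "\<And>x. x \<notin> A \<times> B ==> g x = 0" by metis
  have gx: "(\<lambda>y. g (x, y)) \<in> borel_measurable borel" for x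
    by (intro measurable_compose[OF _ g(1)])
      (auto intro!: borel_measurable_continuous_onI continuous_intros)
  from AE_lebesgue_on_slice[OF A B g(2)]
  have "AE x in leb A. (\<lambda>y. f (x, y)) \<in> borel_measurable (leb B)
      \<and> (integrable (leb B) (\<lambda>y. f (x, y)) \<longleftrightarrow> integrable lborel (\<lambda>y. g (x, y)))
      \<and> (LINT y|leb B. f (x, y)) = (LINT y|lborel. g (x, y))"
  proof eventually_elim
    case (elim x)
    from lebesgue_on_representative[OF B gx elim] g(3) show ?case by auto
  qed
  then show ?thesis by (intro exI[of _ g] conjI allI impI g)
qed

lemma lebesgue_on_Fubini:
  fixes f :: "'a::euclidean_space \<times> 'b::euclidean_space => real"
  assumes A: "A \<in> sets borel" and B: "B \<in> sets borel"
    and f: "integrable (leb (A \<times> B)) f"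
  shows "AE x in leb A. integrable (leb B) (\<lambda>y. f (x, y))"
    and "integrable (leb A) (\<lambda>x. \<integral>y. f (x, y) \<partial>leb B)"
    and "(LINT x|leb A. (LINT y|leb B. f (x, y))) = (LINT z|leb (A \<times> B). f z)"
proof -
  have AB: "A \<times> B \<in> sets borel" using A B by (simp add: borel_Times)
  obtain g where g: "g \<in> borel_measurable borel"
    "\<And>x. x \<notin> A \<times> B ==> g x = 0" "AE x in leb (A \<times> B). f x = g x"
    and ae: "AE x in leb A. (\<lambda>y. f (x, y)) \<in> borel_measurable (leb B)
      \<and> (integrable (leb B) (\<lambda>y. f (x, y)) \<longleftrightarrow> integrable lborel (\<lambda>y. g (x, y)))
      \<and> (LINT y|leb B. f (x, y)) = (LINT y|lborel. g (x, y))"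
    using lebesgue_on_slice[OF A B borel_measurable_integrable[OF f]]
    by (elim exE conjE) (rule that, assumption, blast, assumption+)
  note r = lebesgue_on_representative[OF AB g(1) g(3) g(2)]
  have gi: "integrable (lborel \<Otimes>\<^sub>M lborel) g"
    using r(2) f by (simp add: lborel_prod)
  from lborel_pair.AE_integrable_fst'[OF gi]
  have "AE x in leb A. integrable lborel (\<lambda>y. g (x, y))"
    using A by (subst AE_lebesgue_on_iff) auto
  with ae show "AE x in leb A. integrable (leb B) (\<lambda>y. f (x, y))"
    by eventually_elim simp
  have i: "integrable lborel (\<lambda>x. \<integral>y. g (x, y) \<partial>lborel)"
    by (rule lborel_pair.integrable_fst'[OF gi])
  have z: "(LINT y|lborel. g (x, y)) = 0" if "x \<notin> A" for x
  proof -
    have "(\<lambda>y. g (x, y)) = (\<lambda>y. 0)" using g(2) that by auto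
    then show ?thesis by simp
  qed
  have mi: "(\<lambda>x. \<integral>y. g (x, y) \<partial>lborel) \<in> borel_measurable borel"
    using borel_measurable_integrable[OF i] by simp
  have ae2: "AE x in leb A. (LINT y|leb B. f (x, y)) = (LINT y|lborel. g (x, y))"
    using ae by eventually_elim simp
  note rr = lebesgue_on_representative[OF A mi ae2 z]
  show "integrable (leb A) (\<lambda>x. \<integral>y. f (x, y) \<partial>leb B)"
    using rr(2) i by simp
  show "(LINT x|leb A. (LINT y|leb B. f (x, y))) = (LINT z|leb (A \<times> B). f z)"
    using rr(3) r(3) lborel_pair.integral_fst'[OF gi] by (simp add: lborel_prod)
qed

lemma lebesgue_on_Tonelli_integrable:
  fixes f :: "'a::euclidean_space \<times> 'b::euclidean_space => real"
  assumes A: "A \<in> sets borel" and B: "B \<in> sets borel"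
    and f: "f \<in> borel_measurable (leb (A \<times> B))"
    and 1: "AE x in leb A. integrable (leb B) (\<lambda>y. f (x, y))"
    and 2: "integrable (leb A) (\<lambda>x. \<integral>y. \<bar>f (x, y)\<bar> \<partial>leb B)"
  shows "integrable (leb (A \<times> B)) f"
proof -
  have AB: "A \<times> B \<in> sets borel" using A B by (simp add: borel_Times)
  obtain g where g: "g \<in> borel_measurable borel"
    "\<And>x. x \<notin> A \<times> B ==> g x = 0" "AE x in leb (A \<times> B). f x = g x"
    and ae: "AE x in leb A. (\<lambda>y. f (x, y)) \<in> borel_measurable (leb B)
      \<and> (integrable (leb B) (\<lambda>y. f (x, y)) \<longleftrightarrow> integrable lborel (\<lambda>y. g (x, y)))
      \<and> (LINT y|leb B. f (x, y)) = (LINT y|lborel. g (x, y))"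
    using lebesgue_on_slice[OF A B f]
    by (elim exE conjE) (rule that, assumption, blast, assumption+)
  have g2: "g \<in> borel_measurable (lborel \<Otimes>\<^sub>M lborel)" using g(1) by (simp add: lborel_prod)
  have gx: "(\<lambda>y. g (x, y)) \<in> borel_measurable borel" for x
    by (intro measurable_compose[OF _ g(1)])
      (auto intro!: borel_measurable_continuous_onI continuous_intros)
  have z: "(\<lambda>y. g (x, y)) = (\<lambda>y. 0)" if "x \<notin> A" for x
    using g(2) that by auto
  have i1: "AE x in lborel. integrable lborel (\<lambda>y. g (x, y))"
  proof -
    have "AE x in leb A. integrable lborel (\<lambda>y. g (x, y))"
      using ae 1 by eventually_elim simp
    then have "AE x in lborel. x \<in> A \<longrightarrow> integrable lborel (\<lambda>y. g (x, y))"
      using A by (subst (asm) AE_lebesgue_on_iff) auto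
    then show ?thesis by eventually_elim (use z in auto)
  qed
  have ae3: "AE x in leb A. (LINT y|leb B. \<bar>f (x, y)\<bar>) = (LINT y|lborel. \<bar>g (x, y)\<bar>)"
    using AE_lebesgue_on_slice[OF A B g(3)]
  proof eventually_elim
    case (elim x)
    then have "AE y in leb B. \<bar>f (x, y)\<bar> = \<bar>g (x, y)\<bar>" by auto
    moreover have "(\<lambda>y. \<bar>g (x, y)\<bar>) \<in> borel_measurable borel" using gx[of x] by simp
    ultimately show ?case
      using lebesgue_on_representative(3)[OF B, of "\<lambda>y. \<bar>g (x, y)\<bar>" "\<lambda>y. \<bar>f (x, y)\<bar>"] g(2)
      by simp
  qed
  have m3: "(\<lambda>x. \<integral>y. \<bar>g (x, y)\<bar> \<partial>lborel) \<in> borel_measurable borel"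
  proof -
    have "(\<lambda>x. \<integral>y. \<bar>g (x, y)\<bar> \<partial>lborel) \<in> borel_measurable lborel"
      using g2 by (intro lborel.borel_measurable_lebesgue_integral) (simp add: case_prod_unfold)
    then show ?thesis by simp
  qed
  have "(LINT y|lborel. \<bar>g (x, y)\<bar>) = 0" if "x \<notin> A" for x
    using z[OF that] by (simp add: fun_eq_iff)
  from lebesgue_on_representative(2)[OF A m3 ae3 this] 2
  have "integrable lborel (\<lambda>x. \<integral>y. \<bar>g (x, y)\<bar> \<partial>lborel)" by simp
  then have "integrable (lborel \<Otimes>\<^sub>M lborel) g"
    by (intro lborel_pair.Fubini_integrable g2) (use i1 in auto)
  then show ?thesis
    using lebesgue_on_representative(2)[OF AB g(1) g(3) g(2)] by (simp add: lborel_prod)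
qed

section \<open>Smooth functions\<close>

text \<open>The one-variable counterpart of \<open>Ck_on\<close>. The derivative is a witness
  instead of \<open>frechet_derivative\<close>, so it can be supplied by computation;
  \<open>Ck_on_lift\<close> then carries the result over to functions of one coordinate.\<close>

primrec Ck1 :: "nat => (real => real) => bool" where
  "Ck1 0 f = continuous_on UNIV f"
| "Ck1 (Suc k) f = (\<exists>f'. (\<forall>x. (f has_real_derivative f' x) (at x)) \<and> Ck1 k f')"

definition smooth1 :: "(real => real) => bool" where
  "smooth1 f \<longleftrightarrow> (\<forall>k. Ck1 k f)"

lemma Ck1_pred: "Ck1 (Suc k) f ==> Ck1 k f"
proof (induction k arbitrary: f)
  case 0
  then show ?case
    by (auto intro: continuous_at_imp_continuous_on DERIV_isCont)
next
  case (Suc k)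
  then show ?case by (metis Ck1.simps(2))
qed

lemma Ck1_const: "Ck1 k (\<lambda>x. c)"
proof (induction k arbitrary: c)
  case (Suc k) then show ?case by (auto intro!: exI[of _ "\<lambda>x. 0"] derivative_eq_intros)
qed auto

lemma Ck1_add: "Ck1 k f ==> Ck1 k g ==> Ck1 k (\<lambda>x. f x + g x)"
proof (induction k arbitrary: f g)
  case 0 then show ?case by (auto intro: continuous_intros)
next
  case (Suc k)
  from Suc.prems obtain f' g' where
    "\<And>x. (f has_real_derivative f' x) (at x)" "\<And>x. (g has_real_derivative g' x) (at x)"
    "Ck1 k f'" "Ck1 k g'" by auto
  with Suc.IH show ?case unfolding Ck1.simps(2)
    by (intro exI[of _ "\<lambda>x. f' x + g' x"] conjI allI DERIV_add)
qed

lemma Ck1_mult: "Ck1 k f ==> Ck1 k g ==> Ck1 k (\<lambda>x. f x * g x)"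
proof (induction k arbitrary: f g)
  case 0 then show ?case by (auto intro: continuous_intros)
next
  case (Suc k)
  from Suc.prems obtain f' g' where d:
    "\<And>x. (f has_real_derivative f' x) (at x)" "\<And>x. (g has_real_derivative g' x) (at x)"
    and c: "Ck1 k f'" "Ck1 k g'" by auto
  have "Ck1 k (\<lambda>x. f' x * g x + g' x * f x)"
    using Suc.IH Suc.prems[THEN Ck1_pred] c by (auto intro: Ck1_add)
  with d show ?case unfolding Ck1.simps(2)
    by (intro exI[of _ "\<lambda>x. f' x * g x + g' x * f x"] conjI allI DERIV_mult)
qed

lemma Ck1_affine: "Ck1 k f ==> Ck1 k (\<lambda>x. f (c * x + d))"
proof (induction k arbitrary: f)
  case 0
  then show ?case by (auto intro!: continuous_on_compose2[of UNIV f] continuous_intros)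
next
  case (Suc k)
  from Suc.prems obtain f' where d: "\<And>x. (f has_real_derivative f' x) (at x)" and c: "Ck1 k f'" by auto
  have "((\<lambda>x. f (c * x + d)) has_real_derivative f' (c * x + d) * c) (at x)" for x
    by (rule DERIV_chain2[OF d]) (auto intro!: derivative_eq_intros)
  moreover have "Ck1 k (\<lambda>x. f' (c * x + d) * c)" using Suc.IH[OF c] Ck1_const by (rule Ck1_mult)
  ultimately show ?case unfolding Ck1.simps(2)
    by (intro exI[of _ "\<lambda>x. f' (c * x + d) * c"] conjI allI)
qed

lemma smooth1_const: "smooth1 (\<lambda>x. c)" by (simp add: smooth1_def Ck1_const)
lemma smooth1_add: "smooth1 f ==> smooth1 g ==> smooth1 (\<lambda>x. f x + g x)"
  by (simp add: smooth1_def Ck1_add)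
lemma smooth1_mult: "smooth1 f ==> smooth1 g ==> smooth1 (\<lambda>x. f x * g x)"
  by (simp add: smooth1_def Ck1_mult)
lemma smooth1_affine: "smooth1 f ==> smooth1 (\<lambda>x. f (c * x + d))"
  by (simp add: smooth1_def Ck1_affine)

text \<open>A family closed under differentiation consists of smooth functions. It is applied to the
  combinations of sine and cosine and to the range of \<open>exp_bump\<close>.\<close>

lemma smooth1_coinduct:
  assumes "f \<in> P"
    and P: "\<And>f. f \<in> P ==> \<exists>f'\<in>P. \<forall>x. (f has_real_derivative f' x) (at x)"
  shows "smooth1 f"
proof -
  have "Ck1 k f" if "f \<in> P" for k f using that
  proof (induction k arbitrary: f)
    case 0
    from P[OF 0] obtain f' where "\<And>x. (f has_real_derivative f' x) (at x)" by auto
    then have "isCont f x" for x by (rule DERIV_isCont)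
    then show ?case by (simp add: continuous_at_imp_continuous_on)
  next
    case (Suc k)
    from P[OF Suc.prems] obtain f' where "f' \<in> P" "\<forall>x. (f has_real_derivative f' x) (at x)" by auto
    with Suc.IH show ?case unfolding Ck1.simps(2) by (intro exI[of _ f'] conjI)
  qed
  with assms show ?thesis by (simp add: smooth1_def)
qed

lemma smooth1_from_deriv:
  assumes "smooth1 f'" "\<And>x. (f has_real_derivative f' x) (at x)"
  shows "smooth1 f"
  unfolding smooth1_def
proof
  fix k
  have "Ck1 (Suc k) f" using assms by (auto simp: smooth1_def)
  then show "Ck1 k f" by (rule Ck1_pred)
qed

lemma smooth1_id: "smooth1 (\<lambda>x. x)"
  by (rule smooth1_from_deriv[of "\<lambda>x. 1"]) (auto intro: smooth1_const)

lemma smooth1_sin_cos: "smooth1 sin" "smooth1 cos"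
proof -
  let ?P = "{\<lambda>x. c * sin x + d * cos x | c d :: real. True}"
  have *: "\<exists>f'\<in>?P. \<forall>x. (f has_real_derivative f' x) (at x)" if "f \<in> ?P" for f
  proof -
    from that obtain c d where f: "f = (\<lambda>x. c * sin x + d * cos x)" by auto
    have "\<forall>x. (f has_real_derivative (- d) * sin x + c * cos x) (at x)"
      unfolding f by (auto intro!: derivative_eq_intros)
    then show ?thesis by (intro bexI[of _ "\<lambda>x. (- d) * sin x + c * cos x"]) blast+
  qed
  have "(sin :: real => real) = (\<lambda>x. 1 * sin x + 0 * cos x)"
    "(cos :: real => real) = (\<lambda>x. 0 * sin x + 1 * cos x)" by auto
  then have "(sin :: real => real) \<in> ?P" "(cos :: real => real) \<in> ?P" by blast+
  then show "smooth1 sin" "smooth1 cos" using smooth1_coinduct[of _ ?P] * by blast+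
qed

text \<open>The classical flat function \<open>exp (- (1 / x))\<close> with polynomial factors in
  \<open>1 / x\<close>. The factors are included to make the family closed under
  differentiation.\<close>

definition exp_bump :: "real poly => real => real" where
  "exp_bump p x = (if x \<le> 0 then 0 else poly p (1 / x) * exp (- (1 / x)))"

lemma poly_times_exp_minus_tendsto_0:
  fixes p :: "real poly"
  shows "((\<lambda>t. poly p t * exp (- t)) \<longlongrightarrow> 0) at_top"
proof -
  have "((\<lambda>t. \<Sum>i\<le>degree p. coeff p i * (t ^ i / exp t)) \<longlongrightarrow> (\<Sum>i\<le>degree p. coeff p i * 0)) at_top"
    by (intro tendsto_intros tendsto_power_div_exp_0)
  moreover have "(\<Sum>i\<le>degree p. coeff p i * (t ^ i / exp t)) = poly p t * exp (- t)" for t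
    by (simp add: poly_altdef sum_distrib_right exp_minus divide_inverse mult.assoc)
  ultimately show ?thesis by simp
qed

lemma exp_bump_deriv:
  "(exp_bump p has_real_derivative exp_bump ([:0, 0, 1:] * (p - pderiv p)) x) (at x)"
proof -
  consider "x < 0" | "x = 0" | "x > 0" by linarith
  then show ?thesis
  proof cases
    case 1
    have "((\<lambda>x. 0) has_real_derivative 0) (at x)" by simp
    then have "(exp_bump p has_real_derivative 0) (at x)"
      by (rule has_field_derivative_transform_within_open[of _ _ _ "{..<0}"])
        (use 1 in \<open>auto simp: exp_bump_def\<close>)
    with 1 show ?thesis by (simp add: exp_bump_def)
  next
    case 3
    have "((\<lambda>x. poly p (1 / x) * exp (- (1 / x))) has_real_derivative
       exp_bump ([:0, 0, 1:] * (p - pderiv p)) x) (at x)"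
      using 3 by (auto intro!: derivative_eq_intros DERIV_chain2[OF poly_DERIV]
          simp: exp_bump_def field_simps power2_eq_square)
    then show ?thesis
      by (rule has_field_derivative_transform_within_open[of _ _ _ "{0<..}"])
        (use 3 in \<open>auto simp: exp_bump_def\<close>)
  next
    case 2
    have "((\<lambda>h. exp_bump p h / h) \<longlongrightarrow> 0) (at_right 0)"
    proof -
      \<comment> \<open>Dividing by \<open>h\<close> multiplies the polynomial in
        \<open>1 / h\<close> by its variable, hence \<open>pCons 0 p\<close>.\<close>
      have "((\<lambda>h. poly (pCons 0 p) (inverse h) * exp (- inverse h)) \<longlongrightarrow> 0) (at_right (0::real))"
        using filterlim_compose[OF poly_times_exp_minus_tendsto_0 filterlim_inverse_at_top_right] .
      moreover have "\<forall>\<^sub>F h in at_right (0::real).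
          poly (pCons 0 p) (inverse h) * exp (- inverse h) = exp_bump p h / h"
        by (rule eventually_at_rightI[of 0 1])
          (auto simp: exp_bump_def field_simps inverse_eq_divide)
      ultimately show ?thesis by (rule Lim_transform_eventually)
    qed
    moreover have "((\<lambda>h. exp_bump p h / h) \<longlongrightarrow> 0) (at_left 0)"
    proof -
      have "\<forall>\<^sub>F h in at_left (0::real). 0 = exp_bump p h / h"
        by (rule eventually_at_leftI[of "-1"]) (auto simp: exp_bump_def)
      then show ?thesis by (rule Lim_transform_eventually[OF tendsto_const])
    qed
    ultimately have "((\<lambda>h. exp_bump p h / h) \<longlongrightarrow> 0) (at 0)"
      by (simp add: filterlim_split_at)
    then show ?thesis using 2 by (simp add: DERIV_def exp_bump_def)
  qed
qed

lemma smooth1_exp_bump: "smooth1 (exp_bump p)"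
  by (rule smooth1_coinduct[of _ "range exp_bump"]) (use exp_bump_deriv in blast)+

text \<open>The step is the normalised primitive of a product of two reflected
  \<open>exp_bump\<close> functions, which is positive exactly between 1 and 2.\<close>

lemma ex_smooth_step:
  "\<exists>h h' C. smooth1 h \<and> (\<forall>t. (h has_real_derivative h' t) (at t))
    \<and> (\<forall>t\<le>1. h t = 0) \<and> (\<forall>t\<ge>2. h t = 1) \<and> (\<forall>t. 0 \<le> h t \<and> h t \<le> 1)
    \<and> (\<forall>t\<ge>2. h' t = 0) \<and> (\<forall>t. \<bar>h' t\<bar> \<le> C)"
proof -
  define be where "be t = exp_bump 1 (1 * t + (-1)) * exp_bump 1 ((-1) * t + 2)" for t
  have sbe: "smooth1 be" unfolding be_def by (intro smooth1_mult smooth1_affine smooth1_exp_bump)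
  have b01: "0 \<le> exp_bump 1 t" "exp_bump 1 t \<le> 1" for t by (auto simp: exp_bump_def)
  have be01: "0 \<le> be t" "be t \<le> 1" for t
    unfolding be_def using b01 by (auto intro: mult_le_one)
  have be0: "be t = 0" if "t \<le> 1 \<or> t \<ge> 2" for t using that by (auto simp: be_def exp_bump_def)
  have bep: "be t > 0" if "1 < t" "t < 2" for t using that by (auto simp: be_def exp_bump_def)
  have cbe: "continuous_on A be" for A
    using sbe Ck1.simps(1)[of be] continuous_on_subset unfolding smooth1_def by blast
  \<comment> \<open>The integrand vanishes up to 1 and the interval is empty for negative
    \<open>t\<close>, so \<open>A\<close> is zero on all of \<open>{..1}\<close> although the
    integral starts at 0.\<close>
  define A where "A t = integral {0..t} be" for t
  have A0: "A t = 0" if "t \<le> 1" for t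
  proof -
    have "A t = integral {0..t} (\<lambda>x. 0)"
      unfolding A_def by (rule integral_cong) (use that be0 in auto)
    then show ?thesis by simp
  qed
  have dA: "(A has_real_derivative be t) (at t)" for t
  proof (cases "t < 1")
    case True
    have "((\<lambda>x. 0) has_real_derivative 0) (at t)" by simp
    then have "(A has_real_derivative 0) (at t)"
      by (rule has_field_derivative_transform_within_open[of _ _ _ "{..<1}"])
        (use True A0 in auto)
    with True be0 show ?thesis by simp
  next
    case False
    have "(A has_real_derivative be t) (at t within {0..t+1})"
      unfolding A_def by (rule integral_has_real_derivative[OF cbe]) (use False in auto)
    then have "(A has_real_derivative be t) (at t within {0<..<t+1})"
      by (rule DERIV_subset) auto
    then show ?thesis using False by (subst (asm) at_within_open) auto
  qed
  have mono: "A s \<le> A t" if "s \<le> t" for s t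
    by (rule DERIV_nonneg_imp_nondecreasing[OF that]) (use dA be01 in blast)
  have A2: "A t = A 2" if "t \<ge> 2" for t
  proof (rule antisym[OF _ mono[OF that]])
    show "A t \<le> A 2"
      by (rule DERIV_nonpos_imp_nonincreasing[OF that]) (use dA be0 in force)
  qed
  have "A 1 < A 2"
  proof (rule DERIV_pos_imp_increasing_open[of 1 2])
    show "continuous_on {1..2} A"
      using DERIV_isCont[OF dA] by (simp add: continuous_at_imp_continuous_on)
  qed (use dA bep in auto)
  then have pos: "A 2 > 0" using A0[of 1] by simp
  define h where "h t = A t * (1 / A 2)" for t
  have dh: "(h has_real_derivative be t * (1 / A 2)) (at t)" for t
    unfolding h_def by (rule DERIV_cmult_right[OF dA])
  have "smooth1 h"
    by (rule smooth1_from_deriv[OF _ dh]) (intro smooth1_mult sbe smooth1_const)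
  moreover have "h t = 0" if "t \<le> 1" for t using A0[OF that] by (simp add: h_def)
  moreover have "h t = 1" if "t \<ge> 2" for t using A2[OF that] pos by (simp add: h_def)
  moreover have "0 \<le> h t \<and> h t \<le> 1" for t
  proof -
    have "0 \<le> A t" using mono[of "min t 1" t] A0[of "min t 1"] by simp
    moreover have "A t \<le> A 2" using mono[of t "max t 2"] A2[of "max t 2"] by simp
    ultimately show ?thesis using pos by (simp add: h_def field_simps)
  qed
  moreover have "be t * (1 / A 2) = 0" if "t \<ge> 2" for t using be0 that by simp
  moreover have "\<bar>be t * (1 / A 2)\<bar> \<le> 1 / A 2" for t
    using be01[of t] pos by (simp add: field_simps)
  ultimately show ?thesis using dh
    by (intro exI[of _ h] exI[of _ "\<lambda>t. be t * (1 / A 2)"] exI[of _ "1 / A 2"]) auto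
qed

section \<open>Smooth functions of several variables\<close>

lemma Ck_on_SucI:
  assumes "\<And>x. (f has_derivative f' x) (at x)" "\<And>e. e \<in> Basis ==> Ck_on k UNIV (\<lambda>x. f' x e)"
  shows "Ck_on (Suc k) UNIV f"
proof -
  have "frechet_derivative f (at x) = f' x" for x
    using frechet_derivative_at[OF assms(1)] by simp
  then show ?thesis using assms by (auto simp: differentiable_def)
qed

lemma Ck_on_SucD:
  assumes "Ck_on (Suc k) UNIV f"
  shows "(f has_derivative frechet_derivative f (at x)) (at x)"
    and "e \<in> Basis ==> Ck_on k UNIV (\<lambda>x. frechet_derivative f (at x) e)"
  using assms frechet_derivative_works by auto

lemma Ck_on_pred: "Ck_on (Suc k) UNIV f ==> Ck_on k UNIV f"
proof (induction k arbitrary: f)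
  case 0
  then have "isCont f x" for x
    using has_derivative_continuous[OF Ck_on_SucD(1)] by blast
  then show ?case by (simp add: continuous_on_eq_continuous_at)
next
  case (Suc k)
  show ?case
    by (rule Ck_on_SucI[OF Ck_on_SucD(1)[OF Suc.prems] Suc.IH[OF Ck_on_SucD(2)[OF Suc.prems]]])
qed

lemma Ck_on_const: "Ck_on k UNIV (\<lambda>x. c)"
proof (induction k arbitrary: c)
  case (Suc k)
  show ?case by (rule Ck_on_SucI[of _ "\<lambda>x h. 0"]) (use Suc in auto)
qed auto

lemma Ck_on_add: "Ck_on k UNIV f ==> Ck_on k UNIV g ==> Ck_on k UNIV (\<lambda>x. f x + g x)"
proof (induction k arbitrary: f g)
  case 0 then show ?case by (auto intro: continuous_intros)
next
  case (Suc k)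
  show ?case
    by (rule Ck_on_SucI[OF has_derivative_add[OF Ck_on_SucD(1)[OF Suc.prems(1)] Ck_on_SucD(1)[OF Suc.prems(2)]]])
      (use Suc Ck_on_SucD(2) in blast)
qed

lemma Ck_on_mult: "Ck_on k UNIV f ==> Ck_on k UNIV g ==> Ck_on k UNIV (\<lambda>x. f x * g x)"
proof (induction k arbitrary: f g)
  case 0 then show ?case by (auto intro: continuous_intros)
next
  case (Suc k)
  show ?case
    by (rule Ck_on_SucI[OF has_derivative_mult[OF Ck_on_SucD(1)[OF Suc.prems(1)] Ck_on_SucD(1)[OF Suc.prems(2)]]])
      (intro Ck_on_add Suc.IH Ck_on_SucD(2) Suc.prems Ck_on_pred)
qed

lemma Ck_on_lift: "Ck1 k f ==> Ck_on k UNIV (\<lambda>x::'a::euclidean_space. f (x \<bullet> e))"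
proof (induction k arbitrary: f)
  case 0
  then show ?case by (auto intro!: continuous_on_compose2[of UNIV f] continuous_intros)
next
  case (Suc k)
  from Suc.prems obtain f' where d: "\<And>x. (f has_real_derivative f' x) (at x)" and c: "Ck1 k f'" by auto
  have "((\<lambda>x::'a. f (x \<bullet> e)) has_derivative (\<lambda>h. f' (x \<bullet> e) * (h \<bullet> e))) (at x)" for x
  proof -
    have "(f has_derivative (*) (f' (x \<bullet> e))) (at (x \<bullet> e))"
      using d[of "x \<bullet> e"] by (simp add: has_field_derivative_def)
    from has_derivative_compose[OF has_derivative_inner_left[OF has_derivative_ident] this]
    show ?thesis by simp
  qed
  then show ?case
    by (rule Ck_on_SucI) (intro Ck_on_mult Suc.IH c Ck_on_const)
qed

lemma smooth_fun_const: "smooth_fun (\<lambda>x. c)" by (simp add: smooth_fun_def Ck_on_const)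
lemma smooth_fun_add: "smooth_fun f ==> smooth_fun g ==> smooth_fun (\<lambda>x. f x + g x)"
  by (simp add: smooth_fun_def Ck_on_add)
lemma smooth_fun_mult: "smooth_fun f ==> smooth_fun g ==> smooth_fun (\<lambda>x. f x * g x)"
  by (simp add: smooth_fun_def Ck_on_mult)
lemma smooth_fun_lift: "smooth1 f ==> smooth_fun (\<lambda>x. f (x \<bullet> e))"
  by (simp add: smooth_fun_def smooth1_def Ck_on_lift)
lemma smooth_fun_sum: "(\<And>i. i \<in> I ==> smooth_fun (f i)) ==> smooth_fun (\<lambda>x. \<Sum>i\<in>I. f i x)"
  by (induction I rule: infinite_finite_induct) (auto intro: smooth_fun_const smooth_fun_add)
lemma smooth_fun_prod: "(\<And>i. i \<in> I ==> smooth_fun (f i)) ==> smooth_fun (\<lambda>x. \<Prod>i\<in>I. f i x)"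
  by (induction I rule: infinite_finite_induct) (auto intro: smooth_fun_const smooth_fun_mult)

lemma smooth_fun_has_derivative:
  "smooth_fun f ==> (f has_derivative frechet_derivative f (at x)) (at x)"
  using Ck_on_SucD(1)[of 0 f] by (simp only: smooth_fun_def)

lemma smooth_fun_partial:
  "smooth_fun f ==> e \<in> Basis ==> smooth_fun (\<lambda>x. frechet_derivative f (at x) e)"
  using Ck_on_SucD(2)[of _ f e] by (simp only: smooth_fun_def) blast

lemma smooth_fun_continuous: "smooth_fun f ==> continuous_on A f"
  using Ck_on.simps(1)[of UNIV f] continuous_on_subset unfolding smooth_fun_def by blast

lemma frechet_derivative_mult_smooth:
  assumes "smooth_fun f" "smooth_fun g"
  shows "frechet_derivative (\<lambda>x. f x * g x) (at x) e
    = f x * frechet_derivative g (at x) e + frechet_derivative f (at x) e * g x"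
  using frechet_derivative_at[OF has_derivative_mult[OF assms[THEN smooth_fun_has_derivative]]]
  by (simp add: fun_eq_iff)

lemma frechet_derivative_direction:
  assumes "(f has_derivative f') (at x)"
  shows "((\<lambda>t. f (x + t *\<^sub>R e)) has_real_derivative f' e) (at 0)"
proof -
  have "((\<lambda>t. x + t *\<^sub>R e) has_derivative (\<lambda>t. t *\<^sub>R e)) (at 0)"
    by (auto intro!: derivative_eq_intros)
  then have "((\<lambda>t. f (x + t *\<^sub>R e)) has_derivative (\<lambda>t. f' (t *\<^sub>R e))) (at 0)"
    by (rule has_derivative_compose) (use assms in simp)
  moreover have "f' (t *\<^sub>R e) = f' e * t" for t
    using assms[THEN has_derivative_linear] by (simp add: linear_cmul)
  ultimately show ?thesis by (simp add: has_field_derivative_def)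
qed

text \<open>Along the line \<open>x + t *\<^sub>R e\<close> only the factor belonging to
  \<open>e\<close> varies, so the partial derivative reduces to a one-variable derivative.\<close>

lemma frechet_derivative_coordinate_prod:
  fixes e :: "'a::euclidean_space"
  assumes g: "\<And>j. j \<in> Basis ==> smooth1 (g j)" and e: "e \<in> Basis"
    and d: "(g e has_real_derivative g') (at (x \<bullet> e))"
  shows "frechet_derivative (\<lambda>x. \<Prod>j\<in>Basis. g j (x \<bullet> j)) (at x) e
    = g' * (\<Prod>j\<in>Basis - {e}. g j (x \<bullet> j))"
proof -
  let ?f = "\<lambda>x::'a. \<Prod>j\<in>Basis. g j (x \<bullet> j)"
  have "smooth_fun ?f" by (intro smooth_fun_prod smooth_fun_lift g)
  from frechet_derivative_direction[OF smooth_fun_has_derivative[OF this]]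
  have 1: "((\<lambda>t. ?f (x + t *\<^sub>R e)) has_real_derivative frechet_derivative ?f (at x) e) (at 0)" .
  have 2: "?f (x + t *\<^sub>R e) = g e (x \<bullet> e + t) * (\<Prod>j\<in>Basis - {e}. g j (x \<bullet> j))" for t
  proof -
    have "?f (x + t *\<^sub>R e) = g e ((x + t *\<^sub>R e) \<bullet> e) * (\<Prod>j\<in>Basis - {e}. g j ((x + t *\<^sub>R e) \<bullet> j))"
      using e by (subst prod.remove[of _ e]) auto
    also have "(\<Prod>j\<in>Basis - {e}. g j ((x + t *\<^sub>R e) \<bullet> j)) = (\<Prod>j\<in>Basis - {e}. g j (x \<bullet> j))"
      using e by (intro prod.cong) (auto simp: inner_add_left inner_Basis)
    finally show ?thesis using e by (simp add: inner_add_left)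
  qed
  have 3: "((\<lambda>t. g e (x \<bullet> e + t) * (\<Prod>j\<in>Basis - {e}. g j (x \<bullet> j)))
      has_real_derivative g' * (\<Prod>j\<in>Basis - {e}. g j (x \<bullet> j))) (at 0)"
  proof (rule DERIV_cmult_right)
    have "((\<lambda>t. g e (x \<bullet> e + t)) has_real_derivative g' * 1) (at 0)"
      by (rule DERIV_chain2[of "g e"]) (use d in \<open>auto intro!: derivative_eq_intros\<close>)
    then show "((\<lambda>t. g e (x \<bullet> e + t)) has_real_derivative g') (at 0)" by simp
  qed
  show ?thesis by (rule DERIV_unique[OF 1]) (simp only: 2 3)
qed

section \<open>Integration by parts for weak derivatives\<close>

text \<open>One profile is fixed once and for all, so that the cutoffs of every width are rescalings
  of it and share their constants.\<close>

definition smooth_step :: "real => real" where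
  "smooth_step = (SOME h. smooth1 h \<and> (\<forall>t\<le>1. h t = 0) \<and> (\<forall>t\<ge>2. h t = 1) \<and> (\<forall>t. 0 \<le> h t \<and> h t \<le> 1)
     \<and> (\<exists>h' C. (\<forall>t. (h has_real_derivative h' t) (at t)) \<and> (\<forall>t\<ge>2. h' t = 0) \<and> (\<forall>t. \<bar>h' t\<bar> \<le> C)))"

lemma smooth_step:
  shows "smooth1 smooth_step" "t \<le> 1 ==> smooth_step t = 0" "t \<ge> 2 ==> smooth_step t = 1"
    "0 \<le> smooth_step t" "smooth_step t \<le> 1"
    "\<exists>h' C. (\<forall>t. (smooth_step has_real_derivative h' t) (at t)) \<and> (\<forall>t\<ge>2. h' t = 0) \<and> (\<forall>t. \<bar>h' t\<bar> \<le> C)"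
proof -
  have "\<exists>h. smooth1 h \<and> (\<forall>t\<le>1. h t = 0) \<and> (\<forall>t\<ge>2. h t = 1) \<and> (\<forall>t. 0 \<le> h t \<and> h t \<le> 1)
     \<and> (\<exists>h' C. (\<forall>t. (h has_real_derivative h' t) (at t)) \<and> (\<forall>t\<ge>2. h' t = 0) \<and> (\<forall>t. \<bar>h' t\<bar> \<le> C))"
    using ex_smooth_step by blast
  from someI_ex[OF this, folded smooth_step_def]
  show "smooth1 smooth_step" "t \<le> 1 ==> smooth_step t = 0" "t \<ge> 2 ==> smooth_step t = 1"
    "0 \<le> smooth_step t" "smooth_step t \<le> 1"
    "\<exists>h' C. (\<forall>t. (smooth_step has_real_derivative h' t) (at t)) \<and> (\<forall>t\<ge>2. h' t = 0) \<and> (\<forall>t. \<bar>h' t\<bar> \<le> C)"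
    by blast+
qed

text \<open>By the choice of \<open>smooth_step\<close> it vanishes within distance
  \<open>1 / Suc n\<close> of the two faces orthogonal to \<open>j\<close> and equals 1 from
  distance \<open>2 / Suc n\<close> on.\<close>

definition edge_cutoff :: "'a::euclidean_space => 'a => nat => 'a => real => real" where
  "edge_cutoff l u n j t = smooth_step (real (Suc n) * (t - l \<bullet> j)) * smooth_step (real (Suc n) * (u \<bullet> j - t))"

definition box_cutoff :: "'a::euclidean_space => 'a => nat => 'a => real" where
  "box_cutoff l u n x = (\<Prod>j\<in>Basis. edge_cutoff l u n j (x \<bullet> j))"

lemma smooth1_edge_cutoff: "smooth1 (edge_cutoff l u n j)"
proof -
  have "smooth1 (\<lambda>t. smooth_step (real (Suc n) * t + (- real (Suc n) * (l \<bullet> j)))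
     * smooth_step ((- real (Suc n)) * t + real (Suc n) * (u \<bullet> j)))"
    by (intro smooth1_mult smooth1_affine smooth_step(1))
  moreover have "edge_cutoff l u n j = (\<lambda>t. smooth_step (real (Suc n) * t + (- real (Suc n) * (l \<bullet> j)))
     * smooth_step ((- real (Suc n)) * t + real (Suc n) * (u \<bullet> j)))"
    by (simp add: edge_cutoff_def fun_eq_iff algebra_simps)
  ultimately show ?thesis by simp
qed

lemma edge_cutoff_bounds: "0 \<le> edge_cutoff l u n j t" "edge_cutoff l u n j t \<le> 1"
  by (auto simp: edge_cutoff_def smooth_step(4,5) intro: mult_le_one)

text \<open>The growth \<open>Suc n\<close> comes from the rescaling. That the derivative lives only
  in strips of width \<open>2 / Suc n\<close> is what compensates this growth later.\<close>

lemma edge_cutoff_deriv: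
  "\<exists>C\<ge>0. \<forall>n t. \<exists>D. (edge_cutoff l u n j has_real_derivative D) (at t)
      \<and> \<bar>D\<bar> \<le> C * real (Suc n)
      \<and> (2 \<le> real (Suc n) * (t - l \<bullet> j) \<longrightarrow> 2 \<le> real (Suc n) * (u \<bullet> j - t) \<longrightarrow> D = 0)"
proof -
  obtain h' C where h: "\<And>t. (smooth_step has_real_derivative h' t) (at t)"
    "\<And>t. t \<ge> 2 ==> h' t = 0" "\<And>t. \<bar>h' t\<bar> \<le> C" using smooth_step(6) by blast
  have C0: "C \<ge> 0" using h(3)[of 0] by linarith
  have main: "\<exists>D. (edge_cutoff l u n j has_real_derivative D) (at t)
      \<and> \<bar>D\<bar> \<le> (2 * C) * real (Suc n)
      \<and> (2 \<le> real (Suc n) * (t - l \<bullet> j) \<longrightarrow> 2 \<le> real (Suc n) * (u \<bullet> j - t) \<longrightarrow> D = 0)" for n t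
  proof -
    let ?N = "real (Suc n)"
    let ?p = "?N * (t - l \<bullet> j)" and ?q = "?N * (u \<bullet> j - t)"
    let ?D = "(h' ?p * ?N) * smooth_step ?q + (h' ?q * (- ?N)) * smooth_step ?p"
    have "(edge_cutoff l u n j has_real_derivative ?D) (at t)"
      unfolding edge_cutoff_def
    proof (rule DERIV_mult)
      show "((\<lambda>t. smooth_step (?N * (t - l \<bullet> j))) has_real_derivative h' ?p * ?N) (at t)"
        by (rule DERIV_chain2[OF h(1)]) (auto intro!: derivative_eq_intros)
      show "((\<lambda>t. smooth_step (?N * (u \<bullet> j - t))) has_real_derivative h' ?q * (- ?N)) (at t)"
        by (rule DERIV_chain2[OF h(1)]) (auto intro!: derivative_eq_intros)
    qed
    moreover have "\<bar>?D\<bar> \<le> (2 * C) * ?N"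
    proof -
      have b: "\<bar>h' s * smooth_step r\<bar> \<le> C" for s r
        using h(3)[of s] smooth_step(4,5)[of r] C0 mult_mono[of "\<bar>h' s\<bar>" C "\<bar>smooth_step r\<bar>" 1]
        by (simp add: abs_mult)
      have "?D = ?N * (h' ?p * smooth_step ?q - h' ?q * smooth_step ?p)" by (simp add: algebra_simps)
      also have "\<bar>\<dots>\<bar> \<le> ?N * (C + C)"
        unfolding abs_mult using b[of ?p ?q] b[of ?q ?p] by (intro mult_mono) auto
      finally show ?thesis by (simp add: algebra_simps)
    qed
    moreover have "2 \<le> ?p \<longrightarrow> 2 \<le> ?q \<longrightarrow> ?D = 0" using h(2) by auto
    ultimately show ?thesis by (intro exI[of _ ?D] conjI)
  qed
  have "0 \<le> 2 * C" using C0 by simp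
  with main show ?thesis by blast
qed

lemma smooth_fun_box_cutoff: "smooth_fun (box_cutoff l u n)"
  unfolding box_cutoff_def by (intro smooth_fun_prod smooth_fun_lift smooth1_edge_cutoff)

lemma box_cutoff_bounds: "0 \<le> box_cutoff l u n x" "box_cutoff l u n x \<le> 1"
  unfolding box_cutoff_def by (auto intro!: prod_nonneg prod_le_1 simp: edge_cutoff_bounds)

lemma box_cutoff_nonzero:
  fixes l u x :: "'a::euclidean_space"
  assumes "box_cutoff l u n x \<noteq> 0"
  shows "x \<in> cbox (l + (1 / real (Suc n)) *\<^sub>R One) (u - (1 / real (Suc n)) *\<^sub>R One)"
proof -
  have "edge_cutoff l u n j (x \<bullet> j) \<noteq> 0" if "j \<in> Basis" for j
    using assms that by (auto simp: box_cutoff_def)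
  then have "1 < real (Suc n) * (x \<bullet> j - l \<bullet> j) \<and> 1 < real (Suc n) * (u \<bullet> j - x \<bullet> j)" if "j \<in> Basis" for j
    using that smooth_step(2) unfolding edge_cutoff_def by (metis mult_eq_0_iff not_le)
  then have "1 / real (Suc n) < (x \<bullet> j - l \<bullet> j) \<and> 1 / real (Suc n) < (u \<bullet> j - x \<bullet> j)" if "j \<in> Basis" for j
    using that by (simp add: divide_less_eq mult.commute)
  then show ?thesis by (fastforce simp: mem_box algebra_simps)
qed

text \<open>This turns an arbitrary smooth function into an admissible test function, and so brings
  the weak derivative to bear on functions that reach the boundary.\<close>

lemma test_fun_box_cutoff:
  assumes "smooth_fun \<psi>"
  shows "test_fun (box l u) (\<lambda>x. box_cutoff l u n x * \<psi> x)"
proof -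
  let ?K = "cbox (l + (1 / real (Suc n)) *\<^sub>R One) (u - (1 / real (Suc n)) *\<^sub>R One)"
  have 0: "{x. box_cutoff l u n x * \<psi> x \<noteq> 0} \<subseteq> ?K" using box_cutoff_nonzero by auto
  then have 1: "closure {x. box_cutoff l u n x * \<psi> x \<noteq> 0} \<subseteq> ?K"
    by (rule closure_minimal) (rule closed_cbox)
  moreover have "?K \<subseteq> box l u"
  proof
    fix x assume x: "x \<in> ?K"
    have r: "0 < 1 / real (Suc n)" by simp
    have "l \<bullet> j < x \<bullet> j \<and> x \<bullet> j < u \<bullet> j" if j: "j \<in> Basis" for j
    proof -
      have "l \<bullet> j + 1 / real (Suc n) \<le> x \<bullet> j" "x \<bullet> j \<le> u \<bullet> j - 1 / real (Suc n)"
        using x j unfolding mem_box by (auto simp: inner_add_left inner_diff_left simp del: of_nat_Suc)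
      with r show ?thesis by linarith
    qed
    then show "x \<in> box l u" by (simp add: mem_box)
  qed
  moreover have "compact (closure {x. box_cutoff l u n x * \<psi> x \<noteq> 0})"
    unfolding compact_closure by (rule bounded_subset[OF bounded_cbox 0])
  ultimately show ?thesis
    unfolding test_fun_def using smooth_fun_mult[OF smooth_fun_box_cutoff assms] by blast
qed

lemma box_cutoff_eventually_1:
  fixes l u x :: "'a::euclidean_space"
  assumes "x \<in> box l u"
  shows "\<forall>\<^sub>F n in sequentially. \<forall>j\<in>Basis. 2 \<le> real (Suc n) * (x \<bullet> j - l \<bullet> j) \<and> 2 \<le> real (Suc n) * (u \<bullet> j - x \<bullet> j)"
proof -
  have *: "\<forall>\<^sub>F n in sequentially. 2 \<le> real (Suc n) * c" if "c > 0" for c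
  proof -
    obtain N where "2 / c < real N" using reals_Archimedean2 by blast
    then have "2 \<le> real (Suc n) * c" if "n \<ge> N" for n
    proof -
      have "2 / c \<le> real (Suc n)" using \<open>2 / c < real N\<close> that by linarith
      then show ?thesis using \<open>c > 0\<close> by (simp add: divide_le_eq)
    qed
    then show ?thesis by (auto simp: eventually_sequentially)
  qed
  show ?thesis
    by (intro eventually_ball_finite finite_Basis ballI eventually_conj *) (use assms in \<open>auto simp: mem_box\<close>)
qed

lemma box_cutoff_tendsto_1:
  assumes "x \<in> box l u"
  shows "(\<lambda>n. box_cutoff l u n x) \<longlonglongrightarrow> 1"
proof (rule tendsto_eventually)
  show "\<forall>\<^sub>F n in sequentially. box_cutoff l u n x = 1"
    using box_cutoff_eventually_1[OF assms]
    by eventually_elim (simp add: box_cutoff_def edge_cutoff_def smooth_step(3))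
qed

lemma box_cutoff_deriv:
  fixes l u :: "'a::euclidean_space"
  assumes e: "e \<in> Basis"
  shows "\<exists>C\<ge>0. \<forall>n x. \<bar>frechet_derivative (box_cutoff l u n) (at x) e\<bar> \<le> C * real (Suc n)
      \<and> (2 \<le> real (Suc n) * (x \<bullet> e - l \<bullet> e) \<longrightarrow> 2 \<le> real (Suc n) * (u \<bullet> e - x \<bullet> e)
          \<longrightarrow> frechet_derivative (box_cutoff l u n) (at x) e = 0)"
proof -
  from edge_cutoff_deriv[of l u e] obtain C where C: "C \<ge> 0"
    and D: "\<And>n t. \<exists>D. (edge_cutoff l u n e has_real_derivative D) (at t)
      \<and> \<bar>D\<bar> \<le> C * real (Suc n)
      \<and> (2 \<le> real (Suc n) * (t - l \<bullet> e) \<longrightarrow> 2 \<le> real (Suc n) * (u \<bullet> e - t) \<longrightarrow> D = 0)"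
    by blast
  have "\<bar>frechet_derivative (box_cutoff l u n) (at x) e\<bar> \<le> C * real (Suc n)
      \<and> (2 \<le> real (Suc n) * (x \<bullet> e - l \<bullet> e) \<longrightarrow> 2 \<le> real (Suc n) * (u \<bullet> e - x \<bullet> e)
          \<longrightarrow> frechet_derivative (box_cutoff l u n) (at x) e = 0)" for n x
  proof -
    obtain D where D: "(edge_cutoff l u n e has_real_derivative D) (at (x \<bullet> e))"
      "\<bar>D\<bar> \<le> C * real (Suc n)"
      "2 \<le> real (Suc n) * (x \<bullet> e - l \<bullet> e) \<longrightarrow> 2 \<le> real (Suc n) * (u \<bullet> e - x \<bullet> e) \<longrightarrow> D = 0"
      using D by blast
    let ?P = "\<Prod>j\<in>Basis - {e}. edge_cutoff l u n j (x \<bullet> j)"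
    have eq: "frechet_derivative (box_cutoff l u n) (at x) e = D * ?P"
      using frechet_derivative_coordinate_prod[of "edge_cutoff l u n", OF smooth1_edge_cutoff e D(1)]
      unfolding box_cutoff_def[abs_def] .
    have P: "0 \<le> ?P" "?P \<le> 1" by (auto intro!: prod_nonneg prod_le_1 simp: edge_cutoff_bounds)
    have "\<bar>D * ?P\<bar> \<le> \<bar>D\<bar>" using P mult_left_le[of ?P "\<bar>D\<bar>"] by (simp add: abs_mult)
    with D(2,3) show ?thesis unfolding eq by auto
  qed
  with C show ?thesis by blast
qed

lemma smooth_fun_bounded_on_cbox:
  assumes "smooth_fun \<psi>" obtains K where "\<And>x. x \<in> cbox l u ==> \<bar>\<psi> x\<bar> \<le> K"
proof -
  have "bounded (\<psi> ` cbox l u)"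
    using compact_continuous_image[OF smooth_fun_continuous[OF assms] compact_cbox] compact_imp_bounded by blast
  then show ?thesis using that by (auto simp: bounded_iff)
qed

lemma smooth_fun_measurable: "smooth_fun \<psi> ==> \<psi> \<in> borel_measurable (leb S)"
  by (intro measurable_restrict_space1 measurable_completion)
    (simp add: borel_measurable_continuous_onI smooth_fun_continuous)

lemma L2_on_smooth: "smooth_fun \<psi> ==> L2_on (box l u) \<psi>"
  by (rule L2_on_continuous[OF smooth_fun_continuous compact_cbox box_subset_cbox]) auto

lemma integral_box_cutoff_tendsto:
  assumes v: "L2_on (box l u) v" and \<psi>: "smooth_fun \<psi>"
  shows "(\<lambda>n. \<integral>x. v x * (box_cutoff l u n x * \<psi> x) \<partial>leb (box l u))
     \<longlonglongrightarrow> (LINT x|leb (box l u). v x * \<psi> x)"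
proof (rule integral_dominated_convergence[where w="\<lambda>x. \<bar>v x * \<psi> x\<bar>"])
  have i: "integrable (leb (box l u)) (\<lambda>x. v x * \<psi> x)"
    by (rule L2_on_integrable_mult[OF v L2_on_smooth[OF \<psi>]])
  then show "integrable (leb (box l u)) (\<lambda>x. \<bar>v x * \<psi> x\<bar>)" by simp
  show "(\<lambda>x. v x * \<psi> x) \<in> borel_measurable (leb (box l u))"
    using i by (rule borel_measurable_integrable)
  show "(\<lambda>x. v x * (box_cutoff l u n x * \<psi> x)) \<in> borel_measurable (leb (box l u))" for n
    using v smooth_fun_measurable[OF \<psi>] smooth_fun_measurable[OF smooth_fun_box_cutoff]
    by (intro borel_measurable_times) (auto simp: L2_on_def)
  show "AE x in leb (box l u). (\<lambda>n. v x * (box_cutoff l u n x * \<psi> x)) \<longlonglongrightarrow> v x * \<psi> x"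
  proof (rule AE_I2)
    fix x assume "x \<in> space (leb (box l u))"
    then have "(\<lambda>n. v x * (box_cutoff l u n x * \<psi> x)) \<longlonglongrightarrow> v x * (1 * \<psi> x)"
      by (intro tendsto_intros box_cutoff_tendsto_1) simp
    then show "(\<lambda>n. v x * (box_cutoff l u n x * \<psi> x)) \<longlonglongrightarrow> v x * \<psi> x" by simp
  qed
  show "AE x in leb (box l u). norm (v x * (box_cutoff l u n x * \<psi> x)) \<le> \<bar>v x * \<psi> x\<bar>" for n
  proof (rule AE_I2)
    fix x
    have "box_cutoff l u n x * \<bar>v x * \<psi> x\<bar> \<le> \<bar>v x * \<psi> x\<bar>"
      using box_cutoff_bounds[of l u n x] by (simp add: mult_left_le_one_le)
    then show "norm (v x * (box_cutoff l u n x * \<psi> x)) \<le> \<bar>v x * \<psi> x\<bar>"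
      using box_cutoff_bounds(1)[of l u n x] by (simp add: abs_mult mult_ac)
  qed
qed

text \<open>The three integration-by-parts lemmas differ only in why the commutator term
  with the derivative of the cutoff disappears in the limit.\<close>

lemma weak_partial_by_parts_cutoff:
  assumes v: "L2_on (box l u) v" "L2_on (box l u) v'"
    and w: "is_weak_partial (box l u) v e v'" and e: "e \<in> Basis" and \<psi>: "smooth_fun \<psi>"
    and lim: "(\<lambda>n. \<integral>x. v x * (frechet_derivative (box_cutoff l u n) (at x) e * \<psi> x) \<partial>leb (box l u)) \<longlonglongrightarrow> 0"
  shows "(LINT x|leb (box l u). v' x * \<psi> x)
     = - (LINT x|leb (box l u). v x * frechet_derivative \<psi> (at x) e)"
proof -
  let ?M = "leb (box l u)"
  let ?z = "box_cutoff l u" let ?d\<psi> = "\<lambda>x. frechet_derivative \<psi> (at x) e"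
  let ?dz = "\<lambda>n x. frechet_derivative (?z n) (at x) e"
  have eq: "(LINT x|?M. v x * (?z n x * ?d\<psi> x)) + (LINT x|?M. v x * (?dz n x * \<psi> x))
      = - (LINT x|?M. v' x * (?z n x * \<psi> x))" for n
  proof -
    have i1: "integrable ?M (\<lambda>x. v x * (?z n x * ?d\<psi> x))"
      by (intro L2_on_integrable_mult v L2_on_smooth smooth_fun_mult smooth_fun_box_cutoff smooth_fun_partial \<psi> e)
    have i2: "integrable ?M (\<lambda>x. v x * (?dz n x * \<psi> x))"
      by (intro L2_on_integrable_mult v L2_on_smooth smooth_fun_mult smooth_fun_box_cutoff smooth_fun_partial \<psi> e)
    have "(LINT x|?M. v x * (?z n x * ?d\<psi> x)) + (LINT x|?M. v x * (?dz n x * \<psi> x))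
       = (LINT x|?M. v x * frechet_derivative (\<lambda>x. ?z n x * \<psi> x) (at x) e)"
      unfolding frechet_derivative_mult_smooth[OF smooth_fun_box_cutoff \<psi>]
      using i1 i2 by (simp add: distrib_left)
    also have "\<dots> = - (LINT x|?M. v' x * (?z n x * \<psi> x))"
      using w test_fun_box_cutoff[OF \<psi>] unfolding is_weak_partial_def by blast
    finally show ?thesis .
  qed
  have "(\<lambda>n. (LINT x|?M. v x * (?z n x * ?d\<psi> x)) + (LINT x|?M. v x * (?dz n x * \<psi> x)))
      \<longlonglongrightarrow> (LINT x|?M. v x * ?d\<psi> x) + 0"
    by (intro tendsto_add lim integral_box_cutoff_tendsto v smooth_fun_partial \<psi> e)
  moreover have "(\<lambda>n. - (LINT x|?M. v' x * (?z n x * \<psi> x))) \<longlonglongrightarrow> - (LINT x|?M. v' x * \<psi> x)"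
    by (intro tendsto_minus integral_box_cutoff_tendsto v \<psi>)
  ultimately have "(LINT x|?M. v x * ?d\<psi> x) + 0 = - (LINT x|?M. v' x * \<psi> x)"
    unfolding eq by (rule LIMSEQ_unique)
  then show ?thesis by simp
qed

text \<open>Where the derivative of the cutoff is nonzero, the distance to a face is below
  \<open>2 / Suc n\<close>, so the linear decay of \<open>\<psi>\<close> cancels its size of order
  \<open>Suc n\<close>. The product is bounded uniformly in \<open>n\<close> and tends to 0 at every
  point; dominated convergence finishes. No boundary condition on \<open>v\<close> enters.\<close>

lemma weak_partial_by_parts:
  fixes l u :: "'a::euclidean_space"
  assumes v: "L2_on (box l u) v" "L2_on (box l u) v'"
    and w: "is_weak_partial (box l u) v e v'" and e: "e \<in> Basis" and \<psi>: "smooth_fun \<psi>"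
    and 0: "\<And>x. x \<in> box l u ==> \<bar>\<psi> x\<bar> \<le> K * (x \<bullet> e - l \<bullet> e) \<and> \<bar>\<psi> x\<bar> \<le> K * (u \<bullet> e - x \<bullet> e)"
  shows "(LINT x|leb (box l u). v' x * \<psi> x)
     = - (LINT x|leb (box l u). v x * frechet_derivative \<psi> (at x) e)"
proof (rule weak_partial_by_parts_cutoff[OF v w e \<psi>])
  let ?M = "leb (box l u)"
  let ?dz = "\<lambda>n x. frechet_derivative (box_cutoff l u n) (at x) e"
  from box_cutoff_deriv[OF e, of l u] obtain C where C: "C \<ge> 0"
    and D: "\<And>n x. \<bar>?dz n x\<bar> \<le> C * real (Suc n)"
    and D0: "\<And>n x. 2 \<le> real (Suc n) * (x \<bullet> e - l \<bullet> e) ==> 2 \<le> real (Suc n) * (u \<bullet> e - x \<bullet> e) ==> ?dz n x = 0"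
    by blast
  have bd: "\<bar>?dz n x * \<psi> x\<bar> \<le> C * (2 * \<bar>K\<bar>)" if x: "x \<in> box l u" for n x
  proof (cases "?dz n x = 0")
    case True with C show ?thesis by simp
  next
    case False
    have "\<bar>\<psi> x\<bar> * real (Suc n) \<le> 2 * \<bar>K\<bar>"
    proof -
      have h: "\<bar>\<psi> x\<bar> * real (Suc n) \<le> 2 * \<bar>K\<bar>"
        if "\<bar>\<psi> x\<bar> \<le> K * s" "real (Suc n) * s < 2" "0 < s" for s
      proof -
        have "K * s \<le> \<bar>K\<bar> * s" using that(3) by (intro mult_right_mono) auto
        then have "\<bar>\<psi> x\<bar> * real (Suc n) \<le> (\<bar>K\<bar> * s) * real (Suc n)"
          using that(1) by (intro mult_right_mono) auto
        also have "\<dots> = \<bar>K\<bar> * (real (Suc n) * s)" by (simp add: mult_ac)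
        also have "\<dots> \<le> \<bar>K\<bar> * 2" using that(2) by (intro mult_left_mono) auto
        finally show ?thesis by simp
      qed
      have "0 < x \<bullet> e - l \<bullet> e" "0 < u \<bullet> e - x \<bullet> e" using x e by (auto simp: mem_box)
      with False D0[of n x] h 0[OF x] show ?thesis by (meson not_le)
    qed
    moreover have "\<bar>?dz n x * \<psi> x\<bar> \<le> C * real (Suc n) * \<bar>\<psi> x\<bar>"
      unfolding abs_mult using D by (intro mult_right_mono) auto
    ultimately show ?thesis using C mult_left_mono[of "\<bar>\<psi> x\<bar> * real (Suc n)" "2 * \<bar>K\<bar>" C]
      by (simp add: mult_ac)
  qed
  have "(\<lambda>n. \<integral>x. v x * (?dz n x * \<psi> x) \<partial>?M) \<longlonglongrightarrow> (LINT x|?M. 0)"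
  proof (rule integral_dominated_convergence[where w="\<lambda>x. C * (2 * \<bar>K\<bar>) * \<bar>v x\<bar>"])
    show "(\<lambda>x. v x * (?dz n x * \<psi> x)) \<in> borel_measurable ?M" for n
      by (rule borel_measurable_integrable)
        (intro L2_on_integrable_mult v L2_on_smooth smooth_fun_mult smooth_fun_box_cutoff smooth_fun_partial \<psi> e)
    show "integrable ?M (\<lambda>x. C * (2 * \<bar>K\<bar>) * \<bar>v x\<bar>)"
      by (intro integrable_mult_right integrable_abs L2_on_integrable v) simp
    show "AE x in ?M. (\<lambda>n. v x * (?dz n x * \<psi> x)) \<longlonglongrightarrow> 0"
    proof (rule AE_I2)
      fix x assume "x \<in> space ?M"
      then have "x \<in> box l u" by simp
      from box_cutoff_eventually_1[OF this] have "\<forall>\<^sub>F n in sequentially. v x * (?dz n x * \<psi> x) = 0"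
      proof eventually_elim
        case (elim n)
        have "?dz n x = 0" by (rule D0) (use elim e in blast)+
        then show ?case by simp
      qed
      then show "(\<lambda>n. v x * (?dz n x * \<psi> x)) \<longlonglongrightarrow> 0" by (rule tendsto_eventually)
    qed
    show "AE x in ?M. norm (v x * (?dz n x * \<psi> x)) \<le> C * (2 * \<bar>K\<bar>) * \<bar>v x\<bar>" for n
    proof (rule AE_I2)
      fix x assume "x \<in> space ?M"
      then have "\<bar>v x\<bar> * \<bar>?dz n x * \<psi> x\<bar> \<le> \<bar>v x\<bar> * (C * (2 * \<bar>K\<bar>))"
        by (intro mult_left_mono bd) auto
      then show "norm (v x * (?dz n x * \<psi> x)) \<le> C * (2 * \<bar>K\<bar>) * \<bar>v x\<bar>"
        by (simp add: abs_mult mult_ac)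
    qed
  qed auto
  then show "(\<lambda>n. \<integral>x. v x * (?dz n x * \<psi> x) \<partial>?M) \<longlonglongrightarrow> 0" by simp
qed

lemma measure_edge_strip:
  fixes l u :: "'a::euclidean_space"
  assumes lu: "\<And>j. j \<in> Basis ==> l \<bullet> j < u \<bullet> j" and e: "e \<in> Basis"
  shows "\<exists>A\<ge>0. \<forall>n. measure lebesgue {x \<in> box l u. real (Suc n) * (x \<bullet> e - l \<bullet> e) < 2 \<or> real (Suc n) * (u \<bullet> e - x \<bullet> e) < 2}
     \<le> A / real (Suc n)"
proof -
  define P where "P = (\<Prod>j\<in>Basis - {e}. (u - l) \<bullet> j)"
  have P0: "P \<ge> 0" unfolding P_def using lu by (intro prod_nonneg) (auto simp: inner_diff_left less_imp_le)
  have "measure lebesgue {x \<in> box l u. real (Suc n) * (x \<bullet> e - l \<bullet> e) < 2 \<or> real (Suc n) * (u \<bullet> e - x \<bullet> e) < 2}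
     \<le> 4 * P / real (Suc n)" (is "measure lebesgue ?S \<le> _") for n
  proof -
    let ?r = "2 / real (Suc n)"
    \<comment> \<open>\<open>cbox l u'\<close> and \<open>cbox l' u\<close> are the slabs of
      thickness \<open>?r\<close> at the lower and the upper face. Each has measure
      \<open>?r * P\<close> with \<open>P\<close> the cross-section, whence the constant
      \<open>4 * P\<close>.\<close>
    define u' where "u' = u + (l \<bullet> e + ?r - u \<bullet> e) *\<^sub>R e"
    define l' where "l' = l + (u \<bullet> e - ?r - l \<bullet> e) *\<^sub>R e"
    have u': "u' \<bullet> e = l \<bullet> e + ?r" "\<And>j. j \<in> Basis - {e} ==> u' \<bullet> j = u \<bullet> j"
      using e by (auto simp: u'_def inner_add_left inner_Basis)
    have l': "l' \<bullet> e = u \<bullet> e - ?r" "\<And>j. j \<in> Basis - {e} ==> l' \<bullet> j = l \<bullet> j"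
      using e by (auto simp: l'_def inner_add_left inner_Basis)
    have r: "?r > 0" by simp
    have m: "measure lebesgue (cbox l u') = ?r * P"
    proof -
      have "\<forall>j\<in>Basis. l \<bullet> j \<le> u' \<bullet> j"
      proof
        fix j :: 'a assume "j \<in> Basis"
        then show "l \<bullet> j \<le> u' \<bullet> j" using u' lu[of j] r by (cases "j = e") auto
      qed
      then have "measure lborel (cbox l u') = (\<Prod>j\<in>Basis. u' \<bullet> j - l \<bullet> j)" by (rule content_cbox)
      also have "\<dots> = (u' \<bullet> e - l \<bullet> e) * (\<Prod>j\<in>Basis - {e}. u' \<bullet> j - l \<bullet> j)"
        using e by (subst prod.remove[of _ e]) auto
      also have "\<dots> = ?r * P" unfolding P_def using u' by (simp add: inner_diff_left)
      finally show ?thesis by simp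
    qed
    have m': "measure lebesgue (cbox l' u) = ?r * P"
    proof -
      have "\<forall>j\<in>Basis. l' \<bullet> j \<le> u \<bullet> j"
      proof
        fix j :: 'a assume "j \<in> Basis"
        then show "l' \<bullet> j \<le> u \<bullet> j" using l' lu[of j] r by (cases "j = e") auto
      qed
      then have "measure lborel (cbox l' u) = (\<Prod>j\<in>Basis. u \<bullet> j - l' \<bullet> j)" by (rule content_cbox)
      also have "\<dots> = (u \<bullet> e - l' \<bullet> e) * (\<Prod>j\<in>Basis - {e}. u \<bullet> j - l' \<bullet> j)"
        using e by (subst prod.remove[of _ e]) auto
      also have "\<dots> = ?r * P" unfolding P_def using l' by (simp add: inner_diff_left)
      finally show ?thesis by simp
    qed
    have sub: "?S \<subseteq> cbox l u' \<union> cbox l' u"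
    proof
      fix x assume x: "x \<in> ?S"
      then have xb: "\<And>j. j \<in> Basis ==> l \<bullet> j < x \<bullet> j \<and> x \<bullet> j < u \<bullet> j" by (auto simp: mem_box)
      from x consider "x \<bullet> e - l \<bullet> e < ?r" | "u \<bullet> e - x \<bullet> e < ?r"
        by (auto simp: less_divide_eq mult.commute)
      then show "x \<in> cbox l u' \<union> cbox l' u"
      proof cases
        case 1
        have "l \<bullet> j \<le> x \<bullet> j \<and> x \<bullet> j \<le> u' \<bullet> j" if "j \<in> Basis" for j
          using xb[OF that] u' 1 that by (cases "j = e") auto
        then show ?thesis by (auto simp: mem_box)
      next
        case 2
        have "l' \<bullet> j \<le> x \<bullet> j \<and> x \<bullet> j \<le> u \<bullet> j" if "j \<in> Basis" for j
          using xb[OF that] l' 2 that by (cases "j = e") auto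
        then show ?thesis by (auto simp: mem_box)
      qed
    qed
    have "measure lebesgue ?S \<le> measure lebesgue (cbox l u' \<union> cbox l' u)"
      by (rule measure_mono_fmeasurable[OF sub]) auto
    also have "\<dots> \<le> measure lebesgue (cbox l u') + measure lebesgue (cbox l' u)"
      by (rule measure_Un_le) auto
    also have "\<dots> = 4 * P / real (Suc n)" using m m' by simp
    finally show ?thesis .
  qed
  then show ?thesis using P0 by (intro exI[of _ "4 * P"]) auto
qed

text \<open>Here \<open>\<psi>\<close> may be nonzero on the faces. The size \<open>Suc n\<close> of
  the cutoff derivative is balanced by the measure of the edge strip, and the required smallness
  comes from \<open>v\<close>, which is uniformly continuous and zero on the two faces.\<close>

lemma weak_partial_by_parts_Dirichlet:
  fixes l u :: "'a::euclidean_space"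
  assumes lu: "\<And>j. j \<in> Basis ==> l \<bullet> j < u \<bullet> j"
    and c: "continuous_on (cbox l u) v" and v': "L2_on (box l u) v'"
    and w: "is_weak_partial (box l u) v e v'" and e: "e \<in> Basis" and \<psi>: "smooth_fun \<psi>"
    and 0: "\<And>x. x \<in> cbox l u ==> x \<bullet> e = l \<bullet> e \<or> x \<bullet> e = u \<bullet> e ==> v x = 0"
  shows "(LINT x|leb (box l u). v' x * \<psi> x)
     = - (LINT x|leb (box l u). v x * frechet_derivative \<psi> (at x) e)"
proof (rule weak_partial_by_parts_cutoff[OF _ v' w e \<psi>])
  let ?M = "leb (box l u)"
  let ?dz = "\<lambda>n x. frechet_derivative (box_cutoff l u n) (at x) e"
  show v: "L2_on (box l u) v" by (rule L2_on_continuous[OF c]) (auto simp: box_subset_cbox)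
  from box_cutoff_deriv[OF e, of l u] obtain C where C: "C \<ge> 0"
    and D: "\<And>n x. \<bar>?dz n x\<bar> \<le> C * real (Suc n)"
    and D0: "\<And>n x. 2 \<le> real (Suc n) * (x \<bullet> e - l \<bullet> e) ==> 2 \<le> real (Suc n) * (u \<bullet> e - x \<bullet> e) ==> ?dz n x = 0"
    by blast
  obtain K0 where K0: "\<And>x. x \<in> cbox l u ==> \<bar>\<psi> x\<bar> \<le> K0" using smooth_fun_bounded_on_cbox[OF \<psi>] by blast
  define K where "K = \<bar>K0\<bar>"
  have K: "\<And>x. x \<in> box l u ==> \<bar>\<psi> x\<bar> \<le> K" and Kp: "K \<ge> 0"
    using K0 box_subset_cbox[of l u] unfolding K_def by force+
  define S where "S n = {x \<in> box l u. real (Suc n) * (x \<bullet> e - l \<bullet> e) < 2 \<or> real (Suc n) * (u \<bullet> e - x \<bullet> e) < 2}" for n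
  obtain A where A: "A \<ge> 0" "\<And>n. measure lebesgue (S n) \<le> A / real (Suc n)"
    using measure_edge_strip[of l u e, OF lu e] unfolding S_def by blast
  have Sm: "S n \<in> lmeasurable" for n
  proof (rule bounded_set_imp_lmeasurable)
    show "bounded (S n)" unfolding S_def by (rule bounded_subset[OF bounded_box[of l u]]) auto
    have "{x. real (Suc n) * (x \<bullet> e - l \<bullet> e) < 2} \<union> {x. real (Suc n) * (u \<bullet> e - x \<bullet> e) < 2} \<in> sets borel"
      by (intro sets.Un borel_open open_Collect_less continuous_intros)
    then have "box l u \<inter> ({x. real (Suc n) * (x \<bullet> e - l \<bullet> e) < 2} \<union> {x. real (Suc n) * (u \<bullet> e - x \<bullet> e) < 2}) \<in> sets borel"
      by (intro sets.Int) auto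
    moreover have "S n = box l u \<inter> ({x. real (Suc n) * (x \<bullet> e - l \<bullet> e) < 2} \<union> {x. real (Suc n) * (u \<bullet> e - x \<bullet> e) < 2})"
      by (auto simp: S_def)
    ultimately show "S n \<in> sets lebesgue" by simp
  qed
  have uc: "uniformly_continuous_on (cbox l u) v"
    by (rule compact_uniformly_continuous[OF c compact_cbox])
  have key: "\<forall>\<^sub>F n in sequentially. \<bar>\<integral>x. v x * (?dz n x * \<psi> x) \<partial>?M\<bar> \<le> \<eta> * (C * K * A)" if \<eta>: "\<eta> > 0" for \<eta>
  proof -
    obtain r where r: "r > 0" "\<And>x y. x \<in> cbox l u ==> y \<in> cbox l u ==> dist y x < r ==> dist (v y) (v x) < \<eta>"
      using uc \<eta> unfolding uniformly_continuous_on_def by metis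
    obtain N where N: "2 / r < real N" using reals_Archimedean2 by blast
    have "\<bar>\<integral>x. v x * (?dz n x * \<psi> x) \<partial>?M\<bar> \<le> \<eta> * (C * K * A)" if n: "n \<ge> N" for n
    proof -
      have nr: "2 < r * real (Suc n)"
      proof -
        have "2 / r < real (Suc n)" using N n by linarith
        then show ?thesis using r(1) by (simp add: divide_less_eq mult.commute)
      qed
      have vS: "\<bar>v x\<bar> \<le> \<eta>" if x: "x \<in> S n" for x
      proof -
        have xb: "\<And>j. j \<in> Basis ==> l \<bullet> j < x \<bullet> j \<and> x \<bullet> j < u \<bullet> j" using x by (auto simp: S_def mem_box)
        \<comment> \<open>A point of the strip is moved along \<open>e\<close> onto the nearby face,
          where \<open>v\<close> vanishes; the displacement is below \<open>r\<close>, the modulus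
          of continuity for \<open>\<eta>\<close>.\<close>
        have *: "\<bar>v x\<bar> \<le> \<eta>" if s: "real (Suc n) * \<bar>s\<bar> < 2" "x \<bullet> e + s = l \<bullet> e \<or> x \<bullet> e + s = u \<bullet> e" for s
        proof -
          let ?y = "x + s *\<^sub>R e"
          have ye: "?y \<bullet> e = x \<bullet> e + s" "\<And>j. j \<in> Basis ==> j \<noteq> e ==> ?y \<bullet> j = x \<bullet> j"
            using e by (auto simp: inner_add_left inner_Basis)
          have "l \<bullet> j \<le> ?y \<bullet> j \<and> ?y \<bullet> j \<le> u \<bullet> j" if "j \<in> Basis" for j
            using xb[OF that] ye s(2) lu[OF that] that by (cases "j = e") auto
          then have yc: "?y \<in> cbox l u" by (auto simp: mem_box)
          have xc: "x \<in> cbox l u" using x box_subset_cbox unfolding S_def by blast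
          have "real (Suc n) * \<bar>s\<bar> < real (Suc n) * r"
            using s(1) nr unfolding mult.commute[of r] by (rule less_trans)
          then have "\<bar>s\<bar> < r" by (rule mult_left_less_imp_less) simp
          then have "dist ?y x < r" using e by (simp add: dist_norm)
          from r(2)[OF xc yc this] have "dist (v ?y) (v x) < \<eta>" .
          moreover have "v ?y = 0" using 0[OF yc] ye(1) s(2) by simp
          ultimately show ?thesis by (simp add: dist_real_def)
        qed
        from x have "real (Suc n) * (x \<bullet> e - l \<bullet> e) < 2 \<or> real (Suc n) * (u \<bullet> e - x \<bullet> e) < 2"
          by (simp add: S_def)
        then show ?thesis
        proof
          assume "real (Suc n) * (x \<bullet> e - l \<bullet> e) < 2"
          then show ?thesis using xb[OF e] by (intro *[of "l \<bullet> e - x \<bullet> e"]) (auto simp: abs_if)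
        next
          assume "real (Suc n) * (u \<bullet> e - x \<bullet> e) < 2"
          then show ?thesis using xb[OF e] by (intro *[of "u \<bullet> e - x \<bullet> e"]) (auto simp: abs_if)
        qed
      qed
      have i: "integrable ?M (\<lambda>x. v x * (?dz n x * \<psi> x))"
        by (intro L2_on_integrable_mult v L2_on_smooth smooth_fun_mult smooth_fun_box_cutoff smooth_fun_partial \<psi> e)
      have bd: "\<bar>v x * (?dz n x * \<psi> x)\<bar> \<le> indicator (S n) x * (\<eta> * (C * real (Suc n) * K))" if x: "x \<in> box l u" for x
      proof (cases "x \<in> S n")
        case True
        have "\<bar>v x * (?dz n x * \<psi> x)\<bar> \<le> \<eta> * (C * real (Suc n) * K)"
          unfolding abs_mult using vS[OF True] D[of n x] K[OF x] \<eta> C Kp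
          by (intro mult_mono mult_nonneg_nonneg) auto
        then show ?thesis using True by simp
      next
        case False
        then have "?dz n x = 0" using x by (intro D0) (auto simp: S_def)
        then show ?thesis using False by simp
      qed
      have iS: "integrable ?M (indicator (S n) :: 'a => real)"
        and mS: "(LINT x|?M. indicator (S n) x) = measure lebesgue (S n)"
      proof -
        have sub: "S n \<subseteq> box l u" by (auto simp: S_def)
        then have eq: "(\<lambda>x. indicator (box l u) x *\<^sub>R (indicator (S n) x :: real)) = indicator (S n)"
          by (auto simp: indicator_def fun_eq_iff)
        have il: "integrable lebesgue (indicator (S n) :: 'a => real)"
          using Sm[of n] by (intro integrable_real_indicator) (auto simp: fmeasurable_def)
        show "integrable ?M (indicator (S n) :: 'a => real)"
          by (subst integrable_restrict_space) (use il eq in auto)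
        show "(LINT x|?M. indicator (S n) x) = measure lebesgue (S n)"
          by (subst integral_restrict_space) (use eq in auto)
      qed
      have "\<bar>\<integral>x. v x * (?dz n x * \<psi> x) \<partial>?M\<bar> \<le> (LINT x|?M. \<bar>v x * (?dz n x * \<psi> x)\<bar>)"
        by (rule integral_abs_bound)
      also have "\<dots> \<le> (LINT x|?M. indicator (S n) x * (\<eta> * (C * real (Suc n) * K)))"
        by (rule integral_mono) (use i iS bd in auto)
      also have "\<dots> = measure lebesgue (S n) * (\<eta> * (C * real (Suc n) * K))"
        using mS by simp
      \<comment> \<open>The two powers of \<open>Suc n\<close>, from the strip and from the cutoff
        derivative, cancel here.\<close>
      also have "\<dots> \<le> A / real (Suc n) * (\<eta> * (C * real (Suc n) * K))"
        using A(2) \<eta> C Kp by (intro mult_right_mono) auto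
      also have "\<dots> = \<eta> * (C * K * A)" by simp
      finally show ?thesis .
    qed
    then show ?thesis by (auto simp: eventually_sequentially)
  qed
  show "(\<lambda>n. \<integral>x. v x * (?dz n x * \<psi> x) \<partial>?M) \<longlonglongrightarrow> 0"
  proof (rule tendstoI)
    fix \<epsilon> :: real assume \<epsilon>: "\<epsilon> > 0"
    define Q where "Q = C * K * A"
    have Q: "Q \<ge> 0" using C Kp A by (simp add: Q_def)
    \<comment> \<open>\<open>Q\<close> may be zero; adding 1 keeps the quotient positive and the
      final inequality strict.\<close>
    have "\<epsilon> / (Q + 1) > 0" using \<epsilon> Q by simp
    from key[OF this, folded Q_def]
    show "\<forall>\<^sub>F n in sequentially. dist (LINT x|?M. v x * (?dz n x * \<psi> x)) 0 < \<epsilon>"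
    proof eventually_elim
      case (elim n)
      have "\<epsilon> / (Q + 1) * Q < \<epsilon>" using \<epsilon> Q by (simp add: divide_less_eq)
      with elim show ?case by (simp add: dist_real_def)
    qed
  qed
qed

section \<open>Sine and cosine series on a box\<close>

lemma continuous_borel_real: "continuous_on UNIV f ==> f \<in> borel_measurable borel"
  by (rule borel_measurable_continuous_onI)

lemma lebesgue_on_integral_borel:
  fixes f :: "'a::euclidean_space => real"
  assumes f: "f \<in> borel_measurable borel" and S: "S \<in> sets borel"
  shows "integral\<^sup>L (leb S) f = (LINT x|lborel. indicator S x * f x)"
    and "integrable (leb S) f \<longleftrightarrow> integrable lborel (\<lambda>x. indicator S x * f x)"
proof -
  have 1: "(\<lambda>x. indicator S x * f x) \<in> borel_measurable borel" using f S by simp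
  have 2: "AE x in leb S. f x = indicator S x * f x" by (rule AE_I2) simp
  have 3: "indicator S x * f x = 0" if "x \<notin> S" for x using that by simp
  from lebesgue_on_representative(2,3)[OF S 1 2 3]
  show "integral\<^sup>L (leb S) f = (LINT x|lborel. indicator S x * f x)"
    and "integrable (leb S) f \<longleftrightarrow> integrable lborel (\<lambda>x. indicator S x * f x)"
    by simp_all
qed

lemma integrable_continuous_interval:
  fixes f :: "real => real"
  assumes "continuous_on UNIV f"
  shows "integrable (leb {c<..<d}) f"
proof -
  have "L2_on {c<..<d} f"
    by (rule L2_on_continuous[OF continuous_on_subset[OF assms], of "{c..d}"]) auto
  then show ?thesis by (intro L2_on_integrable) auto
qed

text \<open>\<open>lborel_eq\<close> presents Lebesgue measure as the image of a product measure
  over \<open>Basis\<close>. The restriction to the box is absorbed into the factors as indicators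
  of intervals.\<close>

lemma integral_box_prod:
  fixes f :: "'a::euclidean_space => real => real"
  assumes f: "\<And>j. j \<in> Basis ==> continuous_on UNIV (f j)"
  shows "(LINT x|leb (box l u). (\<Prod>j\<in>Basis. f j (x \<bullet> j)))
     = (\<Prod>j\<in>Basis. (LINT t|leb {l \<bullet> j<..<u \<bullet> j}. f j t))"
proof -
  define g where "g j t = indicator {l \<bullet> j<..<u \<bullet> j} t * f j t" for j t
  have fb: "f j \<in> borel_measurable borel" if "j \<in> Basis" for j
    using f[OF that] by (rule continuous_borel_real)
  have gb: "g j \<in> borel_measurable borel" if "j \<in> Basis" for j
    unfolding g_def using fb[OF that] by simp
  have gi: "integrable lborel (g j)" if "j \<in> Basis" for j
    using lebesgue_on_integral_borel(2)[OF fb[OF that], of "{l \<bullet> j<..<u \<bullet> j}"]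
      integrable_continuous_interval[OF f[OF that]] by (simp add: g_def[abs_def])
  have g1: "integral\<^sup>L lborel (g j) = (LINT t|leb {l \<bullet> j<..<u \<bullet> j}. f j t)" if "j \<in> Basis" for j
    using lebesgue_on_integral_borel(1)[OF fb[OF that], of "{l \<bullet> j<..<u \<bullet> j}"] by (simp add: g_def[abs_def])
  have Gb: "(\<lambda>x::'a. \<Prod>j\<in>Basis. g j (x \<bullet> j)) \<in> borel_measurable borel"
    by (intro borel_measurable_prod measurable_compose[OF _ gb]) auto
  have Fb: "(\<lambda>x::'a. \<Prod>j\<in>Basis. f j (x \<bullet> j)) \<in> borel_measurable borel"
    by (intro borel_measurable_prod measurable_compose[OF _ fb]) auto
  have ind: "indicator (box l u) x * (\<Prod>j\<in>Basis. f j (x \<bullet> j)) = (\<Prod>j\<in>Basis. g j (x \<bullet> j))" for x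
  proof (cases "x \<in> box l u")
    case True
    then show ?thesis by (auto simp: g_def mem_box intro!: prod.cong)
  next
    case False
    then obtain j where j: "j \<in> Basis" "\<not> (l \<bullet> j < x \<bullet> j \<and> x \<bullet> j < u \<bullet> j)" by (auto simp: mem_box)
    then have "g j (x \<bullet> j) = 0" by (auto simp: g_def)
    with j(1) have "(\<Prod>j\<in>Basis. g j (x \<bullet> j)) = 0" by (auto intro!: prod_zero)
    with False show ?thesis by simp
  qed
  interpret product_sigma_finite "\<lambda>_::'a. lborel :: real measure" ..
  have "(LINT x|leb (box l u). (\<Prod>j\<in>Basis. f j (x \<bullet> j))) = (LINT x|lborel. (\<Prod>j\<in>Basis. g j (x \<bullet> j)))"
    using lebesgue_on_integral_borel(1)[OF Fb, of "box l u"] by (simp add: ind)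
  also have "\<dots> = (LINT x|distr (\<Pi>\<^sub>M b\<in>Basis. lborel) borel (\<lambda>f. \<Sum>b\<in>Basis. f b *\<^sub>R b). (\<Prod>j\<in>Basis. g j (x \<bullet> j)))"
    by (subst lborel_eq) (rule refl)
  also have "\<dots> = (LINT x|(\<Pi>\<^sub>M b\<in>Basis. lborel). (\<Prod>j\<in>Basis. g j ((\<Sum>b\<in>Basis. x b *\<^sub>R b) \<bullet> j)))"
    by (rule integral_distr[OF _ Gb]) simp
  also have "\<dots> = (LINT x|(\<Pi>\<^sub>M b\<in>Basis. lborel). (\<Prod>j\<in>Basis. g j (x j)))"
    by (intro lint_cong refl prod.cong arg_cong2[where f=g])
      (simp add: inner_sum_left_Basis)
  also have "\<dots> = (\<Prod>j\<in>Basis. integral\<^sup>L lborel (g j))"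
    by (rule product_integral_prod[OF finite_Basis gi])
  also have "\<dots> = (\<Prod>j\<in>Basis. (LINT t|leb {l \<bullet> j<..<u \<bullet> j}. f j t))"
    by (intro prod.cong refl g1)
  finally show ?thesis .
qed

lemma integral_lebesgue_on_FTC:
  fixes f F :: "real => real"
  assumes "c \<le> d" "\<And>t. (F has_real_derivative f t) (at t)" "continuous_on UNIV f"
  shows "(LINT t|leb {c<..<d}. f t) = F d - F c"
proof -
  have "(f has_integral (F d - F c)) {c..d}"
    using assms by (intro fundamental_theorem_of_calculus)
      (auto simp flip: has_real_derivative_iff_has_vector_derivative intro: has_field_derivative_at_within)
  then have 1: "(f has_integral (F d - F c)) {c<..<d}"
    using has_integral_open_interval[of f "F d - F c" c d] by simp
  have "(f has_integral (LINT t|leb {c<..<d}. f t)) {c<..<d}"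
    by (rule has_integral_integral_lebesgue_on[OF integrable_continuous_interval[OF assms(3)]]) simp
  from has_integral_unique[OF this 1] show ?thesis .
qed

text \<open>The frequency is an integer because the lemma is applied to the sum and to the
  difference of two natural frequencies.\<close>

lemma integral_cos_interval:
  assumes "c < d"
  shows "(LINT t|leb {c<..<d}. cos (of_int m * (pi * (t - c) / (d - c)))) = (if m = 0 then d - c else 0)"
proof (cases "m = 0")
  case True
  then show ?thesis using assms by (simp add: measure_restrict_space)
next
  case False
  define w where "w = of_int m * pi / (d - c)"
  have w: "w \<noteq> 0" using False assms by (simp add: w_def)
  have eq: "of_int m * (pi * (t - c) / (d - c)) = w * (t - c)" for t by (simp add: w_def)
  have "(LINT t|leb {c<..<d}. cos (w * (t - c))) = sin (w * (d - c)) / w - sin (w * (c - c)) / w"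
    by (rule integral_lebesgue_on_FTC)
      (use assms w in \<open>auto intro!: derivative_eq_intros continuous_intros\<close>)
  also have "w * (d - c) = pi * of_int m" using assms by (simp add: w_def)
  finally have "(LINT t|leb {c<..<d}. cos (w * (t - c))) = 0" by simp
  then show ?thesis using False by (simp only: eq if_False)
qed

section \<open>Trigonometric systems on a box and their derivatives\<close>

definition trig :: "bool => nat => real => real" where
  "trig s k \<theta> = (if s then sin (real k * \<theta>) else cos (real k * \<theta>))"

text \<open>The L2 normalisation on an interval of length \<open>L\<close>; the constant cosine has
  mean square 1 where the other functions have 1/2. For positive \<open>L\<close> the value is never
  zero, so \<open>trig_span_mult_cos\<close> can divide by it.\<close>

definition trig_norm :: "bool => nat => real => real" where
  "trig_norm s k L = (if \<not> s \<and> k = 0 then sqrt (1 / L) else sqrt (2 / L))"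

definition trig_factor :: "'a::euclidean_space => 'a => 'a set => ('a => nat) => 'a => real => real" where
  "trig_factor l u S k j t = trig_norm (j \<in> S) (k j) (u \<bullet> j - l \<bullet> j)
     * trig (j \<in> S) (k j) (pi * (t - l \<bullet> j) / (u \<bullet> j - l \<bullet> j))"

text \<open>The trigonometric system on a box with sines in the directions of S and cosines in the
  others. Members with k j = 0 for some j in S vanish identically, so each member has norm 0 or 1.\<close>

definition trig_sys :: "'a::euclidean_space => 'a => 'a set => ('a => nat) => 'a => real" where
  "trig_sys l u S k x = (\<Prod>j\<in>Basis. trig_factor l u S k j (x \<bullet> j))"

lemma trig_factor_deriv:
  assumes "l \<bullet> j < u \<bullet> j"
  shows "(trig_factor l u S k j has_real_derivative
     (if j \<in> S then (real (k j) * pi / (u \<bullet> j - l \<bullet> j)) * trig_factor l u (S - {j}) k j t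
      else - (real (k j) * pi / (u \<bullet> j - l \<bullet> j)) * trig_factor l u (insert j S) k j t)) (at t)"
proof (cases "k j = 0")
  \<comment> \<open>For frequency 0 the sine and the cosine are normalised differently, so the
    general formula cannot be read off termwise; but then the function is constant and the claimed
    derivative is 0.\<close>
  case True
  then have "trig_factor l u S k j = (\<lambda>t. trig_factor l u S k j 0)"
    by (auto simp: trig_factor_def trig_def)
  moreover have "((\<lambda>t. trig_factor l u S k j 0) has_real_derivative 0) (at t)" by simp
  ultimately show ?thesis using True by simp
next
  case False
  then have n: "trig_norm b (k j) L = sqrt (2 / L)" for b L by (simp add: trig_norm_def)
  let ?L = "u \<bullet> j - l \<bullet> j" and ?k = "real (k j)"
  have lin: "((\<lambda>t. ?k * (pi * (t - l \<bullet> j) / ?L)) has_real_derivative ?k * pi / ?L) (at t)"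
    using assms by (auto intro!: derivative_eq_intros)
  have "((\<lambda>t. sqrt (2 / ?L) * sin (?k * (pi * (t - l \<bullet> j) / ?L))) has_real_derivative
      sqrt (2 / ?L) * (cos (?k * (pi * (t - l \<bullet> j) / ?L)) * (?k * pi / ?L))) (at t)"
    by (intro DERIV_cmult DERIV_chain2[OF DERIV_sin lin])
  moreover have "((\<lambda>t. sqrt (2 / ?L) * cos (?k * (pi * (t - l \<bullet> j) / ?L))) has_real_derivative
      sqrt (2 / ?L) * (- sin (?k * (pi * (t - l \<bullet> j) / ?L)) * (?k * pi / ?L))) (at t)"
    by (intro DERIV_cmult DERIV_chain2[OF DERIV_cos lin])
  ultimately show ?thesis
    unfolding trig_factor_def[abs_def] n trig_def by (cases "j \<in> S") (simp_all add: mult_ac)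
qed

lemma smooth1_trig_factor: "smooth1 (trig_factor l u S k j)"
proof -
  let ?c = "real (k j) * (pi / (u \<bullet> j - l \<bullet> j))" and ?d = "- (real (k j) * (pi * (l \<bullet> j) / (u \<bullet> j - l \<bullet> j)))"
  have "trig_factor l u S k j = (\<lambda>t. trig_norm (j \<in> S) (k j) (u \<bullet> j - l \<bullet> j)
     * (if j \<in> S then sin (?c * t + ?d) else cos (?c * t + ?d)))"
  proof
    fix t
    have "real (k j) * (pi * (t - l \<bullet> j) / (u \<bullet> j - l \<bullet> j)) = ?c * t + ?d"
      by (simp add: right_diff_distrib diff_divide_distrib)
    then show "trig_factor l u S k j t = trig_norm (j \<in> S) (k j) (u \<bullet> j - l \<bullet> j)
     * (if j \<in> S then sin (?c * t + ?d) else cos (?c * t + ?d))"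
      by (simp only: trig_factor_def trig_def)
  qed
  moreover have "smooth1 (\<lambda>t. trig_norm (j \<in> S) (k j) (u \<bullet> j - l \<bullet> j)
     * (if j \<in> S then sin (?c * t + ?d) else cos (?c * t + ?d)))"
  proof (cases "j \<in> S")
    case True
    show ?thesis unfolding if_P[OF True]
      by (intro smooth1_mult smooth1_const smooth1_affine[OF smooth1_sin_cos(1)])
  next
    case False
    show ?thesis unfolding if_not_P[OF False]
      by (intro smooth1_mult smooth1_const smooth1_affine[OF smooth1_sin_cos(2)])
  qed
  ultimately show ?thesis by simp
qed

lemma smooth_fun_trig_sys: "smooth_fun (trig_sys l u S k)"
  unfolding trig_sys_def by (intro smooth_fun_prod smooth_fun_lift smooth1_trig_factor)

text \<open>Differentiation in direction \<open>e\<close> moves \<open>e\<close> out of or into the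
  set of sine directions. The systems for all \<open>S\<close> together are thus closed under
  partial derivatives.\<close>

lemma trig_sys_partial:
  fixes l u :: "'a::euclidean_space"
  assumes e: "e \<in> Basis" and lu: "l \<bullet> e < u \<bullet> e"
  shows "frechet_derivative (trig_sys l u S k) (at x) e =
     (if e \<in> S then (real (k e) * pi / (u \<bullet> e - l \<bullet> e)) * trig_sys l u (S - {e}) k x
      else - (real (k e) * pi / (u \<bullet> e - l \<bullet> e)) * trig_sys l u (insert e S) k x)"
proof -
  have o: "(\<Prod>j\<in>Basis - {e}. trig_factor l u S k j (x \<bullet> j)) = (\<Prod>j\<in>Basis - {e}. trig_factor l u T k j (x \<bullet> j))"
    if "T = S - {e} \<or> T = insert e S" for T
    using that by (intro prod.cong) (auto simp: trig_factor_def)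
  have r: "trig_sys l u T k x = trig_factor l u T k e (x \<bullet> e) * (\<Prod>j\<in>Basis - {e}. trig_factor l u T k j (x \<bullet> j))" for T
    unfolding trig_sys_def using e by (subst prod.remove[of _ e]) auto
  have "frechet_derivative (trig_sys l u S k) (at x) e =
     (if e \<in> S then (real (k e) * pi / (u \<bullet> e - l \<bullet> e)) * trig_factor l u (S - {e}) k e (x \<bullet> e)
      else - (real (k e) * pi / (u \<bullet> e - l \<bullet> e)) * trig_factor l u (insert e S) k e (x \<bullet> e))
      * (\<Prod>j\<in>Basis - {e}. trig_factor l u S k j (x \<bullet> j))"
    using frechet_derivative_coordinate_prod[of "trig_factor l u S k", OF smooth1_trig_factor e trig_factor_deriv[OF lu]]
    unfolding trig_sys_def[abs_def] .
  also have "\<dots> = (if e \<in> S then (real (k e) * pi / (u \<bullet> e - l \<bullet> e)) * trig_sys l u (S - {e}) k x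
      else - (real (k e) * pi / (u \<bullet> e - l \<bullet> e)) * trig_sys l u (insert e S) k x)"
  proof (cases "e \<in> S")
    case True
    show ?thesis unfolding if_P[OF True] r[of "S - {e}"] o[OF disjI1, OF refl] by (rule mult.assoc)
  next
    case False
    show ?thesis unfolding if_not_P[OF False] r[of "insert e S"] o[OF disjI2, OF refl] by (rule mult.assoc)
  qed
  finally show ?thesis .
qed

lemma abs_trig_factor_le:
  assumes "l \<bullet> j < u \<bullet> j"
  shows "\<bar>trig_factor l u S k j t\<bar> \<le> trig_norm (j \<in> S) (k j) (u \<bullet> j - l \<bullet> j)"
proof -
  have "0 \<le> trig_norm (j \<in> S) (k j) (u \<bullet> j - l \<bullet> j)" using assms by (simp add: trig_norm_def)
  moreover have "\<bar>trig (j \<in> S) (k j) s\<bar> \<le> 1" for s by (simp add: trig_def)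
  ultimately show ?thesis by (simp add: trig_factor_def abs_mult mult_left_le)
qed

text \<open>This supplies the linear decay required by \<open>weak_partial_by_parts\<close>. At the
  lower face it is the bound of the sine by its argument; the upper face is reduced to it by
  reflection.\<close>

lemma trig_sys_vanish:
  fixes l u :: "'a::euclidean_space"
  assumes lu: "\<And>j. j \<in> Basis ==> l \<bullet> j < u \<bullet> j" and e: "e \<in> Basis" "e \<in> S"
  shows "\<exists>K. \<forall>x\<in>box l u. \<bar>trig_sys l u S k x\<bar> \<le> K * (x \<bullet> e - l \<bullet> e)
     \<and> \<bar>trig_sys l u S k x\<bar> \<le> K * (u \<bullet> e - x \<bullet> e)"
proof -
  let ?L = "u \<bullet> e - l \<bullet> e"
  let ?N = "\<lambda>j. trig_norm (j \<in> S) (k j) (u \<bullet> j - l \<bullet> j)"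
  define P where "P = (\<Prod>j\<in>Basis - {e}. ?N j)"
  have L: "?L > 0" using lu e by simp
  have N0: "?N j \<ge> 0" if "j \<in> Basis" for j using lu[OF that] by (simp add: trig_norm_def)
  have P0: "P \<ge> 0" unfolding P_def using N0 by (intro prod_nonneg) auto
  define K where "K = ?N e * (real (k e) * pi / ?L) * P"
  have "\<bar>trig_sys l u S k x\<bar> \<le> K * (x \<bullet> e - l \<bullet> e) \<and> \<bar>trig_sys l u S k x\<bar> \<le> K * (u \<bullet> e - x \<bullet> e)"
    if x: "x \<in> box l u" for x
  proof -
    have xe: "0 < x \<bullet> e - l \<bullet> e" "0 < u \<bullet> e - x \<bullet> e" using x e by (auto simp: mem_box)
    have "(\<Prod>j\<in>Basis - {e}. \<bar>trig_factor l u S k j (x \<bullet> j)\<bar>) \<le> P"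
      unfolding P_def using lu by (intro prod_mono) (auto intro: abs_trig_factor_le)
    then have "\<bar>trig_sys l u S k x\<bar> \<le> \<bar>trig_factor l u S k e (x \<bullet> e)\<bar> * P"
      unfolding trig_sys_def using e
      by (subst prod.remove[of _ e]) (auto simp: abs_mult abs_prod intro!: mult_left_mono)
    also have "\<bar>trig_factor l u S k e (x \<bullet> e)\<bar> = ?N e * \<bar>sin (real (k e) * (pi * (x \<bullet> e - l \<bullet> e) / ?L))\<bar>"
      using N0[OF e(1)] e by (simp add: trig_factor_def trig_def abs_mult)
    finally have b: "\<bar>trig_sys l u S k x\<bar> \<le> ?N e * \<bar>sin (real (k e) * (pi * (x \<bullet> e - l \<bullet> e) / ?L))\<bar> * P" .
    have fin: "\<bar>trig_sys l u S k x\<bar> \<le> K * s"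
      if "\<bar>sin (real (k e) * (pi * (x \<bullet> e - l \<bullet> e) / ?L))\<bar> \<le> real (k e) * pi / ?L * s" for s
    proof -
      have "?N e * \<bar>sin (real (k e) * (pi * (x \<bullet> e - l \<bullet> e) / ?L))\<bar> * P \<le> ?N e * (real (k e) * pi / ?L * s) * P"
        by (intro mult_right_mono mult_left_mono that N0 e P0)
      with b show ?thesis by (simp add: K_def mult_ac)
    qed
    have s1: "\<bar>sin (real (k e) * (pi * (x \<bullet> e - l \<bullet> e) / ?L))\<bar> \<le> real (k e) * pi / ?L * (x \<bullet> e - l \<bullet> e)"
    proof -
      have "\<bar>sin (real (k e) * (pi * (x \<bullet> e - l \<bullet> e) / ?L))\<bar> \<le> \<bar>real (k e) * (pi * (x \<bullet> e - l \<bullet> e) / ?L)\<bar>"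
        by (rule abs_sin_x_le_abs_x)
      also have "\<dots> = real (k e) * pi / ?L * (x \<bullet> e - l \<bullet> e)" using xe L by (simp add: abs_mult)
      finally show ?thesis .
    qed
    have s2: "\<bar>sin (real (k e) * (pi * (x \<bullet> e - l \<bullet> e) / ?L))\<bar> \<le> real (k e) * pi / ?L * (u \<bullet> e - x \<bullet> e)"
    proof -
      \<comment> \<open>The argument is rewritten as a multiple of \<open>pi\<close> minus the
        scaled distance to the upper face, so that the sine of the multiple drops out of
        \<open>sin_diff\<close>.\<close>
      have eq: "real (k e) * (pi * (x \<bullet> e - l \<bullet> e) / ?L) = real (k e) * pi - real (k e) * pi / ?L * (u \<bullet> e - x \<bullet> e)"
        using L by (simp add: field_simps)
      have "\<bar>sin (real (k e) * (pi * (x \<bullet> e - l \<bullet> e) / ?L))\<bar> = \<bar>cos (real (k e) * pi)\<bar> * \<bar>sin (real (k e) * pi / ?L * (u \<bullet> e - x \<bullet> e))\<bar>"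
        unfolding eq sin_diff by (simp add: abs_mult)
      also have "\<dots> \<le> \<bar>sin (real (k e) * pi / ?L * (u \<bullet> e - x \<bullet> e))\<bar>"
        by (intro mult_left_le_one_le) auto
      also have "\<dots> \<le> \<bar>real (k e) * pi / ?L * (u \<bullet> e - x \<bullet> e)\<bar>"
        by (rule abs_sin_x_le_abs_x)
      also have "\<dots> = real (k e) * pi / ?L * (u \<bullet> e - x \<bullet> e)" using xe L by (simp add: abs_mult)
      finally show ?thesis .
    qed
    show ?thesis using fin[OF s1] fin[OF s2] by blast
  qed
  then show ?thesis by blast
qed

lemma integral_trig_mult:
  assumes "c < d"
  shows "(LINT t|leb {c<..<d}. trig s k (pi * (t - c) / (d - c)) * trig s k' (pi * (t - c) / (d - c)))
     = (if k \<noteq> k' then 0 else if k = 0 then (if s then 0 else d - c) else (d - c) / 2)"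
proof -
  let ?t = "\<lambda>t. pi * (t - c) / (d - c)"
  let ?m = "int k - int k'" and ?p = "int k + int k'"
  \<comment> \<open>In the product-to-sum formulas sines and cosines differ only in the sign of the
    term with the sum of the frequencies.\<close>
  define \<sigma> :: real where "\<sigma> = (if s then -1 else 1)"
  have i: "integrable (leb {c<..<d}) (\<lambda>t. cos (of_int m * ?t t))" for m
    by (intro integrable_continuous_interval continuous_intros) (use assms in auto)
  have "trig s k (?t t) * trig s k' (?t t) = (cos (of_int ?m * ?t t) + \<sigma> * cos (of_int ?p * ?t t)) / 2" for t
  proof -
    have "of_int ?m * ?t t = real k * ?t t - real k' * ?t t" "of_int ?p * ?t t = real k * ?t t + real k' * ?t t"
      by (simp_all only: of_int_diff of_int_add of_int_of_nat_eq left_diff_distrib distrib_right)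
    then show ?thesis
      unfolding trig_def \<sigma>_def by (simp only: cos_diff cos_add) (simp add: field_simps)
  qed
  then have "(LINT t|leb {c<..<d}. trig s k (?t t) * trig s k' (?t t))
     = (LINT t|leb {c<..<d}. (cos (of_int ?m * ?t t) + \<sigma> * cos (of_int ?p * ?t t)) / 2)"
    by presburger
  also have "\<dots> = ((LINT t|leb {c<..<d}. cos (of_int ?m * ?t t))
      + \<sigma> * (LINT t|leb {c<..<d}. cos (of_int ?p * ?t t))) / 2"
    using i[of ?m] i[of ?p]
    by (simp only: integral_divide_zero lint_add integrable_mult_right integral_mult_right_zero)
  also have "\<dots> = (if k \<noteq> k' then 0 else if k = 0 then (if s then 0 else d - c) else (d - c) / 2)"
    unfolding integral_cos_interval[OF assms] \<sigma>_def by auto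
  finally show ?thesis .
qed

lemma trig_sys_orthonormal:
  fixes l u :: "'a::euclidean_space"
  assumes lu: "\<And>j. j \<in> Basis ==> l \<bullet> j < u \<bullet> j"
  shows "(LINT x|leb (box l u). trig_sys l u S k x * trig_sys l u S k' x)
     = (if (\<forall>j\<in>Basis. k j = k' j) \<and> (\<forall>j\<in>Basis \<inter> S. k j \<noteq> 0) then 1 else 0)"
proof -
  have "(LINT x|leb (box l u). trig_sys l u S k x * trig_sys l u S k' x)
     = (LINT x|leb (box l u). (\<Prod>j\<in>Basis. trig_factor l u S k j (x \<bullet> j) * trig_factor l u S k' j (x \<bullet> j)))"
    by (simp add: trig_sys_def prod.distrib)
  also have "\<dots> = (\<Prod>j\<in>Basis. (LINT t|leb {l \<bullet> j<..<u \<bullet> j}. trig_factor l u S k j t * trig_factor l u S k' j t))"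
  proof (rule integral_box_prod)
    fix j :: 'a
    have "continuous_on UNIV (trig_factor l u S k j)" for k
      using smooth1_trig_factor[of l u S k j] Ck1.simps(1) unfolding smooth1_def by blast
    then show "continuous_on UNIV (\<lambda>t. trig_factor l u S k j t * trig_factor l u S k' j t)"
      by (intro continuous_intros)
  qed
  also have "\<dots> = (\<Prod>j\<in>Basis. if k j = k' j \<and> (j \<in> S \<longrightarrow> k j \<noteq> 0) then 1 else 0)"
  proof (rule prod.cong[OF refl])
    fix j :: 'a assume j: "j \<in> Basis"
    let ?L = "u \<bullet> j - l \<bullet> j"
    have L: "?L > 0" using lu[OF j] by simp
    have "(LINT t|leb {l \<bullet> j<..<u \<bullet> j}. trig_factor l u S k j t * trig_factor l u S k' j t)
      = (LINT t|leb {l \<bullet> j<..<u \<bullet> j}. (trig_norm (j \<in> S) (k j) ?L * trig_norm (j \<in> S) (k' j) ?L) *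
          (trig (j \<in> S) (k j) (pi * (t - l \<bullet> j) / ?L) * trig (j \<in> S) (k' j) (pi * (t - l \<bullet> j) / ?L)))"
      by (rule lint_cong) (auto simp: trig_factor_def mult_ac)
    also have "\<dots> = (trig_norm (j \<in> S) (k j) ?L * trig_norm (j \<in> S) (k' j) ?L) *
        (if k j \<noteq> k' j then 0 else if k j = 0 then (if j \<in> S then 0 else ?L) else ?L / 2)"
      by (simp add: integral_trig_mult[OF lu[OF j]])
    also have "\<dots> = (if k j = k' j \<and> (j \<in> S \<longrightarrow> k j \<noteq> 0) then 1 else 0)"
      using L by (auto simp: trig_norm_def real_sqrt_divide field_simps)
    finally show "(LINT t|leb {l \<bullet> j<..<u \<bullet> j}. trig_factor l u S k j t * trig_factor l u S k' j t)
      = (if k j = k' j \<and> (j \<in> S \<longrightarrow> k j \<noteq> 0) then 1 else 0)" .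
  qed
  also have "\<dots> = (if (\<forall>j\<in>Basis. k j = k' j) \<and> (\<forall>j\<in>Basis \<inter> S. k j \<noteq> 0) then 1 else 0)"
  proof (cases "(\<forall>j\<in>Basis. k j = k' j) \<and> (\<forall>j\<in>Basis \<inter> S. k j \<noteq> 0)")
    case True
    show ?thesis unfolding if_P[OF True] by (rule prod.neutral) (use True in auto)
  next
    case False
    then obtain j :: 'a where "j \<in> Basis" "\<not> (k j = k' j \<and> (j \<in> S \<longrightarrow> k j \<noteq> 0))" by auto
    then show ?thesis using False by (auto intro!: prod_zero)
  qed
  finally show ?thesis .
qed

text \<open>Frequencies are total functions of which only the values on \<open>Basis\<close> count.
  Extensional functions provide one representative per frequency vector, and finitely many for each
  cutoff \<open>N\<close>.\<close>

definition freqs :: "nat => ('a::euclidean_space => nat) set" where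
  "freqs N = Basis \<rightarrow>\<^sub>E {..N}"

lemma finite_freqs [simp]: "finite (freqs N)"
  unfolding freqs_def by (intro finite_PiE) auto

lemma freqs_eqI: "k \<in> freqs N ==> k' \<in> freqs M ==> (\<And>j. j \<in> Basis ==> k j = k' j) ==> k = k'"
  unfolding freqs_def by (rule extensionalityI[of _ Basis]) (auto simp: PiE_def)

lemma trig_sys_cong: "(\<And>j. j \<in> Basis ==> k j = k' j) ==> trig_sys l u S k = trig_sys l u S k'"
  by (auto simp: trig_sys_def trig_factor_def fun_eq_iff intro!: prod.cong)

definition trig_coeff :: "'a::euclidean_space => 'a => 'a set => ('a => real) => ('a => nat) => real" where
  "trig_coeff l u S f k = (LINT x|leb (box l u). f x * trig_sys l u S k x)"

definition trig_poly :: "'a::euclidean_space => 'a => 'a set => nat => (('a => nat) => real) => 'a => real" where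
  "trig_poly l u S N c x = (\<Sum>k\<in>freqs N. c k * trig_sys l u S k x)"

lemma smooth_fun_trig_poly: "smooth_fun (trig_poly l u S N c)"
  unfolding trig_poly_def by (intro smooth_fun_sum smooth_fun_mult smooth_fun_const smooth_fun_trig_sys)

lemma trig_sys_null:
  fixes l u :: "'a::euclidean_space"
  assumes "j \<in> Basis" "j \<in> S" "k j = 0"
  shows "trig_sys l u S k x = 0"
proof -
  have "trig_factor l u S k j (x \<bullet> j) = 0" using assms by (simp add: trig_factor_def trig_def)
  then show ?thesis unfolding trig_sys_def using assms(1) by (auto intro!: prod_zero)
qed

text \<open>Completing the square in the coefficients. With \<open>c\<close> the Fourier
  coefficients this is Bessel's inequality, and the nonnegative last sum gives the best
  approximation property. The condition in that sum singles out the members that are not identically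
  zero.\<close>

lemma sqL2_diff_trig_poly:
  fixes l u :: "'a::euclidean_space"
  assumes lu: "\<And>j. j \<in> Basis ==> l \<bullet> j < u \<bullet> j" and f: "L2_on (box l u) f"
  shows "sqL2 (box l u) (\<lambda>x. f x - trig_poly l u S N c x)
     = sqL2 (box l u) f - (\<Sum>k\<in>freqs N. (trig_coeff l u S f k)^2)
       + (\<Sum>k\<in>freqs N. if \<forall>j\<in>Basis \<inter> S. k j \<noteq> 0 then (c k - trig_coeff l u S f k)^2 else 0)"
proof -
  let ?M = "leb (box l u)" and ?e = "trig_sys l u S" and ?c = "trig_coeff l u S f"
  let ?n = "\<lambda>k::'a=>nat. \<forall>j\<in>Basis \<inter> S. k j \<noteq> 0"
  have ei: "integrable ?M (\<lambda>x. ?e k x * ?e k' x)" for k k'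
    by (intro L2_on_integrable_mult L2_on_smooth smooth_fun_trig_sys)
  have fi: "integrable ?M (\<lambda>x. f x * ?e k x)" for k
    by (intro L2_on_integrable_mult f L2_on_smooth smooth_fun_trig_sys)
  have c0: "?c k = 0" if "\<not> ?n k" for k
  proof -
    have "?e k x = 0" for x using that trig_sys_null by blast
    then show ?thesis by (simp add: trig_coeff_def)
  qed
  have 1: "(LINT x|?M. f x * trig_poly l u S N c x) = (\<Sum>k\<in>freqs N. c k * ?c k)"
  proof -
    have "(LINT x|?M. f x * trig_poly l u S N c x) = (LINT x|?M. (\<Sum>k\<in>freqs N. c k * (f x * ?e k x)))"
      by (simp add: trig_poly_def sum_distrib_left mult_ac)
    also have "\<dots> = (\<Sum>k\<in>freqs N. c k * ?c k)"
      using fi by (simp add: trig_coeff_def)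
    finally show ?thesis .
  qed
  have 2: "sqL2 (box l u) (trig_poly l u S N c) = (\<Sum>k\<in>freqs N. if ?n k then (c k)^2 else 0)"
  proof -
    have "sqL2 (box l u) (trig_poly l u S N c)
       = (LINT x|?M. (\<Sum>k\<in>freqs N. \<Sum>k'\<in>freqs N. (c k * c k') * (?e k x * ?e k' x)))"
      by (simp add: sqL2_def trig_poly_def power2_eq_square sum_product mult_ac)
    also have "\<dots> = (\<Sum>k\<in>freqs N. \<Sum>k'\<in>freqs N. (c k * c k') * (LINT x|?M. ?e k x * ?e k' x))"
      using ei by simp
    also have "\<dots> = (\<Sum>k\<in>freqs N. \<Sum>k'\<in>freqs N. if k' = k then (if ?n k then (c k)^2 else 0) else 0)"
    proof (intro sum.cong refl)
      fix k k' :: "'a => nat" assume k: "k \<in> freqs N" "k' \<in> freqs N"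
      have "(LINT x|?M. ?e k x * ?e k' x) = (if (\<forall>j\<in>Basis. k j = k' j) \<and> ?n k then 1 else 0)"
        by (rule trig_sys_orthonormal[OF lu])
      moreover have "(\<forall>j\<in>Basis. k j = k' j) = (k' = k)"
        using freqs_eqI[OF k] by auto
      ultimately have I: "(LINT x|?M. ?e k x * ?e k' x) = (if k' = k \<and> ?n k then 1 else 0)"
        by (simp only:)
      have gen: "(c k * c k') * (if k' = k \<and> Q then 1 else 0) = (if k' = k then (if Q then c k * c k else 0) else 0)" for Q
        by auto
      show "(c k * c k') * (LINT x|?M. ?e k x * ?e k' x)
         = (if k' = k then (if ?n k then (c k)^2 else 0) else 0)"
        unfolding I power2_eq_square by (rule gen)
    qed
    also have "\<dots> = (\<Sum>k\<in>freqs N. if ?n k then (c k)^2 else 0)"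
    proof (intro sum.cong refl)
      fix k :: "'a => nat" assume "k \<in> freqs N"
      then show "(\<Sum>k'\<in>freqs N. if k' = k then (if ?n k then (c k)^2 else 0) else 0) = (if ?n k then (c k)^2 else 0)"
        by (subst sum.delta) auto
    qed
    finally show ?thesis .
  qed
  have "sqL2 (box l u) (\<lambda>x. f x - trig_poly l u S N c x)
     = sqL2 (box l u) f - 2 * (\<Sum>k\<in>freqs N. c k * ?c k) + (\<Sum>k\<in>freqs N. if ?n k then (c k)^2 else 0)"
    using sqL2_expand_diff[OF f L2_on_smooth[OF smooth_fun_trig_poly]] 1 2 by simp
  also have "\<dots> = sqL2 (box l u) f + (\<Sum>k\<in>freqs N. - 2 * (c k * ?c k) + (if ?n k then (c k)\<^sup>2 else 0))"
    unfolding sum.distrib sum_distrib_left[symmetric] by simp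
  also have "(\<Sum>k\<in>freqs N. - 2 * (c k * ?c k) + (if ?n k then (c k)\<^sup>2 else 0))
      = (\<Sum>k\<in>freqs N. - (?c k)\<^sup>2 + (if ?n k then (c k - ?c k)\<^sup>2 else 0))"
  proof (intro sum.cong refl)
    fix k :: "'a => nat"
    show "- 2 * (c k * ?c k) + (if ?n k then (c k)\<^sup>2 else 0) = - (?c k)\<^sup>2 + (if ?n k then (c k - ?c k)\<^sup>2 else 0)"
    proof -
      have gen: "- 2 * (x * y) + (if Q then x\<^sup>2 else 0) = - y\<^sup>2 + (if Q then (x - y)\<^sup>2 else 0)"
        if "\<not> Q ==> y = 0" for x y :: real and Q
        using that by (cases Q) (simp_all add: power2_eq_square algebra_simps)
      show ?thesis by (rule gen) (rule c0)
    qed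
  qed
  finally show ?thesis unfolding sum.distrib sum_negf by linarith
qed

lemma trig_Bessel:
  fixes l u :: "'a::euclidean_space"
  assumes lu: "\<And>j. j \<in> Basis ==> l \<bullet> j < u \<bullet> j" and f: "L2_on (box l u) f"
  shows "(\<Sum>k\<in>freqs N. (trig_coeff l u S f k)^2) \<le> sqL2 (box l u) f"
proof -
  let ?c = "trig_coeff l u S f"
  have "(\<Sum>k\<in>freqs N. if \<forall>j\<in>Basis \<inter> S. k j \<noteq> 0 then (?c k - ?c k)^2 else 0) = 0"
    by (intro sum.neutral) simp
  moreover have "0 \<le> sqL2 (box l u) (\<lambda>x. f x - trig_poly l u S N ?c x)" by simp
  ultimately show ?thesis
    using sqL2_diff_trig_poly[OF lu f, where N=N and S=S and c="?c"] by linarith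
qed

text \<open>Finite linear combinations, with one coefficient family that works at every sufficiently
  large level \<open>N\<close>. Two members can then be compared at a common level, and the best
  approximation property can be used at all large levels.\<close>

definition trig_span :: "'a::euclidean_space => 'a => 'a set => ('a => real) set" where
  "trig_span l u S = {f. \<exists>N0 c. \<forall>N\<ge>N0. f = trig_poly l u S N c}"

lemma trig_span_add:
  assumes "f \<in> trig_span l u S" "g \<in> trig_span l u S" shows "(\<lambda>x. f x + g x) \<in> trig_span l u S"
proof -
  obtain M c where 1: "\<And>N. N \<ge> M ==> f = trig_poly l u S N c" using assms(1) by (auto simp: trig_span_def)
  obtain M' c' where 2: "\<And>N. N \<ge> M' ==> g = trig_poly l u S N c'" using assms(2) by (auto simp: trig_span_def)
  have "(\<lambda>x. f x + g x) = trig_poly l u S N (\<lambda>k. c k + c' k)" if "N \<ge> max M M'" for N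
    using 1[of N] 2[of N] that by (simp add: trig_poly_def fun_eq_iff sum.distrib distrib_right)
  then show ?thesis unfolding trig_span_def by blast
qed

lemma trig_span_cmult:
  assumes "f \<in> trig_span l u S" shows "(\<lambda>x. a * f x) \<in> trig_span l u S"
proof -
  obtain M c where 1: "\<And>N. N \<ge> M ==> f = trig_poly l u S N c" using assms(1) by (auto simp: trig_span_def)
  have "(\<lambda>x. a * f x) = trig_poly l u S N (\<lambda>k. a * c k)" if "N \<ge> M" for N
    using 1[OF that] by (simp add: trig_poly_def fun_eq_iff sum_distrib_left mult.assoc)
  then show ?thesis unfolding trig_span_def by blast
qed

lemma trig_span_sys: "trig_sys l u S k \<in> trig_span l u S"
proof -
  let ?k = "restrict k Basis"
  define M where "M = Max (k ` Basis)"
  have kM: "?k \<in> freqs N" if "N \<ge> M" for N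
  proof -
    have "k j \<le> N" if "j \<in> Basis" for j
    proof -
      have "k j \<le> M" unfolding M_def using that by (intro Max_ge) auto
      then show ?thesis using \<open>N \<ge> M\<close> by simp
    qed
    then show ?thesis by (auto simp: freqs_def)
  qed
  have "trig_sys l u S k = trig_poly l u S N (\<lambda>k'. if k' = ?k then 1 else 0)" if "N \<ge> M" for N
  proof
    fix x
    have "trig_poly l u S N (\<lambda>k'. if k' = ?k then 1 else 0) x
      = (\<Sum>k'\<in>freqs N. if k' = ?k then trig_sys l u S k' x else 0)"
      unfolding trig_poly_def by (intro sum.cong) auto
    also have "\<dots> = trig_sys l u S ?k x" using kM[OF that] by (simp add: sum.delta')
    also have "\<dots> = trig_sys l u S k x" by (subst trig_sys_cong[of ?k k]) auto
    finally show "trig_sys l u S k x = trig_poly l u S N (\<lambda>k'. if k' = ?k then 1 else 0) x" by simp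
  qed
  then show ?thesis unfolding trig_span_def by blast
qed

text \<open>Multiplication by the lowest cosine shifts the frequency by one in both directions and
  preserves the kind. The span is therefore a module over cosine polynomials, whatever the set of
  sine directions.\<close>

lemma trig_mult_cos:
  "\<exists>al be. \<forall>\<theta>. trig s k \<theta> * cos \<theta> = al * trig s (Suc k) \<theta> + be * trig s (k - 1) \<theta>"
proof (cases k)
  \<comment> \<open>Here \<open>k - 1\<close> is again 0, so the lower frequency is given the
    coefficient 0 and the product is matched by the upper one alone.\<close>
  case 0
  then have "trig s k \<theta> * cos \<theta> = (if s then 0 else 1) * trig s (Suc k) \<theta> + 0 * trig s (k - 1) \<theta>" for \<theta>
    by (simp add: trig_def)
  then show ?thesis by blast
next
  case (Suc m)
  have "trig s k \<theta> * cos \<theta> = (1/2) * trig s (Suc k) \<theta> + (1/2) * trig s (k - 1) \<theta>" for \<theta>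
  proof -
    have "real (Suc k) * \<theta> = real k * \<theta> + \<theta>" "real (k - 1) * \<theta> = real k * \<theta> - \<theta>"
      using Suc by (simp_all add: algebra_simps)
    then show ?thesis
      unfolding trig_def by (simp only: sin_add sin_diff cos_add cos_diff) (simp add: field_simps)
  qed
  then show ?thesis by blast
qed

lemma trig_span_mult_cos:
  fixes l u :: "'a::euclidean_space"
  assumes lu: "\<And>j. j \<in> Basis ==> l \<bullet> j < u \<bullet> j" and j: "j \<in> Basis"
    and f: "f \<in> trig_span l u S"
  shows "(\<lambda>x. cos (pi * (x \<bullet> j - l \<bullet> j) / (u \<bullet> j - l \<bullet> j)) * f x) \<in> trig_span l u S"
proof -
  let ?L = "u \<bullet> j - l \<bullet> j"
  let ?\<theta> = "\<lambda>x. pi * (x \<bullet> j - l \<bullet> j) / ?L"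
  have L: "?L > 0" using lu j by simp
  have nz: "trig_norm b k ?L \<noteq> 0" for b k using L by (simp add: trig_norm_def)
  have base: "(\<lambda>x. cos (?\<theta> x) * trig_sys l u S k x) \<in> trig_span l u S" for k
  proof -
    obtain al be where ab: "\<And>\<theta>. trig (j \<in> S) (k j) \<theta> * cos \<theta> = al * trig (j \<in> S) (Suc (k j)) \<theta> + be * trig (j \<in> S) (k j - 1) \<theta>"
      using trig_mult_cos by blast
    let ?k1 = "k(j := Suc (k j))" and ?k2 = "k(j := k j - 1)"
    define n0 where "n0 = trig_norm (j \<in> S) (k j) ?L"
    define n1 where "n1 = trig_norm (j \<in> S) (Suc (k j)) ?L"
    define n2 where "n2 = trig_norm (j \<in> S) (k j - 1) ?L"
    have r: "trig_sys l u S k' x = trig_factor l u S k' j (x \<bullet> j) * (\<Prod>i\<in>Basis - {j}. trig_factor l u S k i (x \<bullet> i))"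
      if "k' = k \<or> k' = ?k1 \<or> k' = ?k2" for k' x
    proof -
      have "(\<Prod>i\<in>Basis - {j}. trig_factor l u S k' i (x \<bullet> i)) = (\<Prod>i\<in>Basis - {j}. trig_factor l u S k i (x \<bullet> i))"
        using that by (intro prod.cong) (auto simp: trig_factor_def)
      then show ?thesis unfolding trig_sys_def using j by (subst prod.remove[of _ j]) auto
    qed
    have fac: "cos (?\<theta> x) * trig_factor l u S k j (x \<bullet> j)
       = (n0 * al / n1) * trig_factor l u S ?k1 j (x \<bullet> j) + (n0 * be / n2) * trig_factor l u S ?k2 j (x \<bullet> j)" for x
    proof -
      have "cos (?\<theta> x) * trig_factor l u S k j (x \<bullet> j) = n0 * (trig (j \<in> S) (k j) (?\<theta> x) * cos (?\<theta> x))"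
        by (simp add: trig_factor_def n0_def)
      also have "\<dots> = n0 * al * trig (j \<in> S) (Suc (k j)) (?\<theta> x) + n0 * be * trig (j \<in> S) (k j - 1) (?\<theta> x)"
        unfolding ab by (simp add: distrib_left)
      also have "trig (j \<in> S) (Suc (k j)) (?\<theta> x) = trig_factor l u S ?k1 j (x \<bullet> j) / n1"
        using nz by (simp add: trig_factor_def n1_def)
      also have "trig (j \<in> S) (k j - 1) (?\<theta> x) = trig_factor l u S ?k2 j (x \<bullet> j) / n2"
        using nz by (simp add: trig_factor_def n2_def)
      finally show ?thesis by (simp only: times_divide_eq_left times_divide_eq_right)
    qed
    have "(\<lambda>x. cos (?\<theta> x) * trig_sys l u S k x)
      = (\<lambda>x. (n0 * al / n1) * trig_sys l u S ?k1 x + (n0 * be / n2) * trig_sys l u S ?k2 x)"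
    proof
      fix x
      let ?R = "\<Prod>i\<in>Basis - {j}. trig_factor l u S k i (x \<bullet> i)"
      have "cos (?\<theta> x) * trig_sys l u S k x = (cos (?\<theta> x) * trig_factor l u S k j (x \<bullet> j)) * ?R"
        using r[of k x] by simp
      also have "\<dots> = (n0 * al / n1) * trig_sys l u S ?k1 x + (n0 * be / n2) * trig_sys l u S ?k2 x"
        unfolding fac using r[of ?k1 x] r[of ?k2 x] by (simp only: distrib_right mult.assoc simp_thms)
      finally show "cos (?\<theta> x) * trig_sys l u S k x
        = (n0 * al / n1) * trig_sys l u S ?k1 x + (n0 * be / n2) * trig_sys l u S ?k2 x" .
    qed
    then show ?thesis by (simp only:) (intro trig_span_add trig_span_cmult trig_span_sys)
  qed
  obtain N c where fN: "f = trig_poly l u S N c" using f by (auto simp: trig_span_def)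
  have zero: "(\<lambda>x. 0) \<in> trig_span l u S" using trig_span_cmult[OF trig_span_sys, of 0] by simp
  have sum: "(\<lambda>x. \<Sum>k\<in>K. c k * (cos (?\<theta> x) * trig_sys l u S k x)) \<in> trig_span l u S" if "finite K" for K
    using that
  proof (induction K)
    case empty then show ?case using zero by simp
  next
    case (insert k K)
    show ?case unfolding sum.insert[OF insert.hyps]
      by (rule trig_span_add[OF trig_span_cmult[OF base] insert.IH])
  qed
  have "(\<lambda>x. cos (?\<theta> x) * f x) = (\<lambda>x. \<Sum>k\<in>freqs N. c k * (cos (?\<theta> x) * trig_sys l u S k x))"
    unfolding fN trig_poly_def sum_distrib_left by (simp only: mult.left_commute)
  then show ?thesis using sum[OF finite_freqs] by simp
qed

text \<open>The algebra generated by the lowest cosine of each coordinate: it acts on every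
  \<open>trig_span\<close>, and Stone-Weierstrass applies to it on the closed box.\<close>

inductive_set cos_algebra :: "'a::euclidean_space => 'a => ('a => real) set" for l u where
  const: "(\<lambda>x. c) \<in> cos_algebra l u"
| cos: "j \<in> Basis ==> (\<lambda>x. cos (pi * (x \<bullet> j - l \<bullet> j) / (u \<bullet> j - l \<bullet> j))) \<in> cos_algebra l u"
| add: "f \<in> cos_algebra l u ==> g \<in> cos_algebra l u ==> (\<lambda>x. f x + g x) \<in> cos_algebra l u"
| mult: "f \<in> cos_algebra l u ==> g \<in> cos_algebra l u ==> (\<lambda>x. f x * g x) \<in> cos_algebra l u"

lemma trig_span_mult_cos_algebra:
  fixes l u :: "'a::euclidean_space"
  assumes lu: "\<And>j. j \<in> Basis ==> l \<bullet> j < u \<bullet> j"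
    and g: "g \<in> cos_algebra l u" and f: "f \<in> trig_span l u S"
  shows "(\<lambda>x. g x * f x) \<in> trig_span l u S"
  using g f
proof (induction arbitrary: f)
  case (const c) then show ?case by (rule trig_span_cmult)
next
  case (cos j) then show ?case by (intro trig_span_mult_cos lu)
next
  case (add g h)
  from trig_span_add[OF add.IH(1)[OF add.prems] add.IH(2)[OF add.prems]]
  show ?case by (simp add: distrib_right)
next
  case (mult g h)
  from mult.IH(1)[OF mult.IH(2)[OF mult.prems]] show ?case by (simp add: mult.assoc)
qed

lemma continuous_on_cos_algebra:
  assumes lu: "\<And>j. j \<in> Basis ==> l \<bullet> j < u \<bullet> j" and "g \<in> cos_algebra l u"
  shows "continuous_on A g"
  using assms(2) by induction (auto intro!: continuous_intros dest: lu)

text \<open>The generators separate points because \<open>cos\<close> is injective on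
  \<open>{0..pi}\<close>, the range of the rescaled coordinates.\<close>

lemma cos_algebra_dense:
  fixes l u :: "'a::euclidean_space"
  assumes lu: "\<And>j. j \<in> Basis ==> l \<bullet> j < u \<bullet> j"
    and G: "continuous_on (cbox l u) G" and e: "0 < \<epsilon>"
  shows "\<exists>g\<in>cos_algebra l u. \<forall>x\<in>cbox l u. \<bar>G x - g x\<bar> < \<epsilon>"
proof -
  interpret function_ring_on "cos_algebra l u" "cbox l u"
  proof
    fix x y assume xy: "x \<in> cbox l u" "y \<in> cbox l u" "x \<noteq> y"
    then obtain j where j: "j \<in> Basis" "x \<bullet> j \<noteq> y \<bullet> j" using euclidean_eq_iff[of x y] by auto
    let ?L = "u \<bullet> j - l \<bullet> j"
    have L: "?L > 0" using lu j by simp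
    have r: "0 \<le> pi * (z \<bullet> j - l \<bullet> j) / ?L \<and> pi * (z \<bullet> j - l \<bullet> j) / ?L \<le> pi" if "z \<in> cbox l u" for z
    proof -
      have "0 \<le> z \<bullet> j - l \<bullet> j" "z \<bullet> j - l \<bullet> j \<le> ?L" using that j by (auto simp: mem_box)
      then show ?thesis using L by (simp add: divide_le_eq)
    qed
    have "cos (pi * (x \<bullet> j - l \<bullet> j) / ?L) \<noteq> cos (pi * (y \<bullet> j - l \<bullet> j) / ?L)"
    proof
      assume "cos (pi * (x \<bullet> j - l \<bullet> j) / ?L) = cos (pi * (y \<bullet> j - l \<bullet> j) / ?L)"
      then have "pi * (x \<bullet> j - l \<bullet> j) / ?L = pi * (y \<bullet> j - l \<bullet> j) / ?L"
        using cos_inj_pi r[OF xy(1)] r[OF xy(2)] by blast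
      then show False using L j(2) by simp
    qed
    then show "\<exists>f\<in>cos_algebra l u. f x \<noteq> f y"
      by (rule bexI[OF _ cos_algebra.cos[OF j(1)]])
  next
    show "continuous_on (cbox l u) f" if "f \<in> cos_algebra l u" for f
      by (rule continuous_on_cos_algebra[OF lu that])
  qed (simp_all add: cos_algebra.intros)
  show ?thesis by (rule Stone_Weierstrass_basic[OF G e])
qed

section \<open>Completeness of the trigonometric systems\<close>

definition trig_approx :: "'a::euclidean_space => 'a => 'a set => ('a => real) => bool" where
  "trig_approx l u S f \<longleftrightarrow> L2_on (box l u) f \<and>
    (\<forall>\<epsilon>>0. \<exists>p\<in>trig_span l u S. sqL2 (box l u) (\<lambda>x. f x - p x) < \<epsilon>)"

lemma trig_approx_limit:
  assumes F: "\<And>n::nat. trig_approx l u S (F n)" and f: "L2_on (box l u) f"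
    and lim: "(\<lambda>n. sqL2 (box l u) (\<lambda>x. F n x - f x)) \<longlonglongrightarrow> 0"
  shows "trig_approx l u S f"
  unfolding trig_approx_def
proof (intro conjI f allI impI)
  fix \<epsilon> :: real assume e: "\<epsilon> > 0"
  have "\<forall>\<^sub>F n in sequentially. sqL2 (box l u) (\<lambda>x. F n x - f x) < \<epsilon> / 4"
    using lim e by (intro order_tendstoD(2)) auto
  then obtain n where n: "sqL2 (box l u) (\<lambda>x. F n x - f x) < \<epsilon> / 4"
    by (auto simp: eventually_sequentially)
  have "\<epsilon> / 4 > 0" using e by simp
  with F[of n] obtain p where p: "p \<in> trig_span l u S" "sqL2 (box l u) (\<lambda>x. F n x - p x) < \<epsilon> / 4"
    unfolding trig_approx_def by blast
  obtain N c where "p = trig_poly l u S N c" using p(1) by (auto simp: trig_span_def)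
  then have "L2_on (box l u) p" by (simp add: L2_on_smooth smooth_fun_trig_poly)
  then have "sqL2 (box l u) (\<lambda>x. f x - p x) \<le> 2 * sqL2 (box l u) (\<lambda>x. f x - F n x) + 2 * sqL2 (box l u) (\<lambda>x. F n x - p x)"
    using F f by (intro sqL2_triangle) (auto simp: trig_approx_def)
  also have "\<dots> < \<epsilon>" using n p(2) sqL2_minus_commute[of "box l u" "F n" f] by simp
  finally show "\<exists>p\<in>trig_span l u S. sqL2 (box l u) (\<lambda>x. f x - p x) < \<epsilon>" using p(1) by blast
qed

text \<open>Up to normalisation this is the lowest nonzero member of the system for
  \<open>S\<close>. Sine systems contain no constants and do not form an algebra, so
  Stone-Weierstrass is applied to the quotient by this weight, which is positive in the open
  box.\<close>

definition sin_weight :: "'a::euclidean_space => 'a => 'a set => 'a => real" where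
  "sin_weight l u S x = (\<Prod>j\<in>Basis. if j \<in> S then sin (pi * (x \<bullet> j - l \<bullet> j) / (u \<bullet> j - l \<bullet> j)) else 1)"

lemma sin_weight_span:
  fixes l u :: "'a::euclidean_space"
  assumes lu: "\<And>j. j \<in> Basis ==> l \<bullet> j < u \<bullet> j"
  shows "sin_weight l u S \<in> trig_span l u S"
proof -
  define k where "k j = (if j \<in> S then 1 else 0 :: nat)" for j
  define P where "P = (\<Prod>j\<in>Basis. trig_norm (j \<in> S) (k j) (u \<bullet> j - l \<bullet> j))"
  have "trig_norm (j \<in> S) (k j) (u \<bullet> j - l \<bullet> j) \<noteq> 0" if "j \<in> Basis" for j
    using lu[OF that] by (simp add: trig_norm_def)
  then have P: "P \<noteq> 0" unfolding P_def by (simp add: prod_zero_iff)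
  have t: "trig (j \<in> S) (k j) \<theta> = (if j \<in> S then sin \<theta> else 1)" for j \<theta> by (simp add: trig_def k_def)
  have "trig_sys l u S k x = P * sin_weight l u S x" for x
    unfolding trig_sys_def trig_factor_def prod.distrib P_def sin_weight_def t by simp
  then have "sin_weight l u S = (\<lambda>x. (1 / P) * trig_sys l u S k x)" using P by auto
  then show ?thesis by (simp only: trig_span_cmult trig_span_sys)
qed

lemma sin_weight_pos:
  fixes l u :: "'a::euclidean_space"
  assumes "x \<in> box l u" shows "sin_weight l u S x > 0"
  unfolding sin_weight_def
proof (intro prod_pos ballI)
  fix j :: 'a assume "j \<in> Basis"
  then have "0 < x \<bullet> j - l \<bullet> j" "x \<bullet> j - l \<bullet> j < u \<bullet> j - l \<bullet> j" using assms by (auto simp: mem_box)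
  then have "0 < pi * (x \<bullet> j - l \<bullet> j) / (u \<bullet> j - l \<bullet> j)" "pi * (x \<bullet> j - l \<bullet> j) / (u \<bullet> j - l \<bullet> j) < pi"
    by (simp_all add: divide_less_eq)
  then show "0 < (if j \<in> S then sin (pi * (x \<bullet> j - l \<bullet> j) / (u \<bullet> j - l \<bullet> j)) else 1)"
    by (simp add: sin_gt_zero)
qed

lemma abs_sin_weight_le: "\<bar>sin_weight l u S x\<bar> \<le> 1"
  unfolding sin_weight_def abs_prod by (intro prod_le_1) auto

lemma continuous_on_sin_weight:
  assumes lu: "\<And>j. j \<in> Basis ==> l \<bullet> j < u \<bullet> j"
  shows "continuous_on A (sin_weight l u S)"
proof -
  have "continuous_on A (\<lambda>x. if j \<in> S then sin (pi * (x \<bullet> j - l \<bullet> j) / (u \<bullet> j - l \<bullet> j)) else 1)" if "j \<in> Basis" for j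
    using lu[OF that] by (cases "j \<in> S") (auto intro!: continuous_intros)
  then show ?thesis unfolding sin_weight_def[abs_def] by (intro continuous_on_prod)
qed

lemma trig_approx_weighted_continuous:
  fixes l u :: "'a::euclidean_space"
  assumes lu: "\<And>j. j \<in> Basis ==> l \<bullet> j < u \<bullet> j" and G: "continuous_on UNIV G"
  shows "trig_approx l u S (\<lambda>x. sin_weight l u S x * G x)"
  unfolding trig_approx_def
proof (intro conjI allI impI)
  let ?W = "sin_weight l u S"
  show L: "L2_on (box l u) (\<lambda>x. ?W x * G x)"
    by (rule L2_on_continuous[of "cbox l u"])
      (auto intro!: continuous_intros continuous_on_sin_weight lu continuous_on_subset[OF G] simp: box_subset_cbox)
  fix \<epsilon> :: real assume e: "\<epsilon> > 0"
  define m where "m = measure lebesgue (box l u)"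
  have m: "m \<ge> 0" by (simp add: m_def)
  \<comment> \<open>Chosen so that a uniform error \<open>r\<close> on a set of measure
    \<open>m\<close> has squared norm below \<open>\<epsilon>\<close>.\<close>
  define r where "r = sqrt (\<epsilon> / (2 * (m + 1)))"
  have r: "r > 0" "r^2 = \<epsilon> / (2 * (m + 1))" using e m by (simp_all add: r_def)
  from cos_algebra_dense[OF lu continuous_on_subset[OF G] r(1)] obtain g
    where g: "g \<in> cos_algebra l u" "\<And>x. x \<in> cbox l u ==> \<bar>G x - g x\<bar> < r" by blast
  have gW: "(\<lambda>x. g x * ?W x) \<in> trig_span l u S"
    by (rule trig_span_mult_cos_algebra[OF lu g(1) sin_weight_span[OF lu]])
  have "sqL2 (box l u) (\<lambda>x. ?W x * G x - g x * ?W x) \<le> sqL2 (box l u) (\<lambda>x. r)"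
  proof (rule sqL2_mono_AE)
    show "L2_on (box l u) (\<lambda>x. r)" by (rule L2_on_bounded[of _ _ r]) (use r in auto)
    have "L2_on (box l u) (\<lambda>x. g x * ?W x)"
      by (rule L2_on_continuous[of "cbox l u"])
        (auto intro!: continuous_intros continuous_on_sin_weight lu continuous_on_cos_algebra[OF lu g(1)] simp: box_subset_cbox)
    with L show "L2_on (box l u) (\<lambda>x. ?W x * G x - g x * ?W x)" by (rule L2_on_diff)
    show "AE x in leb (box l u). \<bar>?W x * G x - g x * ?W x\<bar> \<le> \<bar>r\<bar>"
    proof (rule AE_I2)
      fix x assume "x \<in> space (leb (box l u))"
      then have x: "x \<in> cbox l u" using box_subset_cbox by auto
      have "\<bar>?W x * G x - g x * ?W x\<bar> = \<bar>?W x\<bar> * \<bar>G x - g x\<bar>"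
        by (simp add: abs_mult[symmetric] algebra_simps)
      also have "\<dots> \<le> 1 * r" using abs_sin_weight_le g(2)[OF x] by (intro mult_mono) auto
      finally show "\<bar>?W x * G x - g x * ?W x\<bar> \<le> \<bar>r\<bar>" using r by simp
    qed
  qed
  also have "\<dots> = r^2 * m" by (simp add: sqL2_def m_def measure_restrict_space)
  also have "\<dots> < \<epsilon>"
  proof -
    have "\<epsilon> * m < \<epsilon> * (2 * (m + 1))" using e m by (intro mult_strict_left_mono) auto
    then show ?thesis unfolding r(2) using m by (simp add: divide_less_eq)
  qed
  finally show "\<exists>p\<in>trig_span l u S. sqL2 (box l u) (\<lambda>x. ?W x * G x - p x) < \<epsilon>" by (rule bexI[OF _ gW])
qed

text \<open>Since the weight degenerates at the faces, division by it is regularised by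
  \<open>1 / Suc n\<close>. The approximants are clipped to the bound \<open>C\<close> before
  division, so that \<open>?W * G n\<close> stays bounded by \<open>C\<close> and dominated
  convergence applies; convergence in the open box uses positivity of the weight there.\<close>

lemma trig_approx_bounded:
  fixes l u :: "'a::euclidean_space"
  assumes lu: "\<And>j. j \<in> Basis ==> l \<bullet> j < u \<bullet> j"
    and f: "f \<in> borel_measurable (leb (box l u))" and C: "\<And>x. \<bar>f x\<bar> \<le> C"
  shows "trig_approx l u S f"
proof -
  have fL: "L2_on (box l u) f" by (rule L2_on_bounded[OF _ f C]) auto
  have C0: "C \<ge> 0" using C[of undefined] by linarith
  have "(\<lambda>x. if x \<in> box l u then f x else 0) \<in> borel_measurable lebesgue"
    using f by (subst borel_measurable_if) auto
  \<comment> \<open>By its definition \<open>measurable_on\<close> delivers continuous functions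
    that converge to the given one outside a negligible set.\<close>
  then have "(\<lambda>x. if x \<in> box l u then f x else 0) measurable_on UNIV"
    by (rule lebesgue_measurable_imp_measurable_on_real) simp
  then obtain Z g where Z: "negligible Z" and g: "\<And>n. continuous_on UNIV (g n)"
    and lim: "\<And>x. x \<notin> Z ==> (\<lambda>n. g n x) \<longlonglongrightarrow> (if x \<in> box l u then f x else 0)"
    unfolding measurable_on_def by auto
  let ?W = "sin_weight l u S"
  define h where "h n x = max (- C) (min C (g n x))" for n x
  define G where "G n x = h n x / (\<bar>?W x\<bar> + 1 / real (Suc n))" for n x
  have den: "\<bar>?W x\<bar> + 1 / real (Suc n) \<noteq> 0" for x n
  proof -
    have "0 < 1 / real (Suc n)" by simp
    then show ?thesis using abs_ge_zero[of "?W x"] by linarith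
  qed
  have G: "continuous_on UNIV (G n)" for n
    unfolding G_def[abs_def] h_def[abs_def] using den
    by (intro continuous_intros continuous_on_sin_weight[OF lu] g) auto
  have hb: "\<bar>h n x\<bar> \<le> C" for n x using C0 by (auto simp: h_def)
  have WG: "\<bar>?W x * G n x\<bar> \<le> C" for n x
  proof -
    have "\<bar>?W x * G n x\<bar> = \<bar>h n x\<bar> * (\<bar>?W x\<bar> / (\<bar>?W x\<bar> + 1 / real (Suc n)))"
    proof -
      have "\<bar>\<bar>?W x\<bar> + 1 / real (Suc n)\<bar> = \<bar>?W x\<bar> + 1 / real (Suc n)" by (rule abs_of_nonneg) simp
      then show ?thesis unfolding G_def by (simp only: abs_mult abs_divide) simp
    qed
    also have "\<dots> \<le> C * 1"
    proof (rule mult_mono)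
      show "\<bar>?W x\<bar> / (\<bar>?W x\<bar> + 1 / real (Suc n)) \<le> 1"
        by (rule divide_le_eq_1_pos[THEN iffD2]) (simp_all add: add_nonneg_pos)
    qed (use hb C0 in auto)
    finally show ?thesis by simp
  qed
  show ?thesis
  proof (rule trig_approx_limit[OF _ fL])
    show "trig_approx l u S (\<lambda>x. ?W x * G n x)" for n
      by (rule trig_approx_weighted_continuous[OF lu G])
    show "(\<lambda>n. sqL2 (box l u) (\<lambda>x. ?W x * G n x - f x)) \<longlonglongrightarrow> 0"
    proof (rule sqL2_dominated_convergence[OF _ f])
      show "(\<lambda>x. ?W x * G n x) \<in> borel_measurable (leb (box l u))" for n
        by (intro measurable_restrict_space1 measurable_completion)
          (simp add: borel_measurable_continuous_onI continuous_on_mult continuous_on_sin_weight[OF lu] G)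
      show "L2_on (box l u) (\<lambda>x. 2 * C)" by (rule L2_on_bounded[of _ _ "2 * C"]) (use C0 in auto)
      show "AE x in leb (box l u). \<bar>?W x * G n x - f x\<bar> \<le> \<bar>2 * C\<bar>" for n
      proof (rule AE_I2)
        fix x show "\<bar>?W x * G n x - f x\<bar> \<le> \<bar>2 * C\<bar>" using WG[of x n] C[of x] by linarith
      qed
      have "AE x in lebesgue. x \<notin> Z"
        using Z by (auto simp: negligible_iff_null_sets intro: AE_not_in)
      then have "AE x in leb (box l u). x \<notin> Z"
        by (subst AE_restrict_space_iff) auto
      moreover have "AE x in leb (box l u). x \<in> box l u" by (rule AE_I2) simp
      ultimately show "AE x in leb (box l u). (\<lambda>n. ?W x * G n x) \<longlonglongrightarrow> f x"
      proof eventually_elim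
        case (elim x)
        then have xZ: "x \<notin> Z" and xb: "x \<in> box l u" by auto
        have W: "?W x > 0" by (rule sin_weight_pos[OF xb])
        have "(\<lambda>n. h n x) \<longlonglongrightarrow> max (- C) (min C (f x))"
          unfolding h_def using lim[OF xZ] xb by (intro tendsto_intros) auto
        also have "max (- C) (min C (f x)) = f x" using C[of x] by auto
        finally have "(\<lambda>n. ?W x * (h n x / (\<bar>?W x\<bar> + 1 / real (Suc n)))) \<longlonglongrightarrow> ?W x * (f x / (\<bar>?W x\<bar> + 0))"
          using W by (intro tendsto_intros LIMSEQ_Suc[OF lim_1_over_n]) auto
        then show ?case using W by (simp add: G_def)
      qed
    qed
  qed
qed

lemma trig_approx_L2:
  fixes l u :: "'a::euclidean_space"
  assumes lu: "\<And>j. j \<in> Basis ==> l \<bullet> j < u \<bullet> j" and f: "L2_on (box l u) f"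
  shows "trig_approx l u S f"
proof (rule trig_approx_limit[OF _ f])
  let ?F = "\<lambda>n x. max (- real n) (min (real n) (f x))"
  have fm: "f \<in> borel_measurable (leb (box l u))" using f by (rule L2_on_measurable)
  have Fm: "?F n \<in> borel_measurable (leb (box l u))" for n using fm by simp
  show "trig_approx l u S (?F n)" for n by (rule trig_approx_bounded[OF lu Fm, of _ "real n"]) auto
  show "(\<lambda>n. sqL2 (box l u) (\<lambda>x. ?F n x - f x)) \<longlonglongrightarrow> 0"
  proof (rule sqL2_dominated_convergence[OF Fm fm f])
    show "AE x in leb (box l u). (\<lambda>n. ?F n x) \<longlonglongrightarrow> f x"
    proof (rule AE_I2, rule tendsto_eventually)
      fix x
      obtain N where N: "\<bar>f x\<bar> \<le> real N" using real_arch_simple by blast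
      have "?F n x = f x" if "n \<ge> N" for n
      proof -
        have "\<bar>f x\<bar> \<le> real n" using N that by linarith
        then show ?thesis by (auto simp: max_def min_def abs_le_iff)
      qed
      then show "\<forall>\<^sub>F n in sequentially. ?F n x = f x" by (auto simp: eventually_sequentially)
    qed
    show "AE x in leb (box l u). \<bar>?F n x - f x\<bar> \<le> \<bar>f x\<bar>" for n
      by (rule AE_I2) (auto simp: max_def min_def abs_if)
  qed
qed

text \<open>Some element of the span is close to \<open>f\<close>. At every large level the Fourier
  partial sum is at least as close, by the best approximation property.\<close>

lemma trig_series_converges:
  fixes l u :: "'a::euclidean_space"
  assumes lu: "\<And>j. j \<in> Basis ==> l \<bullet> j < u \<bullet> j" and f: "L2_on (box l u) f"
  shows "(\<lambda>N. sqL2 (box l u) (\<lambda>x. f x - trig_poly l u S N (trig_coeff l u S f) x)) \<longlonglongrightarrow> 0"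
proof (rule tendstoI)
  fix \<epsilon> :: real assume "\<epsilon> > 0"
  then obtain p where p: "p \<in> trig_span l u S" "sqL2 (box l u) (\<lambda>x. f x - p x) < \<epsilon>"
    using trig_approx_L2[OF lu f] unfolding trig_approx_def by blast
  obtain N0 c where c: "\<And>N. N \<ge> N0 ==> p = trig_poly l u S N c" using p(1) by (auto simp: trig_span_def)
  have "sqL2 (box l u) (\<lambda>x. f x - trig_poly l u S N (trig_coeff l u S f) x) < \<epsilon>" if "N \<ge> N0" for N
  proof -
    have "0 \<le> (\<Sum>k\<in>freqs N. if \<forall>j\<in>Basis \<inter> S. k j \<noteq> 0 then (c k - trig_coeff l u S f k)^2 else 0)"
      by (intro sum_nonneg) auto
    moreover have null: "(\<Sum>k\<in>freqs N. if \<forall>j\<in>Basis \<inter> S. k j \<noteq> 0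
        then (trig_coeff l u S f k - trig_coeff l u S f k)^2 else 0) = 0"
      by (intro sum.neutral) simp
    ultimately have "sqL2 (box l u) (\<lambda>x. f x - trig_poly l u S N (trig_coeff l u S f) x)
       \<le> sqL2 (box l u) (\<lambda>x. f x - trig_poly l u S N c x)"
      using sqL2_diff_trig_poly[OF lu f, where N=N and S=S and c="trig_coeff l u S f"]
        sqL2_diff_trig_poly[OF lu f, where N=N and S=S and c=c] by linarith
    also have "\<dots> < \<epsilon>" using p(2) c[OF that] by simp
    finally show ?thesis .
  qed
  then show "\<forall>\<^sub>F N in sequentially. dist (sqL2 (box l u) (\<lambda>x. f x - trig_poly l u S N (trig_coeff l u S f) x)) 0 < \<epsilon>"
    by (auto simp: eventually_sequentially dist_real_def)
qed

lemma trig_Parseval: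
  fixes l u :: "'a::euclidean_space"
  assumes lu: "\<And>j. j \<in> Basis ==> l \<bullet> j < u \<bullet> j" and f: "L2_on (box l u) f"
  shows "(\<lambda>N. \<Sum>k\<in>freqs N. (trig_coeff l u S f k)^2) \<longlonglongrightarrow> sqL2 (box l u) f"
proof -
  have "(\<Sum>k\<in>freqs N. (trig_coeff l u S f k)^2) = sqL2 (box l u) f
    - sqL2 (box l u) (\<lambda>x. f x - trig_poly l u S N (trig_coeff l u S f) x)" for N
  proof -
    have "(\<Sum>k\<in>freqs N. if \<forall>j\<in>Basis \<inter> S. k j \<noteq> 0
        then (trig_coeff l u S f k - trig_coeff l u S f k)^2 else 0) = 0"
      by (intro sum.neutral) simp
    then show ?thesis
      using sqL2_diff_trig_poly[OF lu f, where N=N and S=S and c="trig_coeff l u S f"] by linarith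
  qed
  moreover have "(\<lambda>N. sqL2 (box l u) f
    - sqL2 (box l u) (\<lambda>x. f x - trig_poly l u S N (trig_coeff l u S f) x)) \<longlonglongrightarrow> sqL2 (box l u) f - 0"
    by (intro tendsto_intros trig_series_converges lu f)
  ultimately show ?thesis by simp
qed

lemma trig_coeff_eq_0_AE:
  fixes l u :: "'a::euclidean_space"
  assumes lu: "\<And>j. j \<in> Basis ==> l \<bullet> j < u \<bullet> j" and f: "L2_on (box l u) f"
    and 0: "\<And>k. trig_coeff l u S f k = 0"
  shows "AE x in leb (box l u). f x = 0"
proof -
  have "(\<lambda>N::nat. 0) \<longlonglongrightarrow> sqL2 (box l u) f" using trig_Parseval[OF lu f, of S] by (simp add: 0)
  then have "sqL2 (box l u) f = 0" using LIMSEQ_unique tendsto_const by blast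
  then show ?thesis using sqL2_eq_0_iff[OF f] by simp
qed

section \<open>A Carleman estimate in one variable\<close>

text \<open>Absolute continuity in the form "primitive of an integrable function". The upper limit
  is encoded by a condition under the integral, so that all points \<open>z\<close> refer to one and
  the same measure space.\<close>

definition ac_on :: "real => real => (real => real) => (real => real) => bool" where
  "ac_on a b f f' \<longleftrightarrow> integrable (leb {a<..<b}) f' \<and>
     (\<forall>z\<in>{a..b}. f z = f a + (LINT t|leb {a<..<b}. (if t < z then f' t else 0)))"

lemma ac_onD:
  assumes "ac_on a b f f'"
  shows "integrable (leb {a<..<b}) f'"
    and "z \<in> {a..b} ==> f z = f a + (LINT t|leb {a<..<b}. (if t < z then f' t else 0))"
  using assms unfolding ac_on_def by blast+

lemma ac_onI:
  assumes "integrable (leb {a<..<b}) f'"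
    and "\<And>z. z \<in> {a..b} ==> f z = f a + (LINT t|leb {a<..<b}. (if t < z then f' t else 0))"
  shows "ac_on a b f f'"
  unfolding ac_on_def by (intro conjI ballI assms)

lemma measurable_less_lebesgue_on [measurable]:
  "Measurable.pred (leb S) (\<lambda>t::real. t < z)"
  "Measurable.pred (leb S) (\<lambda>t::real. z < t)"
proof -
  have "(\<lambda>t. t) \<in> borel_measurable (leb S)" using id_borel_measurable_lebesgue_on by (simp add: id_def)
  then show "Measurable.pred (leb S) (\<lambda>t::real. t < z)" "Measurable.pred (leb S) (\<lambda>t::real. z < t)"
    by simp_all
qed

lemma integrable_if_less:
  assumes "integrable (leb S) f"
  shows "integrable (leb S) (\<lambda>t::real. if t < z then f t else (0::real))"
    "integrable (leb S) (\<lambda>t::real. if z < t then f t else (0::real))"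
  by (rule Bochner_Integration.integrable_bound[OF assms]; use borel_measurable_integrable[OF assms] in simp)+

lemma AE_lebesgue_on_neq: "AE t in leb S. t \<noteq> (z::'a::euclidean_space)"
  if "S \<in> sets lebesgue"
  using AE_lborel_singleton[of z] that by (subst AE_lebesgue_on_iff) auto

lemma ac_on_continuous:
  assumes "ac_on a b f f'"
  shows "continuous_on {a..b} f"
  unfolding continuous_on_sequentially
proof (intro allI ballI impI, elim conjE)
  fix X z assume X: "\<forall>n. X n \<in> {a..b}" and z: "z \<in> {a..b}" and lim: "X \<longlonglongrightarrow> z"
  let ?M = "leb {a<..<b}"
  note i = ac_onD(1)[OF assms]
  have "(\<lambda>n. \<integral>t. (if t < X n then f' t else 0) \<partial>?M) \<longlonglongrightarrow> (LINT t|?M. (if t < z then f' t else 0))"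
  proof (rule integral_dominated_convergence[where w="\<lambda>t. \<bar>f' t\<bar>"])
    show "AE t in ?M. (\<lambda>n. if t < X n then f' t else 0) \<longlonglongrightarrow> (if t < z then f' t else 0)"
    proof -
      have "AE t in ?M. t \<noteq> z" by (rule AE_lebesgue_on_neq) simp
      then show ?thesis
      proof eventually_elim
        case (elim t)
        show ?case
        proof (rule tendsto_eventually)
          from elim consider "t < z" | "z < t" by linarith
          then show "\<forall>\<^sub>F n in sequentially. (if t < X n then f' t else 0) = (if t < z then f' t else 0)"
          proof cases
            case 1
            from order_tendstoD(1)[OF lim 1] show ?thesis by eventually_elim (use 1 in simp)
          next
            case 2
            from order_tendstoD(2)[OF lim 2] show ?thesis by eventually_elim (use 2 in simp)
          qed
        qed
      qed
    qed
  qed (use i integrable_if_less[OF i] in \<open>auto intro: borel_measurable_integrable\<close>)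
  then have "(\<lambda>n. f a + (LINT t|?M. (if t < X n then f' t else 0))) \<longlonglongrightarrow> f a + (LINT t|?M. (if t < z then f' t else 0))"
    by (intro tendsto_intros)
  moreover have "f (X n) = f a + (LINT t|?M. (if t < X n then f' t else 0))" for n
    by (rule ac_onD(2)[OF assms]) (use X in simp)
  moreover have "f z = f a + (LINT t|?M. (if t < z then f' t else 0))"
    by (rule ac_onD(2)[OF assms z])
  ultimately show "(f \<circ> X) \<longlonglongrightarrow> f z" by (simp only: o_def)
qed

lemma ac_on_L2:
  assumes "ac_on a b f f'" shows "L2_on {a<..<b} f"
  by (rule L2_on_continuous[OF ac_on_continuous[OF assms]]) auto

lemma ac_on_diff_ends:
  assumes "ac_on a b f f'" "a \<le> b"
  shows "(LINT t|leb {a<..<b}. f' t) = f b - f a"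
proof -
  have "(LINT t|leb {a<..<b}. (if t < b then f' t else 0)) = (LINT t|leb {a<..<b}. f' t)"
    by (rule lint_cong) auto
  then show ?thesis using ac_onD(2)[OF assms(1), of b] assms(2) by simp
qed

lemma ac_on_cong_AE:
  assumes "ac_on a b f f'" "\<And>z. z \<in> {a..b} ==> f z = g z"
    "g' \<in> borel_measurable (leb {a<..<b})" "AE t in leb {a<..<b}. f' t = g' t"
  shows "ac_on a b g g'"
proof -
  note i = ac_onD(1)[OF assms(1)]
  have ig: "integrable (leb {a<..<b}) g'"
    by (rule integrable_cong_AE_imp[OF i assms(3)]) (use assms(4) in auto)
  have "g z = g a + (LINT t|leb {a<..<b}. (if t < z then g' t else 0))" if z: "z \<in> {a..b}" for z
  proof -
    have "(LINT t|leb {a<..<b}. (if t < z then g' t else 0)) = (LINT t|leb {a<..<b}. (if t < z then f' t else 0))"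
      using integrable_if_less(1)[OF i, of z] integrable_if_less(1)[OF ig, of z] assms(4)
      by (intro integral_cong_AE) auto
    then show ?thesis using ac_onD(2)[OF assms(1) z] assms(2)[OF z] assms(2)[of a] z by simp
  qed
  with ig show ?thesis by (intro ac_onI)
qed

lemma ac_on_add:
  assumes "ac_on a b f f'" "ac_on a b g g'"
  shows "ac_on a b (\<lambda>z. f z + g z) (\<lambda>z. f' z + g' z)"
proof -
  note i = ac_onD(1)[OF assms(1)] ac_onD(1)[OF assms(2)]
  have "f z + g z = f a + g a + (LINT t|leb {a<..<b}. (if t < z then f' t + g' t else 0))" if z: "z \<in> {a..b}" for z
  proof -
    have "(LINT t|leb {a<..<b}. (if t < z then f' t + g' t else 0))
      = (LINT t|leb {a<..<b}. (if t < z then f' t else 0) + (if t < z then g' t else 0))"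
      by (rule lint_cong) auto
    then show ?thesis
      using ac_onD(2)[OF assms(1) z] ac_onD(2)[OF assms(2) z] integrable_if_less(1)[OF i(1), of z]
        integrable_if_less(1)[OF i(2), of z] by simp
  qed
  then show ?thesis using i by (intro ac_onI lintable_add)
qed

lemma ac_on_cmult:
  assumes "ac_on a b f f'" shows "ac_on a b (\<lambda>z. c * f z) (\<lambda>z. c * f' z)"
proof -
  have "c * f z = c * f a + (LINT t|leb {a<..<b}. (if t < z then c * f' t else 0))" if z: "z \<in> {a..b}" for z
  proof -
    have "(LINT t|leb {a<..<b}. (if t < z then c * f' t else 0))
      = (LINT t|leb {a<..<b}. c * (if t < z then f' t else 0))"
      by (rule lint_cong) auto
    then show ?thesis
      using ac_onD(2)[OF assms z] by (simp add: distrib_left)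
  qed
  then show ?thesis using ac_onD(1)[OF assms] by (intro ac_onI integrable_mult_right)
qed

lemma ac_on_C1:
  assumes "\<And>t. (f has_real_derivative f' t) (at t)" "continuous_on UNIV f'"
  shows "ac_on a b f f'"
proof -
  have "f z = f a + (LINT t|leb {a<..<b}. (if t < z then f' t else 0))" if z: "z \<in> {a..b}" for z
  proof -
    have "(LINT t|leb {a<..<b}. (if t < z then f' t else 0)) = (LINT t|lebesgue. indicator {a<..<b} t *\<^sub>R (if t < z then f' t else 0))"
      by (rule integral_restrict_space) simp
    also have "\<dots> = (LINT t|lebesgue. indicator {a<..<z} t *\<^sub>R f' t)"
      by (rule lint_cong) (use z in \<open>auto simp: indicator_def\<close>)
    also have "\<dots> = (LINT t|leb {a<..<z}. f' t)"
      by (rule integral_restrict_space[symmetric]) simp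
    also have "\<dots> = f z - f a" by (rule integral_lebesgue_on_FTC[OF _ assms]) (use z in auto)
    finally show ?thesis by simp
  qed
  with integrable_continuous_interval[OF assms(2)] show ?thesis by (intro ac_onI)
qed

lemma ac_on_antiderivative:
  assumes "integrable (leb {a<..<b}) h"
  shows "ac_on a b (\<lambda>z. c + (LINT t|leb {a<..<b}. (if t < z then h t else 0))) h"
proof -
  have "(LINT t|leb {a<..<b}. (if t < a then h t else 0)) = (LINT t|leb {a<..<b}. 0)"
    by (rule lint_cong) auto
  then show ?thesis using assms by (intro ac_onI) simp_all
qed

text \<open>Fubini on a square cut along its diagonal, which is a null set. This is integration by
  parts for primitives of merely integrable functions.\<close>

lemma integral_product_triangles:
  fixes F G :: "real => real"
  assumes F: "integrable (leb {a<..<b}) F" and G: "integrable (leb {a<..<b}) G"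
  shows "(LINT t|leb {a<..<b}. F t) * (LINT t|leb {a<..<b}. G t)
    = (LINT t|leb {a<..<b}. F t * (LINT s|leb {a<..<b}. (if s < t then G s else 0)))
    + (LINT t|leb {a<..<b}. G t * (LINT s|leb {a<..<b}. (if s < t then F s else 0)))"
    and "integrable (leb {a<..<b}) (\<lambda>t. F t * (LINT s|leb {a<..<b}. (if s < t then G s else 0)))"
proof -
  let ?M = "leb {a<..<b}"
  interpret M: finite_measure ?M by (rule finite_measure_lebesgue_on) simp
  interpret pair_sigma_finite ?M ?M ..
  have Fm[measurable]: "F \<in> borel_measurable ?M" and Gm[measurable]: "G \<in> borel_measurable ?M"
    using F G by (auto intro: borel_measurable_integrable)
  have id[measurable]: "(\<lambda>t. t) \<in> borel_measurable ?M"
    using id_borel_measurable_lebesgue_on by (simp add: id_def)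
  have fs: "(\<lambda>z. fst z) \<in> borel_measurable (?M \<Otimes>\<^sub>M ?M)" "(\<lambda>z. snd z) \<in> borel_measurable (?M \<Otimes>\<^sub>M ?M)"
    using measurable_compose[OF measurable_fst id] measurable_compose[OF measurable_snd id] by simp_all
  have lt[measurable]: "Measurable.pred (?M \<Otimes>\<^sub>M ?M) (\<lambda>z. fst z < snd z)" "Measurable.pred (?M \<Otimes>\<^sub>M ?M) (\<lambda>z. snd z < fst z)"
    unfolding pred_def using borel_measurable_less[OF fs(1) fs(2)] borel_measurable_less[OF fs(2) fs(1)] by simp_all
  have i1: "integrable (?M \<Otimes>\<^sub>M ?M) (\<lambda>z. F (fst z) * (if snd z < fst z then G (snd z) else 0))"
    if F: "integrable ?M F" and G: "integrable ?M G" for F G :: "real => real"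
  proof (rule Fubini_integrable)
    have [measurable]: "F \<in> borel_measurable ?M" "G \<in> borel_measurable ?M"
      using F G by (auto intro: borel_measurable_integrable)
    show m: "(\<lambda>z. F (fst z) * (if snd z < fst z then G (snd z) else 0)) \<in> borel_measurable (?M \<Otimes>\<^sub>M ?M)"
      by measurable
    show "AE t in ?M. integrable ?M (\<lambda>s. F (fst (t, s)) * (if snd (t, s) < fst (t, s) then G (snd (t, s)) else 0))"
      using integrable_if_less(1)[OF G] by (simp cong: if_cong)
    show "integrable ?M (\<lambda>t. \<integral>s. norm (F (fst (t, s)) * (if snd (t, s) < fst (t, s) then G (snd (t, s)) else 0)) \<partial>?M)"
    proof (rule Bochner_Integration.integrable_bound)
      show "integrable ?M (\<lambda>t. \<bar>F t\<bar> * (LINT s|?M. \<bar>G s\<bar>))" using F by simp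
      show "(\<lambda>t. \<integral>s. norm (F (fst (t, s)) * (if snd (t, s) < fst (t, s) then G (snd (t, s)) else 0)) \<partial>?M) \<in> borel_measurable ?M"
      proof -
        have "(\<lambda>z. norm (F (fst z) * (if snd z < fst z then G (snd z) else 0))) \<in> borel_measurable (?M \<Otimes>\<^sub>M ?M)"
          by measurable
        then have "(\<lambda>(t, s). norm (F (fst (t, s)) * (if snd (t, s) < fst (t, s) then G (snd (t, s)) else 0))) \<in> borel_measurable (?M \<Otimes>\<^sub>M ?M)"
          by (simp add: case_prod_unfold)
        from M.borel_measurable_lebesgue_integral[OF this] show ?thesis .
      qed
      show "AE t in ?M. norm (LINT s|?M. norm (F (fst (t, s)) * (if snd (t, s) < fst (t, s) then G (snd (t, s)) else 0)))
         \<le> norm (\<bar>F t\<bar> * (LINT s|?M. \<bar>G s\<bar>))"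
      proof (rule AE_I2)
        fix t
        have "(LINT s|?M. norm (F t * (if s < t then G s else 0))) \<le> (LINT s|?M. \<bar>F t\<bar> * \<bar>G s\<bar>)"
          using integrable_if_less(1)[OF G, of t] G
          by (intro integral_mono) (auto simp: abs_mult)
        then show "norm (LINT s|?M. norm (F (fst (t, s)) * (if snd (t, s) < fst (t, s) then G (snd (t, s)) else 0)))
         \<le> norm (\<bar>F t\<bar> * (LINT s|?M. \<bar>G s\<bar>))" by (simp cong: if_cong)
      qed
    qed
  qed
  show i: "integrable ?M (\<lambda>t. F t * (LINT s|?M. (if s < t then G s else 0)))"
    using integrable_fst'[OF i1[OF F G]] by (simp cong: if_cong)
  have i': "integrable ?M (\<lambda>t. G t * (LINT s|?M. (if s < t then F s else 0)))"
    using integrable_fst'[OF i1[OF G F]] by (simp cong: if_cong)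
  have j: "integrable (?M \<Otimes>\<^sub>M ?M) (\<lambda>(s, t). G t * (if s < t then F s else 0))"
    using i1[OF G F] by (subst integrable_product_swap_iff[symmetric]) (simp add: case_prod_unfold cong: if_cong)
  have sw: "(LINT t|?M. (LINT s|?M. G t * (if s < t then F s else 0))) = (LINT s|?M. (LINT t|?M. G t * (if s < t then F s else 0)))"
    by (rule Fubini_integral[OF j])
  have j2: "integrable ?M (\<lambda>s. (LINT t|?M. G t * (if s < t then F s else 0)))"
    using integrable_fst'[OF j] by (simp cong: if_cong)
  have inner: "F t * (LINT s|?M. (if s < t then G s else 0)) + (LINT s|?M. G s * (if t < s then F t else 0)) = F t * (LINT s|?M. G s)" for t
  proof -
    have "(LINT s|?M. G s * (if t < s then F t else 0)) = (LINT s|?M. F t * (if t < s then G s else 0))"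
      by (rule lint_cong) auto
    also have "\<dots> = F t * (LINT s|?M. (if t < s then G s else 0))" by simp
    also have "F t * (LINT s|?M. (if s < t then G s else 0)) + \<dots>
       = F t * (LINT s|?M. (if s < t then G s else 0) + (if t < s then G s else 0))"
      using integrable_if_less[OF G, of t] by (simp add: distrib_left)
    also have "(LINT s|?M. (if s < t then G s else 0) + (if t < s then G s else 0)) = (LINT s|?M. G s)"
    proof (rule integral_cong_AE)
      have "AE s in ?M. s \<noteq> t" by (rule AE_lebesgue_on_neq) simp
      then show "AE s in ?M. (if s < t then G s else 0) + (if t < s then G s else 0) = G s"
        by eventually_elim auto
    qed measurable
    finally show ?thesis .
  qed
  have "(LINT t|?M. F t * (LINT s|?M. (if s < t then G s else 0))) + (LINT t|?M. G t * (LINT s|?M. (if s < t then F s else 0)))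
     = (LINT t|?M. F t * (LINT s|?M. (if s < t then G s else 0))) + (LINT s|?M. (LINT t|?M. G t * (if s < t then F s else 0)))"
    unfolding sw[symmetric] by simp
  also have "\<dots> = (LINT t|?M. F t * (LINT s|?M. (if s < t then G s else 0)) + (LINT s|?M. G s * (if t < s then F t else 0)))"
    by (rule lint_add[symmetric, OF i j2])
  also have "\<dots> = (LINT t|?M. F t) * (LINT t|?M. G t)" unfolding inner by simp
  finally show "(LINT t|?M. F t) * (LINT t|?M. G t)
    = (LINT t|?M. F t * (LINT s|?M. (if s < t then G s else 0))) + (LINT t|?M. G t * (LINT s|?M. (if s < t then F s else 0)))" by simp
qed

text \<open>For fixed \<open>z\<close> the derivatives truncated at \<open>z\<close> have integrals
  \<open>f z - f a\<close> and \<open>g z - g a\<close>; splitting the product of these integrals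
  along the diagonal yields the product rule.\<close>

lemma ac_on_mult:
  assumes f: "ac_on a b f f'" and g: "ac_on a b g g'"
  shows "ac_on a b (\<lambda>z. f z * g z) (\<lambda>z. f' z * g z + g' z * f z)"
proof -
  let ?M = "leb {a<..<b}"
  note fi = ac_onD(1)[OF f] and gi = ac_onD(1)[OF g]
  have bi: "integrable ?M (\<lambda>z. h z * k z)" if k: "continuous_on {a..b} k" and h: "integrable ?M h" for h k :: "real => real"
  proof -
    have "bounded (k ` {a..b})" using compact_continuous_image[OF k] compact_imp_bounded by auto
    then obtain C where "\<forall>x\<in>k ` {a..b}. norm x \<le> C" unfolding bounded_iff by blast
    then have C: "\<And>z. z \<in> {a..b} ==> \<bar>k z\<bar> \<le> C" by simp
    have km: "k \<in> borel_measurable ?M"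
      by (rule continuous_imp_measurable_on_sets_lebesgue) (auto intro: continuous_on_subset[OF k])
    show ?thesis
    proof (rule Bochner_Integration.integrable_bound[where f="\<lambda>z. C * \<bar>h z\<bar>"])
      show "(\<lambda>z. h z * k z) \<in> borel_measurable ?M" using km borel_measurable_integrable[OF h] by simp
      show "AE z in ?M. norm (h z * k z) \<le> norm (C * \<bar>h z\<bar>)"
      proof (rule AE_I2)
        fix z assume "z \<in> space ?M"
        then have "\<bar>k z\<bar> \<le> \<bar>C\<bar>" using C[of z] by auto
        then show "norm (h z * k z) \<le> norm (C * \<bar>h z\<bar>)"
          using mult_left_mono[of "\<bar>k z\<bar>" "\<bar>C\<bar>" "\<bar>h z\<bar>"] by (simp add: abs_mult mult.commute)
      qed
    qed (use h in simp)
  qed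
  have i1: "integrable ?M (\<lambda>z. f' z * g z)" by (rule bi[OF ac_on_continuous[OF g] fi])
  have i2: "integrable ?M (\<lambda>z. g' z * f z)" by (rule bi[OF ac_on_continuous[OF f] gi])
  have "f z * g z = f a * g a + (LINT t|?M. (if t < z then f' t * g t + g' t * f t else 0))" if z: "z \<in> {a..b}" for z
  proof -
    define F where "F t = (if t < z then f' t else 0)" for t
    define G where "G t = (if t < z then g' t else 0)" for t
    have Fi: "integrable ?M F" and Gi: "integrable ?M G"
      unfolding F_def[abs_def] G_def[abs_def] using integrable_if_less(1) fi gi by blast+
    note tr = integral_product_triangles(1)[OF Fi Gi]
    have fz: "f z = f a + (LINT t|?M. F t)" and gz: "g z = g a + (LINT t|?M. G t)"
      using ac_onD(2)[OF f z] ac_onD(2)[OF g z] by (simp_all add: F_def G_def)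
    have ft: "f t = f a + (LINT s|?M. (if s < t then F s else 0))"
      and gt: "g t = g a + (LINT s|?M. (if s < t then G s else 0))" if "t \<in> {a<..<b}" "t < z" for t
    proof -
      have "(LINT s|?M. (if s < t then F s else 0)) = (LINT s|?M. (if s < t then f' s else 0))"
        "(LINT s|?M. (if s < t then G s else 0)) = (LINT s|?M. (if s < t then g' s else 0))"
        using that by (intro lint_cong; auto simp: F_def G_def)+
      then show "f t = f a + (LINT s|?M. (if s < t then F s else 0))"
        "g t = g a + (LINT s|?M. (if s < t then G s else 0))"
        using ac_onD(2)[OF f, of t] ac_onD(2)[OF g, of t] that by auto
    qed
    have iF: "integrable ?M (\<lambda>t. F t * (LINT s|?M. (if s < t then G s else 0)))"
      and iG: "integrable ?M (\<lambda>t. G t * (LINT s|?M. (if s < t then F s else 0)))"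
      using integral_product_triangles(2)[OF Fi Gi] integral_product_triangles(2)[OF Gi Fi] by auto
    have "(LINT t|?M. (if t < z then f' t * g t + g' t * f t else 0))
      = (LINT t|?M. (F t * g a + F t * (LINT s|?M. (if s < t then G s else 0)))
          + (G t * f a + G t * (LINT s|?M. (if s < t then F s else 0))))"
    proof (rule lint_cong[OF refl])
      fix t assume "t \<in> space ?M"
      then have t: "t \<in> {a<..<b}" by simp
      show "(if t < z then f' t * g t + g' t * f t else 0) = (F t * g a + F t * (LINT s|?M. (if s < t then G s else 0)))
          + (G t * f a + G t * (LINT s|?M. (if s < t then F s else 0)))"
      proof (cases "t < z")
        case True
        have "F t = f' t" "G t = g' t" using True by (simp_all add: F_def G_def)
        then show ?thesis using True ft[OF t True] gt[OF t True] by (simp add: distrib_left)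
      next
        case False then show ?thesis by (simp add: F_def G_def)
      qed
    qed
    also have "\<dots> = (LINT t|?M. F t) * g a + (LINT t|?M. F t * (LINT s|?M. (if s < t then G s else 0)))
        + ((LINT t|?M. G t) * f a + (LINT t|?M. G t * (LINT s|?M. (if s < t then F s else 0))))"
      using Fi Gi iF iG by simp
    also have "\<dots> = (LINT t|?M. F t) * g a + (LINT t|?M. G t) * f a + (LINT t|?M. F t) * (LINT t|?M. G t)"
      unfolding tr by simp
    finally show ?thesis unfolding fz gz by (simp add: algebra_simps)
  qed
  then show ?thesis using i1 i2 by (intro ac_onI lintable_add)
qed

text \<open>The multiplier identity behind the Carleman estimate: conjugating with E = exp(lam t^2 / 2)
  turns f = h - mu v into A + B - lam y, and 2 A B - 4 lam A y is a derivative up to positive terms.\<close>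

lemma carleman_pointwise:
  fixes E v g h t lam \<mu> :: real
  defines "y \<equiv> E * v" and "y1 \<equiv> E * (g + lam * t * v)"
    and "y2 \<equiv> lam * t * E * (g + lam * t * v) + E * (h + lam * v + lam * t * g)"
  assumes lam: "lam > 0" "lam * a^2 \<ge> 6" and t: "a \<le> t" "0 < a" and mu: "\<mu> \<ge> 0"
  shows "- 2 * lam * (y1\<^sup>2 + 2 * t * y1 * y2) - 2 * lam * ((3 * lam\<^sup>2 * t\<^sup>2 - \<mu>) * y\<^sup>2 + (lam\<^sup>2 * t ^ 3 - \<mu> * t) * (2 * y * y1))
      - 4 * lam * (y1\<^sup>2 + y * y2) + 6 * lam * y1\<^sup>2 + (lam ^ 3 * a\<^sup>2 + 2 * lam * \<mu>) * y\<^sup>2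
     \<le> 2 * (E * (h - \<mu> * v))^2"
proof -
  \<comment> \<open>\<open>A\<close> is the self-adjoint part of the conjugated operator applied to
    \<open>y\<close>, and \<open>B - lam * y\<close> is the skew-adjoint part.\<close>
  define A where "A = y2 + (lam^2 * t^2 - \<mu>) * y"
  define B where "B = - 2 * lam * t * y1"
  have F: "E * (h - \<mu> * v) = A + B - lam * y"
    unfolding A_def B_def y_def y1_def y2_def by (simp add: power2_eq_square algebra_simps)
  \<comment> \<open>The product \<open>2 * A * B\<close> alone would leave
    \<open>- 2 * lam * \<mu> * y^2\<close>, which is not uniform in \<open>\<mu>\<close>. The extra
    multiplier \<open>- 4 * lam * A * y\<close> changes the coefficient to
    \<open>+ 2 * lam * \<mu>\<close>, at the price of reducing that of
    \<open>lam^3 * t^2 * y^2\<close> from 6 to 2.\<close>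
  have id: "- 2 * lam * (y1\<^sup>2 + 2 * t * y1 * y2) - 2 * lam * ((3 * lam\<^sup>2 * t\<^sup>2 - \<mu>) * y\<^sup>2 + (lam\<^sup>2 * t ^ 3 - \<mu> * t) * (2 * y * y1))
      - 4 * lam * (y1\<^sup>2 + y * y2) = 2 * A * B - 4 * lam * A * y - 6 * lam * y1\<^sup>2 - (2 * lam ^ 3 * t\<^sup>2 + 2 * lam * \<mu>) * y\<^sup>2"
    unfolding A_def B_def by (simp add: power2_eq_square power3_eq_cube algebra_simps)
  \<comment> \<open>One of the two copies of \<open>lam^3 * t^2\<close> is kept; the other absorbs
    the error \<open>6 * lam^2\<close> of the completed square below. This is the origin of the
    threshold 6 for \<open>lam * a^2\<close>.\<close>
  have "lam ^ 3 * a^2 + 6 * lam^2 \<le> 2 * lam ^ 3 * t^2"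
  proof -
    have "lam^2 * 6 \<le> lam^2 * (lam * a^2)" using lam by (intro mult_left_mono) auto
    moreover have "lam ^ 3 * a^2 \<le> lam ^ 3 * t^2"
      using t lam by (intro mult_left_mono power_mono) auto
    ultimately show ?thesis by (simp add: power2_eq_square power3_eq_cube algebra_simps)
  qed
  then have c: "(lam ^ 3 * a^2 + 6 * lam^2) * y^2 \<le> 2 * lam ^ 3 * t^2 * y^2"
    by (intro mult_right_mono) auto
  \<comment> \<open>The difference between \<open>2 * (A + B - lam * y)^2\<close> and the cross
    terms, after adding \<open>6 * lam^2 * y^2\<close>, is exactly the sum of these three
    squares.\<close>
  have s1: "0 \<le> (A + B - 2 * (lam * y))^2" and s2: "0 \<le> (A + 2 * lam * y)^2" and s3: "0 \<le> B^2" by simp_all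
  have "2 * A * B - 4 * lam * A * y - 6 * lam^2 * y^2 \<le> 2 * (A + B - lam * y)^2"
  proof -
    have "2 * (A + B - lam * y)^2 - (2 * A * B - 4 * lam * A * y - 6 * lam^2 * y^2)
       = (A + B - 2 * (lam * y))^2 + (A + 2 * lam * y)^2 + B^2"
      by (simp add: power2_eq_square algebra_simps)
    with s1 s2 s3 show ?thesis by linarith
  qed
  then show ?thesis unfolding id F using c by (simp add: algebra_simps)
qed

text \<open>The price of returning from \<open>y\<close>, \<open>y1\<close> to \<open>v\<close>,
  \<open>g\<close>: the summand \<open>2 * b^2 / a^2\<close> pays for the term
  \<open>lam * t * y\<close> in \<open>E * g\<close>, the summand \<open>a^2\<close> for the
  undifferentiated term \<open>v^2\<close>, and 1 for the rest.\<close>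

definition carleman_const :: "real => real => real" where
  "carleman_const a b = 2 * b^2 / a^2 + a^2 + 1"

text \<open>A majorant for the coefficients of \<open>- Q b\<close> in \<open>carleman_1d\<close>.
  The exponential is the weight at the top end, and \<open>\<mu>\<close> does not occur.\<close>

definition carleman_bdry :: "real => real => real" where
  "carleman_bdry b lam = exp (lam * b^2) * (2 * (2 * lam * b + 2 * lam) * (1 + lam^2 * b^2) + 2 * lam ^ 3 * b ^ 3 + 2 * lam)"

lemma carleman_1d:
  fixes v g h :: "real => real"
  assumes ab: "0 < a" "a < b" and lam: "lam > 0" "lam * a^2 \<ge> 6" and mu: "\<mu> \<ge> 0"
    and v: "ac_on a b v g" and g: "ac_on a b g h" and h: "L2_on {a<..<b} h" and va: "v a = 0"
  shows "lam * (LINT t|leb {a<..<b}. exp (lam * t^2) * ((g t)^2 + \<mu> * (v t)^2 + (v t)^2))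
     \<le> carleman_const a b * (2 * (LINT t|leb {a<..<b}. exp (lam * t^2) * (h t - \<mu> * v t)^2)
         + carleman_bdry b lam * ((v b)^2 + (g b)^2))"
proof -
  let ?M = "leb {a<..<b}"
  define E where "E t = exp (lam * t^2 / 2)" for t
  define y where "y t = E t * v t" for t
  define y1 where "y1 t = E t * (g t + lam * t * v t)" for t
  define y2 where "y2 t = lam * t * E t * (g t + lam * t * v t) + E t * (h t + lam * v t + lam * t * g t)" for t
  have Ed: "(E has_real_derivative lam * t * E t) (at t)" for t
    unfolding E_def by (auto intro!: derivative_eq_intros)
  have Ec: "continuous_on S E" for S unfolding E_def by (intro continuous_intros) auto
  have EE: "(E t)^2 = exp (lam * t^2)" for t
    unfolding E_def power2_eq_square[of "exp _"] exp_add[symmetric] by simp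
  have hm: "h \<in> borel_measurable ?M" using h by (rule L2_on_measurable)
  have cm: "k \<in> borel_measurable ?M" if "continuous_on {a..b} k" for k :: "real => real"
    by (rule continuous_imp_measurable_on_sets_lebesgue) (auto intro: continuous_on_subset[OF that])
  have vc: "continuous_on {a..b} v" and gc: "continuous_on {a..b} g"
    using ac_on_continuous v g by blast+
  have y1c: "continuous_on {a..b} y1" unfolding y1_def by (intro continuous_intros vc gc Ec)
  have yc: "continuous_on {a..b} y" unfolding y_def by (intro continuous_intros vc Ec)
  have y2m: "y2 \<in> borel_measurable ?M"
    unfolding y2_def using hm cm[OF vc] cm[OF gc] cm[OF Ec] cm[OF continuous_on_id]
    by (intro borel_measurable_add borel_measurable_times) auto
  have acE: "ac_on a b E (\<lambda>t. lam * t * E t)"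
    by (rule ac_on_C1[OF Ed]) (intro continuous_intros Ec)
  have acL: "ac_on a b (\<lambda>t. lam * t) (\<lambda>t. lam)"
    by (rule ac_on_C1) (auto intro!: derivative_eq_intros)
  have acy: "ac_on a b y y1"
    by (rule ac_on_cong_AE[OF ac_on_mult[OF acE v] _ cm[OF y1c]])
      (auto simp: y_def y1_def algebra_simps)
  have acy1: "ac_on a b y1 y2"
    by (rule ac_on_cong_AE[OF ac_on_mult[OF acE ac_on_add[OF g ac_on_mult[OF acL v]]] _ y2m])
      (auto simp: y1_def y2_def algebra_simps)
  define p where "p t = - 2 * lam * t" for t
  define r where "r t = - 2 * lam * (lam\<^sup>2 * t ^ 3 - \<mu> * t)" for t
  have acp: "ac_on a b p (\<lambda>t. - 2 * lam)"
    unfolding p_def by (rule ac_on_C1) (auto intro!: derivative_eq_intros)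
  have acr: "ac_on a b r (\<lambda>t. - 2 * lam * (3 * lam\<^sup>2 * t\<^sup>2 - \<mu>))"
    unfolding r_def by (rule ac_on_C1) (auto intro!: derivative_eq_intros continuous_intros)
  \<comment> \<open>\<open>Q\<close> collects the quantities whose derivatives occur in
    \<open>carleman_pointwise\<close>; its derivative is \<open>Q'\<close>, so the integral of
    \<open>Q'\<close> consists of end values only.\<close>
  define Q where "Q t = p t * (y1 t * y1 t) + r t * (y t * y t) + (- 4 * lam) * (y t * y1 t)" for t
  define Q' where "Q' t = - 2 * lam * ((y1 t)\<^sup>2 + 2 * t * y1 t * y2 t)
     - 2 * lam * ((3 * lam\<^sup>2 * t\<^sup>2 - \<mu>) * (y t)\<^sup>2 + (lam\<^sup>2 * t ^ 3 - \<mu> * t) * (2 * y t * y1 t))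
     - 4 * lam * ((y1 t)\<^sup>2 + y t * y2 t)" for t
  have Q'm: "Q' \<in> borel_measurable ?M"
    unfolding Q'_def using y2m cm[OF y1c] cm[OF yc] cm[OF continuous_on_id]
    by (intro borel_measurable_diff borel_measurable_add borel_measurable_times borel_measurable_power) auto
  have acQ: "ac_on a b Q Q'"
    by (rule ac_on_cong_AE[OF ac_on_add[OF ac_on_add[OF ac_on_mult[OF acp ac_on_mult[OF acy1 acy1]]
        ac_on_mult[OF acr ac_on_mult[OF acy acy]]] ac_on_cmult[where c="- 4 * lam", OF ac_on_mult[OF acy acy1]]] _ Q'm])
      (auto simp: Q_def Q'_def p_def r_def power2_eq_square algebra_simps)
  define P where "P t = 6 * lam * (y1 t)^2 + (lam ^ 3 * a^2 + 2 * lam * \<mu>) * (y t)^2" for t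
  have vL: "L2_on {a<..<b} v" and gL: "L2_on {a<..<b} g" using ac_on_L2 v g by blast+
  have wb: "\<bar>E t\<bar> \<le> exp (lam * b^2 / 2)" if "t \<in> {a<..<b}" for t
    unfolding E_def using that ab lam by (auto intro!: power_mono)
  have fL: "L2_on {a<..<b} (\<lambda>t. E t * (h t - \<mu> * v t))"
    by (rule L2_on_mult_bounded[OF L2_on_diff[OF h L2_on_cmult[OF vL]] cm[OF Ec] wb])
  have Pi: "integrable ?M P"
  proof -
    have "L2_on {a<..<b} y1" "L2_on {a<..<b} y"
      using ac_on_L2[OF acy] ac_on_L2[OF acy1] by auto
    then show ?thesis unfolding P_def by (auto simp: L2_on_def)
  qed
  have main: "(LINT t|?M. Q' t + P t) \<le> (LINT t|?M. 2 * (E t * (h t - \<mu> * v t))^2)"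
  proof (rule integral_mono)
    show "integrable ?M (\<lambda>t. Q' t + P t)" using ac_onD(1)[OF acQ] Pi by simp
    show "integrable ?M (\<lambda>t. 2 * (E t * (h t - \<mu> * v t))^2)" using fL by (simp add: L2_on_def)
    show "Q' t + P t \<le> 2 * (E t * (h t - \<mu> * v t))^2" if "t \<in> space ?M" for t
    proof -
      have "a \<le> t" using that by auto
      from carleman_pointwise[OF lam this ab(1) mu, where E="E t" and v="v t" and g="g t" and h="h t"]
      show ?thesis unfolding Q'_def P_def y_def y1_def y2_def by linarith
    qed
  qed
  have Qab: "(LINT t|?M. Q' t) = Q b - Q a" using ac_on_diff_ends[OF acQ] ab by simp
  \<comment> \<open>From \<open>v a = 0\<close> follows \<open>y a = 0\<close>, and what remains of
    \<open>Q a\<close> is \<open>p a * (y1 a)^2\<close> with \<open>p a\<close> negative. This is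
    why \<open>g a\<close> needs no control.\<close>
  have Qa: "Q a \<le> 0" using va lam ab by (simp add: Q_def p_def y_def mult_nonneg_nonneg)
  have K: "carleman_const a b \<ge> 1" using ab by (simp add: carleman_const_def)
  have low: "lam * (exp (lam * t^2) * ((g t)^2 + \<mu> * (v t)^2 + (v t)^2)) \<le> carleman_const a b * P t" if t: "t \<in> {a<..<b}" for t
  proof -
    let ?K = "carleman_const a b"
    \<comment> \<open>The weighted derivative of \<open>v\<close> differs from the derivative of the
      weighted \<open>v\<close>; the correction \<open>lam * t * y\<close> is paid for by the term
      with \<open>lam^3\<close> in \<open>P\<close>.\<close>
    have "E t * g t = y1 t - lam * t * y t" by (simp add: y1_def y_def algebra_simps)
    moreover have "(p - q)^2 \<le> 2 * p^2 + 2 * q^2" for p q :: real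
      using zero_le_power2[of "p + q"] by (simp add: power2_eq_square algebra_simps)
    ultimately have "(E t * g t)^2 \<le> 2 * (y1 t)^2 + 2 * (lam * t * y t)^2" by simp
    also have "(lam * t * y t)^2 \<le> lam^2 * b^2 * (y t)^2"
      using t ab by (auto simp: power_mult_distrib intro!: mult_right_mono mult_left_mono power_mono)
    finally have 1: "(E t * g t)^2 \<le> 2 * (y1 t)^2 + 2 * lam^2 * b^2 * (y t)^2" by simp
    have "lam * (exp (lam * t^2) * ((g t)^2 + \<mu> * (v t)^2 + (v t)^2)) = lam * ((E t * g t)^2 + (\<mu> + 1) * (y t)^2)"
      by (simp add: EE[symmetric] y_def power_mult_distrib algebra_simps)
    also have "\<dots> \<le> lam * (2 * (y1 t)^2 + 2 * lam^2 * b^2 * (y t)^2 + (\<mu> + 1) * (y t)^2)"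
      using 1 lam by (intro mult_left_mono) auto
    also have "\<dots> = 2 * lam * (y1 t)^2 + (2 * lam ^ 3 * b^2 + lam + lam * \<mu>) * (y t)^2"
      by (simp add: power2_eq_square power3_eq_cube algebra_simps)
    also have "\<dots> \<le> ?K * (6 * lam * (y1 t)^2) + ?K * ((lam ^ 3 * a^2 + 2 * lam * \<mu>) * (y t)^2)"
    proof (rule add_mono)
      have "2 * lam * (y1 t)^2 \<le> 1 * (6 * lam * (y1 t)^2)" using lam by (simp add: mult_right_mono)
      also have "\<dots> \<le> ?K * (6 * lam * (y1 t)^2)" using K lam by (intro mult_right_mono) auto
      finally show "2 * lam * (y1 t)^2 \<le> ?K * (6 * lam * (y1 t)^2)" .
      have "lam \<le> lam * (lam^2 * a ^ 4)"
      proof -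
        have "1 \<le> (lam * a^2)^2" using lam by (simp add: one_le_power)
        also have "\<dots> = lam^2 * a ^ 4" by (simp add: power_mult_distrib)
        finally show ?thesis using lam by simp
      qed
      moreover have "?K * (lam ^ 3 * a^2) = 2 * lam ^ 3 * b^2 + lam * (lam^2 * a ^ 4) + lam ^ 3 * a^2"
        using ab by (simp add: carleman_const_def field_simps power2_eq_square power3_eq_cube power4_eq_xxxx)
      moreover have "0 \<le> lam ^ 3 * a^2" using lam by simp
      moreover have "lam * \<mu> \<le> ?K * (2 * lam * \<mu>)"
      proof -
        have "lam * \<mu> \<le> 1 * (2 * lam * \<mu>)" using lam mu by simp
        also have "\<dots> \<le> ?K * (2 * lam * \<mu>)" using K lam mu by (intro mult_right_mono) auto
        finally show ?thesis .
      qed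
      ultimately have "2 * lam ^ 3 * b^2 + lam + lam * \<mu> \<le> ?K * (lam ^ 3 * a^2 + 2 * lam * \<mu>)"
        by (simp add: distrib_left)
      then show "(2 * lam ^ 3 * b^2 + lam + lam * \<mu>) * (y t)^2 \<le> ?K * ((lam ^ 3 * a^2 + 2 * lam * \<mu>) * (y t)^2)"
        by (simp add: mult.assoc[symmetric] mult_right_mono)
    qed
    also have "\<dots> = ?K * P t" by (simp add: P_def distrib_left)
    finally show ?thesis .
  qed
  have bd: "- Q b \<le> carleman_bdry b lam * ((v b)\<^sup>2 + (g b)\<^sup>2)"
  proof -
    define w where "w = exp (lam * b^2)"
    have w: "w > 0" "(E b)^2 = w" by (simp_all add: w_def EE)
    have yb: "(y b)^2 = w * (v b)^2" by (simp add: y_def power_mult_distrib w)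
    have y1b: "(y1 b)^2 \<le> w * (2 * (g b)^2 + 2 * lam^2 * b^2 * (v b)^2)"
    proof -
      have "(g b + lam * b * v b)^2 \<le> 2 * (g b)^2 + 2 * (lam * b * v b)^2"
        using zero_le_power2[of "g b - lam * b * v b"] by (simp add: power2_eq_square algebra_simps)
      then show ?thesis using w by (simp add: y1_def power_mult_distrib)
    qed
    have "- Q b = 2 * lam * b * (y1 b)\<^sup>2 + 2 * lam ^ 3 * b ^ 3 * (y b)\<^sup>2 - 2 * lam * b * \<mu> * (y b)\<^sup>2 + 4 * lam * (y b * y1 b)"
      by (simp add: Q_def p_def r_def power2_eq_square power3_eq_cube algebra_simps)
    \<comment> \<open>The term with \<open>\<mu>\<close> is nonpositive and is dropped, so the
      boundary constant is the same for all modes.\<close>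
    also have "\<dots> \<le> 2 * lam * b * (y1 b)^2 + 2 * lam ^ 3 * b ^ 3 * (y b)^2 + 2 * lam * ((y b)^2 + (y1 b)^2)"
    proof -
      have "2 * (y b * y1 b) \<le> (y b)^2 + (y1 b)^2" using sum_squares_bound[of "y b" "y1 b"] by simp
      then have "2 * lam * (2 * (y b * y1 b)) \<le> 2 * lam * ((y b)^2 + (y1 b)^2)"
        using lam by (intro mult_left_mono) auto
      moreover have "0 \<le> 2 * lam * b * \<mu> * (y b)^2" using lam ab mu by simp
      moreover have "4 * lam * (y b * y1 b) = 2 * lam * (2 * (y b * y1 b))" by simp
      ultimately show ?thesis by linarith
    qed
    also have "\<dots> = (2 * lam * b + 2 * lam) * (y1 b)^2 + (2 * lam ^ 3 * b ^ 3 + 2 * lam) * (y b)^2"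
      by (simp add: algebra_simps)
    also have "\<dots> \<le> (2 * lam * b + 2 * lam) * (w * (2 * (g b)^2 + 2 * lam^2 * b^2 * (v b)^2)) + (2 * lam ^ 3 * b ^ 3 + 2 * lam) * (w * (v b)^2)"
      using y1b yb lam ab by (intro add_mono mult_left_mono) auto
    also have "\<dots> \<le> carleman_bdry b lam * ((v b)^2 + (g b)^2)"
    proof -
      define al where "al = 2 * lam * b + 2 * lam"
      define be where "be = 2 * lam ^ 3 * b ^ 3 + 2 * lam"
      have p: "al \<ge> 0" "be \<ge> 0" using lam ab by (simp_all add: al_def be_def)
      have "carleman_bdry b lam * ((v b)^2 + (g b)^2)
        = al * (w * (2 * (g b)^2 + 2 * lam^2 * b^2 * (v b)^2)) + be * (w * (v b)^2)
          + (2 * al * w * (v b)^2 + 2 * al * w * (lam^2 * b^2) * (g b)^2 + be * w * (g b)^2)"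
        unfolding carleman_bdry_def al_def[symmetric] w_def[symmetric] by (simp add: be_def algebra_simps)
      moreover have "0 \<le> 2 * al * w * (v b)^2 + 2 * al * w * (lam^2 * b^2) * (g b)^2 + be * w * (g b)^2"
        using p w by simp
      ultimately show ?thesis unfolding al_def be_def by linarith
    qed
    finally show ?thesis .
  qed
  have Pint: "(LINT t|?M. P t) \<le> 2 * (LINT t|?M. exp (lam * t^2) * (h t - \<mu> * v t)^2) + carleman_bdry b lam * ((v b)^2 + (g b)^2)"
  proof -
    have "(LINT t|?M. Q' t + P t) = Q b - Q a + (LINT t|?M. P t)"
      using ac_onD(1)[OF acQ] Pi Qab by simp
    moreover have "(LINT t|?M. 2 * (E t * (h t - \<mu> * v t))^2) = 2 * (LINT t|?M. exp (lam * t^2) * (h t - \<mu> * v t)^2)"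
      by (simp add: power_mult_distrib EE)
    ultimately show ?thesis using main Qa bd by linarith
  qed
  have "lam * (LINT t|?M. exp (lam * t^2) * ((g t)^2 + \<mu> * (v t)^2 + (v t)^2))
    = (LINT t|?M. lam * (exp (lam * t^2) * ((g t)^2 + \<mu> * (v t)^2 + (v t)^2)))" by simp
  also have "\<dots> \<le> (LINT t|?M. carleman_const a b * P t)"
  proof (rule integral_mono)
    have c: "continuous_on {a..b} (\<lambda>t. lam * (exp (lam * t^2) * ((g t)^2 + \<mu> * (v t)^2 + (v t)^2)))"
      by (intro continuous_intros vc gc)
    show "integrable ?M (\<lambda>t. lam * (exp (lam * t^2) * ((g t)^2 + \<mu> * (v t)^2 + (v t)^2)))"
      by (rule L2_on_integrable[OF _ L2_on_continuous[OF c]]) auto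
    show "integrable ?M (\<lambda>t. carleman_const a b * P t)" using Pi by simp
  qed (use low in auto)
  also have "\<dots> = carleman_const a b * (LINT t|?M. P t)" by simp
  also have "\<dots> \<le> carleman_const a b * (2 * (LINT t|?M. exp (lam * t^2) * (h t - \<mu> * v t)^2) + carleman_bdry b lam * ((v b)^2 + (g b)^2))"
    using Pint K by (intro mult_left_mono) auto
  finally show ?thesis .
qed

section \<open>Slices and traces\<close>

lemma smooth_fun_bounded_measure: "smooth_fun \<psi> ==> \<psi> \<in> borel_measurable borel"
  by (simp add: borel_measurable_continuous_onI smooth_fun_continuous)

lemma continuous_on_fst_comp: "continuous_on UNIV f ==> continuous_on UNIV (\<lambda>x. f (fst x))"
  by (rule continuous_on_compose2[of UNIV f]) (auto intro: continuous_intros)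

lemma continuous_on_snd_comp: "continuous_on UNIV f ==> continuous_on UNIV (\<lambda>x. f (snd x))"
  by (rule continuous_on_compose2[of UNIV f]) (auto intro: continuous_intros)

lemma lmeasurable_Times:
  fixes A :: "'a::euclidean_space set" and B :: "'b::euclidean_space set"
  assumes "A \<in> sets borel" "bounded A" "B \<in> sets borel" "bounded B"
  shows "A \<times> B \<in> lmeasurable"
  by (rule bounded_set_imp_lmeasurable) (use assms in \<open>auto simp: bounded_Times borel_Times\<close>)

text \<open>The norm bound is Cauchy-Schwarz against the constant 1 on \<open>B\<close>, whose
  squared norm is the factor \<open>m\<close>.\<close>

lemma L2_on_partial_integral:
  fixes F :: "'a::euclidean_space \<times> 'b::euclidean_space => real"
  assumes A: "A \<in> sets borel" "bounded A" and B: "B \<in> sets borel" "bounded B"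
    and F: "L2_on (A \<times> B) F"
  defines "m \<equiv> measure lebesgue B"
  shows "AE x in leb A. L2_on B (\<lambda>y. F (x, y))"
    and "integrable (leb A) (\<lambda>x. sqL2 B (\<lambda>y. F (x, y)))"
    and "(LINT x|leb A. sqL2 B (\<lambda>y. F (x, y))) = sqL2 (A \<times> B) F"
    and "L2_on A (\<lambda>x. \<integral>y. F (x, y) \<partial>leb B)"
    and "sqL2 A (\<lambda>x. \<integral>y. F (x, y) \<partial>leb B) \<le> m * sqL2 (A \<times> B) F"
    and "\<And>\<phi> C. \<phi> \<in> borel_measurable borel ==> (\<And>x. x \<in> A ==> \<bar>\<phi> x\<bar> \<le> C) ==>
      (LINT x|leb A. (LINT y|leb B. F (x, y)) * \<phi> x) = (LINT z|leb (A \<times> B). F z * \<phi> (fst z))"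
proof -
  have ABm: "A \<times> B \<in> lmeasurable" by (rule lmeasurable_Times[OF A B])
  have Bm: "B \<in> lmeasurable" and Am: "A \<in> lmeasurable"
    using A B by (auto intro: bounded_set_imp_lmeasurable)
  have Fi: "integrable (leb (A \<times> B)) F" by (rule L2_on_integrable[OF ABm F])
  have F2: "integrable (leb (A \<times> B)) (\<lambda>z. (F z)^2)" using F by (rule L2_on_integrable_sq)
  note f1 = lebesgue_on_Fubini[OF A(1) B(1) Fi] and f2 = lebesgue_on_Fubini[OF A(1) B(1) F2]
  show sl: "AE x in leb A. L2_on B (\<lambda>y. F (x, y))"
    using f1(1) f2(1)
  proof eventually_elim
    case (elim x)
    then show ?case using borel_measurable_integrable by (auto simp: L2_on_def)
  qed
  show i: "integrable (leb A) (\<lambda>x. sqL2 B (\<lambda>y. F (x, y)))" using f2(2) by (simp add: sqL2_def)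
  show eq: "(LINT x|leb A. sqL2 B (\<lambda>y. F (x, y))) = sqL2 (A \<times> B) F" using f2(3) by (simp add: sqL2_def)
  have one: "L2_on B (\<lambda>y. 1)" by (rule L2_on_bounded[OF Bm, of _ 1]) auto
  have one_m: "sqL2 B (\<lambda>y. 1) = m" using B by (simp add: sqL2_def m_def measure_restrict_space)
  have cs: "AE x in leb A. (LINT y|leb B. F (x, y))^2 \<le> m * sqL2 B (\<lambda>y. F (x, y))"
    using sl
  proof eventually_elim
    case (elim x)
    from L2_on_Cauchy_Schwarz[OF elim one] show ?case by (simp add: one_m mult.commute)
  qed
  have mi: "(\<lambda>x. \<integral>y. F (x, y) \<partial>leb B) \<in> borel_measurable (leb A)"
    using f1(2) by (rule borel_measurable_integrable)
  have i2: "integrable (leb A) (\<lambda>x. (LINT y|leb B. F (x, y))^2)"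
  proof (rule Bochner_Integration.integrable_bound[where f="\<lambda>x. m * sqL2 B (\<lambda>y. F (x, y))"])
    show "integrable (leb A) (\<lambda>x. m * sqL2 B (\<lambda>y. F (x, y)))" using i by simp
    show "AE x in leb A. norm ((LINT y|leb B. F (x, y))^2) \<le> norm (m * sqL2 B (\<lambda>y. F (x, y)))"
      using cs by eventually_elim simp
  qed (use mi in simp)
  with mi show "L2_on A (\<lambda>x. \<integral>y. F (x, y) \<partial>leb B)" by (simp add: L2_on_def)
  have "sqL2 A (\<lambda>x. \<integral>y. F (x, y) \<partial>leb B) \<le> (LINT x|leb A. m * sqL2 B (\<lambda>y. F (x, y)))"
    unfolding sqL2_def[of A] by (rule integral_mono_AE[OF i2 _ cs]) (use i in simp)
  then show "sqL2 A (\<lambda>x. \<integral>y. F (x, y) \<partial>leb B) \<le> m * sqL2 (A \<times> B) F" by (simp add: eq)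
  show "(LINT x|leb A. (LINT y|leb B. F (x, y)) * \<phi> x) = (LINT z|leb (A \<times> B). F z * \<phi> (fst z))"
    if \<phi>: "\<phi> \<in> borel_measurable borel" "\<And>x. x \<in> A ==> \<bar>\<phi> x\<bar> \<le> C" for \<phi> C
  proof -
    have "(\<lambda>z::'a \<times> 'b. \<phi> (fst z)) \<in> borel_measurable borel"
      by (intro measurable_compose[OF _ \<phi>(1)]) (auto intro!: borel_measurable_continuous_onI continuous_intros)
    then have pm: "(\<lambda>z::'a \<times> 'b. \<phi> (fst z)) \<in> borel_measurable (leb (A \<times> B))"
      by (intro measurable_restrict_space1 measurable_completion) simp
    have "L2_on (A \<times> B) (\<lambda>z. \<phi> (fst z) * F z)"
      by (rule L2_on_mult_bounded[OF F pm, of C]) (use \<phi>(2) in auto)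
    then have "integrable (leb (A \<times> B)) (\<lambda>z. \<phi> (fst z) * F z)" by (rule L2_on_integrable[OF ABm])
    from lebesgue_on_Fubini(3)[OF A(1) B(1) this] show ?thesis by (simp add: mult.commute)
  qed
qed

lemma L2_on_swap_prod:
  fixes F :: "'a::euclidean_space \<times> 'b::euclidean_space => real"
  assumes A: "A \<in> sets borel" and B: "B \<in> sets borel" and F: "L2_on (A \<times> B) F"
  shows "L2_on (B \<times> A) (\<lambda>z. F (snd z, fst z))" "sqL2 (B \<times> A) (\<lambda>z. F (snd z, fst z)) = sqL2 (A \<times> B) F"
proof -
  have Fm: "F \<in> borel_measurable (leb (A \<times> B))" using F by (rule L2_on_measurable)
  have F2: "integrable (leb (A \<times> B)) (\<lambda>z. (F z)^2)" using F by (rule L2_on_integrable_sq)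
  note s1 = lebesgue_on_swap[OF A B Fm] and s2 = lebesgue_on_swap[OF A B borel_measurable_integrable[OF F2]]
  show "L2_on (B \<times> A) (\<lambda>z. F (snd z, fst z))" using s1(1) s2(2) F2 by (simp add: L2_on_def)
  show "sqL2 (B \<times> A) (\<lambda>z. F (snd z, fst z)) = sqL2 (A \<times> B) F" using s2(3) by (simp add: sqL2_def)
qed

lemma box_Pair: "box (l, a) (u, b) = box l u \<times> box a b"
  by (auto simp: Basis_prod_def ball_Un box_def)

lemma cbox_Pair: "cbox (l, a) (u, b) = cbox l u \<times> cbox a b"
  by (auto simp: Basis_prod_def ball_Un cbox_def)

section \<open>Separated trigonometric systems on the product with an interval\<close>

definition lift_sines :: "'b::euclidean_space set => bool => ('b \<times> real) set" where
  "lift_sines S s = (\<lambda>i. (i, 0)) ` S \<union> (if s then {(0, 1)} else {})"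

text \<open>Basis vectors of the product are \<open>(i, 0)\<close> or \<open>(0, 1)\<close>, so the
  second component decides between the lateral frequencies \<open>k\<close> and the vertical
  frequency \<open>m\<close>.\<close>

definition lift_freq :: "('b::euclidean_space => nat) => nat => ('b \<times> real) => nat" where
  "lift_freq k m = (\<lambda>(i, t). if t = 0 then k i else m)"

definition trig1 :: "real => real => bool => nat => real => real" where
  "trig1 a b s m = trig_sys a b (if s then {1} else {}) (\<lambda>_. m)"

text \<open>Separation of variables. It lets an identity on the whole box be read as a statement
  about lateral coefficients tested against trigonometric functions of z.\<close>

lemma trig_sys_lift:
  "trig_sys (l, a) (u, b) (lift_sines S s) (lift_freq k m) (y, z) = trig_sys l u S k y * trig1 a b s m z"
proof -
  have 1: "trig_factor (l, a) (u, b) (lift_sines S s) (lift_freq k m) (i, 0) ((y, z) \<bullet> (i, 0)) = trig_factor l u S k i (y \<bullet> i)" for i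
    by (simp add: trig_factor_def lift_sines_def lift_freq_def image_iff)
  have 2: "trig_factor (l, a) (u, b) (lift_sines S s) (lift_freq k m) (0, 1) ((y, z) \<bullet> (0, 1)) = trig1 a b s m z"
    by (cases s) (simp_all add: trig1_def trig_sys_def trig_factor_def lift_sines_def lift_freq_def image_iff)
  have inj: "inj_on (\<lambda>i. (i, 0::real)) (Basis :: 'a set)" by (auto intro: inj_onI)
  have "trig_sys (l, a) (u, b) (lift_sines S s) (lift_freq k m) (y, z)
    = (\<Prod>j\<in>(\<lambda>i. (i, 0)) ` Basis. trig_factor (l, a) (u, b) (lift_sines S s) (lift_freq k m) j ((y, z) \<bullet> j))
     * (\<Prod>j\<in>(\<lambda>t. (0, t)) ` (Basis :: real set). trig_factor (l, a) (u, b) (lift_sines S s) (lift_freq k m) j ((y, z) \<bullet> j))"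
    unfolding trig_sys_def Basis_prod_def by (rule prod.union_disjoint) auto
  also have "\<dots> = (\<Prod>i\<in>Basis. trig_factor l u S k i (y \<bullet> i)) * trig1 a b s m z"
    unfolding prod.reindex[OF inj] using 1 2 by (simp del: inner_Pair)
  finally show ?thesis by (simp add: trig_sys_def)
qed

lemma continuous_trig1: "continuous_on S (trig1 a b s m)"
  unfolding trig1_def by (rule smooth_fun_continuous[OF smooth_fun_trig_sys])

lemma trig1_factor: "trig1 a b s m z = trig_factor a b (if s then {1} else {}) (\<lambda>_. m) 1 z"
  by (simp add: trig1_def trig_sys_def)

lemma trig1_deriv:
  assumes "a < b"
  shows "(trig1 a b True m has_real_derivative real m * pi / (b - a) * trig1 a b False m z) (at z)"
proof -
  have "(trig_factor a b {1} (\<lambda>_. m) 1 has_real_derivative real m * pi / (b - a) * trig_factor a b ({1} - {1}) (\<lambda>_. m) 1 z) (at z)"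
    using trig_factor_deriv[of a 1 b "{1}" "\<lambda>_. m" z] assms by simp
  then show ?thesis unfolding trig1_factor[abs_def] by simp
qed

lemma trig1_ends:
  assumes "a < b"
  shows "trig1 a b True m a = 0" "trig1 a b True m b = 0"
  unfolding trig1_factor using assms by (simp_all add: trig_factor_def trig_def)

lemma trig1_orthonormal:
  assumes "a < b"
  shows "(LINT t|leb {a<..<b}. trig1 a b False m t * trig1 a b False n t) = (if m = n then 1 else 0)"
  using trig_sys_orthonormal[of a b "{}" "\<lambda>_. m" "\<lambda>_. n"] assms by (simp add: trig1_def box_real)

lemma trig1_complete:
  assumes ab: "a < b" and F: "L2_on {a<..<b} F"
    and 0: "\<And>m. (LINT t|leb {a<..<b}. F t * trig1 a b False m t) = 0"
  shows "AE t in leb {a<..<b}. F t = 0"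
proof -
  have "trig_coeff a b {} F k = 0" for k
  proof -
    have "trig_sys a b {} k = trig1 a b False (k 1)"
      unfolding trig1_def by (subst if_not_P, simp) (rule trig_sys_cong, simp)
    then show ?thesis using 0[of "k 1"] by (simp add: trig_coeff_def box_real)
  qed
  moreover have bx: "box a b = {a<..<b}" by (rule box_real)
  ultimately show ?thesis using trig_coeff_eq_0_AE[of a b F "{}", unfolded bx] ab F by auto
qed

text \<open>A weak derivative in one variable, tested only against the sines, has an absolutely continuous
  representative: the difference to an antiderivative is orthogonal to all nonconstant cosines.\<close>

lemma weak_derivative_ac:
  assumes ab: "a < b" and g: "L2_on {a<..<b} g" and h: "L2_on {a<..<b} h"
    and w: "\<And>m. (LINT t|leb {a<..<b}. h t * trig1 a b True m t)
       = - (real m * pi / (b - a)) * (LINT t|leb {a<..<b}. g t * trig1 a b False m t)"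
  shows "\<exists>G. ac_on a b G h \<and> (AE t in leb {a<..<b}. g t = G t)"
proof -
  let ?M = "leb {a<..<b}"
  let ?s = "trig1 a b True" and ?c = "trig1 a b False" and ?\<kappa> = "\<lambda>m. real m * pi / (b - a)"
  have hi: "integrable ?M h" by (rule L2_on_integrable[OF _ h]) simp
  define G0 where "G0 z = 0 + (LINT t|?M. (if t < z then h t else 0))" for z
  have ac0: "ac_on a b G0 h" unfolding G0_def by (rule ac_on_antiderivative[OF hi])
  have G0L: "L2_on {a<..<b} G0" by (rule ac_on_L2[OF ac0])
  have cL: "L2_on {a<..<b} (?c m)" for m
    by (rule L2_on_continuous[of "{a..b}"]) (auto intro: continuous_trig1)
  have sL: "L2_on {a<..<b} (?s m)" for m
    by (rule L2_on_continuous[of "{a..b}"]) (auto intro: continuous_trig1)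
  have acs: "ac_on a b (?s m) (\<lambda>t. ?\<kappa> m * ?c m t)" for m
    by (rule ac_on_C1[OF trig1_deriv[OF ab]]) (intro continuous_intros continuous_trig1)
  have "(LINT t|?M. (g t - G0 t) * ?c m t) = 0" if m: "m \<noteq> 0" for m
  proof -
    \<comment> \<open>The integrand is the derivative of \<open>G0\<close> times a sine, and the
      sine vanishes at both ends.\<close>
    have "(LINT t|?M. h t * ?s m t + ?\<kappa> m * ?c m t * G0 t) = 0"
      using ac_on_diff_ends[OF ac_on_mult[OF ac0 acs[of m]]] ab trig1_ends[OF ab] by simp
    moreover have "(LINT t|?M. h t * ?s m t + ?\<kappa> m * ?c m t * G0 t)
       = (LINT t|?M. h t * ?s m t) + ?\<kappa> m * (LINT t|?M. G0 t * ?c m t)"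
    proof -
      have "(LINT t|?M. h t * ?s m t + ?\<kappa> m * ?c m t * G0 t) = (LINT t|?M. h t * ?s m t + ?\<kappa> m * (G0 t * ?c m t))"
        by (simp add: mult_ac)
      then show ?thesis using L2_on_integrable_mult[OF h sL[of m]] L2_on_integrable_mult[OF G0L cL[of m]] by simp
    qed
    ultimately have "?\<kappa> m * ((LINT t|?M. G0 t * ?c m t) - (LINT t|?M. g t * ?c m t)) = 0"
      using w[of m] by (simp add: right_diff_distrib)
    then have "(LINT t|?M. G0 t * ?c m t) = (LINT t|?M. g t * ?c m t)" using m ab by simp
    then show ?thesis
      using L2_on_integrable_mult[OF g cL[of m]] L2_on_integrable_mult[OF G0L cL[of m]] by (simp add: left_diff_distrib)
  qed
  note orth = this
  \<comment> \<open>The only cosine component of \<open>g - G0\<close> that can survive is the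
    constant one; it becomes the constant of integration.\<close>
  define C where "C = (LINT t|?M. (g t - G0 t) * ?c 0 t)"
  define F where "F t = (g t - G0 t) - C * ?c 0 t" for t
  have FL: "L2_on {a<..<b} F" unfolding F_def by (intro L2_on_diff L2_on_cmult g G0L cL)
  have "(LINT t|?M. F t * ?c m t) = 0" for m
  proof -
    have "(LINT t|?M. F t * ?c m t) = (LINT t|?M. (g t - G0 t) * ?c m t - C * (?c 0 t * ?c m t))"
      by (simp add: F_def left_diff_distrib mult.assoc)
    also have "\<dots> = (LINT t|?M. (g t - G0 t) * ?c m t) - C * (LINT t|?M. ?c 0 t * ?c m t)"
      using L2_on_integrable_mult[OF L2_on_diff[OF g G0L] cL[of m]] L2_on_integrable_mult[OF cL[of 0] cL[of m]] by simp
    also have "\<dots> = 0" using orth[of m] by (cases "m = 0") (simp_all add: trig1_orthonormal[OF ab] C_def)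
    finally show ?thesis .
  qed
  from trig1_complete[OF ab FL this] have ae: "AE t in ?M. F t = 0" .
  have c0: "?c 0 t = ?c 0 0" for t by (simp add: trig1_factor trig_factor_def trig_def)
  have "ac_on a b (\<lambda>z. C * ?c 0 0 + (LINT t|?M. (if t < z then h t else 0))) h"
    by (rule ac_on_antiderivative[OF hi])
  moreover have "AE t in ?M. g t = C * ?c 0 0 + (LINT s|?M. (if s < t then h s else 0))"
    using ae
  proof eventually_elim
    case (elim t)
    then have "g t = C * ?c 0 t + G0 t" by (simp add: F_def)
    then show ?case using c0[of t] by (simp add: G0_def)
  qed
  ultimately show ?thesis by blast
qed

section \<open>Lateral Fourier coefficients and the trace along vertical segments\<close>

definition slice_coeff :: "'b::euclidean_space => 'b => 'b set => ('b \<times> real => real) => ('b => nat) => real => real" where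
  "slice_coeff l u S f k z = trig_coeff l u S (\<lambda>y. f (y, z)) k"

lemma slice_L2:
  fixes f :: "'b::euclidean_space \<times> real => real"
  assumes f: "L2_on (box l u \<times> {a<..<b}) f"
  shows "AE z in leb {a<..<b}. L2_on (box l u) (\<lambda>y. f (y, z))"
    and "integrable (leb {a<..<b}) (\<lambda>z. sqL2 (box l u) (\<lambda>y. f (y, z)))"
    and "(LINT z|leb {a<..<b}. sqL2 (box l u) (\<lambda>y. f (y, z))) = sqL2 (box l u \<times> {a<..<b}) f"
proof -
  have A: "box l u \<in> sets borel" "bounded (box l u)" and B: "{a<..<b} \<in> sets borel" "bounded {a<..<b}"
    by (auto simp: bounded_box)
  note s = L2_on_swap_prod[OF A(1) B(1) f]
  note p = L2_on_partial_integral[OF B A s(1)]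
  show "AE z in leb {a<..<b}. L2_on (box l u) (\<lambda>y. f (y, z))" using p(1) by simp
  show "integrable (leb {a<..<b}) (\<lambda>z. sqL2 (box l u) (\<lambda>y. f (y, z)))" using p(2) by simp
  show "(LINT z|leb {a<..<b}. sqL2 (box l u) (\<lambda>y. f (y, z))) = sqL2 (box l u \<times> {a<..<b}) f"
    using p(3) s(2) by simp
qed

lemma slice_coeff_L2:
  fixes f :: "'b::euclidean_space \<times> real => real"
  assumes f: "L2_on (box l u \<times> {a<..<b}) f"
  shows "L2_on {a<..<b} (slice_coeff l u S f k)"
    and "continuous_on UNIV \<eta> ==> (LINT z|leb {a<..<b}. slice_coeff l u S f k z * \<eta> z)
      = (LINT x|leb (box l u \<times> {a<..<b}). f x * (trig_sys l u S k (fst x) * \<eta> (snd x)))"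
proof -
  let ?\<Omega> = "box l u \<times> {a<..<b}"
  have A: "box l u \<in> sets borel" "bounded (box l u)" and B: "{a<..<b} \<in> sets borel" "bounded {a<..<b}"
    by (auto simp: bounded_box)
  obtain K where K: "\<And>x. x \<in> cbox l u ==> \<bar>trig_sys l u S k x\<bar> \<le> K"
    using smooth_fun_bounded_on_cbox[OF smooth_fun_trig_sys] by blast
  have em: "(\<lambda>x::'b \<times> real. trig_sys l u S k (fst x)) \<in> borel_measurable (leb ?\<Omega>)"
    by (intro measurable_restrict_space1 measurable_completion)
      (simp add: borel_measurable_continuous_onI continuous_on_fst_comp smooth_fun_continuous smooth_fun_trig_sys)
  have fe: "L2_on ?\<Omega> (\<lambda>x. trig_sys l u S k (fst x) * f x)"
    by (rule L2_on_mult_bounded[OF f em, of K]) (use K box_subset_cbox[of l u] in auto)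
  note s = L2_on_swap_prod[OF A(1) B(1) fe]
  note p = L2_on_partial_integral[OF B A s(1)]
  have sc: "slice_coeff l u S f k z = (LINT y|leb (box l u). trig_sys l u S k y * f (y, z))" for z
    by (simp add: slice_coeff_def trig_coeff_def mult.commute)
  show "L2_on {a<..<b} (slice_coeff l u S f k)" using p(4) by (simp add: sc[abs_def])
  show "(LINT z|leb {a<..<b}. slice_coeff l u S f k z * \<eta> z)
      = (LINT x|leb ?\<Omega>. f x * (trig_sys l u S k (fst x) * \<eta> (snd x)))" if \<eta>: "continuous_on UNIV \<eta>"
  proof -
    have "bounded (\<eta> ` {a..b})"
      using compact_continuous_image[OF continuous_on_subset[OF \<eta>]] compact_imp_bounded by blast
    then obtain C where "\<forall>x\<in>\<eta> ` {a..b}. norm x \<le> C" unfolding bounded_iff by blast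
    then have C: "\<bar>\<eta> z\<bar> \<le> C" if "z \<in> {a<..<b}" for z using that by auto
    have "(LINT z|leb {a<..<b}. slice_coeff l u S f k z * \<eta> z)
       = (LINT x|leb ({a<..<b} \<times> box l u). trig_sys l u S k (snd x) * f (snd x, fst x) * \<eta> (fst x))"
      using p(6)[OF continuous_borel_real[OF \<eta>] C] by (simp add: sc)
    also have "\<dots> = (LINT x|leb ?\<Omega>. f x * (trig_sys l u S k (fst x) * \<eta> (snd x)))"
    proof -
      have "(\<lambda>x::'b \<times> real. trig_sys l u S k (fst x) * \<eta> (snd x)) \<in> borel_measurable (leb ?\<Omega>)"
        by (intro measurable_restrict_space1 measurable_completion)
          (simp add: borel_measurable_continuous_onI continuous_on_mult continuous_on_fst_comp continuous_on_snd_comp \<eta> smooth_fun_continuous smooth_fun_trig_sys)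
      then have "(\<lambda>x. f x * (trig_sys l u S k (fst x) * \<eta> (snd x))) \<in> borel_measurable (leb ?\<Omega>)"
        using L2_on_measurable[OF f] by simp
      from lebesgue_on_swap(3)[OF A(1) B(1) this] show ?thesis by (simp add: mult_ac)
    qed
    finally show ?thesis .
  qed
qed

text \<open>Both sides are tested against the vertical cosines, which are complete. An identity
  between integrals over the box thus becomes an identity on almost every slice, without any
  differentiability in z.\<close>

lemma slice_coeff_relation:
  fixes f g :: "'b::euclidean_space \<times> real => real"
  assumes ab: "a < b" and f: "L2_on (box l u \<times> {a<..<b}) f" and g: "L2_on (box l u \<times> {a<..<b}) g"
    and eq: "\<And>m. (LINT x|leb (box l u \<times> {a<..<b}). f x * trig_sys (l, a) (u, b) (lift_sines S False) (lift_freq k m) x)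
      = c * (LINT x|leb (box l u \<times> {a<..<b}). g x * trig_sys (l, a) (u, b) (lift_sines S' False) (lift_freq k m) x)"
  shows "AE z in leb {a<..<b}. slice_coeff l u S f k z = c * slice_coeff l u S' g k z"
proof -
  let ?M = "leb {a<..<b}"
  have i: "(LINT x|leb (box l u \<times> {a<..<b}). f x * trig_sys (l, a) (u, b) (lift_sines S s) (lift_freq k m) x)
    = (LINT z|?M. slice_coeff l u S f k z * trig1 a b s m z)"
    if "L2_on (box l u \<times> {a<..<b}) f" for f :: "'b \<times> real => real" and S s m
  proof -
    have "trig_sys (l, a) (u, b) (lift_sines S s) (lift_freq k m) x = trig_sys l u S k (fst x) * trig1 a b s m (snd x)" for x
      using trig_sys_lift[of l a u b S s k m "fst x" "snd x"] by simp
    then show ?thesis using slice_coeff_L2(2)[OF that continuous_trig1, of S k a b s m] by simp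
  qed
  have fL: "L2_on {a<..<b} (slice_coeff l u S f k)" and gL: "L2_on {a<..<b} (slice_coeff l u S' g k)"
    by (rule slice_coeff_L2(1), fact)+
  have cL: "L2_on {a<..<b} (trig1 a b False m)" for m
    by (rule L2_on_continuous[of "{a..b}"]) (auto intro: continuous_trig1)
  have "AE z in ?M. slice_coeff l u S f k z - c * slice_coeff l u S' g k z = 0"
  proof (rule trig1_complete[OF ab])
    show "L2_on {a<..<b} (\<lambda>z. slice_coeff l u S f k z - c * slice_coeff l u S' g k z)"
      by (intro L2_on_diff L2_on_cmult fL gL)
    fix m
    have "(LINT z|?M. (slice_coeff l u S f k z - c * slice_coeff l u S' g k z) * trig1 a b False m z)
      = (LINT z|?M. slice_coeff l u S f k z * trig1 a b False m z - c * (slice_coeff l u S' g k z * trig1 a b False m z))"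
      by (simp add: left_diff_distrib mult.assoc)
    also have "\<dots> = (LINT z|?M. slice_coeff l u S f k z * trig1 a b False m z) - c * (LINT z|?M. slice_coeff l u S' g k z * trig1 a b False m z)"
      using L2_on_integrable_mult[OF fL cL[of m]] L2_on_integrable_mult[OF gL cL[of m]] by simp
    also have "\<dots> = 0" using eq[of m] i[OF f] i[OF g] by simp
    finally show "(LINT z|?M. (slice_coeff l u S f k z - c * slice_coeff l u S' g k z) * trig1 a b False m z) = 0" .
  qed
  then show ?thesis by eventually_elim simp
qed

lemma lift_sines_insert: "insert (i, 0) (lift_sines S s) = lift_sines (insert i S) s"
  by (auto simp: lift_sines_def)

lemma lift_sines_remove: "lift_sines S s - {(i, 0)} = lift_sines (S - {i}) s"
  by (auto simp: lift_sines_def)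

lemma lift_sines_remove_top: "lift_sines S True - {(0, 1)} = lift_sines S False"
  by (auto simp: lift_sines_def)

text \<open>The top trace of an H1 function, written as the derivative of the product with the weight
  that vanishes at z = a and equals 1 at z = b; no limit is needed to define it.\<close>

definition top_trace :: "real => real => ('b \<times> real => real) => ('b \<times> real => real) => 'b => real" where
  "top_trace a b v vz y = (LINT z|leb {a<..<b}. vz (y, z) * ((z - a) / (b - a)) + v (y, z) * (1 / (b - a)))"

lemma top_trace_density:
  fixes v vz :: "'b::euclidean_space \<times> real => real"
  assumes ab: "a < b" and A: "A \<in> sets borel" "bounded A"
    and v: "L2_on (A \<times> {a<..<b}) v" and vz: "L2_on (A \<times> {a<..<b}) vz"
  shows "L2_on (A \<times> {a<..<b}) (\<lambda>x. vz x * ((snd x - a) / (b - a)) + v x * (1 / (b - a)))"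
    and "sqL2 (A \<times> {a<..<b}) (\<lambda>x. vz x * ((snd x - a) / (b - a)) + v x * (1 / (b - a)))
      \<le> 2 * sqL2 (A \<times> {a<..<b}) vz + 2 * (1 / (b - a))^2 * sqL2 (A \<times> {a<..<b}) v"
proof -
  let ?\<Omega> = "A \<times> {a<..<b}"
  have m: "(\<lambda>x::'b \<times> real. (snd x - a) / (b - a)) \<in> borel_measurable (leb ?\<Omega>)"
    by (intro measurable_restrict_space1 measurable_completion)
      (use ab in \<open>auto intro!: borel_measurable_continuous_onI continuous_intros\<close>)
  have bd: "\<bar>(snd x - a) / (b - a)\<bar> \<le> 1" if "x \<in> ?\<Omega>" for x :: "'b \<times> real"
    using that ab by (auto simp: divide_le_eq)
  have 1: "L2_on ?\<Omega> (\<lambda>x. (snd x - a) / (b - a) * vz x)"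
    by (rule L2_on_mult_bounded[OF vz m bd])
  have 2: "L2_on ?\<Omega> (\<lambda>x. (1 / (b - a)) * v x)" by (rule L2_on_cmult[OF v])
  show "L2_on ?\<Omega> (\<lambda>x. vz x * ((snd x - a) / (b - a)) + v x * (1 / (b - a)))"
    using L2_on_add[OF 1 2] by (simp only: mult.commute)
  have "sqL2 ?\<Omega> (\<lambda>x. (snd x - a) / (b - a) * vz x + (1 / (b - a)) * v x)
     \<le> 2 * sqL2 ?\<Omega> (\<lambda>x. (snd x - a) / (b - a) * vz x) + 2 * sqL2 ?\<Omega> (\<lambda>x. (1 / (b - a)) * v x)"
    by (rule sqL2_add_le[OF 1 2])
  moreover have "sqL2 ?\<Omega> (\<lambda>x. (snd x - a) / (b - a) * vz x) \<le> sqL2 ?\<Omega> vz"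
  proof (rule sqL2_mono_AE[OF vz 1 AE_I2])
    fix x assume "x \<in> space (leb ?\<Omega>)"
    then have "\<bar>(snd x - a) / (b - a)\<bar> \<le> 1" using bd by simp
    then show "\<bar>(snd x - a) / (b - a) * vz x\<bar> \<le> \<bar>vz x\<bar>" unfolding abs_mult by (rule mult_left_le_one_le[rotated 2]) auto
  qed
  moreover have "sqL2 ?\<Omega> (\<lambda>x. (1 / (b - a)) * v x) = (1 / (b - a))^2 * sqL2 ?\<Omega> v" by (rule sqL2_cmult)
  ultimately have "sqL2 ?\<Omega> (\<lambda>x. (snd x - a) / (b - a) * vz x + (1 / (b - a)) * v x)
     \<le> 2 * sqL2 ?\<Omega> vz + 2 * (1 / (b - a))^2 * sqL2 ?\<Omega> v" by linarith
  then show "sqL2 ?\<Omega> (\<lambda>x. vz x * ((snd x - a) / (b - a)) + v x * (1 / (b - a)))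
      \<le> 2 * sqL2 ?\<Omega> vz + 2 * (1 / (b - a))^2 * sqL2 ?\<Omega> v" by (simp only: mult.commute)
qed

lemma top_trace_L2:
  fixes v vz :: "'b::euclidean_space \<times> real => real"
  assumes ab: "a < b" and A: "A \<in> sets borel" "bounded A"
    and v: "L2_on (A \<times> {a<..<b}) v" and vz: "L2_on (A \<times> {a<..<b}) vz"
  shows "L2_on A (top_trace a b v vz)"
    and "sqL2 A (top_trace a b v vz) \<le> (b - a) * (2 * sqL2 (A \<times> {a<..<b}) vz + 2 * (1 / (b - a))^2 * sqL2 (A \<times> {a<..<b}) v)"
    and "AE y in leb A. L2_on {a<..<b} (\<lambda>z. vz (y, z) * ((z - a) / (b - a)) + v (y, z) * (1 / (b - a)))"
    and "\<And>\<phi> C. \<phi> \<in> borel_measurable borel ==> (\<And>y. y \<in> A ==> \<bar>\<phi> y\<bar> \<le> C) ==>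
      (LINT y|leb A. top_trace a b v vz y * \<phi> y)
       = (LINT x|leb (A \<times> {a<..<b}). (vz x * ((snd x - a) / (b - a)) + v x * (1 / (b - a))) * \<phi> (fst x))"
proof -
  have B: "{a<..<b} \<in> sets borel" "bounded {a<..<b}" by auto
  note d = top_trace_density[OF ab A v vz]
  note p = L2_on_partial_integral[OF A B d(1)]
  have m: "measure lebesgue {a<..<b} = b - a" using ab by simp
  show "L2_on A (top_trace a b v vz)" using p(4) by (simp add: top_trace_def[abs_def])
  show "AE y in leb A. L2_on {a<..<b} (\<lambda>z. vz (y, z) * ((z - a) / (b - a)) + v (y, z) * (1 / (b - a)))"
    using p(1) by simp
  show "(LINT y|leb A. top_trace a b v vz y * \<phi> y)
       = (LINT x|leb (A \<times> {a<..<b}). (vz x * ((snd x - a) / (b - a)) + v x * (1 / (b - a))) * \<phi> (fst x))"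
    if "\<phi> \<in> borel_measurable borel" "\<And>y. y \<in> A ==> \<bar>\<phi> y\<bar> \<le> C" for \<phi> C
    using p(6)[OF that] by (simp add: top_trace_def)
  have "sqL2 A (top_trace a b v vz) \<le> (b - a) * sqL2 (A \<times> {a<..<b}) (\<lambda>x. vz x * ((snd x - a) / (b - a)) + v x * (1 / (b - a)))"
    using p(5) unfolding m by (simp add: top_trace_def[abs_def])
  also have "\<dots> \<le> (b - a) * (2 * sqL2 (A \<times> {a<..<b}) vz + 2 * (1 / (b - a))^2 * sqL2 (A \<times> {a<..<b}) v)"
    using d(2) ab by (intro mult_left_mono) auto
  finally show "sqL2 A (top_trace a b v vz) \<le> (b - a) * (2 * sqL2 (A \<times> {a<..<b}) vz + 2 * (1 / (b - a))^2 * sqL2 (A \<times> {a<..<b}) v)" .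
qed

text \<open>Only almost everywhere, because linearity of the integral is available only where both
  vertical slices are integrable.\<close>

lemma top_trace_diff_AE:
  fixes v vz :: "'b::euclidean_space \<times> real => real"
  assumes ab: "a < b" and A: "A \<in> sets borel" "bounded A"
    and v: "L2_on (A \<times> {a<..<b}) v" "L2_on (A \<times> {a<..<b}) vz"
    and w: "L2_on (A \<times> {a<..<b}) w" "L2_on (A \<times> {a<..<b}) wz"
  shows "AE y in leb A. top_trace a b (\<lambda>x. v x - w x) (\<lambda>x. vz x - wz x) y = top_trace a b v vz y - top_trace a b w wz y"
  using top_trace_L2(3)[OF ab A v] top_trace_L2(3)[OF ab A w]
proof eventually_elim
  case (elim y)
  have I: "{a<..<b} \<in> lmeasurable" by simp
  note i = L2_on_integrable[OF I elim(1)] L2_on_integrable[OF I elim(2)]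
  have gen: "(p - q) * c + (r - s) * h = (p * c + r * h) - (q * c + s * h)" for p q r s c h :: real
    by (simp add: algebra_simps)
  have "(LINT z|leb {a<..<b}. (vz (y, z) - wz (y, z)) * ((z - a) / (b - a)) + (v (y, z) - w (y, z)) * (1 / (b - a)))
    = (LINT z|leb {a<..<b}. (vz (y, z) * ((z - a) / (b - a)) + v (y, z) * (1 / (b - a))) - (wz (y, z) * ((z - a) / (b - a)) + w (y, z) * (1 / (b - a))))"
    by (rule lint_cong[OF refl]) (rule gen)
  also have "\<dots> = top_trace a b v vz y - top_trace a b w wz y"
    unfolding top_trace_def by (rule lint_diff[OF i])
  finally show ?case by (simp only: top_trace_def)
qed

lemma integral_mult_right_minus:
  fixes f g :: "'a => real"
  shows "- (LINT x|M. f x * (- c * g x)) = c * (LINT x|M. f x * g x)"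
proof -
  have "(LINT x|M. f x * (- c * g x)) = (LINT x|M. - c * (f x * g x))"
    by (simp add: mult.left_commute)
  also have "\<dots> = - c * (LINT x|M. f x * g x)" by (rule integral_mult_right_zero)
  finally show ?thesis by simp
qed

text \<open>Boundary conditions are kept out of this locale: the trace facts are needed for every
  source parameter in the closed interval, the conditions are available only in the open
  one.\<close>

locale box_H2 =
  fixes l u :: "'b::euclidean_space" and a b :: real
    and v :: "'b \<times> real => real" and Dv :: "'b \<times> real => 'b \<times> real" and Hv :: "'b \<times> real => 'b \<times> real => 'b \<times> real"
  assumes lu: "j \<in> Basis ==> l \<bullet> j < u \<bullet> j" and ab: "0 < a" "a < b"
    and cont: "continuous_on (cbox l u \<times> {a..b}) v"
    and H2: "is_H2 (box l u \<times> {a<..<b}) v Dv Hv"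
begin

abbreviation "Om \<equiv> box l u \<times> {a<..<b}"
abbreviation "freq k i \<equiv> real (k i) * pi / (u \<bullet> i - l \<bullet> i)"

lemma Om_box: "Om = box (l, a) (u, b)" by (simp add: box_Pair box_real)

lemma LU: "j \<in> Basis ==> (l, a) \<bullet> j < (u, b) \<bullet> j"
  using lu ab by (auto simp: Basis_prod_def)

lemma basis_lat: "i \<in> Basis ==> (i, 0) \<in> (Basis :: ('b \<times> real) set)"
  and basis_top: "(0, 1) \<in> (Basis :: ('b \<times> real) set)"
  by (auto simp: Basis_prod_def)

lemma vL2: "L2_on Om v" and DL2: "e \<in> Basis ==> L2_on Om (\<lambda>x. Dv x \<bullet> e)"
  and DDL2: "e \<in> Basis ==> e' \<in> Basis ==> L2_on Om (\<lambda>x. Hv x e \<bullet> e')"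
  and wD: "e \<in> Basis ==> is_weak_partial Om v e (\<lambda>x. Dv x \<bullet> e)"
  and wH: "e \<in> Basis ==> e' \<in> Basis ==> is_weak_partial Om (\<lambda>x. Dv x \<bullet> e) e' (\<lambda>x. Hv x e \<bullet> e')"
  using H2 by (auto simp: is_H2_def is_H1_grad_def)

text \<open>The system has sines in direction \<open>e\<close>, so \<open>trig_sys_vanish\<close>
  provides the decay and no boundary value of \<open>f\<close> is involved.\<close>

lemma by_parts_sine:
  assumes e: "e \<in> Basis" "e \<in> S" and f: "L2_on Om f" "L2_on Om f'" and w: "is_weak_partial Om f e f'"
  shows "(LINT x|leb Om. f' x * trig_sys (l, a) (u, b) S K x)
    = - (real (K e) * pi / ((u, b) \<bullet> e - (l, a) \<bullet> e)) * (LINT x|leb Om. f x * trig_sys (l, a) (u, b) (S - {e}) K x)"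
proof -
  let ?\<kappa> = "real (K e) * pi / ((u, b) \<bullet> e - (l, a) \<bullet> e)"
  obtain C where C: "\<And>x. x \<in> box (l, a) (u, b) ==> \<bar>trig_sys (l, a) (u, b) S K x\<bar> \<le> C * (x \<bullet> e - (l, a) \<bullet> e)
     \<and> \<bar>trig_sys (l, a) (u, b) S K x\<bar> \<le> C * ((u, b) \<bullet> e - x \<bullet> e)"
    using trig_sys_vanish[OF LU e, where k=K] by blast
  have "(LINT x|leb (box (l, a) (u, b)). f' x * trig_sys (l, a) (u, b) S K x)
    = - (LINT x|leb (box (l, a) (u, b)). f x * frechet_derivative (trig_sys (l, a) (u, b) S K) (at x) e)"
    by (rule weak_partial_by_parts[OF _ _ _ e(1) smooth_fun_trig_sys C]) (use f w in \<open>simp_all add: Om_box\<close>)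
  also have "\<dots> = - (LINT x|leb (box (l, a) (u, b)). ?\<kappa> * (f x * trig_sys (l, a) (u, b) (S - {e}) K x))"
    unfolding trig_sys_partial[OF e(1) LU[OF e(1)]] if_P[OF e(2)] by (simp only: mult.left_commute)
  also have "\<dots> = - ?\<kappa> * (LINT x|leb (box (l, a) (u, b)). f x * trig_sys (l, a) (u, b) (S - {e}) K x)"
    by (simp only: integral_mult_right_zero mult_minus_left)
  finally show ?thesis by (simp only: Om_box)
qed

text \<open>Integration by parts against vertical sines is exactly the hypothesis of
  \<open>weak_derivative_ac\<close> for the coefficient functions.\<close>

lemma coeff_vertical_ac:
  assumes f: "L2_on Om f" "L2_on Om f'" and w: "is_weak_partial Om f (0, 1) f'"
  shows "\<exists>G. ac_on a b G (slice_coeff l u Basis f' k) \<and> (AE z in leb {a<..<b}. slice_coeff l u Basis f k z = G z)"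
proof (rule weak_derivative_ac[OF ab(2) slice_coeff_L2(1)[OF f(1)] slice_coeff_L2(1)[OF f(2)]])
  fix m
  let ?e = "(0, 1) :: 'b \<times> real"
  have i: "(LINT x|leb Om. f x * trig_sys (l, a) (u, b) (lift_sines Basis s) (lift_freq k m) x)
    = (LINT z|leb {a<..<b}. slice_coeff l u Basis f k z * trig1 a b s m z)" if "L2_on Om f" for f s
  proof -
    have "trig_sys (l, a) (u, b) (lift_sines Basis s) (lift_freq k m) x = trig_sys l u Basis k (fst x) * trig1 a b s m (snd x)" for x
      using trig_sys_lift[of l a u b Basis s k m "fst x" "snd x"] by simp
    then show ?thesis using slice_coeff_L2(2)[OF that continuous_trig1, of Basis k a b s m] by simp
  qed
  have "?e \<in> lift_sines Basis True" by (simp add: lift_sines_def)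
  from by_parts_sine[OF basis_top this f w, of "lift_freq k m"]
  show "(LINT t|leb {a<..<b}. slice_coeff l u Basis f' k t * trig1 a b True m t)
     = - (real m * pi / (b - a)) * (LINT t|leb {a<..<b}. slice_coeff l u Basis f k t * trig1 a b False m t)"
    unfolding lift_sines_remove_top i[OF f(1)] i[OF f(2)] by (simp add: lift_freq_def)
qed

text \<open>This pins down the representative: a continuous coefficient agrees with its absolutely
  continuous version everywhere, in particular at the end points \<open>a\<close> and
  \<open>b\<close>.\<close>

lemma coeff_continuous: "continuous_on {a..b} (slice_coeff l u Basis v k)"
  unfolding continuous_on_sequentially
proof (intro allI ballI impI, elim conjE)
  fix X z assume X: "\<forall>n. X n \<in> {a..b}" and z: "z \<in> {a..b}" and lim: "X \<longlonglongrightarrow> z"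
  let ?M = "leb (box l u)" and ?e = "trig_sys l u Basis k"
  have "bounded (v ` (cbox l u \<times> {a..b}))"
    using compact_continuous_image[OF cont] compact_Times[OF compact_cbox compact_Icc] compact_imp_bounded by blast
  then obtain C where "\<forall>x\<in>v ` (cbox l u \<times> {a..b}). norm x \<le> C" unfolding bounded_iff by blast
  then have C: "\<bar>v (y, t)\<bar> \<le> C" if "y \<in> cbox l u" "t \<in> {a..b}" for y t using that by auto
  have bs: "y \<in> cbox l u" if "y \<in> box l u" for y using that box_subset_cbox by blast
  have cv: "continuous_on (cbox l u) (\<lambda>y. v (y, t))" if "t \<in> {a..b}" for t
    by (rule continuous_on_compose2[OF cont]) (use that in \<open>auto intro!: continuous_intros\<close>)
  have vm: "(\<lambda>y. v (y, t)) \<in> borel_measurable ?M" if "t \<in> {a..b}" for t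
    by (rule L2_on_measurable[OF L2_on_continuous[OF cv[OF that]]]) (auto simp: box_subset_cbox)
  have eL: "L2_on (box l u) ?e" by (rule L2_on_smooth[OF smooth_fun_trig_sys])
  have "(\<lambda>n. \<integral>y. v (y, X n) * ?e y \<partial>?M) \<longlonglongrightarrow> (LINT y|?M. v (y, z) * ?e y)"
  proof (rule integral_dominated_convergence[where w="\<lambda>y. C * \<bar>?e y\<bar>"])
    show "integrable ?M (\<lambda>y. C * \<bar>?e y\<bar>)" using L2_on_integrable[OF _ eL] by simp
    show "(\<lambda>y. v (y, z) * ?e y) \<in> borel_measurable ?M" "(\<lambda>y. v (y, X n) * ?e y) \<in> borel_measurable ?M" for n
      using vm X z L2_on_measurable[OF eL] by (auto intro!: borel_measurable_times)
    show "AE y in ?M. (\<lambda>n. v (y, X n) * ?e y) \<longlonglongrightarrow> v (y, z) * ?e y"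
    proof (rule AE_I2)
      fix y assume "y \<in> space ?M"
      then have y: "y \<in> cbox l u" using bs by simp
      have "continuous_on {a..b} (\<lambda>t. v (y, t))"
        by (rule continuous_on_compose2[OF cont]) (use y in \<open>auto intro!: continuous_intros\<close>)
      from this[unfolded continuous_on_sequentially, rule_format, of z X] X z lim
      have "(\<lambda>n. v (y, X n)) \<longlonglongrightarrow> v (y, z)" by (simp add: o_def)
      then show "(\<lambda>n. v (y, X n) * ?e y) \<longlonglongrightarrow> v (y, z) * ?e y" by (intro tendsto_intros)
    qed
    show "AE y in ?M. norm (v (y, X n) * ?e y) \<le> C * \<bar>?e y\<bar>" for n
    proof (rule AE_I2)
      fix y assume "y \<in> space ?M"
      then have y: "y \<in> cbox l u" using bs by simp
      show "norm (v (y, X n) * ?e y) \<le> C * \<bar>?e y\<bar>"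
        unfolding real_norm_def abs_mult using C[OF y, of "X n"] X by (intro mult_right_mono) auto
    qed
  qed
  then show "(slice_coeff l u Basis v k \<circ> X) \<longlonglongrightarrow> slice_coeff l u Basis v k z"
    by (simp add: slice_coeff_def trig_coeff_def o_def)
qed

end

locale box_Dirichlet = box_H2 l u a b v Dv Hv
  for l u :: "'b::euclidean_space" and a b :: real and v :: "'b \<times> real => real"
    and Dv :: "'b \<times> real => 'b \<times> real" and Hv :: "'b \<times> real => 'b \<times> real => 'b \<times> real" +
  assumes lateral: "y \<in> cbox l u ==> z \<in> {a..b} ==> i \<in> Basis ==> y \<bullet> i = l \<bullet> i \<or> y \<bullet> i = u \<bullet> i ==> v (y, z) = 0"
    and bottom: "y \<in> cbox l u ==> v (y, a) = 0"
begin

text \<open>The derivative in direction \<open>i\<close> is tested with cosines in that direction,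
  which do not vanish on the faces. This is where the lateral Dirichlet condition is consumed,
  through \<open>weak_partial_by_parts_Dirichlet\<close>.\<close>

lemma coeff_lateral:
  assumes i: "i \<in> Basis"
  shows "AE z in leb {a<..<b}. slice_coeff l u (Basis - {i}) (\<lambda>x. Dv x \<bullet> (i, 0)) k z = freq k i * slice_coeff l u Basis v k z"
proof (rule slice_coeff_relation[OF ab(2) DL2[OF basis_lat[OF i]] vL2])
  fix m
  let ?e = "(i, 0) :: 'b \<times> real" and ?S = "lift_sines (Basis - {i}) False" and ?K = "lift_freq k m"
  have n: "?e \<notin> ?S" by (auto simp: lift_sines_def)
  have ins: "insert ?e ?S = lift_sines Basis False" using i by (simp add: lift_sines_insert insert_absorb)
  have K: "?K ?e = k i" by (simp add: lift_freq_def)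
  have c: "continuous_on (cbox (l, a) (u, b)) v" using cont by (simp add: cbox_Pair)
  have z: "v x = 0" if "x \<in> cbox (l, a) (u, b)" "x \<bullet> ?e = (l, a) \<bullet> ?e \<or> x \<bullet> ?e = (u, b) \<bullet> ?e" for x
  proof -
    obtain y z where x: "x = (y, z)" by (cases x)
    show ?thesis unfolding x by (rule lateral[OF _ _ i]) (use that x in \<open>auto simp: cbox_Pair\<close>)
  qed
  have "(LINT x|leb (box (l, a) (u, b)). (Dv x \<bullet> ?e) * trig_sys (l, a) (u, b) ?S ?K x)
     = - (LINT x|leb (box (l, a) (u, b)). v x * frechet_derivative (trig_sys (l, a) (u, b) ?S ?K) (at x) ?e)"
    by (rule weak_partial_by_parts_Dirichlet[OF LU c _ _ basis_lat[OF i] smooth_fun_trig_sys z])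
      (use DL2[OF basis_lat[OF i]] wD[OF basis_lat[OF i]] in \<open>simp_all add: Om_box\<close>)
  also have "\<dots> = - (LINT x|leb (box (l, a) (u, b)). v x * (- freq k i * trig_sys (l, a) (u, b) (lift_sines Basis False) ?K x))"
    unfolding trig_sys_partial[OF basis_lat[OF i] LU[OF basis_lat[OF i]]] if_not_P[OF n] ins K by simp
  also have "\<dots> = freq k i * (LINT x|leb (box (l, a) (u, b)). v x * trig_sys (l, a) (u, b) (lift_sines Basis False) ?K x)"
    by (rule integral_mult_right_minus)
  finally show "(LINT x|leb Om. (Dv x \<bullet> ?e) * trig_sys (l, a) (u, b) ?S ?K x)
     = freq k i * (LINT x|leb Om. v x * trig_sys (l, a) (u, b) (lift_sines Basis False) ?K x)"
    by (simp only: Om_box)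
qed

text \<open>Passing from the second to the first derivative uses sines and hence no boundary value
  of the gradient; passing from the first derivative to \<open>v\<close> is
  \<open>coeff_lateral\<close>.\<close>

lemma coeff_lateral_second:
  assumes i: "i \<in> Basis"
  shows "AE z in leb {a<..<b}. slice_coeff l u Basis (\<lambda>x. Hv x (i, 0) \<bullet> (i, 0)) k z = - (freq k i)\<^sup>2 * slice_coeff l u Basis v k z"
proof -
  let ?e = "(i, 0) :: 'b \<times> real"
  note e = basis_lat[OF i]
  have "AE z in leb {a<..<b}. slice_coeff l u Basis (\<lambda>x. Hv x ?e \<bullet> ?e) k z
     = - freq k i * slice_coeff l u (Basis - {i}) (\<lambda>x. Dv x \<bullet> ?e) k z"
  proof (rule slice_coeff_relation[OF ab(2) DDL2[OF e e] DL2[OF e]])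
    fix m
    have "?e \<in> lift_sines Basis False" using i by (auto simp: lift_sines_def)
    from by_parts_sine[OF e this DL2[OF e] DDL2[OF e e] wH[OF e e], of "lift_freq k m"]
    show "(LINT x|leb Om. (Hv x ?e \<bullet> ?e) * trig_sys (l, a) (u, b) (lift_sines Basis False) (lift_freq k m) x)
      = - freq k i * (LINT x|leb Om. (Dv x \<bullet> ?e) * trig_sys (l, a) (u, b) (lift_sines (Basis - {i}) False) (lift_freq k m) x)"
      by (simp add: lift_sines_remove lift_freq_def)
  qed
  with coeff_lateral[OF i, of k] show ?thesis
    by eventually_elim (simp add: power2_eq_square)
qed

end

lemma AE_zero_continuous_open:
  fixes f :: "'a::euclidean_space => real"
  assumes f: "continuous_on W f" and W: "open W" "W \<subseteq> V" "V \<in> sets borel"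
    and ae: "AE x in leb V. f x = 0" and x: "x \<in> W"
  shows "f x = 0"
proof (rule ccontr)
  assume n: "f x \<noteq> 0"
  let ?Z = "W \<inter> f -` (- {0})"
  have "open ?Z" by (rule continuous_open_preimage[OF f W(1)]) auto
  moreover have "?Z \<noteq> {}" using x n by auto
  ultimately have nn: "\<not> negligible ?Z" using open_not_negligible by blast
  have "AE x in lborel. x \<in> V \<longrightarrow> f x = 0"
    using ae W(3) by (subst (asm) AE_lebesgue_on_iff) auto
  then have "AE x in lebesgue. x \<in> V \<longrightarrow> f x = 0" by (rule AE_completion)
  then obtain N where N: "N \<in> null_sets lebesgue" "\<And>x. x \<notin> N ==> x \<in> V \<longrightarrow> f x = 0"
    unfolding completion.AE_iff_null_sets by auto
  have "negligible N" using N(1) by (simp add: negligible_iff_null_sets)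
  then have "negligible ?Z" by (rule negligible_subset) (use N(2) W(2) in auto)
  with nn show False by simp
qed

lemma AE_eq_continuous_interval:
  fixes f g :: "real => real"
  assumes ab: "a < b" and f: "continuous_on {a..b} f" and g: "continuous_on {a..b} g"
    and ae: "AE t in leb {a<..<b}. f t = g t" and z: "z \<in> {a..b}"
  shows "f z = g z"
proof -
  have eq: "f t - g t = 0" if t: "t \<in> {a<..<b}" for t
  proof (rule AE_zero_continuous_open[OF _ open_greaterThanLessThan order_refl _ _ t])
    show "continuous_on {a<..<b} (\<lambda>t. f t - g t)"
      by (intro continuous_intros continuous_on_subset[OF f] continuous_on_subset[OF g]) auto
    show "AE t in leb {a<..<b}. f t - g t = 0" using ae by eventually_elim simp
  qed simp
  have "continuous_on (closure {a<..<b}) (\<lambda>t. f t - g t)"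
    using ab by (auto intro!: continuous_intros f g)
  from continuous_constant_on_closure[OF this eq] z ab show ?thesis by auto
qed

section \<open>The Carleman estimate on a box\<close>

lemma sqL2_mult_integrand:
  assumes "L2_on U (\<lambda>x. w x * f x)"
  shows "integrable (leb U) (\<lambda>x. (w x)^2 * (f x)^2)" "sqL2 U (\<lambda>x. w x * f x) = (LINT x|leb U. (w x)^2 * (f x)^2)"
  using assms by (auto simp: L2_on_def sqL2_def power_mult_distrib)

lemma norm_sq_Basis: "(norm (x::'a::euclidean_space))^2 = (\<Sum>e\<in>Basis. (x \<bullet> e)^2)"
  unfolding power2_norm_eq_inner euclidean_inner[of x x] by (simp only: power2_eq_square)

lemma exp_half_sq: "(exp (c / 2))^2 = exp (c::real)"
  by (simp add: power2_eq_square exp_add[symmetric])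

context box_H2
begin

abbreviation "mode k \<equiv> slice_coeff l u Basis v k"
abbreviation "mode_g k \<equiv> slice_coeff l u Basis (\<lambda>x. Dv x \<bullet> (0, 1)) k"
abbreviation "mode_h k \<equiv> slice_coeff l u Basis (\<lambda>x. Hv x (0, 1) \<bullet> (0, 1)) k"
abbreviation "normal_trace \<equiv> top_trace a b (\<lambda>x. Dv x \<bullet> (0, 1)) (\<lambda>x. Hv x (0, 1) \<bullet> (0, 1))"

lemma Abox: "box l u \<in> sets borel" "bounded (box l u)" by (auto simp: bounded_box)

text \<open>This prepares the hypotheses of \<open>carleman_1d\<close>. The coefficient itself, and
  not just a representative, is a primitive of \<open>G\<close>, because it is continuous up to the
  end points.\<close>

lemma mode_ac:
  "\<exists>G. ac_on a b (mode k) G \<and> ac_on a b G (mode_h k) \<and> (AE z in leb {a<..<b}. mode_g k z = G z)"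
proof -
  obtain V where V: "ac_on a b V (mode_g k)" "AE z in leb {a<..<b}. mode k z = V z"
    using coeff_vertical_ac[OF vL2 DL2[OF basis_top] wD[OF basis_top]] by blast
  obtain G where G: "ac_on a b G (mode_h k)" "AE z in leb {a<..<b}. mode_g k z = G z"
    using coeff_vertical_ac[OF DL2[OF basis_top] DDL2[OF basis_top basis_top] wH[OF basis_top basis_top]] by blast
  have eq: "mode k z = V z" if "z \<in> {a..b}" for z
    by (rule AE_eq_continuous_interval[OF ab(2) coeff_continuous ac_on_continuous[OF V(1)] V(2) that])
  have "ac_on a b (mode k) G"
    by (rule ac_on_cong_AE[OF V(1) _ L2_on_measurable[OF ac_on_L2[OF G(1)]] G(2)]) (simp add: eq)
  with G show ?thesis by blast
qed

lemma top_value_L2: "L2_on (box l u) (\<lambda>y. v (y, b))"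
proof (rule L2_on_continuous[of "cbox l u"])
  show "continuous_on (cbox l u) (\<lambda>y. v (y, b))"
    by (rule continuous_on_compose2[OF cont]) (use ab in \<open>auto intro!: continuous_intros\<close>)
qed (auto simp: box_subset_cbox)

text \<open>The derivative of \<open>G\<close> times the weight \<open>(z - a) / (b - a)\<close>
  integrates to \<open>G b\<close>; Fubini identifies this integral with the coefficient of the top
  trace.\<close>

lemma top_trace_coeff:
  assumes DL: "L2_on Om f" and HL: "L2_on Om f'"
    and G: "ac_on a b G (slice_coeff l u Basis f' k)" "AE z in leb {a<..<b}. slice_coeff l u Basis f k z = G z"
  shows "G b = trig_coeff l u Basis (top_trace a b f f') k"
proof -
  let ?M = "leb {a<..<b}"
  let ?D = f and ?H = f' and ?e = "trig_sys l u Basis k"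
  let ?\<eta> = "\<lambda>z. (z - a) / (b - a)"
  obtain K where "\<And>x. x \<in> cbox l u ==> \<bar>?e x\<bar> \<le> K"
    using smooth_fun_bounded_on_cbox[OF smooth_fun_trig_sys] by blast
  then have K: "\<And>x. x \<in> box l u ==> \<bar>?e x\<bar> \<le> K" using box_subset_cbox[of l u] by blast
  have gen: "(p * s + q * c) * r = p * (r * s) + q * (r * c)" for p q r s c :: real
    by (simp add: algebra_simps)
  have eta: "continuous_on UNIV ?\<eta>" using ab by (intro continuous_intros) auto
  have "trig_coeff l u Basis (top_trace a b f f') k = (LINT x|leb Om. (?H x * ?\<eta> (snd x) + ?D x * (1 / (b - a))) * ?e (fst x))"
    unfolding trig_coeff_def
    by (rule top_trace_L2(4)[OF ab(2) Abox DL HL smooth_fun_bounded_measure[OF smooth_fun_trig_sys] K])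
  also have "\<dots> = (LINT x|leb Om. ?H x * (?e (fst x) * ?\<eta> (snd x)) + ?D x * (?e (fst x) * (1 / (b - a))))"
    by (rule lint_cong[OF refl]) (rule gen)
  also have "\<dots> = (LINT x|leb Om. ?H x * (?e (fst x) * ?\<eta> (snd x))) + (LINT x|leb Om. ?D x * (?e (fst x) * (1 / (b - a))))"
  proof (rule lint_add)
    have cm: "L2_on Om (\<lambda>x. ?e (fst x) * \<theta> (snd x))" if "continuous_on UNIV \<theta>" for \<theta>
    proof (rule L2_on_continuous[of "cbox (l, a) (u, b)"])
      have "continuous_on UNIV (\<lambda>x. ?e (fst x) * \<theta> (snd x))"
        by (intro continuous_on_mult continuous_on_fst_comp[OF smooth_fun_continuous[OF smooth_fun_trig_sys]] continuous_on_snd_comp that)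
      then show "continuous_on (cbox (l, a) (u, b)) (\<lambda>x. ?e (fst x) * \<theta> (snd x))" by (rule continuous_on_subset) simp
    qed (simp_all add: Om_box box_subset_cbox)
    show "integrable (leb Om) (\<lambda>x. ?H x * (?e (fst x) * ?\<eta> (snd x)))"
      by (rule L2_on_integrable_mult[OF HL cm[OF eta]])
    show "integrable (leb Om) (\<lambda>x. ?D x * (?e (fst x) * (1 / (b - a))))"
      by (rule L2_on_integrable_mult[OF DL cm[of "\<lambda>_. 1 / (b - a)"]]) simp
  qed
  also have "\<dots> = (LINT z|?M. slice_coeff l u Basis f' k z * ?\<eta> z) + (LINT z|?M. slice_coeff l u Basis f k z * (1 / (b - a)))"
    unfolding slice_coeff_L2(2)[OF HL eta, of Basis k] slice_coeff_L2(2)[OF DL continuous_on_const, of Basis k "1 / (b - a)"] by (rule refl)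
  also have "(LINT z|?M. slice_coeff l u Basis f k z * (1 / (b - a))) = (LINT z|?M. 1 / (b - a) * G z)"
    by (rule integral_cong_AE)
      (use G(2) L2_on_measurable[OF slice_coeff_L2(1)[OF DL]] L2_on_measurable[OF ac_on_L2[OF G(1)]] in \<open>auto elim: eventually_mono\<close>)
  also have "(LINT z|?M. slice_coeff l u Basis f' k z * ?\<eta> z) + (LINT z|?M. 1 / (b - a) * G z) = (LINT z|?M. slice_coeff l u Basis f' k z * ?\<eta> z + 1 / (b - a) * G z)"
  proof (rule lint_add[symmetric])
    show "integrable ?M (\<lambda>z. slice_coeff l u Basis f' k z * ?\<eta> z)"
      by (rule L2_on_integrable_mult[OF slice_coeff_L2(1)[OF HL] L2_on_continuous[of "{a..b}"]])
        (auto intro: continuous_on_subset[OF eta])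
    show "integrable ?M (\<lambda>z. 1 / (b - a) * G z)"
      using L2_on_integrable[OF _ ac_on_L2[OF G(1)]] by simp
  qed
  also have "\<dots> = G b * ?\<eta> b - G a * ?\<eta> a"
  proof -
    have "ac_on a b ?\<eta> (\<lambda>_. 1 / (b - a))"
      by (rule ac_on_C1) (use ab in \<open>auto intro!: derivative_eq_intros\<close>)
    from ac_on_diff_ends[OF ac_on_mult[OF G(1) this]] ab show ?thesis by simp
  qed
  also have "\<dots> = G b" using ab by simp
  finally show ?thesis by simp
qed

text \<open>Both functions have the same sine coefficients, namely the values at \<open>b\<close> of
  the absolutely continuous modes.\<close>

lemma top_trace_eq: "AE y in leb (box l u). top_trace a b v (\<lambda>x. Dv x \<bullet> (0, 1)) y = v (y, b)"
proof -
  let ?T = "top_trace a b v (\<lambda>x. Dv x \<bullet> (0, 1))"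
  have TL: "L2_on (box l u) ?T" by (rule top_trace_L2(1)[OF ab(2) Abox vL2 DL2[OF basis_top]])
  have eL: "L2_on (box l u) (trig_sys l u Basis k)" for k by (rule L2_on_smooth[OF smooth_fun_trig_sys])
  have "trig_coeff l u Basis (\<lambda>y. ?T y - v (y, b)) k = 0" for k
  proof -
    obtain V where V: "ac_on a b V (mode_g k)" "AE z in leb {a<..<b}. mode k z = V z"
      using coeff_vertical_ac[OF vL2 DL2[OF basis_top] wD[OF basis_top]] by blast
    have "mode k b = V b"
      by (rule AE_eq_continuous_interval[OF ab(2) coeff_continuous ac_on_continuous[OF V(1)] V(2)]) (use ab in simp)
    then have "trig_coeff l u Basis (\<lambda>y. v (y, b)) k = trig_coeff l u Basis ?T k"
      using top_trace_coeff[OF vL2 DL2[OF basis_top] V] by (simp add: slice_coeff_def)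
    then show ?thesis
      using L2_on_integrable_mult[OF TL eL[of k]] L2_on_integrable_mult[OF top_value_L2 eL[of k]]
      by (simp add: trig_coeff_def left_diff_distrib)
  qed
  have "AE y in leb (box l u). ?T y - v (y, b) = 0"
    by (rule trig_coeff_eq_0_AE[OF lu L2_on_diff[OF TL top_value_L2] \<open>\<And>k. trig_coeff l u Basis (\<lambda>y. ?T y - v (y, b)) k = 0\<close>])
  then show ?thesis by eventually_elim simp
qed

end

context box_Dirichlet
begin

lemma mode_normal_trace:
  assumes G: "ac_on a b G (mode_h k)" "AE z in leb {a<..<b}. mode_g k z = G z"
  shows "G b = trig_coeff l u Basis normal_trace k"
  by (rule top_trace_coeff[OF DL2[OF basis_top] DDL2[OF basis_top basis_top] G])

lemma mode_bottom: "mode k a = 0"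
proof -
  have "(LINT y|leb (box l u). v (y, a) * trig_sys l u Basis k y) = (LINT y|leb (box l u). 0)"
  proof (rule lint_cong[OF refl])
    fix y assume "y \<in> space (leb (box l u))"
    then have "y \<in> cbox l u" using box_subset_cbox by auto
    then show "v (y, a) * trig_sys l u Basis k y = 0" using bottom by simp
  qed
  then show ?thesis by (simp add: slice_coeff_def trig_coeff_def)
qed

text \<open>The weight depends on z alone and factors out of the lateral norm; its square root is
  bounded on the box, so weighted functions remain square integrable.\<close>

lemma weighted_slice:
  assumes f: "L2_on Om f"
  shows "integrable (leb {a<..<b}) (\<lambda>z. exp (lam * z^2) * sqL2 (box l u) (\<lambda>y. f (y, z)))"
    and "(LINT z|leb {a<..<b}. exp (lam * z^2) * sqL2 (box l u) (\<lambda>y. f (y, z))) = (LINT x|leb Om. exp (lam * (snd x)^2) * (f x)^2)"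
    and "integrable (leb Om) (\<lambda>x. exp (lam * (snd x)^2) * (f x)^2)"
proof -
  let ?E = "\<lambda>z. exp (lam * z^2 / 2)"
  have wL: "L2_on Om (\<lambda>x. ?E (snd x) * f x)"
  proof (rule L2_on_mult_bounded[OF f])
    show "(\<lambda>x. ?E (snd x)) \<in> borel_measurable (leb Om)"
      by (intro measurable_restrict_space1 measurable_completion)
        (auto intro!: borel_measurable_continuous_onI continuous_intros)
    show "\<bar>?E (snd x)\<bar> \<le> exp (\<bar>lam\<bar> * b^2 / 2)" if "x \<in> Om" for x
    proof -
      have "(snd x)^2 \<le> b^2" using that ab by (auto intro!: power_mono)
      then have "lam * (snd x)^2 \<le> \<bar>lam\<bar> * b^2" by (intro mult_mono) auto
      then show ?thesis by simp
    qed
  qed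
  note m = sqL2_mult_integrand[OF wL]
  have s: "sqL2 (box l u) (\<lambda>y. ?E (snd (y, z)) * f (y, z)) = exp (lam * z^2) * sqL2 (box l u) (\<lambda>y. f (y, z))" for z
    by (simp add: sqL2_cmult exp_half_sq)
  show "integrable (leb {a<..<b}) (\<lambda>z. exp (lam * z^2) * sqL2 (box l u) (\<lambda>y. f (y, z)))"
    using slice_L2(2)[OF wL] unfolding s .
  show "(LINT z|leb {a<..<b}. exp (lam * z^2) * sqL2 (box l u) (\<lambda>y. f (y, z))) = (LINT x|leb Om. exp (lam * (snd x)^2) * (f x)^2)"
    using slice_L2(3)[OF wL] m(2) unfolding s by (simp only: exp_half_sq)
  show "integrable (leb Om) (\<lambda>x. exp (lam * (snd x)^2) * (f x)^2)"
    using m(1) by (simp only: exp_half_sq)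
qed

lemma weighted_integrable:
  assumes f: "L2_on {a<..<b} f"
  shows "integrable (leb {a<..<b}) (\<lambda>z. exp (lam * z^2) * (f z)^2)"
proof -
  have "L2_on {a<..<b} (\<lambda>z. exp (lam * z^2 / 2) * f z)"
  proof (rule L2_on_mult_bounded[OF f])
    show "(\<lambda>z. exp (lam * z^2 / 2)) \<in> borel_measurable (leb {a<..<b})"
      by (intro measurable_restrict_space1 measurable_completion)
        (auto intro!: borel_measurable_continuous_onI continuous_intros)
    show "\<bar>exp (lam * z^2 / 2)\<bar> \<le> exp (\<bar>lam\<bar> * b^2 / 2)" if "z \<in> {a<..<b}" for z
    proof -
      have "z^2 \<le> b^2" using that ab by (auto intro!: power_mono)
      then have "lam * z^2 \<le> \<bar>lam\<bar> * b^2" by (intro mult_mono) auto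
      then show ?thesis by simp
    qed
  qed
  from sqL2_mult_integrand(1)[OF this] show ?thesis by (simp only: exp_half_sq)
qed

text \<open>The eigenvalue of minus the lateral Dirichlet Laplacian for the sine mode
  \<open>k\<close>.\<close>

definition "mu k = (\<Sum>i\<in>Basis. (freq k i)^2)"

lemma mu_nonneg: "mu k \<ge> 0" unfolding mu_def by (intro sum_nonneg) auto

definition "laplace x = (\<Sum>e\<in>Basis. Hv x e \<bullet> e)"

lemma sum_Basis_prod: "(\<Sum>e\<in>Basis. f e) = (\<Sum>i\<in>(Basis :: 'b set). f (i, 0)) + f (0, 1::real)"
proof -
  have inj: "inj_on (\<lambda>i. (i, 0::real)) (Basis :: 'b set)" by (auto intro: inj_onI)
  have "(\<Sum>e\<in>Basis. f e) = (\<Sum>e\<in>(\<lambda>i. (i, 0)) ` (Basis :: 'b set). f e) + (\<Sum>e\<in>(\<lambda>t. (0, t)) ` (Basis :: real set). f e)"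
    unfolding Basis_prod_def by (rule sum.union_disjoint) auto
  then show ?thesis by (simp add: sum.reindex[OF inj])
qed

lemma laplace_L2: "L2_on Om laplace"
  unfolding laplace_def[abs_def] by (intro L2_on_sum DDL2)

lemma laplace_coeff:
  "AE z in leb {a<..<b}. slice_coeff l u Basis laplace k z = mode_h k z - mu k * mode k z"
proof -
  have 1: "AE z in leb {a<..<b}. \<forall>e\<in>Basis. L2_on (box l u) (\<lambda>y. Hv (y, z) e \<bullet> e)"
    by (intro AE_finite_allI finite_Basis slice_L2(1) DDL2)
  have 2: "AE z in leb {a<..<b}. \<forall>i\<in>Basis. slice_coeff l u Basis (\<lambda>x. Hv x (i, 0) \<bullet> (i, 0)) k z = - (freq k i)\<^sup>2 * mode k z"
    by (intro AE_finite_allI finite_Basis coeff_lateral_second)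
  show ?thesis using 1 2
  proof eventually_elim
    case (elim z)
    have eL: "L2_on (box l u) (trig_sys l u Basis k)" by (rule L2_on_smooth[OF smooth_fun_trig_sys])
    have "slice_coeff l u Basis laplace k z = (LINT y|leb (box l u). (\<Sum>e\<in>Basis. (Hv (y, z) e \<bullet> e) * trig_sys l u Basis k y))"
      by (simp only: slice_coeff_def trig_coeff_def laplace_def sum_distrib_right)
    also have "\<dots> = (\<Sum>e\<in>Basis. slice_coeff l u Basis (\<lambda>x. Hv x e \<bullet> e) k z)"
      unfolding slice_coeff_def trig_coeff_def
      by (rule lint_sum) (use elim(1) eL L2_on_integrable_mult in blast)
    also have "\<dots> = (\<Sum>i\<in>Basis. slice_coeff l u Basis (\<lambda>x. Hv x (i, 0) \<bullet> (i, 0)) k z) + mode_h k z"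
      by (rule sum_Basis_prod)
    also have "(\<Sum>i\<in>Basis. slice_coeff l u Basis (\<lambda>x. Hv x (i, 0) \<bullet> (i, 0)) k z) = (\<Sum>i\<in>Basis. - (freq k i)\<^sup>2 * mode k z)"
      by (rule sum.cong[OF refl]) (use elim(2) in blast)
    also have "\<dots> = - mu k * mode k z" by (simp add: mu_def sum_distrib_right sum_negf)
    finally show ?case by simp
  qed
qed

definition "slice_energy z = sqL2 (box l u) (\<lambda>y. Dv (y, z) \<bullet> (0, 1))
   + (\<Sum>i\<in>Basis. sqL2 (box l u) (\<lambda>y. Dv (y, z) \<bullet> (i, 0))) + sqL2 (box l u) (\<lambda>y. v (y, z))"

definition "mode_energy k z = (mode_g k z)^2 + mu k * (mode k z)^2 + (mode k z)^2"

text \<open>Parseval is used with a different system for each component: all sines for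
  \<open>v\<close> and its vertical derivative, cosines in direction \<open>i\<close> for the
  derivative in that direction. The squares of the latter coefficients add up to \<open>mu k\<close>
  times the squared mode. The upper bound by Bessel serves as majorant in
  \<open>carleman_box\<close>.\<close>

lemma slice_energy_series:
  "AE z in leb {a<..<b}. (\<lambda>N. \<Sum>k\<in>freqs N. mode_energy k z) \<longlonglongrightarrow> slice_energy z
     \<and> (\<forall>N. (\<Sum>k\<in>freqs N. mode_energy k z) \<le> slice_energy z)"
proof -
  let ?M = "leb {a<..<b}"
  have 0: "AE z in ?M. L2_on (box l u) (\<lambda>y. v (y, z))" by (rule slice_L2(1)[OF vL2])
  have 1: "AE z in ?M. \<forall>e\<in>Basis. L2_on (box l u) (\<lambda>y. Dv (y, z) \<bullet> e)"
    by (intro AE_finite_allI finite_Basis slice_L2(1) DL2)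
  have 2: "AE z in ?M. \<forall>N. \<forall>k\<in>freqs N. \<forall>i\<in>Basis. slice_coeff l u (Basis - {i}) (\<lambda>x. Dv x \<bullet> (i, 0)) k z = freq k i * mode k z"
    by (subst AE_all_countable) (intro allI AE_finite_allI finite_Basis finite_freqs coeff_lateral)
  show ?thesis using 0 1 2
  proof eventually_elim
    case (elim z)
    have top: "L2_on (box l u) (\<lambda>y. Dv (y, z) \<bullet> (0, 1))" using elim(2) basis_top by blast
    have lat: "L2_on (box l u) (\<lambda>y. Dv (y, z) \<bullet> (i, 0))" if "i \<in> Basis" for i using elim(2) basis_lat[OF that] by blast
    have split: "(\<Sum>k\<in>freqs N. mode_energy k z) = (\<Sum>k\<in>freqs N. (trig_coeff l u Basis (\<lambda>y. Dv (y, z) \<bullet> (0, 1)) k)^2)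
       + (\<Sum>i\<in>Basis. \<Sum>k\<in>freqs N. (trig_coeff l u (Basis - {i}) (\<lambda>y. Dv (y, z) \<bullet> (i, 0)) k)^2)
       + (\<Sum>k\<in>freqs N. (trig_coeff l u Basis (\<lambda>y. v (y, z)) k)^2)" for N
    proof -
      have "(\<Sum>k\<in>freqs N. mu k * (mode k z)^2) = (\<Sum>k\<in>freqs N. \<Sum>i\<in>Basis. (freq k i * mode k z)^2)"
        unfolding mu_def by (simp only: sum_distrib_right power_mult_distrib)
      also have "\<dots> = (\<Sum>k\<in>freqs N. \<Sum>i\<in>Basis. (trig_coeff l u (Basis - {i}) (\<lambda>y. Dv (y, z) \<bullet> (i, 0)) k)^2)"
      proof (intro sum.cong refl)
        fix k :: "'b => nat" and i :: 'b assume "k \<in> freqs N" "i \<in> Basis"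
        then have "slice_coeff l u (Basis - {i}) (\<lambda>x. Dv x \<bullet> (i, 0)) k z = freq k i * mode k z" using elim(3) by blast
        then show "(freq k i * mode k z)^2 = (trig_coeff l u (Basis - {i}) (\<lambda>y. Dv (y, z) \<bullet> (i, 0)) k)^2"
          by (simp only: slice_coeff_def)
      qed
      also have "\<dots> = (\<Sum>i\<in>Basis. \<Sum>k\<in>freqs N. (trig_coeff l u (Basis - {i}) (\<lambda>y. Dv (y, z) \<bullet> (i, 0)) k)^2)"
        by (rule sum.swap)
      finally show ?thesis
        unfolding mode_energy_def sum.distrib by (simp only: slice_coeff_def)
    qed
    have "(\<lambda>N. \<Sum>k\<in>freqs N. mode_energy k z) \<longlonglongrightarrow> slice_energy z"
      unfolding split slice_energy_def by (intro tendsto_add tendsto_sum trig_Parseval lu top lat elim(1))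
    moreover have "(\<Sum>k\<in>freqs N. mode_energy k z) \<le> slice_energy z" for N
      unfolding split slice_energy_def by (intro add_mono sum_mono trig_Bessel lu top lat elim(1))
    ultimately show ?case by blast
  qed
qed

lemma slice_energy_integral:
  shows "integrable (leb {a<..<b}) (\<lambda>z. exp (lam * z^2) * slice_energy z)"
    and "(LINT z|leb {a<..<b}. exp (lam * z^2) * slice_energy z)
      = (LINT x|leb Om. exp (lam * (snd x)^2) * ((norm (Dv x))^2 + (v x)^2))"
proof -
  let ?w = "\<lambda>z. exp (lam * z^2)"
  note t = weighted_slice[OF DL2[OF basis_top], where lam=lam] and vv = weighted_slice[OF vL2, where lam=lam]
  note la = weighted_slice[OF DL2[OF basis_lat], where lam=lam]
  have e: "?w z * slice_energy z = ?w z * sqL2 (box l u) (\<lambda>y. Dv (y, z) \<bullet> (0, 1))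
     + (\<Sum>i\<in>Basis. ?w z * sqL2 (box l u) (\<lambda>y. Dv (y, z) \<bullet> (i, 0))) + ?w z * sqL2 (box l u) (\<lambda>y. v (y, z))" for z
    by (simp only: slice_energy_def distrib_left sum_distrib_left)
  have ils: "integrable (leb {a<..<b}) (\<lambda>z. \<Sum>i\<in>Basis. ?w z * sqL2 (box l u) (\<lambda>y. Dv (y, z) \<bullet> (i, 0)))"
    by (rule lintable_sum) (rule la(1))
  show "integrable (leb {a<..<b}) (\<lambda>z. ?w z * slice_energy z)"
    unfolding e by (intro lintable_add t(1) vv(1) ils)
  have las: "(LINT z|leb {a<..<b}. (\<Sum>i\<in>Basis. ?w z * sqL2 (box l u) (\<lambda>y. Dv (y, z) \<bullet> (i, 0))))
     = (\<Sum>i\<in>Basis. \<integral>x. ?w (snd x) * (Dv x \<bullet> (i, 0))^2 \<partial>leb Om)"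
    by (subst lint_sum, erule la(1)) (rule sum.cong[OF refl], erule la(2))
  have las': "(LINT x|leb Om. (\<Sum>i\<in>Basis. ?w (snd x) * (Dv x \<bullet> (i, 0))^2))
     = (\<Sum>i\<in>Basis. \<integral>x. ?w (snd x) * (Dv x \<bullet> (i, 0))^2 \<partial>leb Om)"
    by (rule lint_sum) (erule la(3))
  have n: "(norm (Dv x))^2 = (\<Sum>i\<in>Basis. (Dv x \<bullet> (i, 0))^2) + (Dv x \<bullet> (0, 1))^2" for x
    unfolding norm_sq_Basis by (rule sum_Basis_prod)
  have "(LINT z|leb {a<..<b}. ?w z * slice_energy z)
    = (LINT x|leb Om. ?w (snd x) * (Dv x \<bullet> (0, 1))^2)
     + (\<Sum>i\<in>Basis. \<integral>x. ?w (snd x) * (Dv x \<bullet> (i, 0))^2 \<partial>leb Om) + (LINT x|leb Om. ?w (snd x) * (v x)^2)"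
    unfolding e lint_add[OF lintable_add[OF t(1) ils] vv(1)]
      lint_add[OF t(1) ils] las t(2) vv(2) by (rule refl)
  also have "\<dots> = (LINT x|leb Om. ?w (snd x) * (Dv x \<bullet> (0, 1))^2 + (\<Sum>i\<in>Basis. ?w (snd x) * (Dv x \<bullet> (i, 0))^2) + ?w (snd x) * (v x)^2)"
  proof -
    have ils': "integrable (leb Om) (\<lambda>x. \<Sum>i\<in>Basis. ?w (snd x) * (Dv x \<bullet> (i, 0))^2)"
      by (rule lintable_sum) (rule la(3))
    show ?thesis
      unfolding lint_add[OF lintable_add[OF t(3) ils'] vv(3)]
        lint_add[OF t(3) ils'] las' by (rule refl)
  qed
  also have "\<dots> = (LINT x|leb Om. ?w (snd x) * ((norm (Dv x))^2 + (v x)^2))"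
    by (rule lint_cong[OF refl]) (simp only: n distrib_left sum_distrib_left add_ac)
  finally show "(LINT z|leb {a<..<b}. ?w z * slice_energy z)
      = (LINT x|leb Om. ?w (snd x) * ((norm (Dv x))^2 + (v x)^2))" .
qed

lemma mode_carleman:
  assumes lam: "lam > 0" "lam * a^2 \<ge> 6"
  shows "lam * (LINT z|leb {a<..<b}. exp (lam * z^2) * mode_energy k z)
    \<le> carleman_const a b * (2 * (LINT z|leb {a<..<b}. exp (lam * z^2) * (slice_coeff l u Basis laplace k z)^2)
       + carleman_bdry b lam * ((trig_coeff l u Basis (\<lambda>y. v (y, b)) k)^2 + (trig_coeff l u Basis normal_trace k)^2))"
proof -
  let ?M = "leb {a<..<b}"
  obtain G where G: "ac_on a b (mode k) G" "ac_on a b G (mode_h k)" "AE z in ?M. mode_g k z = G z"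
    using mode_ac by blast
  note hL = slice_coeff_L2(1)[OF DDL2[OF basis_top basis_top], of Basis k]
  note C = carleman_1d[OF ab lam mu_nonneg[of k] G(1,2) hL mode_bottom]
  have m: "mode k \<in> borel_measurable ?M" "mode_g k \<in> borel_measurable ?M" "mode_h k \<in> borel_measurable ?M"
    "G \<in> borel_measurable ?M" "slice_coeff l u Basis laplace k \<in> borel_measurable ?M"
    by (rule L2_on_measurable[OF slice_coeff_L2(1)[OF vL2]] L2_on_measurable[OF slice_coeff_L2(1)[OF DL2[OF basis_top]]]
      L2_on_measurable[OF hL] L2_on_measurable[OF ac_on_L2[OF G(2)]] L2_on_measurable[OF slice_coeff_L2(1)[OF laplace_L2]])+
  have w: "(\<lambda>z. exp (lam * z^2)) \<in> borel_measurable ?M"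
    by (intro measurable_restrict_space1 measurable_completion)
      (auto intro!: borel_measurable_continuous_onI continuous_intros)
  have 1: "(LINT z|?M. exp (lam * z^2) * mode_energy k z)
     = (LINT t|?M. exp (lam * t^2) * ((G t)^2 + mu k * (mode k t)^2 + (mode k t)^2))"
    unfolding mode_energy_def
    by (rule integral_cong_AE) (use m w G(3) in \<open>auto elim: eventually_mono\<close>)
  have 2: "(LINT t|?M. exp (lam * t^2) * (mode_h k t - mu k * mode k t)^2)
     = (LINT z|?M. exp (lam * z^2) * (slice_coeff l u Basis laplace k z)^2)"
    by (rule integral_cong_AE) (use m w laplace_coeff[of k] in \<open>auto elim: eventually_mono\<close>)
  have "mode k b = trig_coeff l u Basis (\<lambda>y. v (y, b)) k" by (simp add: slice_coeff_def)
  with C show ?thesis unfolding 1 2 mode_normal_trace[OF G(2,3)] by simp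
qed

theorem carleman_box:
  assumes lam: "lam > 0" "lam * a^2 \<ge> 6"
  shows "lam * (LINT x|leb Om. exp (lam * (snd x)^2) * ((norm (Dv x))^2 + (v x)^2))
    \<le> carleman_const a b * (2 * (LINT x|leb Om. exp (lam * (snd x)^2) * (laplace x)^2)
       + carleman_bdry b lam * (sqL2 (box l u) (\<lambda>y. v (y, b)) + sqL2 (box l u) normal_trace))"
    (is "_ \<le> ?R")
proof -
  let ?M = "leb {a<..<b}" and ?w = "\<lambda>z. exp (lam * z^2)"
  have K: "carleman_const a b \<ge> 0" and Bd: "carleman_bdry b lam \<ge> 0"
    using ab lam by (simp_all add: carleman_const_def carleman_bdry_def)
  note vb = top_value_L2
  have nt: "L2_on (box l u) normal_trace"
    by (rule top_trace_L2(1)[OF ab(2) Abox DL2[OF basis_top] DDL2[OF basis_top basis_top]])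
  have iE: "integrable ?M (\<lambda>z. ?w z * mode_energy k z)" for k
  proof -
    have "integrable ?M (\<lambda>z. ?w z * (mode_g k z)^2 + mu k * (?w z * (mode k z)^2) + ?w z * (mode k z)^2)"
      by (intro lintable_add integrable_mult_right weighted_integrable slice_coeff_L2(1) vL2 DL2 basis_top)
    then show ?thesis by (simp add: mode_energy_def algebra_simps)
  qed
  have iF: "integrable ?M (\<lambda>z. ?w z * (slice_coeff l u Basis laplace k z)^2)" for k
    by (intro weighted_integrable slice_coeff_L2(1) laplace_L2)
  \<comment> \<open>Bessel's inequality suffices for the right-hand side, which gives a bound
    independent of \<open>N\<close>; convergence of the series is required only on the left.\<close>
  have step: "lam * (LINT z|?M. ?w z * (\<Sum>k\<in>freqs N. mode_energy k z)) \<le> ?R" for N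
  proof -
    have "lam * (LINT z|?M. ?w z * (\<Sum>k\<in>freqs N. mode_energy k z)) = (\<Sum>k\<in>freqs N. lam * (LINT z|?M. ?w z * mode_energy k z))"
      unfolding sum_distrib_left lint_sum[OF iE] by (rule refl)
    also have "\<dots> \<le> (\<Sum>k\<in>freqs N. carleman_const a b * (2 * (LINT z|?M. ?w z * (slice_coeff l u Basis laplace k z)^2)
       + carleman_bdry b lam * ((trig_coeff l u Basis (\<lambda>y. v (y, b)) k)^2 + (trig_coeff l u Basis normal_trace k)^2)))"
      by (intro sum_mono mode_carleman lam)
    also have "\<dots> = carleman_const a b * (2 * (\<Sum>k\<in>freqs N. \<integral>z. ?w z * (slice_coeff l u Basis laplace k z)^2 \<partial>?M)
       + carleman_bdry b lam * ((\<Sum>k\<in>freqs N. (trig_coeff l u Basis (\<lambda>y. v (y, b)) k)^2) + (\<Sum>k\<in>freqs N. (trig_coeff l u Basis normal_trace k)^2)))"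
      by (simp only: sum_distrib_left[symmetric] sum.distrib)
    also have "\<dots> \<le> ?R"
    proof (intro mult_left_mono add_mono trig_Bessel lu vb nt K Bd)
      have "(\<Sum>k\<in>freqs N. \<integral>z. ?w z * (slice_coeff l u Basis laplace k z)^2 \<partial>?M)
         = (LINT z|?M. (\<Sum>k\<in>freqs N. ?w z * (slice_coeff l u Basis laplace k z)^2))"
        by (rule lint_sum[symmetric]) (rule iF)
      also have "\<dots> \<le> (LINT z|?M. ?w z * sqL2 (box l u) (\<lambda>y. laplace (y, z)))"
      proof (rule integral_mono_AE)
        show "integrable ?M (\<lambda>z. \<Sum>k\<in>freqs N. ?w z * (slice_coeff l u Basis laplace k z)^2)"
          by (rule lintable_sum) (rule iF)
        show "integrable ?M (\<lambda>z. ?w z * sqL2 (box l u) (\<lambda>y. laplace (y, z)))" by (rule weighted_slice(1)[OF laplace_L2])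
        show "AE z in ?M. (\<Sum>k\<in>freqs N. ?w z * (slice_coeff l u Basis laplace k z)^2) \<le> ?w z * sqL2 (box l u) (\<lambda>y. laplace (y, z))"
          using slice_L2(1)[OF laplace_L2]
        proof eventually_elim
          case (elim z)
          show ?case unfolding sum_distrib_left[symmetric] slice_coeff_def
            by (intro mult_left_mono trig_Bessel[OF lu elim]) simp_all
        qed
      qed
      also have "\<dots> = (LINT x|leb Om. ?w (snd x) * (laplace x)^2)" by (rule weighted_slice(2)[OF laplace_L2])
      finally show "(\<Sum>k\<in>freqs N. \<integral>z. ?w z * (slice_coeff l u Basis laplace k z)^2 \<partial>?M) \<le> (LINT x|leb Om. ?w (snd x) * (laplace x)^2)" .
    qed simp
    finally show ?thesis .
  qed
  have lim: "(\<lambda>N. \<integral>z. ?w z * (\<Sum>k\<in>freqs N. mode_energy k z) \<partial>?M) \<longlonglongrightarrow> (LINT z|?M. ?w z * slice_energy z)"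
  proof (rule integral_dominated_convergence[where w="\<lambda>z. ?w z * slice_energy z"])
    show "integrable ?M (\<lambda>z. ?w z * slice_energy z)" by (rule slice_energy_integral(1))
    then show "(\<lambda>z. ?w z * slice_energy z) \<in> borel_measurable ?M" by (rule borel_measurable_integrable)
    show "(\<lambda>z. ?w z * (\<Sum>k\<in>freqs N. mode_energy k z)) \<in> borel_measurable ?M" for N
      unfolding sum_distrib_left by (intro borel_measurable_sum borel_measurable_integrable[OF iE])
    show "AE z in ?M. (\<lambda>N. ?w z * (\<Sum>k\<in>freqs N. mode_energy k z)) \<longlonglongrightarrow> ?w z * slice_energy z"
      using slice_energy_series by eventually_elim (intro tendsto_intros, simp)
    show "AE z in ?M. norm (?w z * (\<Sum>k\<in>freqs N. mode_energy k z)) \<le> ?w z * slice_energy z" for N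
      using slice_energy_series
    proof eventually_elim
      case (elim z)
      have "0 \<le> (\<Sum>k\<in>freqs N. mode_energy k z)"
        unfolding mode_energy_def using mu_nonneg by (intro sum_nonneg add_nonneg_nonneg mult_nonneg_nonneg) auto
      with elim show ?case by simp
    qed
  qed
  have "lam * (LINT z|?M. ?w z * slice_energy z) \<le> ?R"
    by (rule LIMSEQ_le_const2[OF tendsto_mult_left[OF lim]]) (use step in blast)
  then show ?thesis unfolding slice_energy_integral(2) .
qed

end

section \<open>The H1 trace on the top face\<close>

text \<open>Unlike \<open>integral_lebesgue_on_FTC\<close> this asks for derivatives only on the
  closed interval, since functions in \<open>C1_near\<close> are differentiable only near the closed
  box.\<close>

lemma FTC_interval:
  fixes f F :: "real => real"
  assumes ab: "a \<le> b" and d: "\<And>t. t \<in> {a..b} ==> (F has_real_derivative f t) (at t)" and c: "continuous_on {a..b} f"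
  shows "(LINT t|leb {a<..<b}. f t) = F b - F a"
proof -
  have "(f has_integral (F b - F a)) {a..b}"
    using assms by (intro fundamental_theorem_of_calculus)
      (auto simp flip: has_real_derivative_iff_has_vector_derivative intro: has_field_derivative_at_within)
  then have 1: "(f has_integral (F b - F a)) {a<..<b}"
    using has_integral_open_interval[of f "F b - F a" a b] by simp
  have "integrable (leb {a<..<b}) f"
    by (rule L2_on_integrable[OF _ L2_on_continuous[OF c]]) auto
  then have "(f has_integral (LINT t|leb {a<..<b}. f t)) {a<..<b}"
    by (rule has_integral_integral_lebesgue_on) simp
  from has_integral_unique[OF this 1] show ?thesis .
qed

lemma class_grad_inner: "e \<in> Basis ==> class_grad f x \<bullet> e = frechet_derivative f (at x) e"
  by (simp add: class_grad_def inner_sum_left_Basis)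

lemma C1_near_partial:
  assumes "C1_near S f"
  shows "continuous_on S f" "continuous_on S (\<lambda>x. frechet_derivative f (at x) e)"
    "\<And>x. x \<in> S ==> (f has_derivative frechet_derivative f (at x)) (at x)"
proof -
  obtain U Df where U: "S \<subseteq> U" "\<And>x. x \<in> U ==> (f has_derivative blinfun_apply (Df x)) (at x)" "continuous_on U Df"
    using assms unfolding C1_near_def by blast
  have eq: "frechet_derivative f (at x) = blinfun_apply (Df x)" if "x \<in> S" for x
    using frechet_derivative_at[OF U(2)] U(1) that by force
  show "(f has_derivative frechet_derivative f (at x)) (at x)" if "x \<in> S" for x
    using U(1,2) that by (simp add: eq[OF that] subset_iff)
  show "continuous_on S f"
    by (rule continuous_at_imp_continuous_on) (use U(1) has_derivative_continuous[OF U(2)] in blast)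
  have "continuous_on S (\<lambda>x. blinfun_apply (Df x) e)"
    using continuous_on_subset[OF U(3,1)] by (intro continuous_intros)
  then show "continuous_on S (\<lambda>x. frechet_derivative f (at x) e)"
    by (rule continuous_on_eq) (simp add: eq)
qed

text \<open>\<open>C1_near\<close> demands continuity of the derivative as a bounded linear map. It
  follows by writing the derivative as a finite combination of inner products with the continuous
  partial derivatives as coefficients.\<close>

lemma smooth_fun_C1_near:
  assumes "smooth_fun f" shows "C1_near S f"
  unfolding C1_near_def
proof (intro exI[of _ UNIV] exI[of _ "\<lambda>x. \<Sum>e\<in>Basis. frechet_derivative f (at x) e *\<^sub>R blinfun_inner_right e"] conjI ballI)
  show "continuous_on UNIV (\<lambda>x. \<Sum>e\<in>Basis. frechet_derivative f (at x) e *\<^sub>R blinfun_inner_right e)"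
    using smooth_fun_continuous[OF smooth_fun_partial[OF assms]] by (intro continuous_intros) auto
  fix x
  have d: "(f has_derivative frechet_derivative f (at x)) (at x)" by (rule smooth_fun_has_derivative[OF assms])
  have lin: "linear (frechet_derivative f (at x))" using d by (rule has_derivative_linear)
  have eq: "frechet_derivative f (at x) h = blinfun_apply (\<Sum>e\<in>Basis. frechet_derivative f (at x) e *\<^sub>R blinfun_inner_right e) h" for h
  proof -
    have "frechet_derivative f (at x) h = frechet_derivative f (at x) (\<Sum>e\<in>Basis. (h \<bullet> e) *\<^sub>R e)"
      by (simp add: euclidean_representation)
    also have "\<dots> = (\<Sum>e\<in>Basis. (h \<bullet> e) * frechet_derivative f (at x) e)"
      by (simp add: linear_sum[OF lin] linear_cmul[OF lin])
    also have "\<dots> = blinfun_apply (\<Sum>e\<in>Basis. frechet_derivative f (at x) e *\<^sub>R blinfun_inner_right e) h"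
      by (simp add: blinfun.sum_left blinfun.scaleR_left inner_commute mult.commute)
    finally show ?thesis .
  qed
  show "(f has_derivative blinfun_apply (\<Sum>e\<in>Basis. frechet_derivative f (at x) e *\<^sub>R blinfun_inner_right e)) (at x)"
    by (rule has_derivative_eq_rhs[OF d]) (rule ext, rule eq)
qed auto

lemma is_H1_grad_L2:
  assumes "is_H1_grad U u Du"
  shows "L2_on U u" "e \<in> Basis ==> L2_on U (\<lambda>x. Du x \<bullet> e)" "e \<in> Basis ==> is_weak_partial U u e (\<lambda>x. Du x \<bullet> e)"
  using assms by (auto simp: is_H1_grad_def)

lemma sqH1_eq:
  assumes "L2_on U u" "\<And>e. e \<in> Basis ==> L2_on U (\<lambda>x. Du x \<bullet> e)"
  shows "sqH1 U u Du = sqL2 U u + (\<Sum>e\<in>Basis. sqL2 U (\<lambda>x. Du x \<bullet> e))"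
    and "integrable (leb U) (\<lambda>x. (u x)^2 + (norm (Du x))^2)"
proof -
  have i: "integrable (leb U) (\<lambda>x. (u x)^2)" "\<And>e. e \<in> Basis ==> integrable (leb U) (\<lambda>x. (Du x \<bullet> e)^2)"
    using assms L2_on_integrable_sq by blast+
  then have isum: "integrable (leb U) (\<lambda>x. \<Sum>e\<in>Basis. (Du x \<bullet> e)^2)" by (intro lintable_sum)
  then show "integrable (leb U) (\<lambda>x. (u x)^2 + (norm (Du x))^2)" unfolding norm_sq_Basis using i by simp
  show "sqH1 U u Du = sqL2 U u + (\<Sum>e\<in>Basis. sqL2 U (\<lambda>x. Du x \<bullet> e))"
    unfolding sqH1_def norm_sq_Basis sqL2_def lint_add[OF i(1) isum]
    by (subst lint_sum) (auto intro: i(2))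
qed

lemma L2_on_continuous_closure:
  fixes U :: "'a::euclidean_space set"
  assumes "open U" "bounded U" "continuous_on (closure U) f"
  shows "L2_on U f"
  by (rule L2_on_continuous[OF assms(3)])
    (use assms in \<open>auto simp: compact_closure closure_subset intro: bounded_set_imp_lmeasurable\<close>)

text \<open>Both functions are tested with cut-off cosines; removing the cutoff shows that their
  cosine coefficients agree, and the cosines are complete.\<close>

lemma weak_partial_unique:
  fixes l u :: "'a::euclidean_space"
  assumes lu: "\<And>j. j \<in> Basis ==> l \<bullet> j < u \<bullet> j"
    and f: "L2_on (box l u) f" and g: "L2_on (box l u) g"
    and w: "is_weak_partial (box l u) v e f" "is_weak_partial (box l u) v e g"
  shows "AE x in leb (box l u). f x = g x"
proof -
  let ?M = "leb (box l u)"
  have "(LINT x|?M. f x * trig_sys l u {} k x) = (LINT x|?M. g x * trig_sys l u {} k x)" for k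
  proof (rule LIMSEQ_unique)
    have eq: "(LINT x|?M. f x * (box_cutoff l u n x * trig_sys l u {} k x)) = (LINT x|?M. g x * (box_cutoff l u n x * trig_sys l u {} k x))" for n
    proof -
      have t: "test_fun (box l u) (\<lambda>x. box_cutoff l u n x * trig_sys l u {} k x)"
        by (rule test_fun_box_cutoff[OF smooth_fun_trig_sys])
      from w[unfolded is_weak_partial_def, rule_format, OF t] show ?thesis by linarith
    qed
    show "(\<lambda>n. \<integral>x. f x * (box_cutoff l u n x * trig_sys l u {} k x) \<partial>?M) \<longlonglongrightarrow> (LINT x|?M. g x * trig_sys l u {} k x)"
      unfolding eq by (rule integral_box_cutoff_tendsto[OF g smooth_fun_trig_sys])
    show "(\<lambda>n. \<integral>x. f x * (box_cutoff l u n x * trig_sys l u {} k x) \<partial>?M) \<longlonglongrightarrow> (LINT x|?M. f x * trig_sys l u {} k x)"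
      by (rule integral_box_cutoff_tendsto[OF f smooth_fun_trig_sys])
  qed
  then have z: "trig_coeff l u {} (\<lambda>x. f x - g x) k = 0" for k
    using L2_on_integrable_mult[OF f L2_on_smooth[OF smooth_fun_trig_sys]] L2_on_integrable_mult[OF g L2_on_smooth[OF smooth_fun_trig_sys]]
    by (simp add: trig_coeff_def left_diff_distrib)
  have "AE x in ?M. f x - g x = 0" by (rule trig_coeff_eq_0_AE[OF lu L2_on_diff[OF f g] z])
  then show ?thesis by eventually_elim simp
qed

text \<open>This removes the choice hidden in \<open>weak_grad\<close>: any weak gradient at hand
  may be used to compute the norm.\<close>

lemma sqH1w_eq:
  fixes l u :: "'a::euclidean_space"
  assumes lu: "\<And>j. j \<in> Basis ==> l \<bullet> j < u \<bullet> j" and g: "is_H1_grad (box l u) v Dv"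
  shows "sqH1w (box l u) v = sqL2 (box l u) v + (\<Sum>e\<in>Basis. sqL2 (box l u) (\<lambda>x. Dv x \<bullet> e))"
proof -
  have w: "is_H1_grad (box l u) v (weak_grad (box l u) v)"
    unfolding weak_grad_def by (rule someI[of "is_H1_grad (box l u) v", OF g])
  have eq: "sqL2 (box l u) (\<lambda>x. weak_grad (box l u) v x \<bullet> e) = sqL2 (box l u) (\<lambda>x. Dv x \<bullet> e)" if e: "e \<in> Basis" for e
    by (rule sqL2_cong_AE[OF L2_on_measurable[OF is_H1_grad_L2(2)[OF w e]] L2_on_measurable[OF is_H1_grad_L2(2)[OF g e]]],
      rule weak_partial_unique[OF lu is_H1_grad_L2(2)[OF w e] is_H1_grad_L2(2)[OF g e] is_H1_grad_L2(3)[OF w e] is_H1_grad_L2(3)[OF g e]])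
  have "sqH1w (box l u) v = sqL2 (box l u) v + (\<Sum>e\<in>Basis. sqL2 (box l u) (\<lambda>x. weak_grad (box l u) v x \<bullet> e))"
    unfolding sqH1w_def by (rule sqH1_eq(1)[OF is_H1_grad_L2(1)[OF w] is_H1_grad_L2(2)[OF w]])
  also have "(\<Sum>e\<in>Basis. sqL2 (box l u) (\<lambda>x. weak_grad (box l u) v x \<bullet> e)) = (\<Sum>e\<in>Basis. sqL2 (box l u) (\<lambda>x. Dv x \<bullet> e))"
    by (rule sum.cong[OF refl eq])
  finally show ?thesis .
qed

text \<open>Partial sums of the cosine series converge in H1 because the weak partial derivatives have
  the term-by-term differentiated series, with respect to systems with a single sine direction.\<close>

lemma H1_smooth_approx:
  fixes l u :: "'a::euclidean_space"
  assumes lu: "\<And>j. j \<in> Basis ==> l \<bullet> j < u \<bullet> j" and g: "is_H1_grad (box l u) v Dv"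
  obtains f where "\<And>n::nat. smooth_fun (f n)"
    "(\<lambda>n. sqL2 (box l u) (\<lambda>x. f n x - v x)) \<longlonglongrightarrow> 0"
    "\<And>e. e \<in> Basis ==> (\<lambda>n. sqL2 (box l u) (\<lambda>x. frechet_derivative (f n) (at x) e - Dv x \<bullet> e)) \<longlonglongrightarrow> 0"
proof
  let ?f = "\<lambda>N. trig_poly l u {} N (trig_coeff l u {} v)"
  show "smooth_fun (?f n)" for n by (rule smooth_fun_trig_poly)
  show "(\<lambda>n. sqL2 (box l u) (\<lambda>x. ?f n x - v x)) \<longlonglongrightarrow> 0"
    by (subst sqL2_minus_commute) (rule trig_series_converges[OF lu is_H1_grad_L2(1)[OF g]])
  fix e :: 'a assume e: "e \<in> Basis"
  let ?D = "\<lambda>x. Dv x \<bullet> e"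
  have co: "trig_coeff l u {e} ?D k = - (real (k e) * pi / (u \<bullet> e - l \<bullet> e)) * trig_coeff l u {} v k" for k
  proof -
    obtain C where C: "\<And>x. x \<in> box l u ==> \<bar>trig_sys l u {e} k x\<bar> \<le> C * (x \<bullet> e - l \<bullet> e)
       \<and> \<bar>trig_sys l u {e} k x\<bar> \<le> C * (u \<bullet> e - x \<bullet> e)"
      using trig_sys_vanish[OF lu e, of "{e}" k] by blast
    have "trig_coeff l u {e} ?D k = - (LINT x|leb (box l u). v x * frechet_derivative (trig_sys l u {e} k) (at x) e)"
      unfolding trig_coeff_def
      by (rule weak_partial_by_parts[OF is_H1_grad_L2(1)[OF g] is_H1_grad_L2(2)[OF g e] is_H1_grad_L2(3)[OF g e] e smooth_fun_trig_sys C])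
    also have "\<dots> = - (LINT x|leb (box l u). (real (k e) * pi / (u \<bullet> e - l \<bullet> e)) * (v x * trig_sys l u {} k x))"
      by (simp add: trig_sys_partial[OF e lu[OF e]] mult.left_commute)
    finally show ?thesis by (simp add: trig_coeff_def)
  qed
  have d: "frechet_derivative (?f N) (at x) e = trig_poly l u {e} N (trig_coeff l u {e} ?D) x" for N x
  proof -
    have "(?f N has_derivative (\<lambda>h. \<Sum>k\<in>freqs N. trig_coeff l u {} v k * frechet_derivative (trig_sys l u {} k) (at x) h)) (at x)"
      unfolding trig_poly_def
      by (intro has_derivative_sum has_derivative_mult_right smooth_fun_has_derivative smooth_fun_trig_sys)
    from frechet_derivative_at[OF this, symmetric]
    have "frechet_derivative (?f N) (at x) e = (\<Sum>k\<in>freqs N. trig_coeff l u {} v k * frechet_derivative (trig_sys l u {} k) (at x) e)"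
      by simp
    also have "\<dots> = trig_poly l u {e} N (trig_coeff l u {e} ?D) x"
      unfolding trig_poly_def co by (intro sum.cong refl) (simp add: trig_sys_partial[OF e lu[OF e]])
    finally show ?thesis .
  qed
  show "(\<lambda>n. sqL2 (box l u) (\<lambda>x. frechet_derivative (?f n) (at x) e - Dv x \<bullet> e)) \<longlonglongrightarrow> 0"
    unfolding d by (subst sqL2_minus_commute) (rule trig_series_converges[OF lu is_H1_grad_L2(2)[OF g e]])
qed

lemma smooth_fun_fst:
  fixes \<phi> :: "'b::euclidean_space => real"
  assumes "smooth_fun \<phi>" shows "smooth_fun (\<lambda>x :: 'b \<times> real. \<phi> (fst x))"
proof -
  have "Ck_on k UNIV (\<lambda>x :: 'b \<times> real. \<phi> (fst x))" if "Ck_on k UNIV \<phi>" for k and \<phi> :: "'b => real"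
    using that
  proof (induction k arbitrary: \<phi>)
    case 0
    then show ?case by (auto intro: continuous_on_fst_comp)
  next
    case (Suc k)
    have "((\<lambda>x :: 'b \<times> real. \<phi> (fst x)) has_derivative (\<lambda>h. frechet_derivative \<phi> (at (fst x)) (fst h))) (at x)" for x
      by (rule has_derivative_compose[OF has_derivative_fst[OF has_derivative_ident] Ck_on_SucD(1)[OF Suc.prems]])
    then show ?case
    proof (rule Ck_on_SucI)
      fix e :: "'b \<times> real" assume "e \<in> Basis"
      then consider i where "i \<in> Basis" "e = (i, 0)" | "e = (0, 1)" by (auto simp: Basis_prod_def)
      then show "Ck_on k UNIV (\<lambda>x :: 'b \<times> real. frechet_derivative \<phi> (at (fst x)) (fst e))"
      proof cases
        case 1
        then show ?thesis using Suc.IH[OF Ck_on_SucD(2)[OF Suc.prems 1(1)]] by simp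
      next
        case 2
        have "linear (frechet_derivative \<phi> (at y))" for y
          using Ck_on_SucD(1)[OF Suc.prems] by (rule has_derivative_linear)
        then have "frechet_derivative \<phi> (at y) 0 = 0" for y by (rule linear_0)
        then show ?thesis using 2 Ck_on_const[of k 0] by simp
      qed
    qed
  qed
  then show ?thesis using assms by (simp add: smooth_fun_def)
qed

text \<open>A compact support keeps a positive distance from the faces, and a bound for
  \<open>\<phi>\<close> divided by this distance works as the constant. It provides the decay for
  \<open>weak_partial_by_parts\<close> when \<open>\<phi>\<close> is extended to the box over its
  base.\<close>

lemma test_fun_box_vanish:
  fixes l u :: "'b::euclidean_space"
  assumes t: "test_fun (box l u) \<phi>" and i: "i \<in> Basis"
  shows "\<exists>K\<ge>0. \<forall>y\<in>box l u. \<bar>\<phi> y\<bar> \<le> K * (y \<bullet> i - l \<bullet> i) \<and> \<bar>\<phi> y\<bar> \<le> K * (u \<bullet> i - y \<bullet> i)"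
proof -
  let ?K = "closure {x. \<phi> x \<noteq> 0}"
  have K: "compact ?K" "?K \<subseteq> box l u" and sm: "smooth_fun \<phi>" using t by (auto simp: test_fun_def)
  obtain C where C: "\<And>x. x \<in> cbox l u ==> \<bar>\<phi> x\<bar> \<le> C" using smooth_fun_bounded_on_cbox[OF sm] by blast
  show ?thesis
  proof (cases "?K = {}")
    case True
    then have "\<phi> y = 0" for y using closure_subset[of "{x. \<phi> x \<noteq> 0}"] by auto
    then show ?thesis by (intro exI[of _ 0]) auto
  next
    case False
    define m where "m y = min (y \<bullet> i - l \<bullet> i) (u \<bullet> i - y \<bullet> i)" for y
    have "continuous_on ?K m" unfolding m_def by (intro continuous_intros)
    from continuous_attains_inf[OF K(1) False this] obtain y0 where y0: "y0 \<in> ?K" "\<And>y. y \<in> ?K ==> m y0 \<le> m y" by blast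
    have m0: "m y0 > 0" using y0(1) K(2) i by (auto simp: m_def mem_box)
    have "\<bar>\<phi> y\<bar> \<le> \<bar>C\<bar> / m y0 * s" if y: "y \<in> box l u" "m y \<le> s" "0 \<le> s" for y s
    proof (cases "\<phi> y = 0")
      case True then show ?thesis using m0 that by simp
    next
      case False
      then have "y \<in> ?K" using closure_subset[of "{x. \<phi> x \<noteq> 0}"] by auto
      then have "m y0 \<le> s" using y0(2) that by force
      then have "\<bar>C\<bar> / m y0 * m y0 \<le> \<bar>C\<bar> / m y0 * s" using m0 by (intro mult_left_mono) auto
      moreover have "\<bar>\<phi> y\<bar> \<le> \<bar>C\<bar>" using C[of y] y(1) box_subset_cbox[of l u] by force
      ultimately show ?thesis using m0 by simp
    qed
    moreover have "m y \<le> y \<bullet> i - l \<bullet> i" "m y \<le> u \<bullet> i - y \<bullet> i" for y by (auto simp: m_def)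
    moreover have "0 \<le> y \<bullet> i - l \<bullet> i" "0 \<le> u \<bullet> i - y \<bullet> i" if "y \<in> box l u" for y using that i by (auto simp: mem_box less_imp_le)
    moreover have "0 \<le> \<bar>C\<bar> / m y0" using m0 by simp
    ultimately show ?thesis by blast
  qed
qed

context box_H2
begin

definition "top_grad y = (\<Sum>i\<in>Basis. top_trace a b (\<lambda>x. Dv x \<bullet> (i, 0)) (\<lambda>x. Hv x (0, 1) \<bullet> (i, 0)) y *\<^sub>R i)"

lemma top_grad_inner:
  "i \<in> Basis ==> top_grad y \<bullet> i = top_trace a b (\<lambda>x. Dv x \<bullet> (i, 0)) (\<lambda>x. Hv x (0, 1) \<bullet> (i, 0)) y"
  unfolding top_grad_def by (simp add: inner_sum_left_Basis)

text \<open>The density of the trace of the i-th derivative uses the derivative in direction i of the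
  z-derivative, not the other mixed derivative, so no symmetry of the weak Hessian is needed.\<close>

lemma top_H1_grad: "is_H1_grad (box l u) (\<lambda>y. v (y, b)) top_grad"
  unfolding is_H1_grad_def
proof (intro conjI ballI)
  show "L2_on (box l u) (\<lambda>y. v (y, b))" by (rule top_value_L2)
  fix i :: 'b assume i: "i \<in> Basis"
  let ?e = "(i, 0) :: 'b \<times> real"
  note e = basis_lat[OF i]
  let ?T = "top_trace a b (\<lambda>x. Dv x \<bullet> ?e) (\<lambda>x. Hv x (0, 1) \<bullet> ?e)"
  let ?H = "\<lambda>x. Hv x (0, 1) \<bullet> ?e" and ?D = "\<lambda>x. Dv x \<bullet> ?e" and ?Dz = "\<lambda>x. Dv x \<bullet> (0, 1)"
  have TL: "L2_on (box l u) ?T" by (rule top_trace_L2(1)[OF ab(2) Abox DL2[OF e] DDL2[OF basis_top e]])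
  then show "L2_on (box l u) (\<lambda>y. top_grad y \<bullet> i)" by (simp add: top_grad_inner[OF i])
  show "is_weak_partial (box l u) (\<lambda>y. v (y, b)) i (\<lambda>y. top_grad y \<bullet> i)"
    unfolding is_weak_partial_def top_grad_inner[OF i]
  proof (intro allI impI)
    fix \<phi> :: "'b => real" assume t: "test_fun (box l u) \<phi>"
    have sm: "smooth_fun \<phi>" using t by (simp add: test_fun_def)
    let ?d\<phi> = "\<lambda>y. frechet_derivative \<phi> (at y) i"
    have sd: "smooth_fun ?d\<phi>" by (rule smooth_fun_partial[OF sm i])
    define \<eta> where "\<eta> x = (x \<bullet> (0, 1) - a) / (b - a)" for x :: "'b \<times> real"
    have eta: "\<eta> x = (snd x - a) / (b - a)" for x by (cases x) (simp add: \<eta>_def)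
    have se: "smooth_fun \<eta>"
    proof -
      have "smooth1 (\<lambda>t. (1 / (b - a)) * t + (- a / (b - a)))"
        by (intro smooth1_add smooth1_mult smooth1_const smooth1_id)
      from smooth_fun_lift[OF this, of "(0, 1)"] show ?thesis
        by (simp add: \<eta>_def[abs_def] diff_divide_distrib)
    qed
    \<comment> \<open>These functions of all variables need not vanish at the top face. The
      integration by parts is in the lateral direction \<open>?e\<close>, and decay is required only
      at the two faces orthogonal to it.\<close>
    have ps: "smooth_fun (\<lambda>x :: 'b \<times> real. \<phi> (fst x))" "smooth_fun (\<lambda>x :: 'b \<times> real. \<phi> (fst x) * \<eta> x)"
      by (intro smooth_fun_fst sm smooth_fun_mult se)+
    have dir: "((\<lambda>t. \<phi> (y + t *\<^sub>R i)) has_real_derivative ?d\<phi> y) (at 0)" for y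
      by (rule frechet_derivative_direction[OF smooth_fun_has_derivative[OF sm]])
    have p1: "frechet_derivative (\<lambda>x. \<phi> (fst x)) (at x) ?e = ?d\<phi> (fst x)" for x :: "'b \<times> real"
      by (rule DERIV_unique[OF frechet_derivative_direction[OF smooth_fun_has_derivative[OF ps(1)]]]) (use dir[of "fst x"] in simp)
    have p2: "frechet_derivative (\<lambda>x. \<phi> (fst x) * \<eta> x) (at x) ?e = ?d\<phi> (fst x) * \<eta> x" for x :: "'b \<times> real"
      by (rule DERIV_unique[OF frechet_derivative_direction[OF smooth_fun_has_derivative[OF ps(2)]]])
        (use DERIV_cmult_right[OF dir[of "fst x"], of "\<eta> x"] in \<open>simp add: eta\<close>)
    obtain K where K: "K \<ge> 0" "\<And>y. y \<in> box l u ==> \<bar>\<phi> y\<bar> \<le> K * (y \<bullet> i - l \<bullet> i) \<and> \<bar>\<phi> y\<bar> \<le> K * (u \<bullet> i - y \<bullet> i)"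
      using test_fun_box_vanish[OF t i] by blast
    have v1: "\<bar>\<phi> (fst x)\<bar> \<le> K * (x \<bullet> ?e - (l, a) \<bullet> ?e) \<and> \<bar>\<phi> (fst x)\<bar> \<le> K * ((u, b) \<bullet> ?e - x \<bullet> ?e)" if "x \<in> box (l, a) (u, b)" for x
      using K(2)[of "fst x"] that by (cases x) (auto simp: box_Pair)
    have v2: "\<bar>\<phi> (fst x) * \<eta> x\<bar> \<le> K * (x \<bullet> ?e - (l, a) \<bullet> ?e) \<and> \<bar>\<phi> (fst x) * \<eta> x\<bar> \<le> K * ((u, b) \<bullet> ?e - x \<bullet> ?e)" if x: "x \<in> box (l, a) (u, b)" for x
    proof -
      have "\<bar>\<eta> x\<bar> \<le> 1" using x ab by (cases x) (auto simp: eta box_Pair box_real divide_le_eq)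
      then have "\<bar>\<phi> (fst x) * \<eta> x\<bar> \<le> \<bar>\<phi> (fst x)\<bar>" unfolding abs_mult by (rule mult_left_le) simp
      with v1[OF x] show ?thesis by linarith
    qed
    have b1: "(LINT x|leb Om. ?D x * \<phi> (fst x)) = - (LINT x|leb Om. v x * ?d\<phi> (fst x))"
      using weak_partial_by_parts[OF vL2[unfolded Om_box] DL2[OF e, unfolded Om_box] wD[OF e, unfolded Om_box] e ps(1) v1]
      by (simp only: p1 Om_box)
    have b2: "(LINT x|leb Om. ?H x * (\<phi> (fst x) * \<eta> x)) = - (LINT x|leb Om. ?Dz x * (?d\<phi> (fst x) * \<eta> x))"
      using weak_partial_by_parts[OF DL2[OF basis_top, unfolded Om_box] DDL2[OF basis_top e, unfolded Om_box] wH[OF basis_top e, unfolded Om_box] e ps(2) v2]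
      by (simp only: p2 Om_box)
    have bd: "\<exists>C. \<forall>y\<in>box l u. \<bar>\<psi> y\<bar> \<le> C" if s: "smooth_fun \<psi>" for \<psi> :: "'b => real"
    proof -
      obtain C where "\<And>x. x \<in> cbox l u ==> \<bar>\<psi> x\<bar> \<le> C" using smooth_fun_bounded_on_cbox[OF s] by blast
      then show ?thesis using box_subset_cbox[of l u] by blast
    qed
    have tr: "(LINT y|leb (box l u). top_trace a b f f' y * \<psi> y)
        = (LINT x|leb Om. f' x * (\<psi> (fst x) * \<eta> x)) + 1 / (b - a) * (LINT x|leb Om. f x * \<psi> (fst x))"
      if f: "L2_on Om f" "L2_on Om f'" and p: "smooth_fun \<psi>" for f f' \<psi>
    proof -
      obtain C where C: "\<And>y. y \<in> box l u ==> \<bar>\<psi> y\<bar> \<le> C" using bd[OF p] by blast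
      have gen: "(p * s + q * c) * r = p * (r * s) + c * (q * r)" for p q r s c :: real by (simp add: algebra_simps)
      have "(LINT y|leb (box l u). top_trace a b f f' y * \<psi> y)
        = (LINT x|leb Om. (f' x * ((snd x - a) / (b - a)) + f x * (1 / (b - a))) * \<psi> (fst x))"
        by (rule top_trace_L2(4)[OF ab(2) Abox f smooth_fun_bounded_measure[OF p] C])
      also have "\<dots> = (LINT x|leb Om. f' x * (\<psi> (fst x) * \<eta> x) + 1 / (b - a) * (f x * \<psi> (fst x)))"
        by (rule lint_cong[OF refl]) (simp only: eta gen)
      also have "\<dots> = (LINT x|leb Om. f' x * (\<psi> (fst x) * \<eta> x)) + (LINT x|leb Om. 1 / (b - a) * (f x * \<psi> (fst x)))"
      proof (rule lint_add)
        show "integrable (leb Om) (\<lambda>x. f' x * (\<psi> (fst x) * \<eta> x))"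
          unfolding Om_box by (rule L2_on_integrable_mult[OF f(2)[unfolded Om_box] L2_on_smooth]) (intro smooth_fun_mult smooth_fun_fst p se)
        show "integrable (leb Om) (\<lambda>x. 1 / (b - a) * (f x * \<psi> (fst x)))"
          unfolding Om_box by (intro integrable_mult_right L2_on_integrable_mult[OF f(1)[unfolded Om_box] L2_on_smooth] smooth_fun_fst p)
      qed
      finally show ?thesis by simp
    qed
    have "(LINT y|leb (box l u). v (y, b) * ?d\<phi> y) = (LINT y|leb (box l u). top_trace a b v ?Dz y * ?d\<phi> y)"
    proof (rule integral_cong_AE)
      have dm: "?d\<phi> \<in> borel_measurable (leb (box l u))" by (rule smooth_fun_measurable[OF sd])
      show "(\<lambda>y. v (y, b) * ?d\<phi> y) \<in> borel_measurable (leb (box l u))"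
        by (rule borel_measurable_times[OF L2_on_measurable[OF top_value_L2] dm])
      show "(\<lambda>y. top_trace a b v ?Dz y * ?d\<phi> y) \<in> borel_measurable (leb (box l u))"
        by (rule borel_measurable_times[OF L2_on_measurable[OF top_trace_L2(1)[OF ab(2) Abox vL2 DL2[OF basis_top]]] dm])
      show "AE y in leb (box l u). v (y, b) * ?d\<phi> y = top_trace a b v ?Dz y * ?d\<phi> y"
        using top_trace_eq by eventually_elim simp
    qed
    also have "\<dots> = (LINT x|leb Om. ?Dz x * (?d\<phi> (fst x) * \<eta> x)) + 1 / (b - a) * (LINT x|leb Om. v x * ?d\<phi> (fst x))"
      by (rule tr[OF vL2 DL2[OF basis_top] sd])
    also have "\<dots> = - ((LINT x|leb Om. ?H x * (\<phi> (fst x) * \<eta> x)) + 1 / (b - a) * (LINT x|leb Om. ?D x * \<phi> (fst x)))"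
      unfolding b1 b2 by simp
    also have "\<dots> = - (LINT y|leb (box l u). ?T y * \<phi> y)"
      by (subst tr[OF DL2[OF e] DDL2[OF basis_top e] sm]) (rule refl)
    finally show "(LINT y|leb (box l u). v (y, b) * ?d\<phi> y) = - (LINT y|leb (box l u). ?T y * \<phi> y)" .
  qed
qed

end

section \<open>The concrete domain and the trace in the sense of \<open>is_trace_top\<close>\<close>

lemma cubeQ_box: "cubeQ B = box (\<chi> i. - B) (\<chi> i. B)"
  by (auto simp: cubeQ_def mem_box_cart)

lemma Omega_eq: "Omega B a b = box (\<chi> i. - B) (\<chi> i. B) \<times> {a<..<b}"
  by (simp add: Omega_def cubeQ_box)

lemma cube_corners:
  assumes "0 < B" "j \<in> Basis" shows "(\<chi> i. - B) \<bullet> j < ((\<chi> i. B) :: real^'m) \<bullet> (j :: real^'m)"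
  using assms by (auto simp: Basis_vec_def inner_axis)

lemma closure_Omega:
  assumes "0 < B" "a < b"
  shows "closure (Omega B a b :: 'm::finite pt set) = cbox (\<chi> i. - B) (\<chi> i. B) \<times> {a..b}"
proof -
  have "box (\<chi> i. - B) ((\<chi> i. B) :: real^'m) \<noteq> {}"
    using cube_corners[OF assms(1)] by (auto simp: box_ne_empty)
  then show ?thesis using assms by (simp add: Omega_eq closure_Times closure_box)
qed

lemma ez_Basis: "(ez :: 'm::finite pt) \<in> Basis" by (auto simp: ez_def Basis_prod_def)

lemma cubeQ_simps [simp]:
  "cubeQ B \<in> sets borel" "bounded (cubeQ B)" "open (Omega B a b)" "bounded (Omega B a b)"
  by (auto simp: cubeQ_box Omega_eq bounded_box bounded_Times open_box intro!: open_Times)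

text \<open>The fundamental theorem along the vertical segment over \<open>y\<close>, for the
  product with the weight that is 0 at \<open>a\<close> and 1 at \<open>b\<close>.\<close>

lemma C1_near_top_trace:
  fixes f :: "'m::finite pt => real"
  assumes B: "0 < B" "a < b" and f: "C1_near (closure (Omega B a b)) f" and y: "y \<in> cubeQ B"
  shows "top_trace a b f (\<lambda>x. class_grad f x \<bullet> ez) y = f (y, b)"
proof -
  let ?d = "\<lambda>x. frechet_derivative f (at x) ez"
  have yc: "(y, z) \<in> closure (Omega B a b)" if "z \<in> {a..b}" for z
    using y that box_subset_cbox unfolding closure_Omega[OF B] cubeQ_box by blast
  have D: "((\<lambda>z. f (y, z) * ((z - a) / (b - a))) has_real_derivative ?d (y, z) * ((z - a) / (b - a)) + f (y, z) * (1 / (b - a))) (at z)"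
    if z: "z \<in> {a..b}" for z
  proof -
    have "(f has_derivative frechet_derivative f (at (y, z))) (at (y, z))" by (rule C1_near_partial(3)[OF f yc[OF z]])
    from frechet_derivative_direction[OF this, of ez]
    have "((\<lambda>t. f (y, z + t)) has_real_derivative ?d (y, z)) (at 0)" by (simp add: ez_def)
    then have 1: "((\<lambda>t. f (y, t)) has_real_derivative ?d (y, z)) (at z)"
      using DERIV_shift[of "\<lambda>t. f (y, t)" "?d (y, z)" 0 z] by (simp add: add.commute)
    have 2: "((\<lambda>z. (z - a) / (b - a)) has_real_derivative 1 / (b - a)) (at z)"
      using B by (auto intro!: derivative_eq_intros)
    from DERIV_mult[OF 1 2] show ?thesis by (simp add: mult.commute)
  qed
  have c1: "continuous_on {a..b} (\<lambda>z. f (y, z))" "continuous_on {a..b} (\<lambda>z. ?d (y, z))"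
    by (rule continuous_on_compose2[OF C1_near_partial(1)[OF f]] continuous_on_compose2[OF C1_near_partial(2)[OF f, of ez]];
        use yc in \<open>auto intro!: continuous_intros\<close>)+
  have "(LINT z|leb {a<..<b}. ?d (y, z) * ((z - a) / (b - a)) + f (y, z) * (1 / (b - a)))
     = f (y, b) * ((b - a) / (b - a)) - f (y, a) * ((a - a) / (b - a))"
    by (rule FTC_interval[OF _ D]) (use B in \<open>auto intro!: continuous_intros c1\<close>)
  then show ?thesis using B by (simp add: top_trace_def class_grad_inner[OF ez_Basis])
qed

text \<open>\<open>top_trace\<close> is bounded from H1 of the box to L2 of the face, with constant
  \<open>c\<close>. Hence every H1-approximating sequence of C1 functions has boundary values
  tending to it, whichever sequence \<open>is_trace_top\<close> provides.\<close>

lemma top_trace_tendsto: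
  fixes u :: "'m::finite pt => real"
  assumes B: "0 < B" "a < b" and u: "L2_on (Omega B a b) u" "\<And>e. e \<in> Basis ==> L2_on (Omega B a b) (\<lambda>x. Du x \<bullet> e)"
    and f: "\<And>k::nat. C1_near (closure (Omega B a b)) (f k)"
    and lim: "(\<lambda>k. sqH1 (Omega B a b) (\<lambda>x. f k x - u x) (\<lambda>x. class_grad (f k) x - Du x)) \<longlonglongrightarrow> 0"
  shows "(\<lambda>k. sqL2 (cubeQ B) (\<lambda>y. f k (y, b) - top_trace a b u (\<lambda>x. Du x \<bullet> ez) y)) \<longlonglongrightarrow> 0"
    and "\<And>k. L2_on (cubeQ B) (\<lambda>y. f k (y, b))"
proof -
  let ?\<Omega> = "Omega B a b :: 'm pt set" and ?Q = "cubeQ B :: (real^'m) set"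
  have Om: "?\<Omega> = ?Q \<times> {a<..<b}" by (simp add: Omega_def)
  have A: "?Q \<in> sets borel" "bounded ?Q" by simp_all
  have fL: "L2_on ?\<Omega> (f k)" for k by (rule L2_on_continuous_closure[OF _ _ C1_near_partial(1)[OF f]]) simp_all
  have gL: "L2_on ?\<Omega> (\<lambda>x. class_grad (f k) x \<bullet> e)" if "e \<in> Basis" for k e
    unfolding class_grad_inner[OF that] by (rule L2_on_continuous_closure[OF _ _ C1_near_partial(2)[OF f]]) simp_all
  note uez = u(2)[OF ez_Basis] and gez = gL[OF ez_Basis]
  have fb: "AE y in leb ?Q. f k (y, b) = top_trace a b (f k) (\<lambda>x. class_grad (f k) x \<bullet> ez) y" for k
    by (rule AE_I2) (use C1_near_top_trace[OF B f] in simp)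
  have TfL: "L2_on ?Q (top_trace a b (f k) (\<lambda>x. class_grad (f k) x \<bullet> ez))" for k
    by (rule top_trace_L2(1)[OF B(2) A fL[unfolded Om] gez[unfolded Om]])
  show fbL: "L2_on ?Q (\<lambda>y. f k (y, b))" for k
  proof -
    have "continuous_on (closure ?Q) (\<lambda>y. f k (y, b))"
      by (rule continuous_on_compose2[OF C1_near_partial(1)[OF f]])
        (use B in \<open>auto intro!: continuous_intros simp: Omega_def closure_Times\<close>)
    then show ?thesis by (intro L2_on_continuous_closure) (simp_all add: cubeQ_box open_box)
  qed
  have TuL: "L2_on ?Q (top_trace a b u (\<lambda>x. Du x \<bullet> ez))"
    by (rule top_trace_L2(1)[OF B(2) A u(1)[unfolded Om] uez[unfolded Om]])
  define c where "c = (b - a) * (2 + 2 * (1 / (b - a))^2)"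
  have bound: "sqL2 ?Q (\<lambda>y. f k (y, b) - top_trace a b u (\<lambda>x. Du x \<bullet> ez) y)
     \<le> c * sqH1 ?\<Omega> (\<lambda>x. f k x - u x) (\<lambda>x. class_grad (f k) x - Du x)" for k
  proof -
    let ?v = "\<lambda>x. f k x - u x" and ?D = "\<lambda>x. class_grad (f k) x - Du x"
    have vL: "L2_on ?\<Omega> ?v" by (intro L2_on_diff fL u)
    have DL: "L2_on ?\<Omega> (\<lambda>x. ?D x \<bullet> e)" if "e \<in> Basis" for e
      unfolding inner_diff_left by (intro L2_on_diff gL u that)
    let ?Tv = "top_trace a b ?v (\<lambda>x. class_grad (f k) x \<bullet> ez - Du x \<bullet> ez)"
    have TvL: "L2_on ?Q ?Tv"
      by (rule top_trace_L2(1)[OF B(2) A vL[unfolded Om] DL[OF ez_Basis, unfolded Om inner_diff_left]])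
    have "sqL2 ?Q (\<lambda>y. f k (y, b) - top_trace a b u (\<lambda>x. Du x \<bullet> ez) y) = sqL2 ?Q ?Tv"
    proof (rule sqL2_cong_AE)
      show "AE y in leb ?Q. f k (y, b) - top_trace a b u (\<lambda>x. Du x \<bullet> ez) y = ?Tv y"
        using fb[of k] top_trace_diff_AE[OF B(2) A fL[of k, unfolded Om] gez[of k, unfolded Om] u(1)[unfolded Om] uez[unfolded Om]]
        by eventually_elim simp
    qed (use L2_on_diff[OF fbL[of k] TuL] TvL in \<open>auto intro: L2_on_measurable\<close>)
    also have "\<dots> \<le> (b - a) * (2 * sqL2 ?\<Omega> (\<lambda>x. ?D x \<bullet> ez) + 2 * (1 / (b - a))^2 * sqL2 ?\<Omega> ?v)"
      using top_trace_L2(2)[OF B(2) A vL[unfolded Om] DL[OF ez_Basis, unfolded Om]] unfolding Om by (simp add: inner_diff_left)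
    also have "\<dots> \<le> c * sqH1 ?\<Omega> ?v ?D"
    proof -
      define s where "s = sqH1 ?\<Omega> ?v ?D"
      have s: "s = sqL2 ?\<Omega> ?v + (\<Sum>e\<in>Basis. sqL2 ?\<Omega> (\<lambda>x. ?D x \<bullet> e))" unfolding s_def by (rule sqH1_eq(1)[OF vL DL])
      have "sqL2 ?\<Omega> (\<lambda>x. ?D x \<bullet> ez) \<le> (\<Sum>e\<in>Basis. sqL2 ?\<Omega> (\<lambda>x. ?D x \<bullet> e))"
        by (rule member_le_sum[OF ez_Basis]) auto
      then have 1: "sqL2 ?\<Omega> (\<lambda>x. ?D x \<bullet> ez) \<le> s" using s by (simp add: add_increasing)
      have 2: "sqL2 ?\<Omega> ?v \<le> s" using s by (simp add: sum_nonneg)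
      have "(b - a) * (2 * sqL2 ?\<Omega> (\<lambda>x. ?D x \<bullet> ez) + 2 * (1 / (b - a))^2 * sqL2 ?\<Omega> ?v) \<le> (b - a) * (2 * s + 2 * (1 / (b - a))^2 * s)"
        using 1 2 B by (intro mult_left_mono add_mono) auto
      then show ?thesis by (simp add: c_def s_def[symmetric] algebra_simps)
    qed
    finally show ?thesis .
  qed
  show "(\<lambda>k. sqL2 ?Q (\<lambda>y. f k (y, b) - top_trace a b u (\<lambda>x. Du x \<bullet> ez) y)) \<longlonglongrightarrow> 0"
    by (rule tendsto_sandwich[OF _ _ tendsto_const tendsto_mult_right_zero[OF lim, of c]]) (use bound in auto)
qed

text \<open>\<open>trace_top\<close> is an arbitrary choice. Smooth approximants show that the
  choice is from a nonempty set; the sequence belonging to the chosen trace also converges to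
  \<open>top_trace\<close>, which forces equality almost everywhere.\<close>

lemma trace_top_eq:
  fixes u :: "'m::finite pt => real"
  assumes B: "0 < B" "a < b" and u: "is_H1_grad (Omega B a b) u Du"
  shows "L2_on (cubeQ B) (trace_top B a b u Du)"
    and "AE y in leb (cubeQ B). trace_top B a b u Du y = top_trace a b u (\<lambda>x. Du x \<bullet> ez) y"
proof -
  let ?\<Omega> = "Omega B a b :: 'm pt set" and ?Q = "cubeQ B :: (real^'m) set"
  let ?T = "top_trace a b u (\<lambda>x. Du x \<bullet> ez)"
  let ?L = "((\<chi> i. - B) :: real^'m, a)" and ?U = "((\<chi> i. B) :: real^'m, b)"
  have Ob: "?\<Omega> = box ?L ?U" by (simp add: Omega_eq box_Pair box_real)
  have LU: "?L \<bullet> j < ?U \<bullet> j" if "j \<in> Basis" for j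
    using that B cube_corners[OF B(1)] by (auto simp: Basis_prod_def)
  note uL = is_H1_grad_L2(1,2)[OF u]
  have TL: "L2_on ?Q ?T"
    by (rule top_trace_L2(1)[OF B(2) cubeQ_simps(1,2) uL(1)[unfolded Omega_def] uL(2)[OF ez_Basis, unfolded Omega_def]])
  obtain f where f: "\<And>n::nat. smooth_fun (f n)" "(\<lambda>n. sqL2 (box ?L ?U) (\<lambda>x. f n x - u x)) \<longlonglongrightarrow> 0"
    "\<And>e. e \<in> Basis ==> (\<lambda>n. sqL2 (box ?L ?U) (\<lambda>x. frechet_derivative (f n) (at x) e - Du x \<bullet> e)) \<longlonglongrightarrow> 0"
  proof (rule H1_smooth_approx[OF LU u[unfolded Ob]])
    fix g :: "nat => 'm pt => real"
    assume g: "\<And>n. smooth_fun (g n)" "(\<lambda>n. sqL2 (box ?L ?U) (\<lambda>x. g n x - u x)) \<longlonglongrightarrow> 0"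
      "\<And>e. e \<in> Basis ==> (\<lambda>n. sqL2 (box ?L ?U) (\<lambda>x. frechet_derivative (g n) (at x) e - Du x \<bullet> e)) \<longlonglongrightarrow> 0"
    show thesis by (rule that[OF g])
  qed
  note f = f[folded Ob]
  have C1: "C1_near (closure ?\<Omega>) (f n)" for n by (rule smooth_fun_C1_near[OF f(1)])
  have lim: "(\<lambda>k. sqH1 ?\<Omega> (\<lambda>x. f k x - u x) (\<lambda>x. class_grad (f k) x - Du x)) \<longlonglongrightarrow> 0"
  proof -
    have eq: "sqH1 ?\<Omega> (\<lambda>x. f k x - u x) (\<lambda>x. class_grad (f k) x - Du x) = sqL2 ?\<Omega> (\<lambda>x. f k x - u x)
       + (\<Sum>e\<in>Basis. sqL2 ?\<Omega> (\<lambda>x. frechet_derivative (f k) (at x) e - Du x \<bullet> e))" for k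
    proof -
      have "L2_on ?\<Omega> (\<lambda>x. f k x - u x)" unfolding Ob by (intro L2_on_diff L2_on_smooth f uL[unfolded Ob])
      moreover have "L2_on ?\<Omega> (\<lambda>x. (class_grad (f k) x - Du x) \<bullet> e)" if e: "e \<in> Basis" for e
        unfolding inner_diff_left class_grad_inner[OF e] Ob
        by (intro L2_on_diff L2_on_smooth smooth_fun_partial f uL[unfolded Ob] e)
      ultimately have "sqH1 ?\<Omega> (\<lambda>x. f k x - u x) (\<lambda>x. class_grad (f k) x - Du x) = sqL2 ?\<Omega> (\<lambda>x. f k x - u x)
       + (\<Sum>e\<in>Basis. sqL2 ?\<Omega> (\<lambda>x. (class_grad (f k) x - Du x) \<bullet> e))" by (rule sqH1_eq(1))
      also have "(\<Sum>e\<in>Basis. sqL2 ?\<Omega> (\<lambda>x. (class_grad (f k) x - Du x) \<bullet> e)) = (\<Sum>e\<in>Basis. sqL2 ?\<Omega> (\<lambda>x. frechet_derivative (f k) (at x) e - Du x \<bullet> e))"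
        by (intro sum.cong refl) (simp add: inner_diff_left class_grad_inner)
      finally show ?thesis .
    qed
    have "(\<lambda>k. sqL2 ?\<Omega> (\<lambda>x. f k x - u x) + (\<Sum>e\<in>Basis. sqL2 ?\<Omega> (\<lambda>x. frechet_derivative (f k) (at x) e - Du x \<bullet> e))) \<longlonglongrightarrow> 0 + (\<Sum>e\<in>(Basis :: 'm pt set). 0)"
      by (intro tendsto_add tendsto_sum f)
    then show ?thesis by (simp add: eq)
  qed
  have "is_trace_top B a b u Du ?T"
    unfolding is_trace_top_def using TL C1 lim top_trace_tendsto(1)[OF B uL C1 lim] by blast
  then have tr: "is_trace_top B a b u Du (trace_top B a b u Du)"
    unfolding trace_top_def by (rule someI[of "is_trace_top B a b u Du"])
  then show tL: "L2_on ?Q (trace_top B a b u Du)" by (simp add: is_trace_top_def)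
  from tr obtain h where h: "\<And>k. C1_near (closure ?\<Omega>) (h k)"
    "(\<lambda>k. sqH1 ?\<Omega> (\<lambda>x. h k x - u x) (\<lambda>x. class_grad (h k) x - Du x)) \<longlonglongrightarrow> 0"
    "(\<lambda>k. sqL2 ?Q (\<lambda>y. h k (y, b) - trace_top B a b u Du y)) \<longlonglongrightarrow> 0"
    unfolding is_trace_top_def by blast
  note hT = top_trace_tendsto[OF B uL h(1,2)]
  have le: "sqL2 ?Q (\<lambda>y. trace_top B a b u Du y - ?T y) \<le> 2 * sqL2 ?Q (\<lambda>y. h k (y, b) - trace_top B a b u Du y) + 2 * sqL2 ?Q (\<lambda>y. h k (y, b) - ?T y)" for k
    using sqL2_triangle[OF tL hT(2)[of k] TL] by (simp add: sqL2_minus_commute[of _ "trace_top B a b u Du"])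
  have "(\<lambda>k. 2 * sqL2 ?Q (\<lambda>y. h k (y, b) - trace_top B a b u Du y) + 2 * sqL2 ?Q (\<lambda>y. h k (y, b) - ?T y)) \<longlonglongrightarrow> 2 * 0 + 2 * 0"
    by (intro tendsto_intros h(3) hT(1))
  then have "sqL2 ?Q (\<lambda>y. trace_top B a b u Du y - ?T y) \<le> 0"
    by (intro LIMSEQ_le_const[of _ 0]) (use le in auto)
  then have "sqL2 ?Q (\<lambda>y. trace_top B a b u Du y - ?T y) = 0" using sqL2_nonneg antisym by blast
  then show "AE y in leb ?Q. trace_top B a b u Du y = ?T y"
    using sqL2_eq_0_iff[OF L2_on_diff[OF tL TL]] by auto
qed

section \<open>Families depending on the source parameter\<close>

text \<open>Continuous curves in L2. Continuity makes the squared norms integrable over the compact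
  parameter interval, without which the integrals in the estimate would be default values.\<close>

definition L2_family :: "'a::euclidean_space set => real set => (real => 'a => real) => bool" where
  "L2_family U S f \<longleftrightarrow> (\<forall>al\<in>S. L2_on U (f al)) \<and>
     (\<forall>al0\<in>S. ((\<lambda>al. sqL2 U (\<lambda>x. f al x - f al0 x)) \<longlongrightarrow> 0) (at al0 within S))"

lemma L2_familyD: "L2_family U S f ==> al \<in> S ==> L2_on U (f al)"
  by (simp add: L2_family_def)

lemma eventually_in_within: "\<forall>\<^sub>F al in at al0 within S. al \<in> S"
  by (simp add: eventually_at_filter)

lemma L2_family_bound:
  assumes f: "\<And>al. al \<in> S ==> L2_on U (f al)"
    and lim: "\<And>al0. al0 \<in> S ==> (B al0 \<longlongrightarrow> 0) (at al0 within S)"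
    and bd: "\<And>al al0. al \<in> S ==> al0 \<in> S ==> sqL2 U (\<lambda>x. f al x - f al0 x) \<le> B al0 al"
  shows "L2_family U S f"
  unfolding L2_family_def
proof (intro conjI ballI f)
  fix al0 assume a: "al0 \<in> S"
  show "((\<lambda>al. sqL2 U (\<lambda>x. f al x - f al0 x)) \<longlongrightarrow> 0) (at al0 within S)"
  proof (rule tendsto_sandwich[OF _ _ tendsto_const lim[OF a]])
    show "\<forall>\<^sub>F al in at al0 within S. sqL2 U (\<lambda>x. f al x - f al0 x) \<le> B al0 al"
      using eventually_in_within by eventually_elim (use bd a in blast)
  qed simp
qed

lemma L2_family_continuous:
  assumes "L2_family U S f"
  shows "continuous_on S (\<lambda>al. sqL2 U (f al))"
  unfolding continuous_on_def
proof
  fix al0 assume a: "al0 \<in> S"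
  \<comment> \<open>\<open>L2_on_tendsto_sqL2\<close> wants square integrability for every index;
    outside \<open>S\<close> the family is therefore frozen at \<open>al0\<close>, which the filter
    does not notice.\<close>
  define g where "g al = (if al \<in> S then f al else f al0)" for al
  have gL: "L2_on U (g al)" for al using assms a by (simp add: g_def L2_familyD)
  have ev: "\<forall>\<^sub>F al in at al0 within S. f al = g al"
    using eventually_in_within[of S al0] by eventually_elim (simp add: g_def)
  have "((\<lambda>al. sqL2 U (\<lambda>x. f al x - f al0 x)) \<longlongrightarrow> 0) (at al0 within S)"
    using assms a by (simp add: L2_family_def)
  then have "((\<lambda>al. sqL2 U (\<lambda>x. g al x - f al0 x)) \<longlongrightarrow> 0) (at al0 within S)"
    by (rule Lim_transform_eventually) (use ev in \<open>eventually_elim, simp\<close>)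
  from L2_on_tendsto_sqL2[OF gL L2_familyD[OF assms a] this]
  show "((\<lambda>al. sqL2 U (f al)) \<longlongrightarrow> sqL2 U (f al0)) (at al0 within S)"
    by (rule Lim_transform_eventually) (use ev in \<open>eventually_elim, simp\<close>)
qed

lemma integrable_continuous_Icc:
  fixes f :: "real => real"
  assumes "continuous_on {c..d} f" shows "integrable (leb {c..d}) f"
  by (rule L2_on_integrable[OF _ L2_on_continuous[OF assms]]) auto

lemma L2_family_integrable:
  "L2_family U {c..d} f ==> integrable (leb {c..d}) (\<lambda>al. sqL2 U (f al))"
  by (rule integrable_continuous_Icc[OF L2_family_continuous])

lemma L2_family_diff:
  assumes f: "L2_family U S f" and g: "L2_family U S g"
  shows "L2_family U S (\<lambda>al x. f al x - g al x)"
proof (rule L2_family_bound)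
  fix al0 assume "al0 \<in> S"
  then have "((\<lambda>al. 2 * sqL2 U (\<lambda>x. f al x - f al0 x) + 2 * sqL2 U (\<lambda>x. g al x - g al0 x)) \<longlongrightarrow> 2 * 0 + 2 * 0) (at al0 within S)"
    using f g unfolding L2_family_def by (intro tendsto_intros) auto
  then show "((\<lambda>al. 2 * sqL2 U (\<lambda>x. f al x - f al0 x) + 2 * sqL2 U (\<lambda>x. g al x - g al0 x)) \<longlongrightarrow> 0) (at al0 within S)" by simp
next
  fix al al0 assume a: "al \<in> S" "al0 \<in> S"
  have eq: "(\<lambda>x. (f al x - g al x) - (f al0 x - g al0 x)) = (\<lambda>x. (f al x - f al0 x) - (g al x - g al0 x))" by auto
  show "sqL2 U (\<lambda>x. (f al x - g al x) - (f al0 x - g al0 x)) \<le> 2 * sqL2 U (\<lambda>x. f al x - f al0 x) + 2 * sqL2 U (\<lambda>x. g al x - g al0 x)"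
    unfolding eq by (intro sqL2_diff_le L2_on_diff L2_familyD[OF f] L2_familyD[OF g] a)
qed (intro L2_on_diff L2_familyD[OF f] L2_familyD[OF g])

lemma L2_family_mult_bounded:
  assumes f: "L2_family U S f" and h: "h \<in> borel_measurable (leb U)" "\<And>x. x \<in> U ==> \<bar>h x\<bar> \<le> C"
  shows "L2_family U S (\<lambda>al x. h x * f al x)"
proof (rule L2_family_bound)
  fix al0 assume "al0 \<in> S"
  then have "((\<lambda>al. \<bar>C\<bar>^2 * sqL2 U (\<lambda>x. f al x - f al0 x)) \<longlongrightarrow> \<bar>C\<bar>^2 * 0) (at al0 within S)"
    using f unfolding L2_family_def by (intro tendsto_intros) auto
  then show "((\<lambda>al. \<bar>C\<bar>^2 * sqL2 U (\<lambda>x. f al x - f al0 x)) \<longlongrightarrow> 0) (at al0 within S)" by simp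
next
  fix al al0 assume a: "al \<in> S" "al0 \<in> S"
  have dL: "L2_on U (\<lambda>x. f al x - f al0 x)" by (intro L2_on_diff L2_familyD[OF f] a)
  have "sqL2 U (\<lambda>x. h x * f al x - h x * f al0 x) \<le> sqL2 U (\<lambda>x. \<bar>C\<bar> * (f al x - f al0 x))"
  proof (rule sqL2_mono_AE[OF L2_on_cmult[OF dL]])
    show "L2_on U (\<lambda>x. h x * f al x - h x * f al0 x)"
      by (intro L2_on_diff L2_on_mult_bounded[OF _ h] L2_familyD[OF f] a)
    show "AE x in leb U. \<bar>h x * f al x - h x * f al0 x\<bar> \<le> \<bar>\<bar>C\<bar> * (f al x - f al0 x)\<bar>"
    proof (rule AE_I2)
      fix x assume "x \<in> space (leb U)"
      then have "\<bar>h x\<bar> \<le> \<bar>C\<bar>" using h(2)[of x] by auto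
      then show "\<bar>h x * f al x - h x * f al0 x\<bar> \<le> \<bar>\<bar>C\<bar> * (f al x - f al0 x)\<bar>"
        unfolding right_diff_distrib[symmetric] abs_mult abs_abs by (intro mult_right_mono) auto
    qed
  qed
  then show "sqL2 U (\<lambda>x. h x * f al x - h x * f al0 x) \<le> \<bar>C\<bar>^2 * sqL2 U (\<lambda>x. f al x - f al0 x)" by (simp add: sqL2_cmult)
qed (intro L2_on_mult_bounded[OF _ h] L2_familyD[OF f])

lemma L2_family_top_trace:
  fixes f g :: "real => 'b::euclidean_space \<times> real => real"
  assumes ab: "a < b" and A: "A \<in> sets borel" "bounded A"
    and f: "L2_family (A \<times> {a<..<b}) S f" and g: "L2_family (A \<times> {a<..<b}) S g"
  shows "L2_family A S (\<lambda>al. top_trace a b (f al) (g al))"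
proof (rule L2_family_bound)
  let ?\<Omega> = "A \<times> {a<..<b}"
  let ?B = "\<lambda>al0 al. (b - a) * (2 * sqL2 ?\<Omega> (\<lambda>x. g al x - g al0 x) + 2 * (1 / (b - a))^2 * sqL2 ?\<Omega> (\<lambda>x. f al x - f al0 x))"
  show "(?B al0 \<longlongrightarrow> 0) (at al0 within S)" if "al0 \<in> S" for al0
  proof -
    have "(?B al0 \<longlongrightarrow> (b - a) * (2 * 0 + 2 * (1 / (b - a))^2 * 0)) (at al0 within S)"
      using f g that unfolding L2_family_def by (intro tendsto_add tendsto_mult_left) auto
    then show ?thesis by simp
  qed
  show "L2_on A (top_trace a b (f al) (g al))" if "al \<in> S" for al
    by (rule top_trace_L2(1)[OF ab A L2_familyD[OF f that] L2_familyD[OF g that]])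
  then have TL: "L2_on A (\<lambda>y. top_trace a b (f al) (g al) y)" if "al \<in> S" for al using that .
  fix al al0 assume a: "al \<in> S" "al0 \<in> S"
  have dL: "L2_on ?\<Omega> (\<lambda>x. f al x - f al0 x)" "L2_on ?\<Omega> (\<lambda>x. g al x - g al0 x)"
    by (intro L2_on_diff L2_familyD[OF f] L2_familyD[OF g] a)+
  have "sqL2 A (\<lambda>y. top_trace a b (f al) (g al) y - top_trace a b (f al0) (g al0) y)
    = sqL2 A (top_trace a b (\<lambda>x. f al x - f al0 x) (\<lambda>x. g al x - g al0 x))"
  proof (rule sqL2_cong_AE)
    show "AE y in leb A. top_trace a b (f al) (g al) y - top_trace a b (f al0) (g al0) y
        = top_trace a b (\<lambda>x. f al x - f al0 x) (\<lambda>x. g al x - g al0 x) y"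
      using top_trace_diff_AE[OF ab A L2_familyD[OF f a(1)] L2_familyD[OF g a(1)] L2_familyD[OF f a(2)] L2_familyD[OF g a(2)]]
      by eventually_elim simp
  qed (intro L2_on_measurable L2_on_diff TL a top_trace_L2(1)[OF ab A dL])+
  also have "\<dots> \<le> ?B al0 al" by (rule top_trace_L2(2)[OF ab A dL])
  finally show "sqL2 A (\<lambda>y. top_trace a b (f al) (g al) y - top_trace a b (f al0) (g al0) y) \<le> ?B al0 al" .
qed

lemma sqH2_bounds:
  assumes u: "L2_on U u" and D: "\<And>e. e \<in> Basis ==> L2_on U (\<lambda>x. Du x \<bullet> e)"
    and H: "\<And>e e'. e \<in> Basis ==> e' \<in> Basis ==> L2_on U (\<lambda>x. Hu x e \<bullet> e')"
  shows "sqL2 U u \<le> sqH2 U u Du Hu"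
    and "e \<in> Basis ==> sqL2 U (\<lambda>x. Du x \<bullet> e) \<le> sqH2 U u Du Hu"
    and "e \<in> Basis ==> e' \<in> Basis ==> sqL2 U (\<lambda>x. Hu x e \<bullet> e') \<le> sqH2 U u Du Hu"
proof -
  let ?T = "\<lambda>x. (u x)^2 + (norm (Du x))^2 + (\<Sum>e\<in>Basis. (norm (Hu x e))^2)"
  have "integrable (leb U) (\<lambda>x. \<Sum>e'\<in>Basis. (Hu x e \<bullet> e')^2)" if "e \<in> Basis" for e
    by (intro lintable_sum L2_on_integrable_sq H that)
  then have "integrable (leb U) (\<lambda>x. \<Sum>e\<in>Basis. (norm (Hu x e))^2)"
    unfolding norm_sq_Basis by (rule lintable_sum)
  then have T: "integrable (leb U) ?T" using sqH1_eq(2)[OF u D] by simp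
  have le: "sqL2 U f \<le> sqH2 U u Du Hu" if "L2_on U f" "\<And>x. (f x)^2 \<le> ?T x" for f
    unfolding sqL2_def sqH2_def by (rule integral_mono[OF L2_on_integrable_sq[OF that(1)] T that(2)])
  have s: "0 \<le> (\<Sum>e\<in>Basis. (norm (Hu x e))^2)" for x by (intro sum_nonneg) auto
  show "sqL2 U u \<le> sqH2 U u Du Hu" by (rule le[OF u]) (use s in \<open>simp add: add_increasing2\<close>)
  have cn: "(w \<bullet> e)^2 \<le> (norm w)^2" if "e \<in> Basis" for w e :: 'a
    using Basis_le_norm[OF that, of w] by (simp add: abs_le_square_iff[symmetric])
  show "sqL2 U (\<lambda>x. Du x \<bullet> e) \<le> sqH2 U u Du Hu" if e: "e \<in> Basis"
  proof (rule le[OF D[OF e]])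
    fix x show "(Du x \<bullet> e)^2 \<le> ?T x" using cn[OF e, of "Du x"] s[of x] zero_le_power2[of "u x"] by linarith
  qed
  show "sqL2 U (\<lambda>x. Hu x e \<bullet> e') \<le> sqH2 U u Du Hu" if e: "e \<in> Basis" "e' \<in> Basis"
  proof (rule le[OF H[OF e]])
    fix x
    have "(norm (Hu x e))^2 \<le> (\<Sum>e\<in>Basis. (norm (Hu x e))^2)"
      by (rule member_le_sum[OF e(1)]) auto
    then show "(Hu x e \<bullet> e')^2 \<le> ?T x" using cn[OF e(2), of "Hu x e"] zero_le_power2[of "u x"] zero_le_power2[of "norm (Du x)"] by linarith
  qed
qed

lemma is_H2_L2:
  assumes "is_H2 U u Du Hu"
  shows "L2_on U u" "e \<in> Basis ==> L2_on U (\<lambda>x. Du x \<bullet> e)"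
    "e \<in> Basis ==> e' \<in> Basis ==> L2_on U (\<lambda>x. Hu x e \<bullet> e')"
    "is_H1_grad U u Du" "e \<in> Basis ==> is_H1_grad U (\<lambda>x. Du x \<bullet> e) (\<lambda>x. Hu x e)"
  using assms by (auto simp: is_H2_def is_H1_grad_def)

lemma admissible_families:
  fixes u :: "'m::finite pt => real => real"
  assumes "admissible B a b d M u Du Hu"
  shows "L2_family (Omega B a b) {-d..d} (\<lambda>al x. u x al)"
    and "e \<in> Basis ==> L2_family (Omega B a b) {-d..d} (\<lambda>al x. Du x al \<bullet> e)"
    and "e \<in> Basis ==> e' \<in> Basis ==> L2_family (Omega B a b) {-d..d} (\<lambda>al x. Hu x al e \<bullet> e')"
proof -
  let ?O = "Omega B a b :: 'm pt set"
  let ?N = "\<lambda>al0 al. sqH2 ?O (\<lambda>x. u x al - u x al0) (\<lambda>x. Du x al - Du x al0) (\<lambda>x e. Hu x al e - Hu x al0 e)"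
  have h: "\<And>al. al \<in> {-d..d} ==> is_H2 ?O (\<lambda>x. u x al) (\<lambda>x. Du x al) (\<lambda>x. Hu x al)"
    and lim: "\<And>al0. al0 \<in> {-d..d} ==> ((\<lambda>al. sqH2 ?O (\<lambda>x. u x al - u x al0) (\<lambda>x. Du x al - Du x al0)
          (\<lambda>x e. Hu x al e - Hu x al0 e)) \<longlongrightarrow> 0) (at al0 within {-d..d})"
    using assms unfolding admissible_def by blast+
  have bd: "sqL2 ?O (\<lambda>x. u x al - u x al0) \<le> ?N al0 al"
    "e \<in> Basis ==> sqL2 ?O (\<lambda>x. (Du x al - Du x al0) \<bullet> e) \<le> ?N al0 al"
    "e \<in> Basis ==> e' \<in> Basis ==> sqL2 ?O (\<lambda>x. (Hu x al e - Hu x al0 e) \<bullet> e') \<le> ?N al0 al"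
    if "al \<in> {-d..d}" "al0 \<in> {-d..d}" for al al0 e e'
  proof -
    note hh = is_H2_L2[OF h[OF that(1)]] is_H2_L2[OF h[OF that(2)]]
    have 1: "L2_on ?O (\<lambda>x. u x al - u x al0)" by (intro L2_on_diff hh)
    have 2: "L2_on ?O (\<lambda>x. (Du x al - Du x al0) \<bullet> e)" if "e \<in> Basis" for e
      unfolding inner_diff_left by (intro L2_on_diff hh that)
    have 3: "L2_on ?O (\<lambda>x. (Hu x al e - Hu x al0 e) \<bullet> e')" if "e \<in> Basis" "e' \<in> Basis" for e e'
      unfolding inner_diff_left by (intro L2_on_diff hh that)
    note b = sqH2_bounds[of ?O "\<lambda>x. u x al - u x al0" "\<lambda>x. Du x al - Du x al0" "\<lambda>x e. Hu x al e - Hu x al0 e", OF 1 2 3]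
    show "sqL2 ?O (\<lambda>x. u x al - u x al0) \<le> ?N al0 al"
      "e \<in> Basis ==> sqL2 ?O (\<lambda>x. (Du x al - Du x al0) \<bullet> e) \<le> ?N al0 al"
      "e \<in> Basis ==> e' \<in> Basis ==> sqL2 ?O (\<lambda>x. (Hu x al e - Hu x al0 e) \<bullet> e') \<le> ?N al0 al"
      using b by blast+
  qed
  show "L2_family ?O {-d..d} (\<lambda>al x. u x al)"
    by (rule L2_family_bound[OF is_H2_L2(1)[OF h] lim bd(1)])
  show "L2_family ?O {-d..d} (\<lambda>al x. Du x al \<bullet> e)" if "e \<in> Basis"
    by (rule L2_family_bound[OF is_H2_L2(2)[OF h that] lim bd(2)[OF _ _ that, unfolded inner_diff_left]])
  show "L2_family ?O {-d..d} (\<lambda>al x. Hu x al e \<bullet> e')" if "e \<in> Basis" "e' \<in> Basis"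
    by (rule L2_family_bound[OF is_H2_L2(3)[OF h that] lim bd(3)[OF _ _ that, unfolded inner_diff_left]])
qed

lemma sqL2_iterated:
  fixes F :: "'a::euclidean_space \<times> 'b::euclidean_space => real"
  assumes A: "A \<in> sets borel" "bounded A" and B: "B \<in> sets borel" "bounded B" and F: "L2_on (A \<times> B) F"
  shows "(LINT x|leb A. sqL2 B (\<lambda>y. F (x, y))) = (LINT y|leb B. sqL2 A (\<lambda>x. F (x, y)))"
  using L2_on_partial_integral(3)[OF A B F] L2_on_partial_integral(3)[OF B A L2_on_swap_prod(1)[OF A(1) B(1) F]]
    L2_on_swap_prod(2)[OF A(1) B(1) F] by simp

text \<open>Continuity in L2 does not make the given function jointly measurable, so measurability
  is a separate premise; Tonelli then yields joint square integrability.\<close>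

lemma L2_on_joint:
  fixes f :: "'a::euclidean_space => real => real"
  assumes A: "A \<in> sets borel" "bounded A" and f: "L2_family A {c..d} (\<lambda>al x. f x al)"
    and m: "(\<lambda>z. f (fst z) (snd z)) \<in> borel_measurable (leb (A \<times> {c..d}))"
  shows "L2_on (A \<times> {c..d}) (\<lambda>z. f (fst z) (snd z))"
proof -
  have B: "{c..d} \<in> sets borel" by simp
  have m2: "(\<lambda>z. (f (fst z) (snd z))^2) \<in> borel_measurable (leb (A \<times> {c..d}))" using m by simp
  note s = lebesgue_on_swap[OF A(1) B m2]
  have "integrable (leb ({c..d} \<times> A)) (\<lambda>z. (f (fst (snd z, fst z)) (snd (snd z, fst z)))^2)"
  proof (rule lebesgue_on_Tonelli_integrable[OF B A(1) s(1)])
    show "AE al in leb {c..d}. integrable (leb A) (\<lambda>x. (f (fst (snd (al, x), fst (al, x))) (snd (snd (al, x), fst (al, x))))^2)"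
      by (rule AE_I2) (use L2_familyD[OF f] in \<open>auto simp: L2_on_def\<close>)
    show "integrable (leb {c..d}) (\<lambda>al. \<integral>x. \<bar>(f (fst (snd (al, x), fst (al, x))) (snd (snd (al, x), fst (al, x))))^2\<bar> \<partial>leb A)"
      using L2_family_integrable[OF f] by (simp add: sqL2_def)
  qed
  then have "integrable (leb (A \<times> {c..d})) (\<lambda>z. (f (fst z) (snd z))^2)" using s(2) by blast
  with m show ?thesis by (simp add: L2_on_def)
qed

section \<open>Pointwise bounds for the nonlinear terms and the source directions\<close>

lemma exp_diff_le:
  fixes x y M :: real
  assumes "x \<le> M" "y \<le> M"
  shows "\<bar>exp x - exp y\<bar> \<le> exp M * \<bar>x - y\<bar>"
proof -
  have "exp x - exp y \<le> exp M * \<bar>x - y\<bar>" if "y \<le> x" "x \<le> M" for x y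
  proof -
    have "1 - exp (y - x) \<le> x - y" using exp_ge_add_one_self[of "y - x"] by linarith
    then have "exp x * (1 - exp (y - x)) \<le> exp M * (x - y)"
      using that by (intro mult_mono) auto
    then show ?thesis using that by (simp add: right_diff_distrib exp_diff)
  qed
  then show ?thesis using assms by (cases "y \<le> x") (auto simp: abs_minus_commute abs_if)
qed

lemma kernel_bounds:
  fixes k p1 p2 :: "real => real"
  assumes d: "0 < d" and k: "continuous_on {-d..d} k" "\<And>be. be \<in> {-d..d} ==> \<bar>k be\<bar> \<le> K"
    and p: "continuous_on {-d..d} p1" "continuous_on {-d..d} p2"
      "\<And>be. be \<in> {-d..d} ==> \<bar>p1 be\<bar> \<le> M" "\<And>be. be \<in> {-d..d} ==> \<bar>p2 be\<bar> \<le> M"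
  shows "\<bar>\<integral>be. k be * exp (p1 be) \<partial>leb {-d..d}\<bar> \<le> 2 * d * (K * exp M)"
    and "\<bar>(LINT be|leb {-d..d}. k be * exp (p1 be)) - (LINT be|leb {-d..d}. k be * exp (p2 be))\<bar>
      \<le> K * exp M * (LINT be|leb {-d..d}. \<bar>p1 be - p2 be\<bar>)"
proof -
  let ?M = "leb {-d..d}"
  have K0: "0 \<le> K" using k(2)[of 0] d by auto
  have i: "integrable ?M (\<lambda>be. k be * exp (p1 be))" "integrable ?M (\<lambda>be. k be * exp (p2 be))" "integrable ?M (\<lambda>be. \<bar>p1 be - p2 be\<bar>)"
    by (intro integrable_continuous_Icc continuous_intros k p)+
  have one: "integrable ?M (\<lambda>be. K * exp M)" by (intro integrable_continuous_Icc continuous_intros)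
  have "\<bar>\<integral>be. k be * exp (p1 be) \<partial>?M\<bar> \<le> (LINT be|?M. \<bar>k be * exp (p1 be)\<bar>)" by (rule integral_abs_bound)
  also have "\<dots> \<le> (LINT be|?M. K * exp M)"
  proof (rule integral_mono[OF integrable_abs[OF i(1)] one])
    fix be assume "be \<in> space ?M"
    then have "\<bar>k be\<bar> \<le> K" "p1 be \<le> M" using k(2)[of be] p(3)[of be] by auto
    then show "\<bar>k be * exp (p1 be)\<bar> \<le> K * exp M" unfolding abs_mult using K0 by (intro mult_mono) auto
  qed
  also have "\<dots> = 2 * d * (K * exp M)" using d by (simp add: measure_restrict_space)
  finally show "\<bar>\<integral>be. k be * exp (p1 be) \<partial>?M\<bar> \<le> 2 * d * (K * exp M)" .
  have "(LINT be|?M. k be * exp (p1 be)) - (LINT be|?M. k be * exp (p2 be)) = (LINT be|?M. k be * exp (p1 be) - k be * exp (p2 be))"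
    using i by simp
  also have "\<bar>\<dots>\<bar> \<le> (LINT be|?M. \<bar>k be * exp (p1 be) - k be * exp (p2 be)\<bar>)" by (rule integral_abs_bound)
  also have "\<dots> \<le> (LINT be|?M. K * exp M * \<bar>p1 be - p2 be\<bar>)"
  proof (rule integral_mono)
    show "integrable ?M (\<lambda>be. \<bar>k be * exp (p1 be) - k be * exp (p2 be)\<bar>)" using i by simp
    show "integrable ?M (\<lambda>be. K * exp M * \<bar>p1 be - p2 be\<bar>)" using i(3) by simp
    fix be assume "be \<in> space ?M"
    then have b: "be \<in> {-d..d}" by simp
    have "\<bar>exp (p1 be) - exp (p2 be)\<bar> \<le> exp M * \<bar>p1 be - p2 be\<bar>"
      using p(3)[OF b] p(4)[OF b] by (intro exp_diff_le) auto
    then have "\<bar>k be\<bar> * \<bar>exp (p1 be) - exp (p2 be)\<bar> \<le> K * (exp M * \<bar>p1 be - p2 be\<bar>)"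
      using k(2)[OF b] K0 by (intro mult_mono) auto
    then show "\<bar>k be * exp (p1 be) - k be * exp (p2 be)\<bar> \<le> K * exp M * \<bar>p1 be - p2 be\<bar>"
      by (simp add: abs_mult[symmetric] right_diff_distrib mult.assoc)
  qed
  finally show "\<bar>(LINT be|?M. k be * exp (p1 be)) - (LINT be|?M. k be * exp (p2 be))\<bar> \<le> K * exp M * (LINT be|?M. \<bar>p1 be - p2 be\<bar>)" by simp
qed

text \<open>The three factors are exchanged one at a time. Taking both \<open>q1\<close> and
  \<open>q2\<close> equal to 1 covers the terms without a middle factor.\<close>

lemma exp_product_diff:
  fixes p1 p2 s1 s2 q1 q2 M s J :: real
  assumes p: "\<bar>p1\<bar> \<le> M" "\<bar>p2\<bar> \<le> M" and q: "\<bar>q1\<bar> \<le> Q" "\<bar>q2\<bar> \<le> Q" and s: "\<bar>s1\<bar> \<le> s" "\<bar>s1 - s2\<bar> \<le> J"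
  shows "\<bar>exp (- p1) * q1 * s1 - exp (- p2) * q2 * s2\<bar> \<le> exp M * (Q * s * \<bar>p1 - p2\<bar> + s * \<bar>q1 - q2\<bar> + Q * J)"
proof -
  have Q0: "Q \<ge> 0" and s0: "s \<ge> 0" and J0: "J \<ge> 0" using q s by linarith+
  have e: "\<bar>exp (- p1) - exp (- p2)\<bar> \<le> exp M * \<bar>p1 - p2\<bar>"
    using exp_diff_le[of "- p1" M "- p2"] p by (simp add: abs_minus_commute)
  have e2: "exp (- p2) \<le> exp M" using p by simp
  have "exp (- p1) * q1 * s1 - exp (- p2) * q2 * s2
    = (exp (- p1) - exp (- p2)) * q1 * s1 + exp (- p2) * (q1 - q2) * s1 + exp (- p2) * q2 * (s1 - s2)"
    by (simp add: algebra_simps)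
  also have "\<bar>\<dots>\<bar> \<le> \<bar>(exp (- p1) - exp (- p2)) * q1 * s1\<bar> + \<bar>exp (- p2) * (q1 - q2) * s1\<bar> + \<bar>exp (- p2) * q2 * (s1 - s2)\<bar>"
    by linarith
  also have "\<dots> \<le> (exp M * \<bar>p1 - p2\<bar>) * Q * s + exp M * \<bar>q1 - q2\<bar> * s + exp M * Q * J"
    unfolding abs_mult using e e2 q s Q0 s0 J0
    by (intro add_mono mult_mono mult_nonneg_nonneg) auto
  also have "\<dots> = exp M * (Q * s * \<bar>p1 - p2\<bar> + s * \<bar>q1 - q2\<bar> + Q * J)" by (simp add: algebra_simps)
  finally show ?thesis .
qed

lemma norm_x_src_ge: "\<bar>snd x\<bar> \<le> norm (x - x_src e1 al)"
proof -
  have "norm (snd (x - x_src e1 al)) \<le> norm (x - x_src e1 al)"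
    using norm_snd_le[of "snd (x - x_src e1 al)" "fst (x - x_src e1 al)"] by (simp only: prod.collapse)
  then show ?thesis by (simp add: x_src_def)
qed

lemma norm_nu_le: "norm (nu e1 x al) \<le> 1"
  by (simp add: nu_def)

lemma x_src_deriv: "((\<lambda>t. x - x_src e1 t) has_vector_derivative (- axis e1 1, 0)) (at al)"
proof -
  have "(\<lambda>t. x - x_src e1 t) = (\<lambda>t. x - t *\<^sub>R (axis e1 1, 0))" by (simp add: x_src_def fun_eq_iff)
  moreover have "((\<lambda>t. x - t *\<^sub>R (axis e1 1, 0)) has_vector_derivative 0 - 1 *\<^sub>R (axis e1 1, 0)) (at al)"
    by (intro has_vector_derivative_diff has_vector_derivative_const) (auto intro!: derivative_eq_intros)
  ultimately show ?thesis by simp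
qed

text \<open>The distance to the source is at least the height, hence at least \<open>a\<close>.
  Differentiating the unit vector gives one term from the numerator and one from the norm, each
  bounded by \<open>1 / a\<close>.\<close>

lemma norm_dnu_le:
  assumes "0 < a" "a \<le> snd x"
  shows "norm (dnu e1 x al) \<le> 2 / a"
proof -
  let ?r = "\<lambda>t. x - x_src e1 t" and ?e = "(- axis e1 1, 0) :: 'a pt"
  have ra: "norm (?r t) \<ge> a" for t using norm_x_src_ge[of x e1 t] assms by linarith
  have r0: "?r al \<noteq> 0" using ra[of al] assms by auto
  have ne: "norm ?e = 1" by (simp add: norm_Pair)
  have nd: "((\<lambda>t. norm (?r t)) has_real_derivative ?e \<bullet> sgn (?r al)) (at al)"
  proof -
    have "((\<lambda>t. ?r t) has_derivative (\<lambda>h. h *\<^sub>R ?e)) (at al)" using x_src_deriv[of x e1 al] by (simp add: has_vector_derivative_def)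
    from has_derivative_compose[OF this has_derivative_norm[OF r0]]
    have "((\<lambda>t. norm (?r t)) has_derivative (\<lambda>h. (h *\<^sub>R ?e) \<bullet> sgn (?r al))) (at al)" .
    moreover have "(\<lambda>h. (h *\<^sub>R ?e) \<bullet> sgn (?r al)) = (*) (?e \<bullet> sgn (?r al))"
      by (rule ext) (simp only: inner_scaleR_left mult.commute)
    ultimately show ?thesis unfolding has_field_derivative_def by (simp only:)
  qed
  have id: "((\<lambda>t. 1 / norm (?r t)) has_real_derivative - (?e \<bullet> sgn (?r al)) / (norm (?r al))^2) (at al)"
    using DERIV_divide[OF DERIV_const nd, of 1] r0 by (simp add: power2_eq_square)
  let ?D = "(1 / norm (?r al)) *\<^sub>R ?e + (- (?e \<bullet> sgn (?r al)) / (norm (?r al))\<^sup>2) *\<^sub>R ?r al"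
  have "((\<lambda>t. nu e1 x t) has_vector_derivative ?D) (at al)"
    unfolding nu_def by (rule has_vector_derivative_scaleR[OF id x_src_deriv])
  then have "dnu e1 x al = ?D" unfolding dnu_def by (rule vector_derivative_at)
  also have "norm ?D \<le> 1 / a + 1 / a"
  proof (rule norm_triangle_le[OF add_mono])
    have inv: "1 / norm (?r al) \<le> 1 / a" by (rule frac_le) (use ra[of al] assms in simp_all)
    then show "norm ((1 / norm (?r al)) *\<^sub>R ?e) \<le> 1 / a" using ne by simp
    have "\<bar>?e \<bullet> sgn (?r al)\<bar> \<le> norm ?e * norm (sgn (?r al))" by (rule Cauchy_Schwarz_ineq2)
    also have "\<dots> = 1" using r0 ne by (simp add: norm_sgn)
    finally have c: "\<bar>?e \<bullet> sgn (?r al)\<bar> \<le> 1" .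
    have "norm ((- (?e \<bullet> sgn (?r al)) / (norm (?r al))\<^sup>2) *\<^sub>R ?r al) = \<bar>?e \<bullet> sgn (?r al)\<bar> * (1 / norm (?r al))"
      unfolding norm_scaleR abs_divide abs_minus_cancel using r0 by (simp add: power2_eq_square)
    also have "\<dots> \<le> 1 * (1 / a)" using c inv by (intro mult_mono) auto
    finally show "norm ((- (?e \<bullet> sgn (?r al)) / (norm (?r al))\<^sup>2) *\<^sub>R ?r al) \<le> 1 / a" by simp
  qed
  finally show ?thesis by simp
qed

lemma continuous_nu:
  assumes "0 < a" "a \<le> snd x" shows "continuous_on S (nu e1 x)"
proof -
  have n: "norm (x - x_src e1 t) \<noteq> 0" for t using norm_x_src_ge[of x e1 t] assms by linarith
  have c: "continuous_on S (\<lambda>t. x - x_src e1 t)" unfolding x_src_def by (intro continuous_intros)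
  show ?thesis unfolding nu_def[abs_def]
    by (intro continuous_on_scaleR continuous_on_divide continuous_on_const continuous_on_norm c) (use n in blast)
qed

lemma is_H2_diff:
  fixes l u :: "'a::euclidean_space"
  assumes 1: "is_H2 (box l u) v1 D1 H1" and 2: "is_H2 (box l u) v2 D2 H2"
  shows "is_H2 (box l u) (\<lambda>x. v1 x - v2 x) (\<lambda>x. D1 x - D2 x) (\<lambda>x e. H1 x e - H2 x e)"
proof -
  have wp: "is_weak_partial (box l u) (\<lambda>x. f x - g x) e (\<lambda>x. f' x - g' x)"
    if L: "L2_on (box l u) f" "L2_on (box l u) g" "L2_on (box l u) f'" "L2_on (box l u) g'"
      and w: "is_weak_partial (box l u) f e f'" "is_weak_partial (box l u) g e g'" and e: "e \<in> Basis"
    for f g f' g' :: "'a => real" and e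
    unfolding is_weak_partial_def
  proof (intro allI impI)
    fix \<phi> :: "'a => real" assume t: "test_fun (box l u) \<phi>"
    then have s: "smooth_fun \<phi>" by (simp add: test_fun_def)
    note i = L2_on_integrable_mult[OF L(1) L2_on_smooth[OF smooth_fun_partial[OF s e]]]
      L2_on_integrable_mult[OF L(2) L2_on_smooth[OF smooth_fun_partial[OF s e]]]
      L2_on_integrable_mult[OF L(3) L2_on_smooth[OF s]] L2_on_integrable_mult[OF L(4) L2_on_smooth[OF s]]
    have "(LINT x|leb (box l u). (f x - g x) * frechet_derivative \<phi> (at x) e)
      = (LINT x|leb (box l u). f x * frechet_derivative \<phi> (at x) e) - (LINT x|leb (box l u). g x * frechet_derivative \<phi> (at x) e)"
      unfolding left_diff_distrib by (rule lint_diff[OF i(1,2)])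
    moreover have "(LINT x|leb (box l u). (f' x - g' x) * \<phi> x) = (LINT x|leb (box l u). f' x * \<phi> x) - (LINT x|leb (box l u). g' x * \<phi> x)"
      unfolding left_diff_distrib by (rule lint_diff[OF i(3,4)])
    ultimately show "(LINT x|leb (box l u). (f x - g x) * frechet_derivative \<phi> (at x) e) = - (LINT x|leb (box l u). (f' x - g' x) * \<phi> x)"
      using w t unfolding is_weak_partial_def by simp
  qed
  have g: "is_H1_grad (box l u) (\<lambda>x. f x - g x) (\<lambda>x. Df x - Dg x)"
    if "is_H1_grad (box l u) f Df" "is_H1_grad (box l u) g Dg" for f g Df Dg
    unfolding is_H1_grad_def inner_diff_left
    using is_H1_grad_L2[OF that(1)] is_H1_grad_L2[OF that(2)] by (intro conjI ballI L2_on_diff wp) auto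
  show ?thesis
    unfolding is_H2_def inner_diff_left
    using is_H2_L2(4,5)[OF 1] is_H2_L2(4,5)[OF 2] by (intro conjI ballI g) auto
qed

text \<open>Two functions with equal boundary values off the top face, without any equation. It is
  instantiated once for p and once for q.\<close>

locale admissible_pair =
  fixes B a b d M :: real and u1 u2 :: "'m::finite pt => real => real"
    and D1 D2 :: "'m pt => real => 'm pt" and H1 H2 :: "'m pt => real => 'm pt => 'm pt"
  assumes B: "0 < B" and d: "0 < d" and ab: "0 < a" "a < b"
    and adm: "admissible B a b d M u1 D1 H1" "admissible B a b d M u2 D2 H2"
    and bc: "x \<in> frontier (Omega B a b) - top_face B b ==> al \<in> {-d<..<d} ==> u1 x al = u2 x al"
begin

abbreviation "Om \<equiv> Omega B a b :: 'm pt set"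
abbreviation "Qu \<equiv> cubeQ B :: (real^'m) set"
abbreviation "S \<equiv> {-d..d}"
abbreviation "v al x \<equiv> u1 x al - u2 x al"
abbreviation "D al x \<equiv> D1 x al - D2 x al"
abbreviation "H al x e \<equiv> H1 x al e - H2 x al e"
abbreviation "lapl al x \<equiv> lap H1 x al - lap H2 x al"
abbreviation "lo \<equiv> (\<chi> i. - B) :: real^'m"
abbreviation "up \<equiv> (\<chi> i. B) :: real^'m"

lemma Om_prod: "Om = Qu \<times> {a<..<b}" by (simp add: Omega_def)

lemma Om_sets: "Om \<in> sets borel" "bounded Om" "S \<in> sets borel" "bounded S" "{a<..<b} \<in> sets borel" "bounded {a<..<b}"
  by (simp_all add: borel_open)

lemma v_family: "L2_family Om S v"
  by (rule L2_family_diff[OF admissible_families(1)[OF adm(1)] admissible_families(1)[OF adm(2)]])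

lemma D_family: "e \<in> Basis ==> L2_family Om S (\<lambda>al x. D al x \<bullet> e)"
  unfolding inner_diff_left by (rule L2_family_diff[OF admissible_families(2)[OF adm(1)] admissible_families(2)[OF adm(2)]])

lemma H_family: "e \<in> Basis ==> e' \<in> Basis ==> L2_family Om S (\<lambda>al x. H al x e \<bullet> e')"
  unfolding inner_diff_left by (rule L2_family_diff[OF admissible_families(3)[OF adm(1)] admissible_families(3)[OF adm(2)]])

lemma cont: "continuous_on (closure Om \<times> S) (\<lambda>(x, al). v al x)"
proof -
  have "continuous_on (closure Om \<times> S) (\<lambda>z. (case z of (x, al) => u1 x al) - (case z of (x, al) => u2 x al))"
    using adm unfolding admissible_def by (intro continuous_on_diff) blast+
  then show ?thesis by (simp add: case_prod_unfold)
qed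

lemma v_box_H2:
  assumes al: "al \<in> S"
  shows "box_H2 lo up a b (v al) (D al) (H al)"
proof
  show "\<And>j. j \<in> Basis ==> lo \<bullet> j < up \<bullet> j" by (rule cube_corners[OF B])
  show "0 < a" "a < b" by (fact ab)+
  have "continuous_on (closure Om) (\<lambda>x. (\<lambda>(x, al). v al x) (x, al))"
    by (rule continuous_on_compose2[OF cont]) (use al in \<open>auto intro!: continuous_intros\<close>)
  then show "continuous_on (cbox lo up \<times> {a..b}) (v al)" by (simp add: closure_Omega[OF B ab(2)])
  have h: "is_H2 Om (\<lambda>x. u1 x al) (\<lambda>x. D1 x al) (\<lambda>x. H1 x al)" "is_H2 Om (\<lambda>x. u2 x al) (\<lambda>x. D2 x al) (\<lambda>x. H2 x al)"
    using adm al unfolding admissible_def by blast+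
  have Ob: "Om = box (lo, a) (up, b)" by (simp add: Omega_eq box_Pair box_real)
  have "is_H2 Om (v al) (D al) (H al)" using is_H2_diff[OF h[unfolded Ob]] unfolding Ob .
  then show "is_H2 (box lo up \<times> {a<..<b}) (v al) (D al) (H al)" by (simp add: Omega_eq)
qed

lemma frontier_Om: "frontier Om = closure Om - Om"
  unfolding frontier_def by (simp add: interior_open)

lemma v_box_Dirichlet:
  assumes al: "al \<in> {-d<..<d}"
  shows "box_Dirichlet lo up a b (v al) (D al) (H al)"
proof -
  interpret P: box_H2 lo up a b "v al" "D al" "H al" by (rule v_box_H2) (use al in auto)
  have cl: "closure Om = cbox lo up \<times> {a..b}" by (rule closure_Omega[OF B ab(2)])
  show ?thesis
  proof
    fix y :: "real^'m" and z :: real and i :: "real^'m"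
    assume y: "y \<in> cbox lo up" and z: "z \<in> {a..b}" and i: "i \<in> Basis" "y \<bullet> i = lo \<bullet> i \<or> y \<bullet> i = up \<bullet> i"
    have "y \<notin> box lo up"
    proof
      assume "y \<in> box lo up"
      then have "lo \<bullet> i < y \<bullet> i \<and> y \<bullet> i < up \<bullet> i" unfolding mem_box using i(1) by blast
      with i(2) show False by linarith
    qed
    then have "(y, z) \<in> frontier Om - top_face B b"
      using y z unfolding frontier_Om cl by (auto simp: Omega_eq top_face_def cubeQ_box)
    from bc[OF this al] show "v al (y, z) = 0" by simp
  next
    fix y :: "real^'m" assume y: "y \<in> cbox lo up"
    have "(y, a) \<in> frontier Om - top_face B b"
      using y ab unfolding frontier_Om cl by (auto simp: Omega_eq top_face_def)
    from bc[OF this al] show "v al (y, a) = 0" by simp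
  qed
qed

section \<open>Boundary data and weighted energies of the difference\<close>

definition "value_sq al = sqH1w Qu (\<lambda>y. u1 (y, b) al - u2 (y, b) al)"
definition "normal_sq al = sqL2 Qu (\<lambda>y. trz B a b D1 H1 al y - trz B a b D2 H2 al y)"

lemma ez_eq: "(ez :: 'm pt) = (0, 1)" by (simp add: ez_def)

lemma top_trace_family:
  "e \<in> Basis ==> e' \<in> Basis ==> L2_family Qu S (\<lambda>al. top_trace a b (\<lambda>x. D al x \<bullet> e) (\<lambda>x. H al x e' \<bullet> e))"
  by (rule L2_family_top_trace[OF ab(2) cubeQ_simps(1,2) D_family[unfolded Om_prod] H_family[unfolded Om_prod]])

text \<open>\<open>sqH1w\<close> involves a choice for each parameter, so its dependence on the
  parameter is opaque. Expressed through \<open>top_trace\<close> it is a sum of squared norms of L2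
  families. The second claim is what \<open>pair_carleman\<close> consumes.\<close>

lemma value_sq:
  assumes al: "al \<in> S"
  shows "value_sq al = sqL2 Qu (top_trace a b (v al) (\<lambda>x. D al x \<bullet> (0, 1)))
      + (\<Sum>i\<in>Basis. sqL2 Qu (top_trace a b (\<lambda>x. D al x \<bullet> (i, 0)) (\<lambda>x. H al x (0, 1) \<bullet> (i, 0))))"
    and "sqL2 Qu (\<lambda>y. v al (y, b)) \<le> value_sq al"
proof -
  interpret P: box_H2 lo up a b "v al" "D al" "H al" by (rule v_box_H2[OF al])
  have eq: "value_sq al = sqL2 Qu (\<lambda>y. v al (y, b)) + (\<Sum>i\<in>Basis. sqL2 Qu (\<lambda>y. P.top_grad y \<bullet> i))"
    unfolding value_sq_def cubeQ_box by (rule sqH1w_eq[OF P.lu P.top_H1_grad])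
  show "sqL2 Qu (\<lambda>y. v al (y, b)) \<le> value_sq al" unfolding eq by (simp add: sum_nonneg)
  have "sqL2 Qu (\<lambda>y. v al (y, b)) = sqL2 Qu (top_trace a b (v al) (\<lambda>x. D al x \<bullet> (0, 1)))"
    unfolding cubeQ_box
  proof (rule sqL2_cong_AE[OF L2_on_measurable[OF P.top_value_L2]])
    show "top_trace a b (v al) (\<lambda>x. D al x \<bullet> (0, 1)) \<in> borel_measurable (leb (box lo up))"
      by (rule L2_on_measurable[OF top_trace_L2(1)[OF ab(2) P.Abox P.vL2 P.DL2[OF P.basis_top]]])
    show "AE y in leb (box lo up). v al (y, b) = top_trace a b (v al) (\<lambda>x. D al x \<bullet> (0, 1)) y"
      using P.top_trace_eq by eventually_elim simp
  qed
  moreover have "(\<Sum>i\<in>Basis. sqL2 Qu (\<lambda>y. P.top_grad y \<bullet> i))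
     = (\<Sum>i\<in>Basis. sqL2 Qu (top_trace a b (\<lambda>x. D al x \<bullet> (i, 0)) (\<lambda>x. H al x (0, 1) \<bullet> (i, 0))))"
    by (intro sum.cong refl) (simp add: P.top_grad_inner)
  ultimately show "value_sq al = sqL2 Qu (top_trace a b (v al) (\<lambda>x. D al x \<bullet> (0, 1)))
      + (\<Sum>i\<in>Basis. sqL2 Qu (top_trace a b (\<lambda>x. D al x \<bullet> (i, 0)) (\<lambda>x. H al x (0, 1) \<bullet> (i, 0))))"
    unfolding eq by simp
qed

lemma Basis_parts: "i \<in> Basis ==> (i, 0) \<in> (Basis :: 'm pt set)" "(0, 1) \<in> (Basis :: 'm pt set)"
  by (auto simp: Basis_prod_def)

text \<open>If this failed, the data integral in the theorem would be 0 by convention and could not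
  bound anything.\<close>

lemma value_sq_integrable: "integrable (leb S) value_sq"
proof -
  have 1: "L2_family Qu S (\<lambda>al. top_trace a b (v al) (\<lambda>x. D al x \<bullet> (0, 1)))"
    by (rule L2_family_top_trace[OF ab(2) cubeQ_simps(1,2) v_family[unfolded Om_prod] D_family[OF Basis_parts(2), unfolded Om_prod]])
  have "continuous_on S (\<lambda>al. sqL2 Qu (top_trace a b (v al) (\<lambda>x. D al x \<bullet> (0, 1)))
      + (\<Sum>i\<in>Basis. sqL2 Qu (top_trace a b (\<lambda>x. D al x \<bullet> (i, 0)) (\<lambda>x. H al x (0, 1) \<bullet> (i, 0)))))"
    by (intro continuous_on_add continuous_on_sum L2_family_continuous 1 top_trace_family Basis_parts)
  then have "continuous_on S value_sq" by (rule continuous_on_eq) (simp add: value_sq(1))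
  then show ?thesis by (rule integrable_continuous_Icc)
qed

lemma normal_sq:
  assumes al: "al \<in> S"
  shows "normal_sq al = sqL2 Qu (top_trace a b (\<lambda>x. D al x \<bullet> (0, 1)) (\<lambda>x. H al x (0, 1) \<bullet> (0, 1)))"
proof -
  have h: "is_H2 Om (\<lambda>x. u1 x al) (\<lambda>x. D1 x al) (\<lambda>x. H1 x al)" "is_H2 Om (\<lambda>x. u2 x al) (\<lambda>x. D2 x al) (\<lambda>x. H2 x al)"
    using adm al unfolding admissible_def by blast+
  note g1 = is_H2_L2(5)[OF h(1) ez_Basis] and g2 = is_H2_L2(5)[OF h(2) ez_Basis]
  note t1 = trace_top_eq[OF B ab(2) g1] and t2 = trace_top_eq[OF B ab(2) g2]
  note L1 = is_H1_grad_L2(1)[OF g1, unfolded Om_prod] is_H1_grad_L2(2)[OF g1 ez_Basis, unfolded Om_prod]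
  note L2 = is_H1_grad_L2(1)[OF g2, unfolded Om_prod] is_H1_grad_L2(2)[OF g2 ez_Basis, unfolded Om_prod]
  have "sqL2 Qu (\<lambda>y. trz B a b D1 H1 al y - trz B a b D2 H2 al y)
    = sqL2 Qu (top_trace a b (\<lambda>x. D1 x al \<bullet> ez - D2 x al \<bullet> ez) (\<lambda>x. H1 x al ez \<bullet> ez - H2 x al ez \<bullet> ez))"
  proof (rule sqL2_cong_AE)
    show "(\<lambda>y. trz B a b D1 H1 al y - trz B a b D2 H2 al y) \<in> borel_measurable (leb Qu)"
      unfolding trz_def by (intro L2_on_measurable L2_on_diff t1(1) t2(1))
    show "top_trace a b (\<lambda>x. D1 x al \<bullet> ez - D2 x al \<bullet> ez) (\<lambda>x. H1 x al ez \<bullet> ez - H2 x al ez \<bullet> ez) \<in> borel_measurable (leb Qu)"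
      by (intro L2_on_measurable top_trace_L2(1)[OF ab(2) cubeQ_simps(1,2)] L2_on_diff L1 L2)
    show "AE y in leb Qu. trz B a b D1 H1 al y - trz B a b D2 H2 al y
       = top_trace a b (\<lambda>x. D1 x al \<bullet> ez - D2 x al \<bullet> ez) (\<lambda>x. H1 x al ez \<bullet> ez - H2 x al ez \<bullet> ez) y"
      using t1(2) t2(2) top_trace_diff_AE[OF ab(2) cubeQ_simps(1,2) L1 L2]
      unfolding trz_def by eventually_elim simp
  qed
  then show ?thesis by (simp add: normal_sq_def ez_eq inner_diff_left)
qed

lemma normal_sq_integrable: "integrable (leb S) normal_sq"
proof -
  have "continuous_on S normal_sq"
    by (rule continuous_on_eq[OF L2_family_continuous[OF top_trace_family[OF Basis_parts(2) Basis_parts(2)]]])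
      (simp add: normal_sq)
  then show ?thesis by (rule integrable_continuous_Icc)
qed

text \<open>The square root of the Carleman weight, so that weighted integrals of squares become
  \<open>sqL2\<close> of a product and the L2 lemmas apply.\<close>

definition "root_weight lam x = exp (lam * (snd (x :: 'm pt))^2 / 2)"

lemma root_weight_measurable: "root_weight lam \<in> borel_measurable (leb X)"
  unfolding root_weight_def[abs_def]
  by (intro measurable_restrict_space1 measurable_completion)
    (auto intro!: borel_measurable_continuous_onI continuous_intros)

lemma root_weight_bounds:
  assumes "lam > 0" "x \<in> Om"
  shows "1 \<le> root_weight lam x" "\<bar>root_weight lam x\<bar> \<le> exp (lam * b^2 / 2)"
proof -
  have "(snd x)^2 \<le> b^2" using assms ab by (auto simp: Omega_def intro!: power_mono)
  then show "1 \<le> root_weight lam x" "\<bar>root_weight lam x\<bar> \<le> exp (lam * b^2 / 2)"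
    using assms(1) by (auto simp: root_weight_def)
qed

lemma root_weight_sq: "(root_weight lam x)^2 = exp (lam * (snd x)^2)"
  by (simp add: root_weight_def exp_half_sq)

definition "energy lam al = (LINT x|leb Om. exp (lam * (snd x)^2) * ((norm (D al x))^2 + (v al x)^2))"

lemma weighted_families:
  assumes "lam > 0"
  shows "L2_family Om S (\<lambda>al x. root_weight lam x * v al x)"
    and "e \<in> Basis ==> L2_family Om S (\<lambda>al x. root_weight lam x * (D al x \<bullet> e))"
  by (rule L2_family_mult_bounded[OF v_family root_weight_measurable root_weight_bounds(2)[OF assms]], assumption,
      rule L2_family_mult_bounded[OF D_family root_weight_measurable root_weight_bounds(2)[OF assms]])

lemma energy_eq:
  assumes "lam > 0" "al \<in> S"
  shows "energy lam al = sqL2 Om (\<lambda>x. root_weight lam x * v al x) + (\<Sum>e\<in>Basis. sqL2 Om (\<lambda>x. root_weight lam x * (D al x \<bullet> e)))"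
    and "integrable (leb Om) (\<lambda>x. exp (lam * (snd x)^2) * ((norm (D al x))^2 + (v al x)^2))"
proof -
  note f = weighted_families[OF assms(1)]
  have 1: "L2_on Om (\<lambda>x. root_weight lam x * v al x)" by (rule L2_familyD[OF f(1) assms(2)])
  have 2: "L2_on Om (\<lambda>x. (root_weight lam x *\<^sub>R D al x) \<bullet> e)" if "e \<in> Basis" for e
    using L2_familyD[OF f(2)[OF that] assms(2)] by simp
  have s: "sqH1 Om (\<lambda>x. root_weight lam x * v al x) (\<lambda>x. root_weight lam x *\<^sub>R D al x)
      = sqL2 Om (\<lambda>x. root_weight lam x * v al x) + (\<Sum>e\<in>Basis. sqL2 Om (\<lambda>x. (root_weight lam x *\<^sub>R D al x) \<bullet> e))"
    "integrable (leb Om) (\<lambda>x. (root_weight lam x * v al x)^2 + (norm (root_weight lam x *\<^sub>R D al x))^2)"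
    by (rule sqH1_eq[OF 1 2], assumption)+
  have eq: "(root_weight lam x * v al x)^2 + (norm (root_weight lam x *\<^sub>R D al x))^2 = exp (lam * (snd x)^2) * ((norm (D al x))^2 + (v al x)^2)" for x
    by (simp only: norm_scaleR power_mult_distrib power2_abs root_weight_sq distrib_left add.commute)
  show "energy lam al = sqL2 Om (\<lambda>x. root_weight lam x * v al x) + (\<Sum>e\<in>Basis. sqL2 Om (\<lambda>x. root_weight lam x * (D al x \<bullet> e)))"
    using s(1) unfolding sqH1_def eq by (simp add: energy_def)
  show "integrable (leb Om) (\<lambda>x. exp (lam * (snd x)^2) * ((norm (D al x))^2 + (v al x)^2))"
    using s(2) unfolding eq .
qed

lemma energy_integrable:
  assumes "lam > 0" shows "integrable (leb S) (energy lam)"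
proof -
  have "continuous_on S (\<lambda>al. sqL2 Om (\<lambda>x. root_weight lam x * v al x) + (\<Sum>e\<in>Basis. sqL2 Om (\<lambda>x. root_weight lam x * (D al x \<bullet> e))))"
    by (intro continuous_on_add continuous_on_sum L2_family_continuous weighted_families assms)
  then have "continuous_on S (energy lam)" by (rule continuous_on_eq) (simp add: energy_eq(1)[OF assms])
  then show ?thesis by (rule integrable_continuous_Icc)
qed

lemma energy_nonneg: "0 \<le> energy lam al"
  unfolding energy_def by (rule integral_nonneg_AE) auto

lemma sqH1_le_energy:
  assumes "lam > 0" "al \<in> S"
  shows "sqH1 Om (v al) (D al) \<le> energy lam al"
  unfolding sqH1_def energy_def
proof (rule integral_mono)
  show "integrable (leb Om) (\<lambda>x. (v al x)^2 + (norm (D al x))^2)"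
    by (rule sqH1_eq(2)[OF L2_familyD[OF v_family assms(2)] L2_familyD[OF D_family assms(2)]])
  show "integrable (leb Om) (\<lambda>x. exp (lam * (snd x)^2) * ((norm (D al x))^2 + (v al x)^2))"
    by (rule energy_eq(2)[OF assms])
  fix x
  have "1 * ((norm (D al x))^2 + (v al x)^2) \<le> exp (lam * (snd x)^2) * ((norm (D al x))^2 + (v al x)^2)"
    using assms(1) by (intro mult_right_mono) auto
  then show "(v al x)^2 + (norm (D al x))^2 \<le> exp (lam * (snd x)^2) * ((norm (D al x))^2 + (v al x)^2)" by simp
qed

lemma sqH1_integrable: "integrable (leb S) (\<lambda>al. sqH1 Om (v al) (D al))"
proof -
  have "continuous_on S (\<lambda>al. sqL2 Om (v al) + (\<Sum>e\<in>Basis. sqL2 Om (\<lambda>x. D al x \<bullet> e)))"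
    by (intro continuous_on_add continuous_on_sum L2_family_continuous v_family D_family)
  then have "continuous_on S (\<lambda>al. sqH1 Om (v al) (D al))"
    by (rule continuous_on_eq) (simp add: sqH1_eq(1)[OF L2_familyD[OF v_family] L2_familyD[OF D_family]])
  then show ?thesis by (rule integrable_continuous_Icc)
qed

lemma lapl_eq: "lapl al x = (\<Sum>e\<in>Basis. H al x e \<bullet> e)"
  by (simp add: lap_def inner_diff_left sum_subtractf)

lemma pair_carleman:
  assumes lam: "lam > 0" "lam * a^2 \<ge> 6" and al: "al \<in> {-d<..<d}"
  shows "lam * energy lam al \<le> carleman_const a b * (2 * (LINT x|leb Om. exp (lam * (snd x)^2) * (lapl al x)^2)
       + carleman_bdry b lam * (value_sq al + normal_sq al))"
    and "integrable (leb Om) (\<lambda>x. exp (lam * (snd x)^2) * (lapl al x)^2)"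
proof -
  interpret P: box_Dirichlet lo up a b "v al" "D al" "H al" by (rule v_box_Dirichlet[OF al])
  have aS: "al \<in> S" using al by auto
  have L: "P.laplace = lapl al" by (simp add: fun_eq_iff P.laplace_def lapl_eq)
  have O: "box lo up \<times> {a<..<b} = Om" by (simp add: Omega_eq)
  show "integrable (leb Om) (\<lambda>x. exp (lam * (snd x)^2) * (lapl al x)^2)"
    using P.weighted_slice(3)[OF P.laplace_L2, of lam] unfolding L O .
  have K: "carleman_const a b \<ge> 0" and Bd: "carleman_bdry b lam \<ge> 0"
    using ab lam by (simp_all add: carleman_const_def carleman_bdry_def)
  have "lam * energy lam al \<le> carleman_const a b * (2 * (LINT x|leb Om. exp (lam * (snd x)^2) * (lapl al x)^2)
       + carleman_bdry b lam * (sqL2 Qu (\<lambda>y. v al (y, b)) + normal_sq al))"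
    using P.carleman_box[OF lam] unfolding L O normal_sq[OF aS] energy_def cubeQ_box .
  also have "\<dots> \<le> carleman_const a b * (2 * (LINT x|leb Om. exp (lam * (snd x)^2) * (lapl al x)^2)
       + carleman_bdry b lam * (value_sq al + normal_sq al))"
    by (intro mult_left_mono add_mono value_sq(2)[OF aS] order_refl K Bd)
  finally show "lam * energy lam al \<le> carleman_const a b * (2 * (LINT x|leb Om. exp (lam * (snd x)^2) * (lapl al x)^2)
       + carleman_bdry b lam * (value_sq al + normal_sq al))" .
qed

lemma v_joint: "L2_on (Om \<times> S) (\<lambda>z. v (snd z) (fst z))"
proof -
  have c: "continuous_on (closure Om \<times> S) (\<lambda>z. v (snd z) (fst z))" using cont by (simp add: case_prod_unfold)
  show ?thesis
  proof (rule L2_on_continuous[OF c])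
    show "compact (closure Om \<times> S)" by (intro compact_Times) (simp_all add: compact_closure)
    show "Om \<times> S \<subseteq> closure Om \<times> S" using closure_subset by blast
    show "Om \<times> S \<in> lmeasurable" by (rule lmeasurable_Times[OF Om_sets(1,2,3,4)])
  qed
qed

lemma D_joint:
  assumes e: "e \<in> Basis" shows "L2_on (Om \<times> S) (\<lambda>z. D (snd z) (fst z) \<bullet> e)"
proof (rule L2_on_joint[OF Om_sets(1,2) D_family[OF e]])
  have "(\<lambda>(x, al). D1 x al) \<in> borel_measurable (leb (Om \<times> S))" "(\<lambda>(x, al). D2 x al) \<in> borel_measurable (leb (Om \<times> S))"
    using adm unfolding admissible_def by blast+
  then show "(\<lambda>z. D (snd z) (fst z) \<bullet> e) \<in> borel_measurable (leb (Om \<times> S))"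
    by (simp add: case_prod_unfold)
qed

lemma memory_integral:
  assumes lam: "lam > 0"
  shows "(LINT x|leb Om. exp (lam * (snd x)^2) * sqL2 S (\<lambda>be. v be x)) \<le> (LINT be|leb S. energy lam be)"
    and "integrable (leb Om) (\<lambda>x. exp (lam * (snd x)^2) * sqL2 S (\<lambda>be. v be x))"
proof -
  have "(\<lambda>z :: 'm pt \<times> real. root_weight lam (fst z)) \<in> borel_measurable (leb (Om \<times> S))"
    unfolding root_weight_def[abs_def]
    by (intro measurable_restrict_space1 measurable_completion)
      (auto intro!: borel_measurable_continuous_onI continuous_intros)
  then have j: "L2_on (Om \<times> S) (\<lambda>z. root_weight lam (fst z) * v (snd z) (fst z))"
    by (rule L2_on_mult_bounded[OF v_joint]) (use root_weight_bounds(2)[OF lam] in auto)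
  have eq: "sqL2 S (\<lambda>be. root_weight lam (fst (x, be)) * v (snd (x, be)) (fst (x, be))) = exp (lam * (snd x)^2) * sqL2 S (\<lambda>be. v be x)" for x
    by (simp add: sqL2_cmult root_weight_sq)
  show "integrable (leb Om) (\<lambda>x. exp (lam * (snd x)^2) * sqL2 S (\<lambda>be. v be x))"
    using L2_on_partial_integral(2)[OF Om_sets(1,2,3,4) j] unfolding eq .
  have "(LINT x|leb Om. exp (lam * (snd x)^2) * sqL2 S (\<lambda>be. v be x)) = (LINT be|leb S. sqL2 Om (\<lambda>x. root_weight lam x * v be x))"
    using sqL2_iterated[OF Om_sets(1,2,3,4) j] unfolding eq by simp
  also have "\<dots> \<le> (LINT be|leb S. energy lam be)"
  proof (rule integral_mono[OF L2_family_integrable[OF weighted_families(1)[OF lam]] energy_integrable[OF lam]])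
    fix be assume "be \<in> space (leb S)"
    then show "sqL2 Om (\<lambda>x. root_weight lam x * v be x) \<le> energy lam be"
      using energy_eq(1)[OF lam, of be] by (simp add: sum_nonneg)
  qed
  finally show "(LINT x|leb Om. exp (lam * (snd x)^2) * sqL2 S (\<lambda>be. v be x)) \<le> (LINT be|leb S. energy lam be)" .
qed

end

section \<open>The coupled system\<close>

text \<open>It reconciles the open parameter interval, on which the equations and boundary
  conditions hold, with the closed interval of integration.\<close>

lemma AE_interior_Icc: "AE al in leb {c..d::real}. al \<in> {c<..<d}"
proof -
  have "AE al in lborel. al \<in> {c..d} \<longrightarrow> al \<in> {c<..<d}"
    using AE_lborel_singleton[of c] AE_lborel_singleton[of d] by eventually_elim auto
  then show ?thesis by (subst AE_lebesgue_on_iff) auto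
qed

lemma sqH1w_zero:
  fixes l u :: "'a::euclidean_space"
  assumes lu: "\<And>j. j \<in> Basis ==> l \<bullet> j < u \<bullet> j" and 0: "\<And>x. x \<in> box l u ==> f x = 0"
  shows "sqH1w (box l u) f = 0"
proof -
  have i: "(LINT x|leb (box l u). f x * h x) = 0" for h
  proof -
    have "(LINT x|leb (box l u). f x * h x) = (LINT x|leb (box l u). 0)"
      by (rule lint_cong) (simp_all add: 0)
    then show ?thesis by simp
  qed
  have ae: "AE x in leb (box l u). 0 = f x" by (rule AE_I2) (simp add: 0)
  have fm: "f \<in> borel_measurable (leb (box l u))"
    by (subst measurable_cong[where g="\<lambda>_. 0"]) (simp_all add: 0)
  have L: "L2_on (box l u) f" by (rule L2_on_cong_AE[OF L2_on_zero fm ae])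
  have H1: "is_H1_grad (box l u) f (\<lambda>_. 0)"
    unfolding is_H1_grad_def is_weak_partial_def using L i by simp
  have "sqH1w (box l u) f = sqL2 (box l u) f + (\<Sum>e\<in>(Basis::'a set). sqL2 (box l u) (\<lambda>x. 0 \<bullet> e))"
    by (rule sqH1w_eq[OF lu H1])
  moreover have "sqL2 (box l u) f = 0" using i[of f] by (simp add: sqL2_def power2_eq_square)
  ultimately show ?thesis by (simp add: sqL2_def)
qed

lemma integral_sq_le:
  fixes f :: "real => real"
  assumes "0 < d" "L2_on {-d..d} f"
  shows "(LINT al|leb {-d..d}. f al)^2 \<le> 2 * d * sqL2 {-d..d} f"
proof -
  have one: "L2_on {-d..d} (\<lambda>_. 1)" by (rule L2_on_bounded[of _ _ 1]) auto
  have "sqL2 {-d..d} (\<lambda>_. 1) = 2 * d" using assms(1) by (simp add: sqL2_def measure_restrict_space)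
  with L2_on_Cauchy_Schwarz[OF assms(2) one] show ?thesis by (simp add: mult.commute)
qed

lemma square_sum5_le:
  fixes r s t u w :: real
  shows "(r + s + t + u + w)^2 \<le> 5 * (r^2 + s^2 + t^2 + u^2 + w^2)"
proof -
  have "5 * (r^2 + s^2 + t^2 + u^2 + w^2) - (r + s + t + u + w)^2
    = (r - s)^2 + (r - t)^2 + (r - u)^2 + (r - w)^2 + (s - t)^2 + (s - u)^2 + (s - w)^2 + (t - u)^2 + (t - w)^2 + (u - w)^2"
    by (simp add: power2_eq_square algebra_simps)
  moreover have "\<dots> \<ge> 0" by (intro add_nonneg_nonneg) auto
  ultimately show ?thesis by linarith
qed

text \<open>\<open>G\<close> is differentiable on an open neighbourhood, so the two-sided
  \<open>deriv\<close> is meaningful also at the end points of the parameter interval. It is the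
  total derivative applied to a unit vector, whence the same bound \<open>K\<close>.\<close>

lemma C1_bounded_kernel:
  fixes G :: "'a::euclidean_space \<times> real \<times> real => real"
  assumes "C1_bounded (X \<times> S \<times> S) K G"
  shows "continuous_on (X \<times> S \<times> S) G"
    and "w \<in> X \<times> S \<times> S ==> \<bar>G w\<bar> \<le> K"
    and "x \<in> X ==> al \<in> S ==> continuous_on S (\<lambda>be. deriv (\<lambda>t. G (x, t, be)) al)"
    and "x \<in> X ==> al \<in> S ==> be \<in> S ==> \<bar>deriv (\<lambda>t. G (x, t, be)) al\<bar> \<le> K"
proof -
  obtain U DG where U: "X \<times> S \<times> S \<subseteq> U" and D: "\<And>w. w \<in> U ==> (G has_derivative blinfun_apply (DG w)) (at w)"
    and DG: "continuous_on U DG" and K: "\<And>w. w \<in> X \<times> S \<times> S ==> \<bar>G w\<bar> \<le> K \<and> norm (DG w) \<le> K"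
    using assms unfolding C1_bounded_def by blast
  show "continuous_on (X \<times> S \<times> S) G"
  proof (rule continuous_at_imp_continuous_on, intro ballI)
    fix w assume "w \<in> X \<times> S \<times> S"
    then have "w \<in> U" using U by blast
    from has_derivative_continuous[OF D[OF this]] show "isCont G w" .
  qed
  show "w \<in> X \<times> S \<times> S ==> \<bar>G w\<bar> \<le> K" using K by blast
  let ?e = "(0, 1, 0) :: 'a \<times> real \<times> real"
  have d: "deriv (\<lambda>t. G (x, t, be)) al = blinfun_apply (DG (x, al, be)) ?e" if "(x, al, be) \<in> X \<times> S \<times> S" for x al be
  proof -
    have w: "(x, al, be) \<in> U" using that U by blast
    have i: "((\<lambda>t. (x, t, be)) has_derivative (\<lambda>h. h *\<^sub>R ?e)) (at al)"
      by (auto intro!: derivative_eq_intros simp: zero_prod_def)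
    have "((\<lambda>t. G (x, t, be)) has_derivative (\<lambda>h. blinfun_apply (DG (x, al, be)) (h *\<^sub>R ?e))) (at al)"
      by (rule has_derivative_compose[OF i]) (rule D[OF w])
    moreover have "(\<lambda>h. blinfun_apply (DG (x, al, be)) (h *\<^sub>R ?e)) = (*) (blinfun_apply (DG (x, al, be)) ?e)"
      by (rule ext) (simp only: blinfun.scaleR_right real_scaleR_def mult.commute)
    ultimately have "((\<lambda>t. G (x, t, be)) has_real_derivative blinfun_apply (DG (x, al, be)) ?e) (at al)"
      unfolding has_field_derivative_def by (simp only:)
    then show ?thesis by (rule DERIV_imp_deriv)
  qed
  show "continuous_on S (\<lambda>be. deriv (\<lambda>t. G (x, t, be)) al)" if x: "x \<in> X" "al \<in> S"
  proof -
    have "continuous_on S (\<lambda>be. DG (x, al, be))"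
      by (rule continuous_on_compose2[OF DG]) (use x U in \<open>auto intro!: continuous_intros\<close>)
    then have "continuous_on S (\<lambda>be. blinfun_apply (DG (x, al, be)) ?e)"
      by (intro bounded_bilinear.continuous_on[OF bounded_bilinear_blinfun_apply] continuous_on_const)
    then show ?thesis by (rule continuous_on_eq) (use x in \<open>simp add: d\<close>)
  qed
  show "\<bar>deriv (\<lambda>t. G (x, t, be)) al\<bar> \<le> K" if x: "x \<in> X" "al \<in> S" "be \<in> S"
  proof -
    have "norm (blinfun_apply (DG (x, al, be)) ?e) \<le> norm (DG (x, al, be)) * norm ?e" by (rule norm_blinfun)
    moreover have "norm ?e = 1" by (simp add: norm_Pair)
    ultimately show ?thesis using K[of "(x, al, be)"] x d[of x al be] by simp
  qed
qed

lemma admissible_pointwise: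
  fixes u :: "'m::finite pt => real => real"
  assumes adm: "admissible B a b d M u Du Hu" and x: "x \<in> closure (Omega B a b)"
  shows "continuous_on {-d..d} (u x)" and "al \<in> {-d..d} ==> \<bar>u x al\<bar> \<le> M"
proof -
  have c: "continuous_on (closure (Omega B a b) \<times> {-d..d}) (\<lambda>(x, al). u x al)"
    using adm unfolding admissible_def by blast
  have "continuous_on {-d..d} (\<lambda>al. (\<lambda>(x, al). u x al) (x, al))"
    by (rule continuous_on_compose2[OF c]) (use x in \<open>auto intro!: continuous_intros\<close>)
  then show "continuous_on {-d..d} (u x)" by simp
  show "al \<in> {-d..d} ==> \<bar>u x al\<bar> \<le> M" using adm x unfolding admissible_def by blast
qed

lemma admissible_grad_joint:
  fixes u :: "'m::finite pt => real => real"
  assumes adm: "admissible B a b d M u Du Hu" and e: "e \<in> Basis"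
  shows "L2_on (Omega B a b \<times> {-d..d}) (\<lambda>z. Du (fst z) (snd z) \<bullet> e)"
proof -
  have "(\<lambda>(x, al). Du x al) \<in> borel_measurable (leb (Omega B a b \<times> {-d..d}))"
    using adm unfolding admissible_def by blast
  then have "(\<lambda>z. Du (fst z) (snd z) \<bullet> e) \<in> borel_measurable (leb (Omega B a b \<times> {-d..d}))"
    by (simp add: case_prod_unfold)
  from L2_on_joint[OF _ _ admissible_families(2)[OF adm e] this] show ?thesis
    using cubeQ_simps by (simp add: borel_open)
qed

text \<open>\<open>scat_bound\<close> bounds the scattering integrals, the factor
  \<open>2 * d\<close> being the length of the interval; \<open>scat_lip\<close> is their Lipschitz
  constant with respect to \<open>J x\<close>. In \<open>source_const\<close>, the Lipschitz
  constant of \<open>Lcommon\<close>, the summands 1 and \<open>2 / a\<close> come from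
  \<open>nu\<close> and \<open>dnu\<close>.\<close>

definition "scat_bound d KG Ks M = Ks * (2 * d * (KG * exp M))" for d :: real
definition "scat_lip KG Ks M = Ks * (KG * exp M)" for KG :: real
definition "source_const d a KG Ks M = 1 + 2 / a + exp M * ((M + 1) * (scat_bound d KG Ks M + scat_lip KG Ks M))" for a :: real
text \<open>The factor 5 comes from squaring a sum of five terms; \<open>1 + 2 * d\<close> accounts
  for the Cauchy-Schwarz bound of the squared integral \<open>J x\<close>.\<close>

definition "lap_const d a \<epsilon> KG Ks M = (source_const d a KG Ks M / \<epsilon>)^2 * (5 * (1 + 2 * d))" for \<epsilon> :: real
definition "recon_const d KG Ks M = (1 + (exp M * (scat_bound d KG Ks M + 2 * d * scat_lip KG Ks M))^2) / d" for d :: real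
text \<open>The first entry is the threshold of \<open>carleman_1d\<close>. The second makes lambda
  exceed the coefficient of the terms to be absorbed by 1, so that one full copy of the energy
  survives.\<close>

definition "lam_const d a b \<epsilon> KG Ks M = max (6 / a^2) (1 + carleman_const a b * (4 * lap_const d a \<epsilon> KG Ks M * (1 + 2 * d)))" for b :: real
definition "stab_const d a b \<epsilon> KG Ks M = carleman_const a b * carleman_bdry b (lam_const d a b \<epsilon> KG Ks M)" for b :: real

locale two_solutions =
  P: admissible_pair B a b d M p1 p2 Dp1 Dp2 Hp1 Hp2 + Q: admissible_pair B a b d M q1 q2 Dq1 Dq2 Hq1 Hq2
  for B a b d M :: real and p1 p2 q1 q2 :: "'m::finite pt => real => real"
    and Dp1 Dp2 Dq1 Dq2 :: "'m pt => real => 'm pt" and Hp1 Hp2 Hq1 Hq2 :: "'m pt => real => 'm pt => 'm pt" +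
  fixes \<epsilon> KG Ks :: real and e1 :: 'm and mus :: "'m pt => real" and G :: "'m pt \<times> real \<times> real => real"
  assumes eps: "0 < \<epsilon>"
    and mus: "x \<in> closure (Omega B a b) ==> 0 \<le> mus x \<and> mus x \<le> Ks"
    and G: "C1_bounded (closure (Omega B a b) \<times> {-d..d} \<times> {-d..d}) KG G"
    and eqs: "al \<in> {-d<..<d} ==> AE x in leb (Omega B a b).
        - \<epsilon> * lap Hp1 x al + Lcommon d e1 mus G p1 Dp1 q1 Dq1 x al = 0 \<and>
        - \<epsilon> * lap Hq1 x al + Lcommon d e1 mus G p1 Dp1 q1 Dq1 x al = 0 \<and>
        - \<epsilon> * lap Hp2 x al + Lcommon d e1 mus G p2 Dp2 q2 Dq2 x al = 0 \<and>
        - \<epsilon> * lap Hq2 x al + Lcommon d e1 mus G p2 Dp2 q2 Dq2 x al = 0"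
begin

abbreviation "Om \<equiv> Omega B a b :: 'm pt set"
abbreviation "S \<equiv> {-d..d}"
abbreviation "J x \<equiv> \<integral>be. \<bar>p1 x be - p2 x be\<bar> \<partial>leb S"
abbreviation "s0 \<equiv> scat_bound d KG Ks M"
abbreviation "j0 \<equiv> scat_lip KG Ks M"
abbreviation "Ek lam \<equiv> (LINT al|leb S. P.energy lam al)"

lemma d0: "0 < d" and a0: "0 < a" and ab: "a < b" using P.d P.ab by auto

lemma Om_cl: "x \<in> Om ==> x \<in> closure Om" using closure_subset by blast

lemma Om_snd: "x \<in> Om ==> a \<le> snd x" by (auto simp: Omega_def)

lemmas p_cont = admissible_pointwise(1)[OF P.adm(1)] admissible_pointwise(1)[OF P.adm(2)]
lemmas p_bound = admissible_pointwise(2)[OF P.adm(1)] admissible_pointwise(2)[OF P.adm(2)]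
lemmas q_bound = admissible_pointwise(2)[OF Q.adm(1)] admissible_pointwise(2)[OF Q.adm(2)]

text \<open>The constants are arbitrary reals in the theorem; evaluating the bounds at one point of
  the nonempty domain and at the parameter 0 forces the signs.\<close>

lemma consts_nonneg: "0 \<le> M" "0 \<le> KG" "0 \<le> Ks" "0 \<le> s0" "0 \<le> j0"
proof -
  have "((0::real^'m), (a + b) / 2) \<in> Om" using P.B P.ab by (simp add: Omega_def cubeQ_def)
  then have x: "((0::real^'m), (a + b) / 2) \<in> closure Om" by (rule Om_cl)
  have z: "0 \<in> S" using d0 by simp
  show M: "0 \<le> M" using p_bound(1)[OF x z] by linarith
  show KG: "0 \<le> KG" using C1_bounded_kernel(2)[OF G, of "((0, (a + b) / 2), 0, 0)"] x z by fastforce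
  show Ks: "0 \<le> Ks" using mus[OF x] by linarith
  show "0 \<le> s0" "0 \<le> j0" using KG Ks d0 by (simp_all add: scat_bound_def scat_lip_def)
qed

section \<open>Lipschitz bounds for the lower order terms\<close>

lemma J_nonneg: "0 \<le> J x" by (rule integral_nonneg_AE) simp

lemma J_integrable:
  assumes "x \<in> closure Om" shows "L2_on S (\<lambda>be. \<bar>p1 x be - p2 x be\<bar>)"
  by (rule L2_on_continuous[of S]) (auto intro!: continuous_intros p_cont assms)

lemma J_sq:
  assumes "x \<in> closure Om" shows "(J x)^2 \<le> 2 * d * sqL2 S (\<lambda>be. p1 x be - p2 x be)"
  using integral_sq_le[OF d0 J_integrable[OF assms]] by (simp add: sqL2_def)

lemma scat_bounds:
  assumes x: "x \<in> closure Om" and al: "al \<in> S"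
  shows "\<bar>scatG d mus G p1 x al\<bar> \<le> s0" "\<bar>scatG d mus G p1 x al - scatG d mus G p2 x al\<bar> \<le> j0 * J x"
    and "\<bar>scatdG d mus G p1 x al\<bar> \<le> s0" "\<bar>scatdG d mus G p1 x al - scatdG d mus G p2 x al\<bar> \<le> j0 * J x"
proof -
  have gen1: "\<bar>mus x * (LINT be|leb S. k be * exp (p1 x be))\<bar> \<le> s0"
    and gen2: "\<bar>mus x * (LINT be|leb S. k be * exp (p1 x be)) - mus x * (LINT be|leb S. k be * exp (p2 x be))\<bar> \<le> j0 * J x"
    if k: "continuous_on S k" "\<And>be. be \<in> S ==> \<bar>k be\<bar> \<le> KG" for k
  proof -
    note kb = kernel_bounds[OF d0 k p_cont[OF x] p_bound[OF x]]
    show "\<bar>mus x * (LINT be|leb S. k be * exp (p1 x be))\<bar> \<le> s0"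
      unfolding abs_mult scat_bound_def using mus[OF x] by (intro mult_mono kb(1)) auto
    have "\<bar>mus x\<bar> * \<bar>(LINT be|leb S. k be * exp (p1 x be)) - (LINT be|leb S. k be * exp (p2 x be))\<bar>
      \<le> Ks * (KG * exp M * J x)"
      using mus[OF x] by (intro mult_mono kb(2)) auto
    then show "\<bar>mus x * (LINT be|leb S. k be * exp (p1 x be)) - mus x * (LINT be|leb S. k be * exp (p2 x be))\<bar> \<le> j0 * J x"
      unfolding right_diff_distrib[symmetric] abs_mult scat_lip_def by (simp only: mult.assoc)
  qed
  have gc: "continuous_on S (\<lambda>be. G (x, al, be))"
    by (rule continuous_on_compose2[OF C1_bounded_kernel(1)[OF G]]) (use x al in \<open>auto intro!: continuous_intros\<close>)
  have gb: "\<bar>G (x, al, be)\<bar> \<le> KG" if "be \<in> S" for be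
    using C1_bounded_kernel(2)[OF G, of "(x, al, be)"] x al that by blast
  show "\<bar>scatG d mus G p1 x al\<bar> \<le> s0" "\<bar>scatG d mus G p1 x al - scatG d mus G p2 x al\<bar> \<le> j0 * J x"
    unfolding scatG_def by (rule gen1[OF gc gb], assumption, rule gen2[OF gc gb], assumption)
  show "\<bar>scatdG d mus G p1 x al\<bar> \<le> s0" "\<bar>scatdG d mus G p1 x al - scatdG d mus G p2 x al\<bar> \<le> j0 * J x"
    unfolding scatdG_def
    by (rule gen1[OF C1_bounded_kernel(3)[OF G x al] C1_bounded_kernel(4)[OF G x al]], assumption,
        rule gen2[OF C1_bounded_kernel(3)[OF G x al] C1_bounded_kernel(4)[OF G x al]], assumption)
qed

lemma Lcommon_diff:
  assumes x: "x \<in> Om" and al: "al \<in> S"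
  shows "\<bar>Lcommon d e1 mus G p1 Dp1 q1 Dq1 x al - Lcommon d e1 mus G p2 Dp2 q2 Dq2 x al\<bar>
    \<le> source_const d a KG Ks M * (norm (Q.D al x) + norm (P.D al x) + \<bar>P.v al x\<bar> + \<bar>Q.v al x\<bar> + J x)"
proof -
  note c = Om_cl[OF x] and s = scat_bounds[OF Om_cl[OF x] al]
  let ?E = "exp M" and ?c = "source_const d a KG Ks M"
  define nq np vp vq j where w: "nq = norm (Q.D al x)" "np = norm (P.D al x)" "vp = \<bar>P.v al x\<bar>" "vq = \<bar>Q.v al x\<bar>" "j = J x"
  have w0: "0 \<le> nq" "0 \<le> np" "0 \<le> vp" "0 \<le> vq" "0 \<le> j" unfolding w using J_nonneg by simp_all
  have 1: "\<bar>nu e1 x al \<bullet> Q.D al x\<bar> \<le> 1 * nq"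
    unfolding w by (rule order_trans[OF Cauchy_Schwarz_ineq2]) (intro mult_right_mono norm_nu_le norm_ge_zero)
  have 2: "\<bar>dnu e1 x al \<bullet> P.D al x\<bar> \<le> 2 / a * np"
    unfolding w by (rule order_trans[OF Cauchy_Schwarz_ineq2]) (intro mult_right_mono norm_dnu_le a0 Om_snd x norm_ge_zero)
  have 3: "\<bar>exp (- p1 x al) * q1 x al * scatG d mus G p1 x al - exp (- p2 x al) * q2 x al * scatG d mus G p2 x al\<bar>
     \<le> ?E * (M * s0 * vp + s0 * vq + M * (j0 * j))"
    unfolding w by (rule exp_product_diff) (intro p_bound q_bound c al s)+
  \<comment> \<open>The term with the derivative of the kernel has no factor q; a factor 1 is
    inserted to fit \<open>exp_product_diff\<close>.\<close>
  have 4: "\<bar>exp (- p1 x al) * 1 * scatdG d mus G p1 x al - exp (- p2 x al) * 1 * scatdG d mus G p2 x al\<bar>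
     \<le> ?E * (1 * s0 * vp + s0 * \<bar>1 - 1\<bar> + 1 * (j0 * j))"
    unfolding w by (rule exp_product_diff) (intro p_bound c al s | simp)+
  have eq: "Lcommon d e1 mus G p1 Dp1 q1 Dq1 x al - Lcommon d e1 mus G p2 Dp2 q2 Dq2 x al
    = nu e1 x al \<bullet> Q.D al x + dnu e1 x al \<bullet> P.D al x
     + (exp (- p1 x al) * q1 x al * scatG d mus G p1 x al - exp (- p2 x al) * q2 x al * scatG d mus G p2 x al)
     - (exp (- p1 x al) * 1 * scatdG d mus G p1 x al - exp (- p2 x al) * 1 * scatdG d mus G p2 x al)"
    by (simp add: Lcommon_def inner_diff_right)
  have "\<bar>Lcommon d e1 mus G p1 Dp1 q1 Dq1 x al - Lcommon d e1 mus G p2 Dp2 q2 Dq2 x al\<bar>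
    \<le> 1 * nq + 2 / a * np + ?E * (M * s0 * vp + s0 * vq + M * (j0 * j)) + ?E * (1 * s0 * vp + s0 * \<bar>1 - 1\<bar> + 1 * (j0 * j))"
    unfolding eq using 1 2 3 4 by linarith
  also have "\<dots> = 1 * nq + 2 / a * np + (?E * (M * s0) + ?E * s0) * vp + (?E * s0) * vq + (?E * (M * j0) + ?E * j0) * j"
    by (simp add: algebra_simps)
  also have "\<dots> \<le> ?c * nq + ?c * np + ?c * vp + ?c * vq + ?c * j"
  proof -
    have n: "0 \<le> ?E * (M * s0)" "0 \<le> ?E * s0" "0 \<le> ?E * (M * j0)" "0 \<le> ?E * j0" "0 \<le> 2 / a"
      using consts_nonneg a0 by simp_all
    have c: "?c = 1 + 2 / a + ?E * (M * s0) + ?E * s0 + ?E * (M * j0) + ?E * j0"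
      by (simp add: source_const_def algebra_simps)
    have k: "1 \<le> ?c" "2 / a \<le> ?c" "?E * (M * s0) + ?E * s0 \<le> ?c" "?E * s0 \<le> ?c" "?E * (M * j0) + ?E * j0 \<le> ?c"
      unfolding c using n by linarith+
    show ?thesis by (intro add_mono mult_right_mono w0 k)
  qed
  finally show ?thesis unfolding w by (simp only: distrib_left)
qed

definition "source_sq al x = ((norm (P.D al x))^2 + (P.v al x)^2) + ((norm (Q.D al x))^2 + (Q.v al x)^2)
   + sqL2 S (\<lambda>be. P.v be x)"

lemma lap_bound:
  assumes al: "al \<in> {-d<..<d}"
  shows "AE x in leb Om. (P.lapl al x)^2 \<le> lap_const d a \<epsilon> KG Ks M * source_sq al x
     \<and> (Q.lapl al x)^2 \<le> lap_const d a \<epsilon> KG Ks M * source_sq al x"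
  using eqs[OF al] AE_space
proof eventually_elim
  case (elim x)
  then have x: "x \<in> Om" by simp
  have aS: "al \<in> S" using al by simp
  let ?L = "Lcommon d e1 mus G p1 Dp1 q1 Dq1 x al - Lcommon d e1 mus G p2 Dp2 q2 Dq2 x al"
  let ?T = "norm (Q.D al x) + norm (P.D al x) + \<bar>P.v al x\<bar> + \<bar>Q.v al x\<bar> + J x"
  let ?c = "source_const d a KG Ks M"
  have "?T^2 \<le> 5 * ((norm (Q.D al x))^2 + (norm (P.D al x))^2 + \<bar>P.v al x\<bar>^2 + \<bar>Q.v al x\<bar>^2 + (J x)^2)"
    by (rule square_sum5_le)
  also have "\<dots> \<le> 5 * ((1 + 2 * d) * source_sq al x)"
  proof (rule mult_left_mono)
    let ?R = "((norm (P.D al x))^2 + (P.v al x)^2) + ((norm (Q.D al x))^2 + (Q.v al x)^2)"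
    have R: "0 \<le> 2 * d * ?R" using d0 by (intro mult_nonneg_nonneg add_nonneg_nonneg) auto
    have "(1 + 2 * d) * source_sq al x = ?R + 2 * d * ?R + sqL2 S (\<lambda>be. P.v be x) + 2 * d * sqL2 S (\<lambda>be. P.v be x)"
      by (simp only: source_sq_def distrib_left distrib_right mult_1_left)
    then show "(norm (Q.D al x))^2 + (norm (P.D al x))^2 + \<bar>P.v al x\<bar>^2 + \<bar>Q.v al x\<bar>^2 + (J x)^2 \<le> (1 + 2 * d) * source_sq al x"
      using R J_sq[OF Om_cl[OF x]] sqL2_nonneg[of S "\<lambda>be. P.v be x"] unfolding power2_abs by linarith
  qed simp
  finally have T: "?T^2 \<le> 5 * ((1 + 2 * d) * source_sq al x)" .
  have "(r / \<epsilon>)^2 \<le> lap_const d a \<epsilon> KG Ks M * source_sq al x" if "\<bar>r\<bar> \<le> ?c * ?T" for r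
  proof -
    have "\<bar>r / \<epsilon>\<bar> \<le> ?c / \<epsilon> * ?T" using that eps by (simp add: divide_right_mono abs_divide)
    then have "\<bar>r / \<epsilon>\<bar>^2 \<le> (?c / \<epsilon> * ?T)^2" by (rule power_mono) simp
    also have "\<dots> = (?c / \<epsilon>)^2 * ?T^2" by (rule power_mult_distrib)
    also have "\<dots> \<le> (?c / \<epsilon>)^2 * (5 * ((1 + 2 * d) * source_sq al x))" by (rule mult_left_mono[OF T]) simp
    finally show ?thesis unfolding power2_abs lap_const_def by (simp only: mult.assoc)
  qed
  from this[OF Lcommon_diff[OF x aS]] have r: "(?L / \<epsilon>)^2 \<le> lap_const d a \<epsilon> KG Ks M * source_sq al x" .
  \<comment> \<open>The two equations of a solution share the same lower order part, so the
    Laplacians of both differences coincide at almost every point.\<close>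
  have "P.lapl al x = ?L / \<epsilon>" "Q.lapl al x = ?L / \<epsilon>"
    using elim(1) eps by (simp_all add: field_simps)
  with r show ?case by simp
qed

lemma lap_const_nonneg: "0 \<le> lap_const d a \<epsilon> KG Ks M"
  using d0 by (simp add: lap_const_def)

lemma weighted_lap_bound:
  assumes lam: "lam > 0" "lam * a^2 \<ge> 6" and al: "al \<in> {-d<..<d}"
  shows "(LINT x|leb Om. exp (lam * (snd x)^2) * (P.lapl al x)^2) \<le> lap_const d a \<epsilon> KG Ks M * (P.energy lam al + Q.energy lam al + Ek lam)"
    and "(LINT x|leb Om. exp (lam * (snd x)^2) * (Q.lapl al x)^2) \<le> lap_const d a \<epsilon> KG Ks M * (P.energy lam al + Q.energy lam al + Ek lam)"
proof -
  let ?K = "lap_const d a \<epsilon> KG Ks M" and ?w = "\<lambda>x::'m pt. exp (lam * (snd x)^2)"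
  have aS: "al \<in> S" using al by simp
  note i = P.energy_eq(2)[OF lam(1) aS] Q.energy_eq(2)[OF lam(1) aS] P.memory_integral(2)[OF lam(1)]
  have eq: "?w x * (?K * source_sq al x) = ?K * (?w x * ((norm (P.D al x))^2 + (P.v al x)^2) + ?w x * ((norm (Q.D al x))^2 + (Q.v al x)^2)
      + ?w x * sqL2 S (\<lambda>be. P.v be x))" for x
    by (simp only: source_sq_def distrib_left[of "?w x"] mult.left_commute[of "?w x"])
  have si: "integrable (leb Om) (\<lambda>x. ?w x * (?K * source_sq al x))"
    unfolding eq by (intro integrable_mult_right lintable_add i)
  have "(LINT x|leb Om. ?w x * (?K * source_sq al x))
     = ?K * ((LINT x|leb Om. ?w x * ((norm (P.D al x))^2 + (P.v al x)^2)) + (LINT x|leb Om. ?w x * ((norm (Q.D al x))^2 + (Q.v al x)^2))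
      + (LINT x|leb Om. ?w x * sqL2 S (\<lambda>be. P.v be x)))"
    unfolding eq integral_mult_right_zero
      lint_add[OF lintable_add[OF i(1,2)] i(3)]
      lint_add[OF i(1,2)] by (rule refl)
  also have "\<dots> \<le> ?K * (P.energy lam al + Q.energy lam al + Ek lam)"
    unfolding P.energy_def[symmetric] Q.energy_def[symmetric]
    by (intro mult_left_mono add_mono order_refl P.memory_integral(1)[OF lam(1), unfolded P.energy_def[symmetric]] lap_const_nonneg)
  finally have R: "(LINT x|leb Om. ?w x * (?K * source_sq al x)) \<le> ?K * (P.energy lam al + Q.energy lam al + Ek lam)" .
  have "(LINT x|leb Om. ?w x * (P.lapl al x)^2) \<le> (LINT x|leb Om. ?w x * (?K * source_sq al x))"
  proof (rule integral_mono_AE[OF P.pair_carleman(2)[OF lam al] si])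
    show "AE x in leb Om. ?w x * (P.lapl al x)^2 \<le> ?w x * (?K * source_sq al x)"
      using lap_bound[OF al] by eventually_elim (intro mult_left_mono, auto)
  qed
  with R show "(LINT x|leb Om. ?w x * (P.lapl al x)^2) \<le> ?K * (P.energy lam al + Q.energy lam al + Ek lam)" by linarith
  have "(LINT x|leb Om. ?w x * (Q.lapl al x)^2) \<le> (LINT x|leb Om. ?w x * (?K * source_sq al x))"
  proof (rule integral_mono_AE[OF Q.pair_carleman(2)[OF lam al] si])
    show "AE x in leb Om. ?w x * (Q.lapl al x)^2 \<le> ?w x * (?K * source_sq al x)"
      using lap_bound[OF al] by eventually_elim (intro mult_left_mono, auto)
  qed
  with R show "(LINT x|leb Om. ?w x * (Q.lapl al x)^2) \<le> ?K * (P.energy lam al + Q.energy lam al + Ek lam)" by linarith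
qed

section \<open>Absorption of the lower order terms\<close>

definition "data = (LINT al|leb S. P.value_sq al) + (LINT al|leb S. P.normal_sq al)
   + (LINT al|leb S. Q.value_sq al) + (LINT al|leb S. Q.normal_sq al)"

lemma energy_estimate:
  assumes lam: "lam > 0" "lam * a^2 \<ge> 6"
    and large: "lam \<ge> 1 + carleman_const a b * (4 * lap_const d a \<epsilon> KG Ks M * (1 + 2 * d))"
  shows "Ek lam + (LINT al|leb S. Q.energy lam al) \<le> carleman_const a b * carleman_bdry b lam * data"
proof -
  let ?K = "lap_const d a \<epsilon> KG Ks M" and ?C = "carleman_const a b" and ?B = "carleman_bdry b lam"
  define XP where "XP = Ek lam"
  define XQ where "XQ = (LINT al|leb S. Q.energy lam al)"
  have XP0: "0 \<le> XP" and XQ0: "0 \<le> XQ"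
    unfolding XP_def XQ_def by (intro integral_nonneg_AE AE_I2 P.energy_nonneg Q.energy_nonneg)+
  have C0: "0 \<le> ?C" by (simp add: carleman_const_def)
  let ?val = "\<lambda>al. (P.value_sq al + P.normal_sq al) + (Q.value_sq al + Q.normal_sq al)"
  let ?lhs = "\<lambda>al. lam * (P.energy lam al + Q.energy lam al)"
  \<comment> \<open>The estimates for p and q are added; each contributes 2 times the same bound for
    the Laplacian, hence the 4. \<open>XP\<close> stands for the nonlocal term and is constant in
    the parameter.\<close>
  let ?rhs = "\<lambda>al. ?C * (4 * ?K * ((P.energy lam al + Q.energy lam al) + XP) + ?B * ?val al)"
  have pt: "?lhs al \<le> ?rhs al" if al: "al \<in> {-d<..<d}" for al
  proof -
    let ?X = "?K * (P.energy lam al + Q.energy lam al + XP)"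
    have "lam * P.energy lam al \<le> ?C * (2 * ?X + ?B * (P.value_sq al + P.normal_sq al))"
      by (rule order_trans[OF P.pair_carleman(1)[OF lam al]], intro mult_left_mono add_mono order_refl C0)
        (use weighted_lap_bound(1)[OF lam al] in \<open>simp add: XP_def\<close>)+
    moreover have "lam * Q.energy lam al \<le> ?C * (2 * ?X + ?B * (Q.value_sq al + Q.normal_sq al))"
      by (rule order_trans[OF Q.pair_carleman(1)[OF lam al]], intro mult_left_mono add_mono order_refl C0)
        (use weighted_lap_bound(2)[OF lam al] in \<open>simp add: XP_def\<close>)+
    moreover have "?rhs al = ?C * (2 * ?X + ?B * (P.value_sq al + P.normal_sq al)) + ?C * (2 * ?X + ?B * (Q.value_sq al + Q.normal_sq al))"
      by (simp add: algebra_simps)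
    ultimately show ?thesis by (simp only: distrib_left)
  qed
  note ie = P.energy_integrable[OF lam(1)] Q.energy_integrable[OF lam(1)]
  note iv = P.value_sq_integrable P.normal_sq_integrable Q.value_sq_integrable Q.normal_sq_integrable
  have ic: "integrable (leb S) (\<lambda>_. XP)" by (intro integrable_continuous_Icc continuous_intros)
  have lhs_i: "integrable (leb S) ?lhs" by (intro integrable_mult_right lintable_add ie)
  have rhs_i: "integrable (leb S) ?rhs" by (intro integrable_mult_right lintable_add ie iv ic)
  have int: "(LINT al|leb S. ?lhs al) \<le> (LINT al|leb S. ?rhs al)"
  proof (rule integral_mono_AE[OF lhs_i rhs_i])
    show "AE al in leb S. ?lhs al \<le> ?rhs al"
      using AE_interior_Icc[of "-d" d]
    proof eventually_elim
      case (elim al)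
      from pt[OF elim] show ?case .
    qed
  qed
  have il: "(LINT al|leb S. ?lhs al) = lam * (XP + XQ)"
    using ie by (simp add: XP_def XQ_def)
  have ir: "(LINT al|leb S. ?rhs al) = ?C * (4 * ?K * ((XP + XQ) + 2 * d * XP) + ?B * data)"
  proof -
    note a1 = lintable_add[OF ie] and a2 = lintable_add[OF iv(1,2)] lintable_add[OF iv(3,4)]
    have XPi: "(LINT al|leb S. XP) = 2 * d * XP" using d0 by (simp add: measure_restrict_space)
    have e1: "(LINT al|leb S. 4 * ?K * ((P.energy lam al + Q.energy lam al) + XP)) = 4 * ?K * ((XP + XQ) + 2 * d * XP)"
      unfolding integral_mult_right_zero lint_add[OF a1 ic] lint_add[OF ie] XPi
      by (simp only: XP_def XQ_def)
    have e2: "(LINT al|leb S. ?B * ?val al) = ?B * data"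
      unfolding integral_mult_right_zero lint_add[OF a2] lint_add[OF iv(1,2)]
        lint_add[OF iv(3,4)] by (simp only: data_def add_ac)
    have i1: "integrable (leb S) (\<lambda>al. 4 * ?K * ((P.energy lam al + Q.energy lam al) + XP))"
      and i2: "integrable (leb S) (\<lambda>al. ?B * ?val al)"
      by (intro integrable_mult_right lintable_add ie iv ic)+
    show ?thesis unfolding integral_mult_right_zero lint_add[OF i1 i2] e1[unfolded integral_mult_right_zero] e2[unfolded integral_mult_right_zero]
      by (rule refl)
  qed
  have main: "lam * (XP + XQ) \<le> ?C * (4 * ?K * ((XP + XQ) + 2 * d * XP) + ?B * data)" using int unfolding il ir .
  have "2 * d * XP \<le> 2 * d * (XP + XQ)" using XQ0 d0 by simp
  then have "4 * ?K * ((XP + XQ) + 2 * d * XP) \<le> 4 * ?K * ((1 + 2 * d) * (XP + XQ))"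
    using lap_const_nonneg by (intro mult_left_mono) (simp_all add: algebra_simps)
  then have "?C * (4 * ?K * ((XP + XQ) + 2 * d * XP) + ?B * data) \<le> ?C * (4 * ?K * ((1 + 2 * d) * (XP + XQ)) + ?B * data)"
    by (rule mult_left_mono[OF add_right_mono C0])
  also have "\<dots> = (?C * (4 * ?K * (1 + 2 * d))) * (XP + XQ) + ?C * ?B * data" by (simp add: algebra_simps)
  finally have "lam * (XP + XQ) \<le> (?C * (4 * ?K * (1 + 2 * d))) * (XP + XQ) + ?C * ?B * data" using main by linarith
  \<comment> \<open>By the choice of \<open>lam\<close> the left side exceeds the terms to be
    absorbed by one copy of \<open>XP + XQ\<close>, which remains after subtraction.\<close>
  moreover have "(1 + ?C * (4 * ?K * (1 + 2 * d))) * (XP + XQ) \<le> lam * (XP + XQ)"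
    using large XP0 XQ0 by (intro mult_right_mono) auto
  ultimately have "XP + XQ \<le> ?C * ?B * data" by (simp only: distrib_right mult_1_left)
  then show ?thesis by (simp only: XP_def XQ_def)
qed

lemma lam_const:
  shows "lam_const d a b \<epsilon> KG Ks M > 0" "lam_const d a b \<epsilon> KG Ks M * a^2 \<ge> 6"
proof -
  have "6 / a^2 > 0" using a0 by simp
  then show "lam_const d a b \<epsilon> KG Ks M > 0" unfolding lam_const_def by linarith
  have "6 / a^2 * a^2 \<le> lam_const d a b \<epsilon> KG Ks M * a^2" unfolding lam_const_def by (intro mult_right_mono) auto
  then show "lam_const d a b \<epsilon> KG Ks M * a^2 \<ge> 6" using a0 by simp
qed

lemma stab_const_nonneg: "0 \<le> stab_const d a b \<epsilon> KG Ks M"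
  unfolding stab_const_def carleman_const_def carleman_bdry_def using lam_const(1) a0 ab by simp

lemma H1_estimate:
  "(LINT al|leb S. sqH1 Om (P.v al) (P.D al)) + (LINT al|leb S. sqH1 Om (Q.v al) (Q.D al))
    \<le> stab_const d a b \<epsilon> KG Ks M * data"
proof -
  let ?l = "lam_const d a b \<epsilon> KG Ks M"
  have "(LINT al|leb S. sqH1 Om (P.v al) (P.D al)) \<le> Ek ?l"
    by (rule integral_mono[OF P.sqH1_integrable P.energy_integrable[OF lam_const(1)]]) (rule P.sqH1_le_energy[OF lam_const(1)], simp)
  moreover have "(LINT al|leb S. sqH1 Om (Q.v al) (Q.D al)) \<le> (LINT al|leb S. Q.energy ?l al)"
    by (rule integral_mono[OF Q.sqH1_integrable Q.energy_integrable[OF lam_const(1)]]) (rule Q.sqH1_le_energy[OF lam_const(1)], simp)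
  moreover have "Ek ?l + (LINT al|leb S. Q.energy ?l al) \<le> carleman_const a b * carleman_bdry b ?l * data"
    by (rule energy_estimate[OF lam_const]) (simp add: lam_const_def)
  ultimately show ?thesis unfolding stab_const_def by linarith
qed

section \<open>Stability of the reconstruction\<close>

lemma sqH1_nonneg: "0 \<le> sqH1 U u Du" unfolding sqH1_def by (rule integral_nonneg_AE) simp

text \<open>The reconstruction at \<open>x\<close> averages over the source parameter, so it is
  controlled by the parameter norms at that fixed \<open>x\<close>. Integration over
  \<open>x\<close> and Fubini turn this into the H1 norm of the difference.\<close>

definition "slice_sq x = sqL2 S (\<lambda>be. P.v be x) + (\<Sum>e\<in>Basis. sqL2 S (\<lambda>be. P.D be x \<bullet> e))"

lemma slice_sq:
  shows "integrable (leb Om) slice_sq"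
    and "(LINT x|leb Om. slice_sq x) = (LINT al|leb S. sqH1 Om (P.v al) (P.D al))"
proof -
  note O = P.Om_sets(1,2,3,4)
  have vi: "integrable (leb Om) (\<lambda>x. sqL2 S (\<lambda>be. P.v be x))"
    using L2_on_partial_integral(2)[OF O P.v_joint] by simp
  have Di: "integrable (leb Om) (\<lambda>x. sqL2 S (\<lambda>be. P.D be x \<bullet> e))" if "e \<in> Basis" for e
    using L2_on_partial_integral(2)[OF O P.D_joint[OF that]] by simp
  have Ds: "integrable (leb Om) (\<lambda>x. \<Sum>e\<in>Basis. sqL2 S (\<lambda>be. P.D be x \<bullet> e))"
    by (rule lintable_sum) (erule Di)
  show "integrable (leb Om) slice_sq" unfolding slice_sq_def[abs_def] by (rule lintable_add[OF vi Ds])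
  have vf: "integrable (leb S) (\<lambda>al. sqL2 Om (P.v al))" by (rule L2_family_integrable[OF P.v_family])
  have Df: "integrable (leb S) (\<lambda>al. sqL2 Om (\<lambda>x. P.D al x \<bullet> e))" if "e \<in> Basis" for e
    by (rule L2_family_integrable[OF P.D_family[OF that]])
  have Dfs: "integrable (leb S) (\<lambda>al. \<Sum>e\<in>Basis. sqL2 Om (\<lambda>x. P.D al x \<bullet> e))"
    by (rule lintable_sum) (erule Df)
  have sw: "(LINT x|leb Om. sqL2 S (\<lambda>be. P.v be x)) = (LINT al|leb S. sqL2 Om (P.v al))"
    using sqL2_iterated[OF O P.v_joint] by simp
  have sw2: "(LINT x|leb Om. sqL2 S (\<lambda>be. P.D be x \<bullet> e)) = (LINT al|leb S. sqL2 Om (\<lambda>x. P.D al x \<bullet> e))" if "e \<in> Basis" for e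
    using sqL2_iterated[OF O P.D_joint[OF that]] by simp
  have "(LINT x|leb Om. slice_sq x) = (LINT al|leb S. sqL2 Om (P.v al)) + (\<Sum>e\<in>Basis. \<integral>al. sqL2 Om (\<lambda>x. P.D al x \<bullet> e) \<partial>leb S)"
    unfolding slice_sq_def lint_add[OF vi Ds] sw
    by (subst lint_sum, erule Di) (simp add: sw2)
  also have "\<dots> = (LINT al|leb S. sqL2 Om (P.v al) + (\<Sum>e\<in>Basis. sqL2 Om (\<lambda>x. P.D al x \<bullet> e)))"
    unfolding lint_add[OF vf Dfs]
    by (subst lint_sum[where M="leb S"], erule Df) (rule refl)
  also have "\<dots> = (LINT al|leb S. sqH1 Om (P.v al) (P.D al))"
    by (rule lint_cong[OF refl])
      (simp add: sqH1_eq(1)[OF L2_familyD[OF P.v_family] L2_familyD[OF P.D_family]])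
  finally show "(LINT x|leb Om. slice_sq x) = (LINT al|leb S. sqH1 Om (P.v al) (P.D al))" .
qed

lemma slice_sq_nonneg: "0 \<le> slice_sq x"
  unfolding slice_sq_def by (intro add_nonneg_nonneg sum_nonneg) auto

lemma nu_inner_L2:
  fixes F :: "real => 'm pt"
  assumes x: "x \<in> Om" and F: "\<And>e. e \<in> Basis ==> L2_on S (\<lambda>al. F al \<bullet> e)"
  shows "L2_on S (\<lambda>al. nu e1 x al \<bullet> F al)" "sqL2 S (\<lambda>al. nu e1 x al \<bullet> F al) \<le> (\<Sum>e\<in>Basis. sqL2 S (\<lambda>al. F al \<bullet> e))"
proof -
  have nc: "continuous_on S (nu e1 x)" by (rule continuous_nu[OF a0 Om_snd[OF x]])
  have "L2_on S (\<lambda>al. (nu e1 x al \<bullet> e) * (F al \<bullet> e))" if e: "e \<in> Basis" for e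
  proof (rule L2_on_mult_bounded[OF F[OF e]])
    show "(\<lambda>al. nu e1 x al \<bullet> e) \<in> borel_measurable (leb S)"
      by (rule L2_on_measurable[OF L2_on_continuous[of S]]) (auto intro!: continuous_intros nc)
    show "\<bar>nu e1 x al \<bullet> e\<bar> \<le> 1" for al using Basis_le_norm[OF e, of "nu e1 x al"] norm_nu_le[of e1 x al] by linarith
  qed
  then have "L2_on S (\<lambda>al. \<Sum>e\<in>Basis. (nu e1 x al \<bullet> e) * (F al \<bullet> e))" by (rule L2_on_sum)
  then show L: "L2_on S (\<lambda>al. nu e1 x al \<bullet> F al)" by (simp only: euclidean_inner[symmetric])
  have i: "integrable (leb S) (\<lambda>al. (F al \<bullet> e)^2)" if "e \<in> Basis" for e by (rule L2_on_integrable_sq[OF F[OF that]])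
  have "sqL2 S (\<lambda>al. nu e1 x al \<bullet> F al) \<le> (LINT al|leb S. (\<Sum>e\<in>Basis. (F al \<bullet> e)^2))"
    unfolding sqL2_def
  proof (rule integral_mono[OF L2_on_integrable_sq[OF L] lintable_sum[OF i]])
    fix al
    have "\<bar>nu e1 x al \<bullet> F al\<bar> \<le> norm (nu e1 x al) * norm (F al)" by (rule Cauchy_Schwarz_ineq2)
    also have "\<dots> \<le> 1 * norm (F al)" by (intro mult_right_mono norm_nu_le norm_ge_zero)
    finally have "\<bar>nu e1 x al \<bullet> F al\<bar>^2 \<le> (norm (F al))^2" by (intro power_mono) auto
    then show "(nu e1 x al \<bullet> F al)^2 \<le> (\<Sum>e\<in>Basis. (F al \<bullet> e)^2)" by (simp only: power2_abs norm_sq_Basis)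
  qed
  also have "\<dots> = (\<Sum>e\<in>Basis. sqL2 S (\<lambda>al. F al \<bullet> e))"
    unfolding sqL2_def by (rule lint_sum[OF i])
  finally show "sqL2 S (\<lambda>al. nu e1 x al \<bullet> F al) \<le> (\<Sum>e\<in>Basis. sqL2 S (\<lambda>al. F al \<bullet> e))" .
qed

lemma scattering_integrable:
  assumes x: "x \<in> closure Om" and p: "continuous_on S (p x)"
  shows "integrable (leb S) (\<lambda>al. exp (- p x al) * scatG d mus G p x al)"
proof -
  have SS: "S \<in> sets borel" "bounded S" by auto
  have "continuous_on (S \<times> S) (\<lambda>w. G (x, w) * exp (p x (snd w)))"
  proof (intro continuous_on_mult continuous_on_exp)
    show "continuous_on (S \<times> S) (\<lambda>w. G (x, w))"
      by (rule continuous_on_compose2[OF C1_bounded_kernel(1)[OF G]]) (use x in \<open>auto intro!: continuous_intros\<close>)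
    show "continuous_on (S \<times> S) (\<lambda>w. p x (snd w))"
      by (rule continuous_on_compose2[OF p]) (auto intro!: continuous_intros)
  qed
  then have "L2_on (S \<times> S) (\<lambda>w. G (x, w) * exp (p x (snd w)))"
    by (rule L2_on_continuous) (auto intro!: compact_Times lmeasurable_Times)
  from L2_on_partial_integral(4)[OF SS SS this]
  have "L2_on S (\<lambda>al. mus x * (LINT be|leb S. G (x, al, be) * exp (p x be)))" by (intro L2_on_cmult) simp
  moreover have "L2_on S (\<lambda>al. exp (- p x al))"
    by (rule L2_on_continuous[of S]) (auto intro!: continuous_intros p)
  ultimately show ?thesis unfolding scatG_def by (intro L2_on_integrable_mult)
qed

text \<open>Both averages in the formula are estimated by Cauchy-Schwarz on an interval of length
  \<open>2 * d\<close>: the transport part by the gradient slices, the scattering part through its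
  Lipschitz bound in \<open>J x\<close>. The gradient slices are square integrable in the parameter
  only for almost every \<open>x\<close>.\<close>

lemma recon_diff:
  "AE x in leb Om. (recon d e1 mus G p1 Dp1 x - recon d e1 mus G p2 Dp2 x)^2 \<le> recon_const d KG Ks M * slice_sq x"
proof -
  note O = P.Om_sets(1,2,3,4)
  have D1: "AE x in leb Om. \<forall>e\<in>Basis. L2_on S (\<lambda>al. Dp1 x al \<bullet> e)"
    using L2_on_partial_integral(1)[OF O admissible_grad_joint[OF P.adm(1)]] by (intro AE_finite_allI finite_Basis) simp
  have D2: "AE x in leb Om. \<forall>e\<in>Basis. L2_on S (\<lambda>al. Dp2 x al \<bullet> e)"
    using L2_on_partial_integral(1)[OF O admissible_grad_joint[OF P.adm(2)]] by (intro AE_finite_allI finite_Basis) simp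
  show ?thesis using D1 D2 AE_space
  proof eventually_elim
    case (elim x)
    have x: "x \<in> Om" using elim(3) by simp
    note c = Om_cl[OF x]
    have Sm: "S \<in> lmeasurable" by simp
    let ?M = "leb S"
    let ?I = "\<integral>al. nu e1 x al \<bullet> P.D al x \<partial>?M"
    let ?K = "\<integral>al. exp (- p1 x al) * scatG d mus G p1 x al - exp (- p2 x al) * scatG d mus G p2 x al \<partial>?M"
    let ?c = "exp M * (s0 + 2 * d * j0)"
    have DL: "L2_on S (\<lambda>al. P.D al x \<bullet> e)" if "e \<in> Basis" for e
      unfolding inner_diff_left by (intro L2_on_diff) (use elim(1,2) that in blast)+
    have n1: "L2_on S (\<lambda>al. nu e1 x al \<bullet> Dp1 x al)" and n2: "L2_on S (\<lambda>al. nu e1 x al \<bullet> Dp2 x al)"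
      by (intro nu_inner_L2(1)[OF x]; use elim(1,2) in blast)+
    note nd = nu_inner_L2[OF x DL]
    have I: "?I = (LINT al|?M. nu e1 x al \<bullet> Dp1 x al) - (LINT al|?M. nu e1 x al \<bullet> Dp2 x al)"
      unfolding inner_diff_right by (rule lint_diff[OF L2_on_integrable[OF Sm n1] L2_on_integrable[OF Sm n2]])
    note si = scattering_integrable[where p=p1, OF c p_cont(1)[OF c]] scattering_integrable[where p=p2, OF c p_cont(2)[OF c]]
    have K: "?K = (LINT al|?M. exp (- p1 x al) * scatG d mus G p1 x al) - (LINT al|?M. exp (- p2 x al) * scatG d mus G p2 x al)"
      by (rule lint_diff[OF si])
    have req: "recon d e1 mus G p1 Dp1 x - recon d e1 mus G p2 Dp2 x = (1 / (2 * d)) * (?K - ?I)"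
      unfolding recon_def I K by (simp add: right_diff_distrib)
    have I2: "?I^2 \<le> 2 * d * (\<Sum>e\<in>Basis. sqL2 S (\<lambda>al. P.D al x \<bullet> e))"
      using integral_sq_le[OF d0 nd(1)] mult_left_mono[OF nd(2), of "2 * d"] d0 by linarith
    have Kb: "\<bar>?K\<bar> \<le> ?c * J x"
    proof -
      have ji: "integrable ?M (\<lambda>al. \<bar>p1 x al - p2 x al\<bar>)" by (rule L2_on_integrable[OF Sm J_integrable[OF c]])
      have ci: "integrable ?M (\<lambda>_. exp M * (j0 * J x))" by (intro integrable_continuous_Icc continuous_intros)
      have "\<bar>?K\<bar> \<le> (LINT al|?M. \<bar>exp (- p1 x al) * scatG d mus G p1 x al - exp (- p2 x al) * scatG d mus G p2 x al\<bar>)"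
        by (rule integral_abs_bound)
      also have "\<dots> \<le> (LINT al|?M. exp M * s0 * \<bar>p1 x al - p2 x al\<bar> + exp M * (j0 * J x))"
      proof (rule integral_mono)
        show "integrable ?M (\<lambda>al. \<bar>exp (- p1 x al) * scatG d mus G p1 x al - exp (- p2 x al) * scatG d mus G p2 x al\<bar>)"
          using si by simp
        show "integrable ?M (\<lambda>al. exp M * s0 * \<bar>p1 x al - p2 x al\<bar> + exp M * (j0 * J x))"
          by (intro lintable_add integrable_mult_right ji ci)
        fix al assume "al \<in> space ?M"
        then have al: "al \<in> S" by simp
        have "\<bar>exp (- p1 x al) * 1 * scatG d mus G p1 x al - exp (- p2 x al) * 1 * scatG d mus G p2 x al\<bar>
          \<le> exp M * (1 * s0 * \<bar>p1 x al - p2 x al\<bar> + s0 * \<bar>1 - 1\<bar> + 1 * (j0 * J x))"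
          by (rule exp_product_diff) (intro p_bound c al scat_bounds | simp)+
        then show "\<bar>exp (- p1 x al) * scatG d mus G p1 x al - exp (- p2 x al) * scatG d mus G p2 x al\<bar>
          \<le> exp M * s0 * \<bar>p1 x al - p2 x al\<bar> + exp M * (j0 * J x)" by (simp add: distrib_left mult.assoc)
      qed
      also have "\<dots> = exp M * s0 * J x + 2 * d * (exp M * (j0 * J x))"
        using ji ci d0 by (simp add: measure_restrict_space)
      also have "\<dots> = ?c * J x" by (simp add: algebra_simps)
      finally show ?thesis .
    qed
    have "\<bar>?K\<bar>^2 \<le> (?c * J x)^2" using Kb by (rule power_mono) simp
    also have "\<dots> = ?c^2 * (J x)^2" by (rule power_mult_distrib)
    also have "\<dots> \<le> ?c^2 * (2 * d * sqL2 S (\<lambda>be. P.v be x))" by (intro mult_left_mono J_sq[OF c]) simp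
    finally have K2: "?K^2 \<le> 2 * d * (?c^2 * sqL2 S (\<lambda>be. P.v be x))" by (simp add: mult_ac)
    let ?sv = "sqL2 S (\<lambda>be. P.v be x)" and ?sD = "\<Sum>e\<in>Basis. sqL2 S (\<lambda>al. P.D al x \<bullet> e)"
    have sD: "0 \<le> ?sD" by (intro sum_nonneg) auto
    have "(?K - ?I)^2 \<le> 2 * ?K^2 + 2 * ?I^2"
      using zero_le_power2[of "?K + ?I"] by (simp add: power2_sum power2_diff)
    also have "\<dots> \<le> 4 * d * (?c^2 * ?sv + ?sD)" using K2 I2 by (simp add: distrib_left)
    also have "\<dots> \<le> 4 * d * ((1 + ?c^2) * (?sv + ?sD))"
    proof (rule mult_left_mono)
      have "(1 + ?c^2) * (?sv + ?sD) = ?c^2 * ?sv + ?sD + (?sv + ?c^2 * ?sD)" by (simp only: distrib_left distrib_right mult_1_left add_ac)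
      moreover have "0 \<le> ?c^2 * ?sD" using sD by simp
      ultimately show "?c^2 * ?sv + ?sD \<le> (1 + ?c^2) * (?sv + ?sD)" using sqL2_nonneg[of S "\<lambda>be. P.v be x"] by linarith
    qed (use d0 in simp)
    finally have fin: "(?K - ?I)^2 \<le> 4 * d * ((1 + ?c^2) * slice_sq x)" by (simp only: slice_sq_def)
    have "(recon d e1 mus G p1 Dp1 x - recon d e1 mus G p2 Dp2 x)^2 = (1 / (2 * d))^2 * (?K - ?I)^2"
      unfolding req by (rule power_mult_distrib)
    also have "\<dots> \<le> (1 / (2 * d))^2 * (4 * d * ((1 + ?c^2) * slice_sq x))" by (rule mult_left_mono[OF fin]) simp
    also have "\<dots> = recon_const d KG Ks M * slice_sq x"
    proof -
      have "(1 / (2 * d))^2 * (4 * d * (r * s)) = r / d * s" for r s using d0 by (simp add: power2_eq_square field_simps)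
      then show ?thesis unfolding recon_const_def .
    qed
    finally show ?case .
  qed
qed

lemma recon_const_nonneg: "0 \<le> recon_const d KG Ks M"
  using d0 by (simp add: recon_const_def)

lemma recon_estimate:
  "sqL2 Om (\<lambda>x. recon d e1 mus G p1 Dp1 x - recon d e1 mus G p2 Dp2 x)
    \<le> recon_const d KG Ks M * (LINT al|leb S. sqH1 Om (P.v al) (P.D al))"
proof (cases "integrable (leb Om) (\<lambda>x. (recon d e1 mus G p1 Dp1 x - recon d e1 mus G p2 Dp2 x)^2)")
  case True
  have "sqL2 Om (\<lambda>x. recon d e1 mus G p1 Dp1 x - recon d e1 mus G p2 Dp2 x) \<le> (LINT x|leb Om. recon_const d KG Ks M * slice_sq x)"
    unfolding sqL2_def by (rule integral_mono_AE[OF True integrable_mult_right[OF slice_sq(1)] recon_diff])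
  then show ?thesis by (simp only: integral_mult_right_zero slice_sq(2))
next
  \<comment> \<open>The integral in \<open>sqL2\<close> is then 0 by convention, and the right-hand
    side is nonnegative.\<close>
  case False
  have "0 \<le> (LINT al|leb S. sqH1 Om (P.v al) (P.D al))" by (intro integral_nonneg_AE AE_I2 sqH1_nonneg)
  with False show ?thesis unfolding sqL2_def not_integrable_integral_eq[OF False] by (intro mult_nonneg_nonneg recon_const_nonneg)
qed

section \<open>Uniqueness when the data vanish\<close>

lemma value_normal_nonneg: "0 \<le> P.value_sq al" "0 \<le> Q.value_sq al" "0 \<le> P.normal_sq al" "0 \<le> Q.normal_sq al"
  by (simp_all add: P.value_sq_def Q.value_sq_def sqH1w_def sqH1_nonneg P.normal_sq_def Q.normal_sq_def)

text \<open>A vanishing norm gives equality almost everywhere on the product with the parameter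
  interval; joint continuity upgrades it to every point of the open product.\<close>

lemma zero_if_small:
  fixes u1 u2 :: "'m pt => real => real"
  assumes "continuous_on (closure Om \<times> S) (\<lambda>(x, al). u1 x al - u2 x al)"
    and L: "L2_on (Om \<times> S) (\<lambda>z. u1 (fst z) (snd z) - u2 (fst z) (snd z))"
    and D: "\<And>al e. al \<in> S ==> e \<in> Basis ==> L2_on Om (\<lambda>x. E al x \<bullet> e)" "\<And>al. al \<in> S ==> L2_on Om (\<lambda>x. u1 x al - u2 x al)"
    and i: "integrable (leb S) (\<lambda>al. sqL2 Om (\<lambda>x. u1 x al - u2 x al))"
      "integrable (leb S) (\<lambda>al. sqH1 Om (\<lambda>x. u1 x al - u2 x al) (E al))"
    and small: "(LINT al|leb S. sqH1 Om (\<lambda>x. u1 x al - u2 x al) (E al)) \<le> 0"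
    and x: "x \<in> Om" "al \<in> {-d<..<d}"
  shows "u1 x al = u2 x al"
proof -
  let ?f = "\<lambda>z. u1 (fst z) (snd z) - u2 (fst z) (snd z)"
  note O = P.Om_sets(1,2,3,4)
  have "sqL2 (Om \<times> S) ?f = (LINT al|leb S. sqL2 Om (\<lambda>x. u1 x al - u2 x al))"
    using L2_on_partial_integral(3)[OF O L] sqL2_iterated[OF O L] by simp
  also have "\<dots> \<le> (LINT al|leb S. sqH1 Om (\<lambda>x. u1 x al - u2 x al) (E al))"
  proof (rule integral_mono[OF i])
    fix al assume "al \<in> space (leb S)"
    then have al: "al \<in> S" by simp
    have "sqH1 Om (\<lambda>x. u1 x al - u2 x al) (E al) = sqL2 Om (\<lambda>x. u1 x al - u2 x al) + (\<Sum>e\<in>Basis. sqL2 Om (\<lambda>x. E al x \<bullet> e))"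
      by (rule sqH1_eq(1)[OF D(2)[OF al] D(1)[OF al]])
    then show "sqL2 Om (\<lambda>x. u1 x al - u2 x al) \<le> sqH1 Om (\<lambda>x. u1 x al - u2 x al) (E al)"
      by (simp add: sum_nonneg)
  qed
  finally have "sqL2 (Om \<times> S) ?f = 0" using small sqL2_nonneg[of "Om \<times> S" ?f] by linarith
  then have ae: "AE z in leb (Om \<times> S). ?f z = 0" unfolding sqL2_eq_0_iff[OF L] .
  have "?f (x, al) = 0"
  proof (rule AE_zero_continuous_open[OF _ _ _ _ ae])
    show "continuous_on (Om \<times> {-d<..<d}) ?f"
      by (rule continuous_on_subset[OF assms(1)[unfolded case_prod_unfold]]) (use Om_cl in auto)
    show "open (Om \<times> {-d<..<d})" by (intro open_Times) (simp_all add: P.Om_sets)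
    show "Om \<times> {-d<..<d} \<subseteq> Om \<times> S" by auto
    show "Om \<times> S \<in> sets borel" by (intro borel_Times O)
    show "(x, al) \<in> Om \<times> {-d<..<d}" using x by simp
  qed
  then show ?thesis by simp
qed

lemma uniqueness:
  assumes 0: "data = 0"
  shows "x \<in> Om ==> al \<in> {-d<..<d} ==> p1 x al = p2 x al"
    and "x \<in> Om ==> al \<in> {-d<..<d} ==> q1 x al = q2 x al"
    and "AE x in leb Om. recon d e1 mus G p1 Dp1 x = recon d e1 mus G p2 Dp2 x"
proof -
  let ?P = "\<integral>al. sqH1 Om (P.v al) (P.D al) \<partial>leb S" and ?Q = "\<integral>al. sqH1 Om (Q.v al) (Q.D al) \<partial>leb S"
  have "0 \<le> ?P" "0 \<le> ?Q" by (intro integral_nonneg_AE AE_I2 sqH1_nonneg)+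
  moreover have "?P + ?Q \<le> 0" using H1_estimate 0 by simp
  ultimately have s: "?P \<le> 0" "?Q \<le> 0" "?P = 0" by linarith+
  show "p1 x al = p2 x al" if "x \<in> Om" "al \<in> {-d<..<d}"
    by (rule zero_if_small[OF P.cont P.v_joint _ _ _ P.sqH1_integrable s(1) that])
      (use L2_familyD[OF P.D_family] L2_familyD[OF P.v_family] L2_family_integrable[OF P.v_family] in auto)
  show "q1 x al = q2 x al" if "x \<in> Om" "al \<in> {-d<..<d}"
    by (rule zero_if_small[OF Q.cont Q.v_joint _ _ _ Q.sqH1_integrable s(2) that])
      (use L2_familyD[OF Q.D_family] L2_familyD[OF Q.v_family] L2_family_integrable[OF Q.v_family] in auto)
  have "AE x in leb Om. slice_sq x = 0"
    using integral_nonneg_eq_0_iff_AE[OF slice_sq(1)] slice_sq_nonneg slice_sq(2) s(3) by simp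
  then show "AE x in leb Om. recon d e1 mus G p1 Dp1 x = recon d e1 mus G p2 Dp2 x"
    using recon_diff by eventually_elim simp
qed

lemma data_zero:
  assumes 0: "\<And>al. al \<in> {-d<..<d} ==> (\<forall>y\<in>cubeQ B. p1 (y, b) al = p2 (y, b) al \<and> q1 (y, b) al = q2 (y, b) al) \<and>
          (AE y in leb (cubeQ B). trz B a b Dp1 Hp1 al y = trz B a b Dp2 Hp2 al y \<and>
                                         trz B a b Dq1 Hq1 al y = trz B a b Dq2 Hq2 al y)"
  shows "data = 0"
proof -
  have z: "P.value_sq al = 0" "Q.value_sq al = 0" "P.normal_sq al = 0" "Q.normal_sq al = 0" if al: "al \<in> {-d<..<d}" for al
  proof -
    note h = 0[OF al]
    show "P.value_sq al = 0" unfolding P.value_sq_def cubeQ_box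
      by (rule sqH1w_zero[OF cube_corners[OF P.B]]) (use h in \<open>simp_all add: cubeQ_box\<close>)
    show "Q.value_sq al = 0" unfolding Q.value_sq_def cubeQ_box
      by (rule sqH1w_zero[OF cube_corners[OF P.B]]) (use h in \<open>simp_all add: cubeQ_box\<close>)
    have ae: "AE y in leb P.Qu. (trz B a b Dp1 Hp1 al y - trz B a b Dp2 Hp2 al y)^2 = 0"
      "AE y in leb P.Qu. (trz B a b Dq1 Hq1 al y - trz B a b Dq2 Hq2 al y)^2 = 0"
      using conjunct2[OF h] by (eventually_elim, simp)+
    show "P.normal_sq al = 0" "Q.normal_sq al = 0"
      unfolding P.normal_sq_def Q.normal_sq_def sqL2_def by (rule integral_eq_zero_AE, rule ae)+
  qed
  have "(LINT al|leb S. f al) = 0" if "\<And>al. al \<in> {-d<..<d} ==> f al = 0" for f :: "real => real"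
  proof (rule integral_eq_zero_AE)
    show "AE al in leb S. f al = 0"
      using AE_interior_Icc[of "-d" d] by (rule eventually_mono) (rule that)
  qed
  then show ?thesis unfolding data_def using z by simp
qed

end

text \<open>It passes from the sum of squared norms, in which the energy estimate is stated, to the
  square of the sum of norms.\<close>

lemma sum4_le_sqrt_sum_sq:
  fixes r s t u :: real
  assumes "0 \<le> r" "0 \<le> s" "0 \<le> t" "0 \<le> u"
  shows "r + s + t + u \<le> (sqrt r + sqrt s + sqrt t + sqrt u)^2"
proof -
  have le: "x + y \<le> (sqrt x + sqrt y)^2" if "0 \<le> x" "0 \<le> y" for x y :: real
    using that by (simp add: power2_sum)
  have "r + s + t + u \<le> (sqrt (r + s + t) + sqrt u)^2" using le[of "r + s + t" u] assms by simp
  also have "\<dots> \<le> (sqrt r + sqrt s + sqrt t + sqrt u)^2"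
    using sqrt_add_le_add_sqrt[of "r + s" t] sqrt_add_le_add_sqrt[of r s] assms by (intro power_mono) auto
  finally show ?thesis .
qed

theorem theorem4p1:
  fixes B d a b \<epsilon> :: real and e1 :: "'m::finite"
  assumes "0 < B" "0 < d" "0 < a" "a < b" "0 < \<epsilon>"
  shows "\<forall>KG Ka Ks M. \<exists>C1 > 0. \<forall>(mua :: 'm pt \<Rightarrow> real) mus G
      p1 Dp1 Hp1 q1 Dq1 Hq1 p2 Dp2 Hp2 q2 Dq2 Hq2.
    continuous_on (closure (Omega B a b)) mua \<and>
    (\<forall>x\<in>closure (Omega B a b). 0 \<le> mua x \<and> mua x \<le> Ka) \<and>
    continuous_on (closure (Omega B a b)) mus \<and>
    (\<forall>x\<in>closure (Omega B a b). 0 \<le> mus x \<and> mus x \<le> Ks) \<and>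
    C1_bounded (closure (Omega B a b) \<times> {-d..d} \<times> {-d..d}) KG G \<and>
    (\<forall>w\<in>closure (Omega B a b) \<times> {-d..d} \<times> {-d..d}. 0 \<le> G w) \<and>
    admissible B a b d M p1 Dp1 Hp1 \<and> admissible B a b d M q1 Dq1 Hq1 \<and>
    admissible B a b d M p2 Dp2 Hp2 \<and> admissible B a b d M q2 Dq2 Hq2 \<and>
    (\<forall>\<alpha>\<in>{-d<..<d}. AE x in lebesgue_on (Omega B a b).
        - \<epsilon> * lap Hp1 x \<alpha> + Lcommon d e1 mus G p1 Dp1 q1 Dq1 x \<alpha> = 0 \<and>
        - \<epsilon> * lap Hq1 x \<alpha> + Lcommon d e1 mus G p1 Dp1 q1 Dq1 x \<alpha> = 0 \<and>
        - \<epsilon> * lap Hp2 x \<alpha> + Lcommon d e1 mus G p2 Dp2 q2 Dq2 x \<alpha> = 0 \<and>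
        - \<epsilon> * lap Hq2 x \<alpha> + Lcommon d e1 mus G p2 Dp2 q2 Dq2 x \<alpha> = 0) \<and>
    (\<forall>x\<in>frontier (Omega B a b) - top_face B b. \<forall>\<alpha>\<in>{-d<..<d}.
        p1 x \<alpha> = p2 x \<alpha> \<and> q1 x \<alpha> = q2 x \<alpha>)
    \<longrightarrow>
    (let \<E> =
        sqrt (\<integral>\<alpha>. sqH1w (cubeQ B) (\<lambda>y. p1 (y, b) \<alpha> - p2 (y, b) \<alpha>) \<partial>lebesgue_on {-d..d})
      + sqrt (\<integral>\<alpha>. sqL2 (cubeQ B) (\<lambda>y. trz B a b Dp1 Hp1 \<alpha> y - trz B a b Dp2 Hp2 \<alpha> y) \<partial>lebesgue_on {-d..d})
      + sqrt (\<integral>\<alpha>. sqH1w (cubeQ B) (\<lambda>y. q1 (y, b) \<alpha> - q2 (y, b) \<alpha>) \<partial>lebesgue_on {-d..d})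
      + sqrt (\<integral>\<alpha>. sqL2 (cubeQ B) (\<lambda>y. trz B a b Dq1 Hq1 \<alpha> y - trz B a b Dq2 Hq2 \<alpha> y) \<partial>lebesgue_on {-d..d})
     in
      sqrt (\<integral>\<alpha>. sqH1 (Omega B a b) (\<lambda>x. p1 x \<alpha> - p2 x \<alpha>) (\<lambda>x. Dp1 x \<alpha> - Dp2 x \<alpha>)
              + sqH1 (Omega B a b) (\<lambda>x. q1 x \<alpha> - q2 x \<alpha>) (\<lambda>x. Dq1 x \<alpha> - Dq2 x \<alpha>) \<partial>lebesgue_on {-d..d})
        \<le> C1 * \<E> \<and>
      sqrt (sqL2 (Omega B a b) (\<lambda>x. recon d e1 mus G p1 Dp1 x - recon d e1 mus G p2 Dp2 x))
        \<le> C1 * \<E> \<and>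
      ((\<forall>\<alpha>\<in>{-d<..<d}. (\<forall>y\<in>cubeQ B. p1 (y, b) \<alpha> = p2 (y, b) \<alpha> \<and> q1 (y, b) \<alpha> = q2 (y, b) \<alpha>) \<and>
          (AE y in lebesgue_on (cubeQ B). trz B a b Dp1 Hp1 \<alpha> y = trz B a b Dp2 Hp2 \<alpha> y \<and>
                                         trz B a b Dq1 Hq1 \<alpha> y = trz B a b Dq2 Hq2 \<alpha> y))
       \<longrightarrow> (\<forall>x\<in>Omega B a b. \<forall>\<alpha>\<in>{-d<..<d}. p1 x \<alpha> = p2 x \<alpha> \<and> q1 x \<alpha> = q2 x \<alpha>) \<and>
           (AE x in lebesgue_on (Omega B a b). recon d e1 mus G p1 Dp1 x = recon d e1 mus G p2 Dp2 x)))"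
    (is "\<forall>KG Ka Ks M. \<exists>C1>0. ?stable KG Ka Ks M C1")
proof (intro allI)
  fix KG Ka Ks M :: real
  let ?C = "stab_const d a b \<epsilon> KG Ks M" and ?R = "recon_const d KG Ks M"
  \<comment> \<open>One constant for both estimates. It is chosen before the solutions, when
    nonnegativity of the two constants is not yet known, hence the absolute values; adding 1 makes
    it positive.\<close>
  define C1 where "C1 = sqrt (\<bar>?C\<bar> * (1 + \<bar>?R\<bar>)) + 1"
  have C1: "C1 > 0" unfolding C1_def by (intro add_nonneg_pos) auto
  show "\<exists>C1>0. ?stable KG Ka Ks M C1"
  proof (rule exI[of _ C1], intro conjI[OF C1] allI impI, unfold Let_def, elim conjE, intro conjI)
    fix mua mus :: "'m pt \<Rightarrow> real" and G :: "'m pt \<times> real \<times> real \<Rightarrow> real"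
      and p1 q1 p2 q2 :: "'m pt \<Rightarrow> real \<Rightarrow> real" and Dp1 Dq1 Dp2 Dq2 :: "'m pt \<Rightarrow> real \<Rightarrow> 'm pt"
      and Hp1 Hq1 Hp2 Hq2 :: "'m pt \<Rightarrow> real \<Rightarrow> 'm pt \<Rightarrow> 'm pt"
    let ?O = "Omega B a b :: 'm pt set"
    assume mus: "\<forall>x\<in>closure ?O. 0 \<le> mus x \<and> mus x \<le> Ks" and G: "C1_bounded (closure ?O \<times> {-d..d} \<times> {-d..d}) KG G"
      and adm: "admissible B a b d M p1 Dp1 Hp1" "admissible B a b d M q1 Dq1 Hq1" "admissible B a b d M p2 Dp2 Hp2" "admissible B a b d M q2 Dq2 Hq2"
      and eqs: "\<forall>\<alpha>\<in>{-d<..<d}. AE x in lebesgue_on ?O.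
        - \<epsilon> * lap Hp1 x \<alpha> + Lcommon d e1 mus G p1 Dp1 q1 Dq1 x \<alpha> = 0 \<and>
        - \<epsilon> * lap Hq1 x \<alpha> + Lcommon d e1 mus G p1 Dp1 q1 Dq1 x \<alpha> = 0 \<and>
        - \<epsilon> * lap Hp2 x \<alpha> + Lcommon d e1 mus G p2 Dp2 q2 Dq2 x \<alpha> = 0 \<and>
        - \<epsilon> * lap Hq2 x \<alpha> + Lcommon d e1 mus G p2 Dp2 q2 Dq2 x \<alpha> = 0"
      and bc: "\<forall>x\<in>frontier ?O - top_face B b. \<forall>\<alpha>\<in>{-d<..<d}. p1 x \<alpha> = p2 x \<alpha> \<and> q1 x \<alpha> = q2 x \<alpha>"
    interpret T: two_solutions B a b d M p1 p2 q1 q2 Dp1 Dp2 Dq1 Dq2 Hp1 Hp2 Hq1 Hq2 \<epsilon> KG Ks e1 mus G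
      by unfold_locales (use assms adm mus G eqs bc in blast)+
    let ?i1 = "\<integral>\<alpha>. T.P.value_sq \<alpha> \<partial>lebesgue_on {-d..d}" and ?i2 = "\<integral>\<alpha>. T.P.normal_sq \<alpha> \<partial>lebesgue_on {-d..d}"
      and ?i3 = "\<integral>\<alpha>. T.Q.value_sq \<alpha> \<partial>lebesgue_on {-d..d}" and ?i4 = "\<integral>\<alpha>. T.Q.normal_sq \<alpha> \<partial>lebesgue_on {-d..d}"
    define E where "E = sqrt ?i1 + sqrt ?i2 + sqrt ?i3 + sqrt ?i4"
    have nn: "0 \<le> ?i1" "0 \<le> ?i2" "0 \<le> ?i3" "0 \<le> ?i4"
      by (intro integral_nonneg_AE AE_I2 T.value_normal_nonneg)+
    have E0: "0 \<le> E" unfolding E_def using nn by simp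
    have dat: "T.data \<le> E\<^sup>2" unfolding T.data_def E_def by (rule sum4_le_sqrt_sum_sq[OF nn])
    have fin: "sqrt r \<le> C1 * E" if "r \<le> ?C * (1 + ?R) * E\<^sup>2" for r
    proof -
      have "sqrt r \<le> sqrt (\<bar>?C\<bar> * (1 + \<bar>?R\<bar>) * E\<^sup>2)"
        using that T.stab_const_nonneg T.recon_const_nonneg by simp
      also have "\<dots> = sqrt (\<bar>?C\<bar> * (1 + \<bar>?R\<bar>)) * E" using E0 by (simp add: real_sqrt_mult)
      also have "\<dots> \<le> C1 * E" unfolding C1_def using E0 by (intro mult_right_mono) auto
      finally show ?thesis .
    qed
    let ?P = "\<integral>\<alpha>. sqH1 ?O (\<lambda>x. p1 x \<alpha> - p2 x \<alpha>) (\<lambda>x. Dp1 x \<alpha> - Dp2 x \<alpha>) \<partial>lebesgue_on {-d..d}"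
    let ?Q = "\<integral>\<alpha>. sqH1 ?O (\<lambda>x. q1 x \<alpha> - q2 x \<alpha>) (\<lambda>x. Dq1 x \<alpha> - Dq2 x \<alpha>) \<partial>lebesgue_on {-d..d}"
    have PQ0: "0 \<le> ?P" "0 \<le> ?Q" by (intro integral_nonneg_AE AE_I2 T.sqH1_nonneg)+
    have PQ: "?P + ?Q \<le> ?C * E\<^sup>2"
      using T.H1_estimate mult_left_mono[OF dat T.stab_const_nonneg] by linarith
    have "0 \<le> ?C * E\<^sup>2 * ?R" using T.stab_const_nonneg T.recon_const_nonneg by simp
    then have CR: "?C * E\<^sup>2 \<le> ?C * (1 + ?R) * E\<^sup>2" by (simp add: algebra_simps)
    have "(\<integral>\<alpha>. sqH1 ?O (\<lambda>x. p1 x \<alpha> - p2 x \<alpha>) (\<lambda>x. Dp1 x \<alpha> - Dp2 x \<alpha>)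
        + sqH1 ?O (\<lambda>x. q1 x \<alpha> - q2 x \<alpha>) (\<lambda>x. Dq1 x \<alpha> - Dq2 x \<alpha>) \<partial>lebesgue_on {-d..d}) = ?P + ?Q"
      by (rule Bochner_Integration.integral_add[OF T.P.sqH1_integrable T.Q.sqH1_integrable])
    then have A: "sqrt (\<integral>\<alpha>. sqH1 ?O (\<lambda>x. p1 x \<alpha> - p2 x \<alpha>) (\<lambda>x. Dp1 x \<alpha> - Dp2 x \<alpha>)
        + sqH1 ?O (\<lambda>x. q1 x \<alpha> - q2 x \<alpha>) (\<lambda>x. Dq1 x \<alpha> - Dq2 x \<alpha>) \<partial>lebesgue_on {-d..d}) \<le> C1 * E"
      using PQ CR by (intro fin) linarith
    have R: "sqrt (sqL2 ?O (\<lambda>x. recon d e1 mus G p1 Dp1 x - recon d e1 mus G p2 Dp2 x)) \<le> C1 * E"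
    proof (rule fin)
      have "sqL2 ?O (\<lambda>x. recon d e1 mus G p1 Dp1 x - recon d e1 mus G p2 Dp2 x) \<le> ?R * ?P" by (rule T.recon_estimate)
      also have "\<dots> \<le> ?R * (?C * E\<^sup>2)" using PQ PQ0 by (intro mult_left_mono T.recon_const_nonneg) linarith
      also have "\<dots> \<le> ?C * (1 + ?R) * E\<^sup>2" using T.stab_const_nonneg by (simp add: algebra_simps)
      finally show "sqL2 ?O (\<lambda>x. recon d e1 mus G p1 Dp1 x - recon d e1 mus G p2 Dp2 x) \<le> ?C * (1 + ?R) * E\<^sup>2" .
    qed
    note A = A[unfolded E_def T.P.value_sq_def T.Q.value_sq_def T.P.normal_sq_def T.Q.normal_sq_def]
    note R = R[unfolded E_def T.P.value_sq_def T.Q.value_sq_def T.P.normal_sq_def T.Q.normal_sq_def]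
    note U = T.uniqueness[OF T.data_zero]
    show "sqrt (\<integral>\<alpha>. sqH1 (Omega B a b) (\<lambda>x. p1 x \<alpha> - p2 x \<alpha>) (\<lambda>x. Dp1 x \<alpha> - Dp2 x \<alpha>)
              + sqH1 (Omega B a b) (\<lambda>x. q1 x \<alpha> - q2 x \<alpha>) (\<lambda>x. Dq1 x \<alpha> - Dq2 x \<alpha>) \<partial>lebesgue_on {-d..d})
        \<le> C1 * (sqrt (\<integral>\<alpha>. sqH1w (cubeQ B) (\<lambda>y. p1 (y, b) \<alpha> - p2 (y, b) \<alpha>) \<partial>lebesgue_on {-d..d})
      + sqrt (\<integral>\<alpha>. sqL2 (cubeQ B) (\<lambda>y. trz B a b Dp1 Hp1 \<alpha> y - trz B a b Dp2 Hp2 \<alpha> y) \<partial>lebesgue_on {-d..d})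
      + sqrt (\<integral>\<alpha>. sqH1w (cubeQ B) (\<lambda>y. q1 (y, b) \<alpha> - q2 (y, b) \<alpha>) \<partial>lebesgue_on {-d..d})
      + sqrt (\<integral>\<alpha>. sqL2 (cubeQ B) (\<lambda>y. trz B a b Dq1 Hq1 \<alpha> y - trz B a b Dq2 Hq2 \<alpha> y) \<partial>lebesgue_on {-d..d}))"
      by (rule A)
    show "sqrt (sqL2 (Omega B a b) (\<lambda>x. recon d e1 mus G p1 Dp1 x - recon d e1 mus G p2 Dp2 x))
        \<le> C1 * (sqrt (\<integral>\<alpha>. sqH1w (cubeQ B) (\<lambda>y. p1 (y, b) \<alpha> - p2 (y, b) \<alpha>) \<partial>lebesgue_on {-d..d})
      + sqrt (\<integral>\<alpha>. sqL2 (cubeQ B) (\<lambda>y. trz B a b Dp1 Hp1 \<alpha> y - trz B a b Dp2 Hp2 \<alpha> y) \<partial>lebesgue_on {-d..d})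
      + sqrt (\<integral>\<alpha>. sqH1w (cubeQ B) (\<lambda>y. q1 (y, b) \<alpha> - q2 (y, b) \<alpha>) \<partial>lebesgue_on {-d..d})
      + sqrt (\<integral>\<alpha>. sqL2 (cubeQ B) (\<lambda>y. trz B a b Dq1 Hq1 \<alpha> y - trz B a b Dq2 Hq2 \<alpha> y) \<partial>lebesgue_on {-d..d}))"
      by (rule R)
    show "(\<forall>\<alpha>\<in>{-d<..<d}. (\<forall>y\<in>cubeQ B. p1 (y, b) \<alpha> = p2 (y, b) \<alpha> \<and> q1 (y, b) \<alpha> = q2 (y, b) \<alpha>) \<and>
          (AE y in lebesgue_on (cubeQ B). trz B a b Dp1 Hp1 \<alpha> y = trz B a b Dp2 Hp2 \<alpha> y \<and>
                                         trz B a b Dq1 Hq1 \<alpha> y = trz B a b Dq2 Hq2 \<alpha> y))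
       \<longrightarrow> (\<forall>x\<in>Omega B a b. \<forall>\<alpha>\<in>{-d<..<d}. p1 x \<alpha> = p2 x \<alpha> \<and> q1 x \<alpha> = q2 x \<alpha>) \<and>
           (AE x in lebesgue_on (Omega B a b). recon d e1 mus G p1 Dp1 x = recon d e1 mus G p2 Dp2 x)"
      using U by blast
  qed
qed

end
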